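(* Let $E$ be a vector orbibundle over an orbispace $X$. Then the space $\Gamma^\infty_{\mathrm{str}}(E)$ of smooth stratified sections carries a natural structure of a $C^\infty(X)$-module (given by the fiberwise linear structure of $E^{\mathrm{str}}$). Moreover, let $\mathcal U$ be an open covering of $X$ and $\mathsf E:\overline{\mathcal U}\to \mathfrak{VBdl}^{\mathrm{sym}}$ an orbibundle functor of $E$, inducing the orbispace functor $\mathsf X$ on the base. Then a continuous section $s:X\to E$ is a smooth stratified section if and only if it is a good section, i.e. if and only if there exists a family $(s_{\tilde U})_{U\in\overline{\mathcal U}}$ of smooth sections $s_{\tilde U}:\tilde U\to\tilde E_U$ such that: (GSEC1) for every orbispace chart $(\tilde U,G,\varrho)=\mathsf X(U)$ the section $s_{\tilde U}$ is $G$-equivariant; (GSEC2) if $(\varphi_{VU},\iota_{VU})=\mathsf X_{VU}:(\tilde V,H,\upsilon)\to(\tilde U,G,\varrho)$ is a morphism of $\mathsf X$ and $(\psi_{VU},\iota_{VU})=\mathsf E_{VU}:(\tilde E_V,H)\to(\tilde E_U,G)$ is the corresponding morphism of vector bundles, then $s_{\tilde U}\circ\varphi_{VU}=\psi_{VU}\circ s_{\tilde V}$; (GSEC3) for every $(\tilde U,G,\varrho)=\mathsf X(U)$ one has $\eta_U\circ s_{\tilde U}=s\circ\varrho$. If $s$ is a smooth stratified section, then the family $(s_{\tilde U})$ satisfying (GSEC1) to (GSEC3) is uniquely determined.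
   Context: Spaces with symmetries. Let $\mathfrak T$ be either the category of finite dimensional smooth manifolds and smooth maps, or the category $\mathfrak{VBdl}$ of smooth vector bundles over finite dimensional manifolds (the fiber is allowed to be a profinite dimensional vector space, i.e. a projective limit, indexed by $\mathbb N$, of finite dimensional real vector spaces along surjective linear maps; a function on such a limit is smooth if it is the pullback of a smooth function on one of the finite dimensional stages) with smooth vector bundle maps over smooth maps of the bases. $\mathfrak T^{\mathrm{sym}}$ has as objects the pairs $(M,G)$, where $M\in\mathfrak T$ and $G$ is a compact Lie group acting smoothly on $M$ by $\mathfrak T$-automorphisms. A morphism $(\varphi,\iota):(N,H)\to(M,G)$ is a $\mathfrak T$-morphism $\varphi:N\to M$ together with a continuous homomorphism $\iota:H\to G$ such that $\varphi(hy)=\iota(h)\varphi(y)$; it induces $\overline\varphi:N/H\to M/G$. It is an open embedding if $\varphi$ is an open smooth embedding and $\overline\varphi$ is a homeomorphism onto an open subset. Orbispaces. A $\mathfrak T$-orbispace chart of a Hausdorff space $X$ is a triple $(\tilde U,G,\varrho)$ with $(\tilde U,G)\in\mathfrak T^{\mathrm{sym}}$ and $\varrho:\tilde U\to X$ continuous, $G$-invariant, inducing a homeomorphism $\tilde U/G\to U$ onto an open set $U\subset X$ (the image of the chart). Morphisms of charts $(\tilde V,H,\upsilon)\to(\tilde U,G,\varrho)$ are morphisms $(\varphi,\iota)$ in $\mathfrak T^{\mathrm{sym}}$ with $\varrho\circ\varphi=\upsilon$. For an open covering $\mathcal U$, $\overline{\mathcal U}$ is the category whose objects are the connected components of finite intersections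 of elements of $\mathcal U$ and whose morphisms are the inclusions. A $\mathfrak T$-orbispace is a second countable, locally connected, paracompact Hausdorff space $X$ with a functor $\mathsf X$ from $\overline{\mathcal U}$ to $\mathfrak T$-orbispace charts of $X$ (orbispace functor) such that $\mathsf X(U)$ has image $U$ and connected domain $\tilde U$, and each $\mathsf X_{VU}:=\mathsf X(V\to U)$ is an open embedding. "Orbispace" means $\mathfrak T$ = finite dimensional manifolds. A continuous function on (an open subset of) an orbispace is smooth if its composition with $\varrho$ is smooth for every chart; a continuous map between orbispaces is smooth if it pulls back smooth functions to smooth functions. $C^\infty(X)$ is the algebra of smooth functions. Vector orbibundles. A vector orbibundle is an orbispace $E$ given by an orbispace functor $\mathsf E$ with values in $\mathfrak{VBdl}^{\mathrm{sym}}$ (orbibundle functor), $U\mapsto(\tilde E_U,G_U)$, $(V\to U)\mapsto(\psi_{VU},\iota_{VU})$, with chart maps $\eta_U:\tilde E_U\to E$. Let $\tilde U$ be the base manifold of $\tilde E_U$ and $\varphi_{VU}$ the map of bases induced by $\psi_{VU}$; then $U\mapsto(\tilde U,G_U)$, $(V\to U)\mapsto(\varphi_{VU},\iota_{VU})$ is an orbispace functor $\mathsf X$ defining the base orbispace $X$ with chart maps $\varrho_U:\tilde U\to X$. The bundle projections $\pi_U:\tilde E_U\to\tilde U$ induce $\pi:E\to X$ with $\pi\circ\eta_U=\varrho_U\circ\pi_U$. A section of $E$ is a continuous map $s:X\to E$ with $\pi\circ s=\mathrm{id}_X$. Smooth stratified sections. For an orbibundle chart $(\tilde E,G,\eta)$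 over $(\tilde U,G,\varrho)$ and $\tilde x\in\tilde U$ let $\tilde E_{\tilde x}^{G_{\tilde x}}$ be the linear subspace of vectors in the fiber $\tilde E_{\tilde x}$ fixed by the isotropy group $G_{\tilde x}$. $E^{\mathrm{str}}\subset E$ is the union over all charts of the sets $\eta\big(\bigcup_{\tilde x}\tilde E_{\tilde x}^{G_{\tilde x}}\big)$. Its fiber over $x=\varrho(\tilde x)$ is canonically identified with the vector space $\tilde E_{\tilde x}^{G_{\tilde x}}$, and for $v\in E$, $w\in E^{\mathrm{str}}$ over the same base point the sum $v+tw\in E$ ($t\in\mathbb R$) is well-defined via a chart. A smooth stratified section of $E$ is a smooth section $s:X\to E$ with image in $E^{\mathrm{str}}$ such that for sufficiently small $\varepsilon>0$ the vertical extension $\mathsf V_s:E\times(-\varepsilon,\varepsilon)\to E$, $(v,t)\mapsto v+t\,s(\pi(v))$, is smooth. Their set is $\Gamma^\infty_{\mathrm{str}}(E)$. *)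

theory Defs
  imports "HOL-Analysis.Analysis" "HOL-Algebra.Group_Action" "HOL-Algebra.Module"
begin

section \<open>Smooth functions on open subsets of Euclidean space\<close>

text \<open>\<open>Ck k n W f\<close>: all partial derivatives of \<open>f\<close> of order at most \<open>k\<close> exist and are continuous on
  the open subset \<open>W\<close> of \<^term>\<open>Euclidean_space n\<close>, the library's version of $\mathbb R^n$, whose
  points are the functions \<open>nat \<Rightarrow> real\<close> vanishing from index \<open>n\<close> on. Only the values of
  \<open>f\<close> on \<open>W\<close> matter.\<close>

primrec Ck :: "nat \<Rightarrow> nat \<Rightarrow> (nat \<Rightarrow> real) set \<Rightarrow> ((nat \<Rightarrow> real) \<Rightarrow> real) \<Rightarrow> bool" where
  "Ck 0 n W f \<longleftrightarrow> continuous_map (subtopology (Euclidean_space n) W) euclideanreal f"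
| "Ck (Suc k) n W f \<longleftrightarrow>
     continuous_map (subtopology (Euclidean_space n) W) euclideanreal f \<and>
     (\<exists>f'. \<forall>i<n. (\<forall>x\<in>W. ((\<lambda>t. f (x(i := t))) has_real_derivative f' i x) (at (x i))) \<and>
                 Ck k n W (f' i))"

definition smooth_on :: "nat \<Rightarrow> (nat \<Rightarrow> real) set \<Rightarrow> ((nat \<Rightarrow> real) \<Rightarrow> real) \<Rightarrow> bool" where
  "smooth_on n W f \<longleftrightarrow> (\<forall>k. Ck k n W f)"

text \<open>The identification of $\mathbb R^m \times \mathbb R^n$ with $\mathbb R^{m+n}$.\<close>

definition cat :: "nat \<Rightarrow> (nat \<Rightarrow> real) \<Rightarrow> (nat \<Rightarrow> real) \<Rightarrow> nat \<Rightarrow> real" where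
  "cat m x y = (\<lambda>i. if i < m then x i else y (i - m))"

section \<open>Smooth functions and smooth maps\<close>

text \<open>Manifolds, total spaces of vector bundles, orbispaces and orbibundles all give rise to a topology
  together with a notion of smooth real function \<open>f\<close> on an open set \<open>W\<close> (only the values of \<open>f\<close> on
  \<open>W\<close> matter). In each case a smooth map is a continuous map which pulls back smooth functions
  to smooth functions; for finite dimensional manifolds this is the usual notion.\<close>

record 'a sspace =
  stop :: "'a topology"
  sfun :: "'a set \<Rightarrow> ('a \<Rightarrow> real) \<Rightarrow> bool"

abbreviation points :: "'a sspace \<Rightarrow> 'a set" where
  "points S \<equiv> topspace (stop S)"

definition smooth_map :: "'a sspace \<Rightarrow> 'b sspace \<Rightarrow> ('a \<Rightarrow> 'b) \<Rightarrow> bool" where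
  "smooth_map S T \<phi> \<longleftrightarrow> continuous_map (stop S) (stop T) \<phi> \<and>
     (\<forall>W f. openin (stop T) W \<and> sfun T W f \<longrightarrow> sfun S {x \<in> points S. \<phi> x \<in> W} (f \<circ> \<phi>))"

definition open_subspace :: "'a sspace \<Rightarrow> 'a set \<Rightarrow> 'a sspace" where
  "open_subspace S A = \<lparr>stop = subtopology (stop S) A, sfun = sfun S\<rparr>"

text \<open>An open smooth embedding is a diffeomorphism onto an open subset.\<close>

definition open_smooth_embedding :: "'a sspace \<Rightarrow> 'b sspace \<Rightarrow> ('a \<Rightarrow> 'b) \<Rightarrow> bool" where
  "open_smooth_embedding S T \<phi> \<longleftrightarrow> smooth_map S T \<phi> \<and> inj_on \<phi> (points S) \<and>
     openin (stop T) (\<phi> ` points S) \<and>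
     smooth_map (open_subspace T (\<phi> ` points S)) S (inv_into (points S) \<phi>)"

section \<open>Finite dimensional manifolds\<close>

record 'm mfd =
  mtop :: "'m topology"
  mdim :: nat
  atlas :: "('m set \<times> ('m \<Rightarrow> nat \<Rightarrow> real)) set"

definition manifold :: "'m mfd \<Rightarrow> bool" where
  "manifold M \<longleftrightarrow> Hausdorff_space (mtop M) \<and> second_countable (mtop M) \<and>
     (\<Union>(C, c)\<in>atlas M. C) = topspace (mtop M) \<and>
     (\<forall>(C, c)\<in>atlas M. openin (mtop M) C \<and> openin (Euclidean_space (mdim M)) (c ` C) \<and>
        homeomorphic_map (subtopology (mtop M) C) (subtopology (Euclidean_space (mdim M)) (c ` C)) c) \<and>
     (\<forall>(C, c)\<in>atlas M. \<forall>(D, d)\<in>atlas M. \<forall>i<mdim M.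
        smooth_on (mdim M) (c ` (C \<inter> D)) (\<lambda>y. d (inv_into C c y) i))"

definition mfd_space :: "'m mfd \<Rightarrow> 'm sspace" where
  "mfd_space M = \<lparr>stop = mtop M,
     sfun = (\<lambda>W f. \<forall>(C, c)\<in>atlas M. smooth_on (mdim M) (c ` (W \<inter> C)) (\<lambda>y. f (inv_into C c y)))\<rparr>"

definition mfd_prod :: "'m mfd \<Rightarrow> 'n mfd \<Rightarrow> ('m \<times> 'n) mfd" where
  "mfd_prod M N = \<lparr>mtop = prod_topology (mtop M) (mtop N), mdim = mdim M + mdim N,
     atlas = {(C \<times> D, \<lambda>(x, y). cat (mdim M) (c x) (d y)) | C c D d.
                (C, c) \<in> atlas M \<and> (D, d) \<in> atlas N}\<rparr>"

definition interval :: "real \<Rightarrow> real mfd" where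
  "interval \<epsilon> = \<lparr>mtop = top_of_set {-\<epsilon><..<\<epsilon>}, mdim = 1,
     atlas = {({-\<epsilon><..<\<epsilon>}, \<lambda>t i. if i = 0 then t else 0)}\<rparr>"

section \<open>Profinite dimensional vector spaces and vector bundles\<close>

text \<open>A projective system of finite dimensional vector spaces $\mathbb R^{d_k}$ along surjective linear
  maps $\mathbb R^{d_{k+1}} \to \mathbb R^{d_k}$. A finite dimensional vector space is the limit of a constant
  system.\<close>

record prosys =
  fdim :: "nat \<Rightarrow> nat"
  fmap :: "nat \<Rightarrow> (nat \<Rightarrow> real) \<Rightarrow> nat \<Rightarrow> real"

abbreviation stage :: "prosys \<Rightarrow> nat \<Rightarrow> (nat \<Rightarrow> real) topology" where
  "stage P k \<equiv> Euclidean_space (fdim P k)"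

definition projective_system :: "prosys \<Rightarrow> bool" where
  "projective_system P \<longleftrightarrow> (\<forall>k.
     fmap P k ` topspace (stage P (Suc k)) = topspace (stage P k) \<and>
     (\<forall>x\<in>topspace (stage P (Suc k)). \<forall>y\<in>topspace (stage P (Suc k)). \<forall>a b.
        fmap P k (\<lambda>i. a * x i + b * y i) = (\<lambda>i. a * fmap P k x i + b * fmap P k y i)))"

definition prolimit :: "prosys \<Rightarrow> (nat \<Rightarrow> nat \<Rightarrow> real) topology" where
  "prolimit P = subtopology (product_topology (stage P) UNIV) {v. \<forall>k. fmap P k (v (Suc k)) = v k}"

text \<open>Elements \<open>(D, P, \<tau>)\<close> of \<open>vtriv\<close> are local trivializations over the open set \<open>D\<close> of the base:
  \<open>e \<mapsto> (vproj e, \<tau> e)\<close> identifies the restriction to \<open>D\<close> with \<open>D \<times> prolimit P\<close>.\<close>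

record ('m, 't) vbundle =
  vbase :: "'m mfd"
  vtop :: "'t topology"
  vproj :: "'t \<Rightarrow> 'm"
  vadd :: "'t \<Rightarrow> 't \<Rightarrow> 't"
  vscale :: "real \<Rightarrow> 't \<Rightarrow> 't"
  vzero :: "'m \<Rightarrow> 't"
  vtriv :: "('m set \<times> prosys \<times> ('t \<Rightarrow> nat \<Rightarrow> nat \<Rightarrow> real)) set"

abbreviation total :: "('m, 't) vbundle \<Rightarrow> 't set" where
  "total F \<equiv> topspace (vtop F)"

abbreviation restr :: "('m, 't) vbundle \<Rightarrow> 'm set \<Rightarrow> 't set" where
  "restr F D \<equiv> {e \<in> total F. vproj F e \<in> D}"

text \<open>Smoothness of a function on the part of \<open>W\<close> over \<open>D\<close>, with respect to the trivialization
  \<open>(D, P, \<tau>)\<close>: locally over the base, \<open>f\<close> is the pullback of a smooth function \<open>g\<close> on an open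
  subset \<open>O'\<close> of $\mathbb R^n \times \mathbb R^{d_k}$ for one of the finite dimensional stages
  $\mathbb R^{d_k}$ of the fiber.\<close>

definition triv_smooth ::
  "('m, 't) vbundle \<Rightarrow> 'm set \<times> prosys \<times> ('t \<Rightarrow> nat \<Rightarrow> nat \<Rightarrow> real) \<Rightarrow> 't set \<Rightarrow> ('t \<Rightarrow> real) \<Rightarrow> bool" where
  "triv_smooth F = (\<lambda>(D, P, \<tau>) W f.
     (\<forall>x \<in> vproj F ` W \<inter> D. \<exists>A C c k O' g.
        openin (mtop (vbase F)) A \<and> x \<in> A \<and> A \<subseteq> D \<and> A \<subseteq> C \<and> (C, c) \<in> atlas (vbase F) \<and>
        openin (Euclidean_space (mdim (vbase F) + fdim P k)) O' \<and>
        smooth_on (mdim (vbase F) + fdim P k) O' g \<and>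
        (\<forall>e \<in> W. vproj F e \<in> A \<longrightarrow>
           cat (mdim (vbase F)) (c (vproj F e)) (\<tau> e k) \<in> O' \<and>
           f e = g (cat (mdim (vbase F)) (c (vproj F e)) (\<tau> e k)))))"

definition vb_space :: "('m, 't) vbundle \<Rightarrow> 't sspace" where
  "vb_space F = \<lparr>stop = vtop F, sfun = (\<lambda>W f. \<forall>T\<in>vtriv F. triv_smooth F T W f)\<rparr>"

text \<open>The vector space axioms in the fibers follow from those of the limits. The last condition says that
  the transition maps are smooth.\<close>

definition vector_bundle :: "('m, 't) vbundle \<Rightarrow> bool" where
  "vector_bundle F \<longleftrightarrow> manifold (vbase F) \<and> continuous_map (vtop F) (mtop (vbase F)) (vproj F) \<and>
     (\<Union>(D, P, \<tau>)\<in>vtriv F. D) = topspace (mtop (vbase F)) \<and>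
     (\<forall>(D, P, \<tau>)\<in>vtriv F. openin (mtop (vbase F)) D \<and> projective_system P \<and>
        homeomorphic_map (subtopology (vtop F) (restr F D))
          (prod_topology (subtopology (mtop (vbase F)) D) (prolimit P)) (\<lambda>e. (vproj F e, \<tau> e)) \<and>
        (\<forall>x\<in>D. vzero F x \<in> total F \<and> vproj F (vzero F x) = x \<and> \<tau> (vzero F x) = (\<lambda>k i. 0)) \<and>
        (\<forall>v\<in>restr F D. \<forall>w\<in>restr F D. vproj F v = vproj F w \<longrightarrow>
           vadd F v w \<in> total F \<and> vproj F (vadd F v w) = vproj F v \<and>
           \<tau> (vadd F v w) = (\<lambda>k i. \<tau> v k i + \<tau> w k i)) \<and>
        (\<forall>v\<in>restr F D. \<forall>t. vscale F t v \<in> total F \<and> vproj F (vscale F t v) = vproj F v \<and>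
           \<tau> (vscale F t v) = (\<lambda>k i. t * \<tau> v k i))) \<and>
     (\<forall>(D, P, \<tau>)\<in>vtriv F. \<forall>(D', P', \<tau>')\<in>vtriv F. \<forall>k. \<forall>i<fdim P' k.
        triv_smooth F (D, P, \<tau>) (restr F (D \<inter> D')) (\<lambda>e. \<tau>' e k i))"

definition vb_map ::
  "('m, 't) vbundle \<Rightarrow> ('m2, 't2) vbundle \<Rightarrow> ('t \<Rightarrow> 't2) \<Rightarrow> ('m \<Rightarrow> 'm2) \<Rightarrow> bool" where
  "vb_map F F' \<psi> \<phi> \<longleftrightarrow> smooth_map (vb_space F) (vb_space F') \<psi> \<and>
     smooth_map (mfd_space (vbase F)) (mfd_space (vbase F')) \<phi> \<and>
     (\<forall>v\<in>total F. vproj F' (\<psi> v) = \<phi> (vproj F v)) \<and>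
     (\<forall>v\<in>total F. \<forall>w\<in>total F. vproj F v = vproj F w \<longrightarrow> \<psi> (vadd F v w) = vadd F' (\<psi> v) (\<psi> w)) \<and>
     (\<forall>v\<in>total F. \<forall>t. \<psi> (vscale F t v) = vscale F' t (\<psi> v))"

text \<open>The bundle $F \times N \to B \times N$ for a bundle $F \to B$ and a manifold $N$.\<close>

definition vb_prod :: "('m, 't) vbundle \<Rightarrow> 'n mfd \<Rightarrow> ('m \<times> 'n, 't \<times> 'n) vbundle" where
  "vb_prod F N = \<lparr>vbase = mfd_prod (vbase F) N, vtop = prod_topology (vtop F) (mtop N),
     vproj = (\<lambda>(e, y). (vproj F e, y)),
     vadd = (\<lambda>(e, y) (e', y'). (vadd F e e', y)),
     vscale = (\<lambda>t (e, y). (vscale F t e, y)),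
     vzero = (\<lambda>(x, y). (vzero F x, y)),
     vtriv = {(D \<times> topspace (mtop N), P, \<lambda>(e, y). \<tau> e) | D P \<tau>. (D, P, \<tau>) \<in> vtriv F}\<rparr>"

section \<open>Spaces with symmetries\<close>

record 'g lgroup = "'g monoid" +
  lmfd :: "'g mfd"

definition compact_lie_group :: "'g lgroup \<Rightarrow> bool" where
  "compact_lie_group G \<longleftrightarrow> Group.group G \<and> manifold (lmfd G) \<and> topspace (mtop (lmfd G)) = carrier G \<and>
     smooth_map (mfd_space (mfd_prod (lmfd G) (lmfd G))) (mfd_space (lmfd G)) (\<lambda>(g, h). g \<otimes>\<^bsub>G\<^esub> h) \<and>
     smooth_map (mfd_space (lmfd G)) (mfd_space (lmfd G)) (\<lambda>g. inv\<^bsub>G\<^esub> g) \<and>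
     compact_space (mtop (lmfd G))"

definition mfd_sym :: "'m mfd \<Rightarrow> 'g lgroup \<Rightarrow> ('g \<Rightarrow> 'm \<Rightarrow> 'm) \<Rightarrow> bool" where
  "mfd_sym M G a \<longleftrightarrow> manifold M \<and> compact_lie_group G \<and> group_action G (topspace (mtop M)) a \<and>
     smooth_map (mfd_space (mfd_prod M (lmfd G))) (mfd_space M) (\<lambda>(x, g). a g x)"

text \<open>\<open>a\<close> is the action on the total space, \<open>b\<close> the action on the base which it covers.\<close>

definition vb_sym ::
  "('m, 't) vbundle \<Rightarrow> 'g lgroup \<Rightarrow> ('g \<Rightarrow> 't \<Rightarrow> 't) \<Rightarrow> ('g \<Rightarrow> 'm \<Rightarrow> 'm) \<Rightarrow> bool" where
  "vb_sym F G a b \<longleftrightarrow> vector_bundle F \<and> mfd_sym (vbase F) G b \<and> group_action G (total F) a \<and>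
     smooth_map (vb_space (vb_prod F (lmfd G))) (vb_space F) (\<lambda>(v, g). a g v) \<and>
     (\<forall>g\<in>carrier G. vb_map F F (a g) (b g))"

record ('a, 'g) sym_space =
  ssp :: "'a sspace"
  sgrp :: "'g lgroup"
  sact :: "'g \<Rightarrow> 'a \<Rightarrow> 'a"

text \<open>The orbit space with the quotient topology.\<close>

definition orbit_space :: "('a, 'g) sym_space \<Rightarrow> 'a set topology" where
  "orbit_space S = topology (\<lambda>Q. Q \<subseteq> orbits (sgrp S) (points (ssp S)) (sact S) \<and>
     openin (stop (ssp S)) {x \<in> points (ssp S). orbit (sgrp S) (sact S) x \<in> Q})"

lemma openin_orbit_space:
  "openin (orbit_space S) Q \<longleftrightarrow> Q \<subseteq> orbits (sgrp S) (points (ssp S)) (sact S) \<and>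
     openin (stop (ssp S)) {x \<in> points (ssp S). orbit (sgrp S) (sact S) x \<in> Q}"
proof -
  have "istopology (\<lambda>Q. Q \<subseteq> orbits (sgrp S) (points (ssp S)) (sact S) \<and>
     openin (stop (ssp S)) {x \<in> points (ssp S). orbit (sgrp S) (sact S) x \<in> Q})"
    unfolding istopology_def
  proof (intro conjI allI impI)
    fix A B
    assume A: "A \<subseteq> orbits (sgrp S) (points (ssp S)) (sact S) \<and>
        openin (stop (ssp S)) {x \<in> points (ssp S). orbit (sgrp S) (sact S) x \<in> A}"
      and B: "B \<subseteq> orbits (sgrp S) (points (ssp S)) (sact S) \<and>
        openin (stop (ssp S)) {x \<in> points (ssp S). orbit (sgrp S) (sact S) x \<in> B}"
    show "A \<inter> B \<subseteq> orbits (sgrp S) (points (ssp S)) (sact S)" using A by blast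
    have eq: "{x \<in> points (ssp S). orbit (sgrp S) (sact S) x \<in> A \<inter> B} =
        {x \<in> points (ssp S). orbit (sgrp S) (sact S) x \<in> A} \<inter>
        {x \<in> points (ssp S). orbit (sgrp S) (sact S) x \<in> B}" by blast
    show "openin (stop (ssp S)) {x \<in> points (ssp S). orbit (sgrp S) (sact S) x \<in> A \<inter> B}"
      unfolding eq using A B by (intro openin_Int) simp_all
  next
    fix K
    assume K: "\<forall>Q\<in>K. Q \<subseteq> orbits (sgrp S) (points (ssp S)) (sact S) \<and>
        openin (stop (ssp S)) {x \<in> points (ssp S). orbit (sgrp S) (sact S) x \<in> Q}"
    show "\<Union>K \<subseteq> orbits (sgrp S) (points (ssp S)) (sact S)" using K by blast
    have eq: "{x \<in> points (ssp S). orbit (sgrp S) (sact S) x \<in> \<Union>K} =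
        (\<Union>Q\<in>K. {x \<in> points (ssp S). orbit (sgrp S) (sact S) x \<in> Q})" by blast
    show "openin (stop (ssp S)) {x \<in> points (ssp S). orbit (sgrp S) (sact S) x \<in> \<Union>K}"
      unfolding eq using K by (intro openin_Union) blast
  qed
  then show ?thesis by (simp add: orbit_space_def)
qed

definition induced_map ::
  "('a, 'g) sym_space \<Rightarrow> ('b, 'h) sym_space \<Rightarrow> ('a \<Rightarrow> 'b) \<Rightarrow> 'a set \<Rightarrow> 'b set" where
  "induced_map S T \<phi> Q = (\<Union>y\<in>Q. orbit (sgrp T) (sact T) (\<phi> y))"

text \<open>The smoothness (and, for bundles, fiberwise linearity) of \<open>\<phi>\<close> is required separately.\<close>

definition equivariant ::
  "('a, 'g) sym_space \<Rightarrow> ('b, 'h) sym_space \<Rightarrow> ('a \<Rightarrow> 'b) \<Rightarrow> ('g \<Rightarrow> 'h) \<Rightarrow> bool" where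
  "equivariant S T \<phi> \<iota> \<longleftrightarrow> \<iota> \<in> hom (sgrp S) (sgrp T) \<and>
     continuous_map (mtop (lmfd (sgrp S))) (mtop (lmfd (sgrp T))) \<iota> \<and>
     (\<forall>h\<in>carrier (sgrp S). \<forall>y\<in>points (ssp S). \<phi> (sact S h y) = sact T (\<iota> h) (\<phi> y))"

definition sym_open_embedding ::
  "('a, 'g) sym_space \<Rightarrow> ('b, 'h) sym_space \<Rightarrow> ('a \<Rightarrow> 'b) \<Rightarrow> ('g \<Rightarrow> 'h) \<Rightarrow> bool" where
  "sym_open_embedding S T \<phi> \<iota> \<longleftrightarrow> equivariant S T \<phi> \<iota> \<and> open_smooth_embedding (ssp S) (ssp T) \<phi> \<and>
     embedding_map (orbit_space S) (orbit_space T) (induced_map S T \<phi>) \<and>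
     openin (orbit_space T) (induced_map S T \<phi> ` topspace (orbit_space S))"

section \<open>Orbispaces\<close>

definition orbichart :: "'y topology \<Rightarrow> ('a, 'g) sym_space \<Rightarrow> ('a \<Rightarrow> 'y) \<Rightarrow> 'y set \<Rightarrow> bool" where
  "orbichart Y S \<rho> U \<longleftrightarrow> openin Y U \<and> continuous_map (stop (ssp S)) Y \<rho> \<and>
     (\<forall>g\<in>carrier (sgrp S). \<forall>x\<in>points (ssp S). \<rho> (sact S g x) = \<rho> x) \<and>
     homeomorphic_map (orbit_space S) (subtopology Y U) (\<lambda>Q. the_elem (\<rho> ` Q))"

definition open_covering :: "'x topology \<Rightarrow> 'x set set \<Rightarrow> bool" where
  "open_covering X \<U> \<longleftrightarrow> (\<forall>U\<in>\<U>. openin X U) \<and> \<Union>\<U> = topspace X"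

text \<open>The objects of $\overline{\mathcal U}$; there is a unique morphism from \<open>V\<close> to \<open>U\<close> if
  \<open>V \<subseteq> U\<close>, and none otherwise.\<close>

definition cover_objects :: "'x topology \<Rightarrow> 'x set set \<Rightarrow> 'x set set" where
  "cover_objects X \<U> =
     (\<Union>F\<in>{F. F \<subseteq> \<U> \<and> finite F \<and> F \<noteq> {}}. connected_components_of (subtopology X (\<Inter>F)))"

definition paracompact_space :: "'x topology \<Rightarrow> bool" where
  "paracompact_space X \<longleftrightarrow> (\<forall>\<U>. open_covering X \<U> \<longrightarrow>
     (\<exists>\<V>. open_covering X \<V> \<and> (\<forall>V\<in>\<V>. \<exists>U\<in>\<U>. V \<subseteq> U) \<and> locally_finite_in X \<V>))"

definition orbi_topology :: "'x topology \<Rightarrow> bool" where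
  "orbi_topology X \<longleftrightarrow> Hausdorff_space X \<and> second_countable X \<and> locally_connected_space X \<and>
     paracompact_space X"

text \<open>The conditions on an orbispace functor common to manifolds and vector bundles. The functor is
  defined on the set of open sets \<open>I\<close>, ordered by inclusion, and the chart at \<open>U\<close> has image \<open>im U\<close>.
  \<open>\<phi> V U\<close> and \<open>\<iota> V U\<close> are the components of the morphism assigned to \<open>V \<subseteq> U\<close>.\<close>

definition orbi_functor ::
  "'y topology \<Rightarrow> 'x set set \<Rightarrow> ('x set \<Rightarrow> 'y set) \<Rightarrow> ('x set \<Rightarrow> ('a, 'g) sym_space) \<Rightarrow>
   ('x set \<Rightarrow> 'a \<Rightarrow> 'y) \<Rightarrow> ('x set \<Rightarrow> 'x set \<Rightarrow> 'a \<Rightarrow> 'a) \<Rightarrow> ('x set \<Rightarrow> 'x set \<Rightarrow> 'g \<Rightarrow> 'g) \<Rightarrow> bool" where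
  "orbi_functor Y I im S \<rho> \<phi> \<iota> \<longleftrightarrow>
     (\<forall>U\<in>I. orbichart Y (S U) (\<rho> U) (im U) \<and> connected_space (stop (ssp (S U)))) \<and>
     (\<forall>U\<in>I. \<forall>V\<in>I. V \<subseteq> U \<longrightarrow> sym_open_embedding (S V) (S U) (\<phi> V U) (\<iota> V U) \<and>
        (\<forall>y\<in>points (ssp (S V)). \<rho> U (\<phi> V U y) = \<rho> V y)) \<and>
     (\<forall>U\<in>I. (\<forall>x\<in>points (ssp (S U)). \<phi> U U x = x) \<and> (\<forall>g\<in>carrier (sgrp (S U)). \<iota> U U g = g)) \<and>
     (\<forall>U\<in>I. \<forall>V\<in>I. \<forall>W\<in>I. W \<subseteq> V \<and> V \<subseteq> U \<longrightarrow>
        (\<forall>x\<in>points (ssp (S W)). \<phi> W U x = \<phi> V U (\<phi> W V x)) \<and>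
        (\<forall>g\<in>carrier (sgrp (S W)). \<iota> W U g = \<iota> V U (\<iota> W V g)))"

record ('x, 'm, 'g) orbispace =
  otop :: "'x topology"
  ocover :: "'x set set"
  odom :: "'x set \<Rightarrow> 'm mfd"
  ogrp :: "'x set \<Rightarrow> 'g lgroup"
  oact :: "'x set \<Rightarrow> 'g \<Rightarrow> 'm \<Rightarrow> 'm"
  ochart :: "'x set \<Rightarrow> 'm \<Rightarrow> 'x"
  omap :: "'x set \<Rightarrow> 'x set \<Rightarrow> 'm \<Rightarrow> 'm"
  ohom :: "'x set \<Rightarrow> 'x set \<Rightarrow> 'g \<Rightarrow> 'g"

definition orbispace :: "('x, 'm, 'g) orbispace \<Rightarrow> bool" where
  "orbispace X \<longleftrightarrow> orbi_topology (otop X) \<and> open_covering (otop X) (ocover X) \<and>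
     (\<forall>U\<in>cover_objects (otop X) (ocover X). mfd_sym (odom X U) (ogrp X U) (oact X U)) \<and>
     orbi_functor (otop X) (cover_objects (otop X) (ocover X)) (\<lambda>U. U)
       (\<lambda>U. \<lparr>ssp = mfd_space (odom X U), sgrp = ogrp X U, sact = oact X U\<rparr>)
       (ochart X) (omap X) (ohom X)"

definition orbispace_space :: "('x, 'm, 'g) orbispace \<Rightarrow> 'x sspace" where
  "orbispace_space X = \<lparr>stop = otop X, sfun = (\<lambda>W f.
     continuous_map (subtopology (otop X) W) euclideanreal f \<and>
     (\<forall>U\<in>cover_objects (otop X) (ocover X).
        sfun (mfd_space (odom X U)) {x \<in> topspace (mtop (odom X U)). ochart X U x \<in> W}
          (f \<circ> ochart X U)))\<rparr>"

text \<open>$C^\infty(X)$ as a ring. Functions on \<open>X\<close> are represented extensionally, so that equality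
  means equality on \<open>X\<close>.\<close>

definition smooth_functions :: "('x, 'm, 'g) orbispace \<Rightarrow> ('x \<Rightarrow> real) ring" where
  "smooth_functions X = \<lparr>
     carrier = {f \<in> extensional (topspace (otop X)). sfun (orbispace_space X) (topspace (otop X)) f},
     mult = (\<lambda>f g. \<lambda>x\<in>topspace (otop X). f x * g x), one = (\<lambda>x\<in>topspace (otop X). 1),
     zero = (\<lambda>x\<in>topspace (otop X). 0), add = (\<lambda>f g. \<lambda>x\<in>topspace (otop X). f x + g x)\<rparr>"

section \<open>Vector orbibundles\<close>

text \<open>The orbibundle functor is indexed by \<open>cover_objects\<close> of a covering \<open>bcover\<close> of the base; \<open>bact\<close>,
  \<open>bchart\<close>, \<open>bmap\<close> refer to the total spaces, \<open>bact0\<close>, \<open>bchart0\<close>, \<open>bmap0\<close> to the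
  bases.\<close>

record ('x, 'e, 'm, 't, 'g) orbibundle =
  btop :: "'e topology"
  btop0 :: "'x topology"
  bproj :: "'e \<Rightarrow> 'x"
  bcover :: "'x set set"
  bdom :: "'x set \<Rightarrow> ('m, 't) vbundle"
  bgrp :: "'x set \<Rightarrow> 'g lgroup"
  bact :: "'x set \<Rightarrow> 'g \<Rightarrow> 't \<Rightarrow> 't"
  bact0 :: "'x set \<Rightarrow> 'g \<Rightarrow> 'm \<Rightarrow> 'm"
  bchart :: "'x set \<Rightarrow> 't \<Rightarrow> 'e"
  bchart0 :: "'x set \<Rightarrow> 'm \<Rightarrow> 'x"
  bmap :: "'x set \<Rightarrow> 'x set \<Rightarrow> 't \<Rightarrow> 't"
  bmap0 :: "'x set \<Rightarrow> 'x set \<Rightarrow> 'm \<Rightarrow> 'm"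
  bhom :: "'x set \<Rightarrow> 'x set \<Rightarrow> 'g \<Rightarrow> 'g"

abbreviation bobjects :: "('x, 'e, 'm, 't, 'g) orbibundle \<Rightarrow> 'x set set" where
  "bobjects E \<equiv> cover_objects (btop0 E) (bcover E)"

abbreviation bdom0 :: "('x, 'e, 'm, 't, 'g) orbibundle \<Rightarrow> 'x set \<Rightarrow> 'm set" where
  "bdom0 E U \<equiv> topspace (mtop (vbase (bdom E U)))"

definition base_orbispace :: "('x, 'e, 'm, 't, 'g) orbibundle \<Rightarrow> ('x, 'm, 'g) orbispace" where
  "base_orbispace E = \<lparr>otop = btop0 E, ocover = bcover E, odom = (\<lambda>U. vbase (bdom E U)),
     ogrp = bgrp E, oact = bact0 E, ochart = bchart0 E, omap = bmap0 E, ohom = bhom E\<rparr>"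

text \<open>The image of the chart at \<open>U\<close> is the preimage of \<open>U\<close> under \<open>bproj\<close>. These preimages are the
  objects of the category belonging to the induced open covering of \<open>E\<close>, since \<open>bproj\<close> has connected fibers and a continuous
  zero section.\<close>

definition vector_orbibundle :: "('x, 'e, 'm, 't, 'g) orbibundle \<Rightarrow> bool" where
  "vector_orbibundle E \<longleftrightarrow> orbispace (base_orbispace E) \<and> orbi_topology (btop E) \<and>
     (\<forall>U\<in>bobjects E. vb_sym (bdom E U) (bgrp E U) (bact E U) (bact0 E U)) \<and>
     (\<forall>U\<in>bobjects E. \<forall>V\<in>bobjects E. V \<subseteq> U \<longrightarrow>
        vb_map (bdom E V) (bdom E U) (bmap E V U) (bmap0 E V U)) \<and>
     orbi_functor (btop E) (bobjects E) (\<lambda>U. {e \<in> topspace (btop E). bproj E e \<in> U})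
       (\<lambda>U. \<lparr>ssp = vb_space (bdom E U), sgrp = bgrp E U, sact = bact E U\<rparr>)
       (bchart E) (bmap E) (bhom E) \<and>
     continuous_map (btop E) (btop0 E) (bproj E) \<and>
     (\<forall>U\<in>bobjects E. \<forall>v\<in>total (bdom E U). bproj E (bchart E U v) = bchart0 E U (vproj (bdom E U) v))"

definition orbibundle_space :: "('x, 'e, 'm, 't, 'g) orbibundle \<Rightarrow> 'e sspace" where
  "orbibundle_space E = \<lparr>stop = btop E, sfun = (\<lambda>W f.
     continuous_map (subtopology (btop E) W) euclideanreal f \<and>
     (\<forall>U\<in>bobjects E.
        sfun (vb_space (bdom E U)) {v \<in> total (bdom E U). bchart E U v \<in> W} (f \<circ> bchart E U)))\<rparr>"

text \<open>The orbispace $E \times (-\varepsilon, \varepsilon)$, with charts $\eta_U \times \mathrm{id}$.\<close>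

definition orbibundle_times_interval ::
  "('x, 'e, 'm, 't, 'g) orbibundle \<Rightarrow> real \<Rightarrow> ('e \<times> real) sspace" where
  "orbibundle_times_interval E \<epsilon> = \<lparr>stop = prod_topology (btop E) (top_of_set {-\<epsilon><..<\<epsilon>}),
     sfun = (\<lambda>W f.
       continuous_map (subtopology (prod_topology (btop E) (top_of_set {-\<epsilon><..<\<epsilon>})) W) euclideanreal f \<and>
       (\<forall>U\<in>bobjects E. sfun (vb_space (vb_prod (bdom E U) (interval \<epsilon>)))
          {(v, t) \<in> total (bdom E U) \<times> {-\<epsilon><..<\<epsilon>}. (bchart E U v, t) \<in> W}
          (\<lambda>(v, t). f (bchart E U v, t))))\<rparr>"

section \<open>Stratified sections\<close>

text \<open>The vectors fixed by the isotropy group of their base point.\<close>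

definition fixed_vectors :: "('x, 'e, 'm, 't, 'g) orbibundle \<Rightarrow> 'x set \<Rightarrow> 't set" where
  "fixed_vectors E U = {v \<in> total (bdom E U).
     \<forall>g\<in>stabilizer (bgrp E U) (bact0 E U) (vproj (bdom E U) v). bact E U g v = v}"

definition Estr :: "('x, 'e, 'm, 't, 'g) orbibundle \<Rightarrow> 'e set" where
  "Estr E = (\<Union>U\<in>bobjects E. bchart E U ` fixed_vectors E U)"

text \<open>The sum \<open>v + t w\<close> for \<open>v\<close> in \<open>E\<close> and \<open>w\<close> in \<open>Estr E\<close> over the same base point, and the zero
  vectors and scalar multiples in the fibers of \<open>Estr E\<close>.\<close>

definition str_plus :: "('x, 'e, 'm, 't, 'g) orbibundle \<Rightarrow> 'e \<Rightarrow> real \<Rightarrow> 'e \<Rightarrow> 'e" where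
  "str_plus E v t w = (THE z. \<exists>U\<in>bobjects E. \<exists>a\<in>total (bdom E U). \<exists>b\<in>fixed_vectors E U.
     vproj (bdom E U) a = vproj (bdom E U) b \<and> bchart E U a = v \<and> bchart E U b = w \<and>
     z = bchart E U (vadd (bdom E U) a (vscale (bdom E U) t b)))"

definition str_scale :: "('x, 'e, 'm, 't, 'g) orbibundle \<Rightarrow> real \<Rightarrow> 'e \<Rightarrow> 'e" where
  "str_scale E t w = (THE z. \<exists>U\<in>bobjects E. \<exists>b\<in>fixed_vectors E U.
     bchart E U b = w \<and> z = bchart E U (vscale (bdom E U) t b))"

definition str_zero :: "('x, 'e, 'm, 't, 'g) orbibundle \<Rightarrow> 'x \<Rightarrow> 'e" where
  "str_zero E x = (THE z. \<exists>U\<in>bobjects E. \<exists>y\<in>bdom0 E U.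
     bchart0 E U y = x \<and> z = bchart E U (vzero (bdom E U) y))"

definition orbisection :: "('x, 'e, 'm, 't, 'g) orbibundle \<Rightarrow> ('x \<Rightarrow> 'e) \<Rightarrow> bool" where
  "orbisection E s \<longleftrightarrow> continuous_map (btop0 E) (btop E) s \<and>
     (\<forall>x\<in>topspace (btop0 E). bproj E (s x) = x)"

definition vertical_extension ::
  "('x, 'e, 'm, 't, 'g) orbibundle \<Rightarrow> ('x \<Rightarrow> 'e) \<Rightarrow> 'e \<times> real \<Rightarrow> 'e" where
  "vertical_extension E s = (\<lambda>(v, t). str_plus E v t (s (bproj E v)))"

definition smooth_stratified_section ::
  "('x, 'e, 'm, 't, 'g) orbibundle \<Rightarrow> ('x \<Rightarrow> 'e) \<Rightarrow> bool" where
  "smooth_stratified_section E s \<longleftrightarrow> orbisection E s \<and>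
     smooth_map (orbispace_space (base_orbispace E)) (orbibundle_space E) s \<and>
     s ` topspace (btop0 E) \<subseteq> Estr E \<and>
     (\<exists>\<epsilon>0>0. \<forall>\<epsilon>. 0 < \<epsilon> \<and> \<epsilon> < \<epsilon>0 \<longrightarrow>
        smooth_map (orbibundle_times_interval E \<epsilon>) (orbibundle_space E) (vertical_extension E s))"

text \<open>The multiplicative fields of the record are not used for modules.\<close>

definition stratified_sections ::
  "('x, 'e, 'm, 't, 'g) orbibundle \<Rightarrow> ('x \<Rightarrow> real, 'x \<Rightarrow> 'e) module" where
  "stratified_sections E = \<lparr>
     carrier = {s \<in> extensional (topspace (btop0 E)). smooth_stratified_section E s},
     mult = undefined, one = undefined,
     zero = (\<lambda>x\<in>topspace (btop0 E). str_zero E x),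
     add = (\<lambda>s s'. \<lambda>x\<in>topspace (btop0 E). str_plus E (s x) 1 (s' x)),
     smult = (\<lambda>f s. \<lambda>x\<in>topspace (btop0 E). str_scale E (f x) (s x))\<rparr>"

section \<open>Good sections\<close>

definition smooth_vb_section :: "('m, 't) vbundle \<Rightarrow> ('m \<Rightarrow> 't) \<Rightarrow> bool" where
  "smooth_vb_section F \<sigma> \<longleftrightarrow> smooth_map (mfd_space (vbase F)) (vb_space F) \<sigma> \<and>
     (\<forall>x\<in>topspace (mtop (vbase F)). vproj F (\<sigma> x) = x)"

definition good_family ::
  "('x, 'e, 'm, 't, 'g) orbibundle \<Rightarrow> ('x \<Rightarrow> 'e) \<Rightarrow> ('x set \<Rightarrow> 'm \<Rightarrow> 't) \<Rightarrow> bool" where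
  "good_family E s \<sigma> \<longleftrightarrow> (\<forall>U\<in>bobjects E. smooth_vb_section (bdom E U) (\<sigma> U)) \<and>
     (\<forall>U\<in>bobjects E. \<forall>g\<in>carrier (bgrp E U). \<forall>x\<in>bdom0 E U.
        \<sigma> U (bact0 E U g x) = bact E U g (\<sigma> U x)) \<and>
     (\<forall>U\<in>bobjects E. \<forall>V\<in>bobjects E. V \<subseteq> U \<longrightarrow>
        (\<forall>y\<in>bdom0 E V. \<sigma> U (bmap0 E V U y) = bmap E V U (\<sigma> V y))) \<and>
     (\<forall>U\<in>bobjects E. \<forall>x\<in>bdom0 E U. bchart E U (\<sigma> U x) = s (bchart0 E U x))"

definition good_section :: "('x, 'e, 'm, 't, 'g) orbibundle \<Rightarrow> ('x \<Rightarrow> 'e) \<Rightarrow> bool" where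
  "good_section E s \<longleftrightarrow> (\<exists>\<sigma>. good_family E s \<sigma>)"

end

theory Submission
  imports Defs "Jordan_Normal_Form.Determinant"
begin

text \<open>The point is that a smooth stratified section \<open>s\<close> lifts to a smooth section \<open>\<sigma>\<close> of every chart. Each value of
  \<open>s\<close> has a unique lift fixed by the isotropy group, since the fibers of the chart maps are the orbits of the group.
  Let \<open>p\<close> be a fiber coordinate in a local trivialization. Averaging over the group gives an invariant inner product
  \<open>\<gamma>\<close> on the linear functionals of the fibers. The quadratic form \<open>f\<close> on the bundle obtained by averaging
  \<open>\<Sum>i j. \<gamma>\<^sup>i\<^sup>j p\<^sub>i(v) p\<^sub>j(v)\<close>, where the \<open>p\<^sub>i\<close> are the coordinates of a finite stage to which all translates of \<open>p\<close>
  belong, is smooth and invariant. If \<open>w\<close> is the vector field representing \<open>p\<close> with respect to \<open>\<gamma>\<close>, then, up to a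
  positive smooth factor, \<open>f (w + t v) - f (w - t v) = 4 t p(v)\<close>. As \<open>f\<close> descends to \<open>E\<close>, smoothness of the vertical
  extension of \<open>s\<close> implies that \<open>p(\<sigma>) = (f (w + t \<sigma>) - f (w - t \<sigma>)) / 4 t\<close> is smooth.\<close>

section \<open>Differential calculus with a continuous parameter\<close>

text \<open>Charts detect only functions on the bundle that are invariant under the group, and
  averaging a linear coordinate \<open>p\<close> may annihilate it; hence the detour through
  quadratic functions. The field \<open>w\<close> need not be invariant: it supplies base vectors at
  which the vertical extension is evaluated, at two fixed times \<open>t\<close> and
  \<open>- t\<close>, so that no derivative in \<open>t\<close> occurs. Fibers may be profinite, and
  a smooth function on them depends locally on one finite stage; a nondegenerate smooth form on
  vectors is then out of reach. Functionals do factor through finite stages, so the metric lives on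
  the dual and only a degenerate form is returned to the vectors. The action does not respect the
  stages; a common one is found with compactness of the group and a cutoff \<open>\<kappa>\<close>
  supported in one trivialization. The cutoff may make the matrices singular away from the given
  point, so determinants are kept as factors and adjugates take the place of inverses. Averages must
  be differentiated under the mean, which explains a calculus with a parameter that enters only
  continuously.\<close>

abbreviation Euclid :: "nat \<Rightarrow> (nat \<Rightarrow> real) set" where
  "Euclid n \<equiv> topspace (Euclidean_space n)"

abbreviation openE :: "nat \<Rightarrow> (nat \<Rightarrow> real) set \<Rightarrow> bool" where
  "openE n \<equiv> openin (Euclidean_space n)"

abbreviation creal :: "'a topology \<Rightarrow> ('a \<Rightarrow> real) \<Rightarrow> bool" where
  "creal T \<equiv> continuous_map T euclideanreal"

abbreviation contE :: "nat \<Rightarrow> (nat \<Rightarrow> real) set \<Rightarrow> ((nat \<Rightarrow> real) \<Rightarrow> real) \<Rightarrow> bool" where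
  "contE n W \<equiv> creal (subtopology (Euclidean_space n) W)"

lemma Euclid_upd: "x \<in> Euclid n \<Longrightarrow> i < n \<Longrightarrow> x(i := s) \<in> Euclid n"
  by (auto simp: topspace_Euclidean_space)

lemma continuous_map_Euclidean_space_iff:
  "continuous_map X (Euclidean_space n) f \<longleftrightarrow>
     (\<forall>i. creal X (\<lambda>x. f x i)) \<and> f \<in> topspace X \<rightarrow> Euclid n"
  unfolding Euclidean_space_def
  by (auto simp: continuous_map_in_subtopology continuous_map_componentwise_UNIV)

lemma continuous_map_Euclidean_coord: "creal (Euclidean_space n) (\<lambda>x. x i)"
  using continuous_map_Euclidean_space_iff[of "Euclidean_space n" n id] by auto

lemma openin_box:
  "openE n {y \<in> Euclid n. \<forall>l<n. \<bar>y l - x l\<bar> < d}"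
proof (induction n)
  case 0
  then show ?case by simp
next
  case (Suc m)
  have op: "openE N {y \<in> Euclid N. \<bar>y l - x l\<bar> < d}" for N l
  proof -
    have "creal (Euclidean_space N) (\<lambda>y. \<bar>y l - x l\<bar>)"
      by (intro continuous_intros continuous_map_Euclidean_coord)
    from openin_continuous_map_preimage[OF this, of "{..<d}"] show ?thesis by simp
  qed
  \<comment> \<open>The dimension \<open>N\<close> and the number \<open>k\<close> of constrained
    coordinates are separated, so that the induction runs over \<open>k\<close> in a fixed
    space.\<close>
  have "openE N {y \<in> Euclid N. \<forall>l<k. \<bar>y l - x l\<bar> < d}" for N k
  proof (induction k)
    case (Suc k)
    have "{y \<in> Euclid N. \<forall>l<Suc k. \<bar>y l - x l\<bar> < d} =
        {y \<in> Euclid N. \<forall>l<k. \<bar>y l - x l\<bar> < d} \<inter> {y \<in> Euclid N. \<bar>y k - x k\<bar> < d}"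
      by (auto simp: less_Suc_eq)
    then show ?case using Suc op by (simp add: openin_Int)
  qed simp
  then show ?case .
qed

text \<open>A basic open set of the product topology gives one radius for each coordinate. Points of
  the space can differ only in the first \<open>n\<close> coordinates, so the minimum of finitely
  many radii is enough.\<close>

lemma openin_Euclidean_space_box:
  assumes "openE n U" "x \<in> U"
  obtains d where "d > 0" "\<And>y. y \<in> Euclid n \<Longrightarrow> (\<And>l. l < n \<Longrightarrow> \<bar>y l - x l\<bar> < d) \<Longrightarrow> y \<in> U"
proof -
  obtain V where V: "openin (powertop_real UNIV) V" "U = V \<inter> {x. \<forall>i\<ge>n. x i = 0}"
    using assms(1) unfolding Euclidean_space_def openin_subtopology by blast
  from product_topology_open_contains_basis[OF V(1), of x] assms V(2)
  obtain X where X: "x \<in> (\<Pi>\<^sub>E i\<in>UNIV. X i)" "\<And>i. openin euclideanreal (X i)"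
    "(\<Pi>\<^sub>E i\<in>UNIV. X i) \<subseteq> V" by auto
  have "\<exists>e>0. \<forall>s. \<bar>s - x l\<bar> < e \<longrightarrow> s \<in> X l" for l
  proof -
    have "open (X l)" "x l \<in> X l" using X by auto
    then show ?thesis unfolding open_dist by (simp add: dist_real_def)
  qed
  then obtain e where e: "\<And>l. e l > (0::real)" "\<And>l s. \<bar>s - x l\<bar> < e l \<Longrightarrow> s \<in> X l" by metis
  \<comment> \<open>The extra element 1 keeps the set nonempty when \<open>n = 0\<close>.\<close>
  define d where "d = Min (insert 1 (e ` {..<n}))"
  show thesis
  proof (rule that[of d])
    show "d > 0" unfolding d_def using e by (subst Min_gr_iff) auto
    fix y assume y: "y \<in> Euclid n" "\<And>l. l < n \<Longrightarrow> \<bar>y l - x l\<bar> < d"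
    have "y l \<in> X l" for l
    proof (cases "l < n")
      case True
      then have "d \<le> e l" unfolding d_def by (intro Min_le) auto
      then show ?thesis using e(2) y(2)[OF True] by force
    next
      case False
      then have "y l = x l" using y(1) assms(2) V(2) by (auto simp: topspace_Euclidean_space)
      then show ?thesis using e by (metis abs_zero cancel_comm_monoid_add_class.diff_cancel)
    qed
    then have "y \<in> V" using X(3) by auto
    then show "y \<in> U" using y(1) V(2) by (auto simp: topspace_Euclidean_space)
  qed
qed

section \<open>Functions of a Euclidean point and a topological parameter\<close>

abbreviation prodE :: "nat \<Rightarrow> 't topology \<Rightarrow> ((nat \<Rightarrow> real) \<times> 't) topology" where
  "prodE n T \<equiv> prod_topology (Euclidean_space n) T"

abbreviation contP :: "nat \<Rightarrow> ((nat \<Rightarrow> real) \<times> 't) set \<Rightarrow> 't topology \<Rightarrow> ((nat \<Rightarrow> real) \<times> 't \<Rightarrow> real) \<Rightarrow> bool" where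
  "contP n Y T \<equiv> creal (subtopology (prodE n T) Y)"

abbreviation pder :: "nat \<Rightarrow> ((nat \<Rightarrow> real) \<times> 't) set \<Rightarrow> ((nat \<Rightarrow> real) \<times> 't \<Rightarrow> real) \<Rightarrow> ((nat \<Rightarrow> real) \<times> 't \<Rightarrow> real) \<Rightarrow> bool" where
  "pder i Y f g \<equiv> \<forall>(x, t)\<in>Y. ((\<lambda>s. f (x(i := s), t)) has_real_derivative g (x, t)) (at (x i))"

lemma openin_prodE_box:
  assumes "openin (prodE n T) Y" "(x, t) \<in> Y"
  obtains d T' where "d > 0" "openin T T'" "t \<in> T'"
    "\<And>y s. y \<in> Euclid n \<Longrightarrow> (\<And>l. l < n \<Longrightarrow> \<bar>y l - x l\<bar> < d) \<Longrightarrow> s \<in> T' \<Longrightarrow> (y, s) \<in> Y"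
proof -
  obtain U T' where U: "openE n U" "openin T T'" "x \<in> U" "t \<in> T'" "U \<times> T' \<subseteq> Y"
    using assms(1)[unfolded openin_prod_topology_alt] assms(2) by meson
  obtain d where "d > 0" "\<And>y. y \<in> Euclid n \<Longrightarrow> (\<And>l. l < n \<Longrightarrow> \<bar>y l - x l\<bar> < d) \<Longrightarrow> y \<in> U"
    using openin_Euclidean_space_box[OF U(1,3)] by blast
  then show thesis using U by (intro that[of d T']) auto
qed

lemma continuous_prodE_box:
  assumes "contP n Y T f"
    "openin (prodE n T) Y" "(x, t) \<in> Y" "e > 0"
  obtains d T' where "d > 0" "openin T T'" "t \<in> T'"
    "\<And>y s. y \<in> Euclid n \<Longrightarrow> (\<And>l. l < n \<Longrightarrow> \<bar>y l - x l\<bar> < d) \<Longrightarrow> s \<in> T' \<Longrightarrow>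
       (y, s) \<in> Y \<and> \<bar>f (y, s) - f (x, t)\<bar> < e"
proof -
  have "openin (subtopology (prodE n T) Y)
      {p \<in> topspace (subtopology (prodE n T) Y). f p \<in> ball (f (x, t)) e}"
    by (rule openin_continuous_map_preimage[OF assms(1)]) simp
  then have "openin (prodE n T) {p \<in> topspace (subtopology (prodE n T) Y). f p \<in> ball (f (x, t)) e}"
    using assms(2) openin_open_subtopology by blast
  moreover have "(x, t) \<in> {p \<in> topspace (subtopology (prodE n T) Y). f p \<in> ball (f (x, t)) e}"
    using assms openin_subset by fastforce
  ultimately obtain d T' where d: "d > 0" "openin T T'" "t \<in> T'"
    "\<And>y s. y \<in> Euclid n \<Longrightarrow> (\<And>l. l < n \<Longrightarrow> \<bar>y l - x l\<bar> < d) \<Longrightarrow> s \<in> T' \<Longrightarrow>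
       (y, s) \<in> {p \<in> topspace (subtopology (prodE n T) Y). f p \<in> ball (f (x, t)) e}"
    by (rule openin_prodE_box) blast
  show thesis
  proof (rule that[OF d(1-3)])
    fix y s assume "y \<in> Euclid n" "\<And>l. l < n \<Longrightarrow> \<bar>y l - x l\<bar> < d" "s \<in> T'"
    from d(4)[OF this] show "(y, s) \<in> Y \<and> \<bar>f (y, s) - f (x, t)\<bar> < e"
      by (simp add: dist_real_def abs_minus_commute)
  qed
qed

text \<open>The recursion of \<open>Ck\<close> with derivatives in the Euclidean variable only, each
  of them jointly continuous in point and parameter. Joint continuity is what survives averaging
  over a compact parameter space.\<close>

primrec PCk :: "nat \<Rightarrow> nat \<Rightarrow> ((nat \<Rightarrow> real) \<times> 't) set \<Rightarrow> 't topology \<Rightarrow> ((nat \<Rightarrow> real) \<times> 't \<Rightarrow> real) \<Rightarrow> bool"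
where
  "PCk 0 n Y T f \<longleftrightarrow> contP n Y T f"
| "PCk (Suc k) n Y T f \<longleftrightarrow> contP n Y T f \<and> (\<exists>f'. \<forall>i<n. pder i Y f (f' i) \<and> PCk k n Y T (f' i))"

abbreviation pstep :: "nat \<Rightarrow> nat \<Rightarrow> ((nat \<Rightarrow> real) \<times> 't) set \<Rightarrow> 't topology \<Rightarrow> ((nat \<Rightarrow> real) \<times> 't \<Rightarrow> real) \<Rightarrow>
    (nat \<Rightarrow> (nat \<Rightarrow> real) \<times> 't \<Rightarrow> real) \<Rightarrow> bool" where
  "pstep k n Y T f f' \<equiv> \<forall>i<n. pder i Y f (f' i) \<and> PCk k n Y T (f' i)"

lemma PCk_continuous: "PCk k n Y T f \<Longrightarrow> contP n Y T f"
  by (cases k) auto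

lemma PCk_SucD: "PCk (Suc k) n Y T f \<Longrightarrow> PCk k n Y T f"
proof (induction k arbitrary: f)
  case 0
  then show ?case by auto
next
  case (Suc k)
  from Suc.prems obtain f' where f': "contP n Y T f"
    "pstep (Suc k) n Y T f f'" by (auto simp only: PCk.simps)
  then have "pstep k n Y T f f'" using Suc.IH by blast
  then show ?case using f'(1) by (simp only: PCk.simps) blast
qed

lemma PCk_SucE:
  assumes "PCk (Suc k) n Y T f"
  obtains f' where
    "\<And>i x t. i < n \<Longrightarrow> (x, t) \<in> Y \<Longrightarrow> ((\<lambda>s. f (x(i := s), t)) has_real_derivative f' i (x, t)) (at (x i))"
    "\<And>i. i < n \<Longrightarrow> PCk k n Y T (f' i)"
proof -
  from assms obtain f' where f': "pstep k n Y T f f'" unfolding PCk.simps by blast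
  show thesis by (rule that[of f']) (use f' in fast)+
qed

lemma PCk_SucI:
  assumes "contP n Y T f"
    "\<And>i x t. i < n \<Longrightarrow> (x, t) \<in> Y \<Longrightarrow> ((\<lambda>s. f (x(i := s), t)) has_real_derivative f' i (x, t)) (at (x i))"
    "\<And>i. i < n \<Longrightarrow> PCk k n Y T (f' i)"
  shows "PCk (Suc k) n Y T f"
proof -
  have "pstep k n Y T f f'" using assms(2,3) by auto
  then show ?thesis using assms(1) unfolding PCk.simps by blast
qed

lemma PCk_subset: "PCk k n Y T f \<Longrightarrow> Y' \<subseteq> Y \<Longrightarrow> PCk k n Y' T f"
proof (induction k arbitrary: f)
  case 0
  then show ?case by (auto intro: continuous_map_from_subtopology_mono)
next
  case (Suc k)
  then obtain f' where f': "pstep k n Y T f f'" by auto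
  have "pstep k n Y' T f f'" using f' Suc by blast
  then show ?case using Suc.prems by (auto intro: continuous_map_from_subtopology_mono)
qed

lemma eventually_slice:
  assumes "openin (prodE n T) Y" "(x, t) \<in> Y" "i < n"
  shows "eventually (\<lambda>s. (x(i := s), t) \<in> Y) (nhds (x i))"
proof -
  obtain d T' where d: "d > 0" "openin T T'" "t \<in> T'"
    "\<And>y s. y \<in> Euclid n \<Longrightarrow> (\<And>l. l < n \<Longrightarrow> \<bar>y l - x l\<bar> < d) \<Longrightarrow> s \<in> T' \<Longrightarrow> (y, s) \<in> Y"
    using openin_prodE_box[OF assms(1,2)] by metis
  have "x \<in> Euclid n" using assms openin_subset by fastforce
  then have "(x(i := s), t) \<in> Y" if "\<bar>s - x i\<bar> < d" for s
    using that d Euclid_upd[OF _ assms(3)] by auto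
  then show ?thesis unfolding eventually_nhds_metric using d(1) by (auto simp: dist_real_def)
qed

lemma DERIV_cong_slice:
  assumes "openin (prodE n T) Y" "(x, t) \<in> Y" "i < n" "\<And>p. p \<in> Y \<Longrightarrow> f p = g p"
    "((\<lambda>s. f (x(i := s), t)) has_real_derivative D) (at (x i))"
  shows "((\<lambda>s. g (x(i := s), t)) has_real_derivative D) (at (x i))"
proof -
  have "eventually (\<lambda>s. f (x(i := s), t) = g (x(i := s), t)) (nhds (x i))"
    using eventually_slice[OF assms(1-3)] by eventually_elim (use assms(4) in auto)
  from DERIV_cong_ev[OF refl this refl, THEN iffD1, OF assms(5)] show ?thesis .
qed

lemma PCk_cong:
  assumes "openin (prodE n T) Y" "\<And>p. p \<in> Y \<Longrightarrow> f p = g p" "PCk k n Y T f"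
  shows "PCk k n Y T g"
proof -
  have c: "contP n Y T g"
    using PCk_continuous[OF assms(3)] by (rule continuous_map_eq) (use assms(2) in auto)
  show ?thesis
  proof (cases k)
    case 0 then show ?thesis using c by simp
  next
    case (Suc k')
    obtain f' where f': "pstep k' n Y T f f'" using assms(3) Suc by auto
    have "((\<lambda>s. g (x(i := s), t)) has_real_derivative f' i (x, t)) (at (x i))"
      if "i < n" "(x, t) \<in> Y" for i x t
      using f' that by (intro DERIV_cong_slice[OF assms(1) that(2,1) assms(2)]) auto
    then show ?thesis using c f' Suc by (auto intro!: exI[of _ f'])
  qed
qed

text \<open>Continuity is glued by the pasting lemma. Local witnesses for the derivatives do not
  form a global one by themselves; as derivatives are unique, \<open>THE\<close> picks one function
  \<open>?D\<close> that agrees with every local witness.\<close>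

lemma PCk_local:
  assumes "openin (prodE n T) Y"
    "\<And>p. p \<in> Y \<Longrightarrow> \<exists>Y'. openin (prodE n T) Y' \<and> p \<in> Y' \<and> PCk k n (Y \<inter> Y') T f"
  shows "PCk k n Y T f"
  using assms(2)
proof (induction k arbitrary: f)
  have cont: "contP n Y T f"
    if *: "\<And>p. p \<in> Y \<Longrightarrow> \<exists>Y'. openin (prodE n T) Y' \<and> p \<in> Y' \<and> PCk k n (Y \<inter> Y') T f" for k f
  proof -
    let ?S = "{Y'. openin (prodE n T) Y' \<and> PCk k n (Y \<inter> Y') T f}"
    show ?thesis
    proof (rule pasting_lemma[where I = ?S and T = "\<lambda>W. Y \<inter> W" and f = "\<lambda>W. f"])
      show "openin (subtopology (prodE n T) Y) (Y \<inter> W)" if "W \<in> ?S" for W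
        using that assms(1) by (auto simp: openin_open_subtopology intro: openin_Int)
      show "creal (subtopology (subtopology (prodE n T) Y) (Y \<inter> W)) f"
        if "W \<in> ?S" for W
        using PCk_continuous[of k n "Y \<inter> W" T f] that by (simp add: subtopology_subtopology)
      show "\<exists>W. W \<in> ?S \<and> p \<in> Y \<inter> W \<and> f p = f p"
        if "p \<in> topspace (subtopology (prodE n T) Y)" for p
        using *[of p] that by auto
    qed auto
  qed
  {
    case 0
    then show ?case using cont[of 0] by simp
  next
    case (Suc k)
    note 2 = Suc
    let ?D = "\<lambda>i p. THE D. ((\<lambda>s. f ((fst p)(i := s), snd p)) has_real_derivative D) (at (fst p i))"
    have D: "((\<lambda>s. f (x(i := s), t)) has_real_derivative ?D i (x, t)) (at (x i))"
      if ix: "i < n" "(x, t) \<in> Y" for i x t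
    proof -
      obtain Y' where O: "openin (prodE n T) Y'" "(x, t) \<in> Y'" "PCk (Suc k) n (Y \<inter> Y') T f"
        using 2(2)[OF ix(2)] by blast
      from O(3) obtain f' where "\<forall>i<n. (\<forall>(x, t)\<in>Y \<inter> Y'. ((\<lambda>s. f (x(i := s), t)) has_real_derivative f' i (x, t)) (at (x i)))"
        unfolding PCk.simps by blast
      then have "((\<lambda>s. f (x(i := s), t)) has_real_derivative f' i (x, t)) (at (x i))"
        using ix O(2) by fast
      then have "\<exists>!D. ((\<lambda>s. f (x(i := s), t)) has_real_derivative D) (at (x i))"
        using DERIV_unique by blast
      from theI'[OF this] show ?thesis by simp
    qed
    have "PCk k n Y T (?D i)" if i: "i < n" for i
    proof (rule 2(1))
      fix p assume p: "p \<in> Y"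
      obtain Y' where O: "openin (prodE n T) Y'" "p \<in> Y'" "PCk (Suc k) n (Y \<inter> Y') T f"
        using 2(2)[OF p] by blast
      from O(3) obtain f' where f': "\<forall>i<n. (\<forall>(x, t)\<in>Y \<inter> Y'. ((\<lambda>s. f (x(i := s), t)) has_real_derivative f' i (x, t)) (at (x i))) \<and>
        PCk k n (Y \<inter> Y') T (f' i)" unfolding PCk.simps by blast
      have "PCk k n (Y \<inter> Y') T (?D i)"
      proof (rule PCk_cong[of _ _ _ "f' i"])
        show "openin (prodE n T) (Y \<inter> Y')" using assms(1) O(1) by blast
        show "f' i q = ?D i q" if q: "q \<in> Y \<inter> Y'" for q
        proof (cases q)
          case (Pair x t)
          have "((\<lambda>s. f (x(i := s), t)) has_real_derivative f' i (x, t)) (at (x i))"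
            using f' i q Pair by fast
          moreover have "(x, t) \<in> Y" using q Pair by simp
          ultimately show ?thesis using D[OF i] DERIV_unique unfolding Pair by blast
        qed
        show "PCk k n (Y \<inter> Y') T (f' i)" using f' i by blast
      qed
      then show "\<exists>Y'. openin (prodE n T) Y' \<and> p \<in> Y' \<and> PCk k n (Y \<inter> Y') T (?D i)" using O by blast
    qed
    then show ?case using D cont[OF 2(2)] by (auto intro!: exI[of _ ?D])
  }
qed

lemma PCk_param:
  assumes "creal T h"
  shows "PCk k n Y T (\<lambda>(x, t). h t)"
proof -
  have c: "contP n Y T (\<lambda>(x, t). h t)"
    if "creal T h" for h
    using continuous_map_compose[OF continuous_map_snd that, of "Euclidean_space n"]
    by (auto simp: comp_def case_prod_unfold continuous_map_from_subtopology)
  have z: "PCk k n Y T (\<lambda>(x, t). 0)" for k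
  proof (induction k)
    case 0
    then show ?case by (simp add: case_prod_unfold)
  next
    case (Suc k)
    then show ?case by (auto simp: case_prod_unfold intro!: exI[of _ "\<lambda>i p. 0"])
  qed
  show ?thesis
  proof (cases k)
    case (Suc k')
    then show ?thesis using c[OF assms] z[of k'] by (auto intro!: exI[of _ "\<lambda>i p. 0"] simp: case_prod_unfold)
  qed (use c[OF assms] in simp)
qed

lemma PCk_const: "PCk k n Y T (\<lambda>p. a)"
  using PCk_param[of T "\<lambda>_. a" k n Y] by (simp add: case_prod_unfold)

lemma PCk_coord: "PCk k n Y T (\<lambda>p. fst p j)"
proof -
  have c: "contP n Y T (\<lambda>p. fst p j)"
    using continuous_map_compose[OF continuous_map_fst continuous_map_Euclidean_coord, of n T j]
    by (auto simp: comp_def continuous_map_from_subtopology)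
  have "((\<lambda>s. (x(i := s)) j) has_real_derivative (if i = j then 1 else 0)) (at (x i))" for x :: "nat \<Rightarrow> real" and i
    by (cases "i = j") auto
  then show ?thesis using c PCk_const
    by (cases k) (auto intro!: exI[of _ "\<lambda>i p. if i = j then 1 else 0"])
qed

lemma PCk_add:
  assumes "PCk k n Y T f" "PCk k n Y T g"
  shows "PCk k n Y T (\<lambda>p. f p + g p)"
  using assms
proof (induction k arbitrary: f g)
  case 0
  then show ?case by (auto intro: continuous_intros)
next
  case (Suc k)
  then obtain f' g' where
    "pstep k n Y T f f'"
    "\<forall>i<n. pder i Y g (g' i) \<and> PCk k n Y T (g' i)"
    by auto
  then have "\<forall>i<n. (\<forall>(x, t)\<in>Y. ((\<lambda>s. f (x(i := s), t) + g (x(i := s), t)) has_real_derivative f' i (x, t) + g' i (x, t)) (at (x i)))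
      \<and> PCk k n Y T (\<lambda>p. f' i p + g' i p)"
    using Suc.IH by (auto intro!: derivative_intros)
  then show ?case using PCk_continuous[OF Suc.prems(1)] PCk_continuous[OF Suc.prems(2)]
    by (auto intro!: continuous_intros exI[of _ "\<lambda>i p. f' i p + g' i p"])
qed

lemma PCk_mult:
  assumes "PCk k n Y T f" "PCk k n Y T g"
  shows "PCk k n Y T (\<lambda>p. f p * g p)"
  using assms
proof (induction k arbitrary: f g)
  case 0
  then show ?case by (auto intro: continuous_intros)
next
  case (Suc k)
  then obtain f' g' where
    "pstep k n Y T f f'"
    "\<forall>i<n. pder i Y g (g' i) \<and> PCk k n Y T (g' i)"
    by auto
  then have "\<forall>i<n. (\<forall>(x, t)\<in>Y. ((\<lambda>s. f (x(i := s), t) * g (x(i := s), t)) has_real_derivative f' i (x, t) * g (x, t) + f (x, t) * g' i (x, t)) (at (x i)))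
      \<and> PCk k n Y T (\<lambda>p. f' i p * g p + f p * g' i p)"
    using Suc.IH PCk_SucD[OF Suc.prems(1)] PCk_SucD[OF Suc.prems(2)]
    by (auto intro!: derivative_eq_intros PCk_add)
  then show ?case using PCk_continuous[OF Suc.prems(1)] PCk_continuous[OF Suc.prems(2)]
    by (auto intro!: continuous_intros exI[of _ "\<lambda>i p. f' i p * g p + f p * g' i p"])
qed

lemma PCk_sum: "finite J \<Longrightarrow> (\<And>j. j \<in> J \<Longrightarrow> PCk k n Y T (f j)) \<Longrightarrow> PCk k n Y T (\<lambda>p. \<Sum>j\<in>J. f j p)"
  by (induction J rule: finite_induct) (auto intro: PCk_const PCk_add)

lemma PCk_prod: "finite J \<Longrightarrow> (\<And>j. j \<in> J \<Longrightarrow> PCk k n Y T (f j)) \<Longrightarrow> PCk k n Y T (\<lambda>p. \<Prod>j\<in>J. f j p)"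
  by (induction J rule: finite_induct) (auto intro: PCk_const PCk_mult)

lemma PCk_cmult: "PCk k n Y T f \<Longrightarrow> PCk k n Y T (\<lambda>p. a * f p)"
  using PCk_mult[OF PCk_const] by blast

lemma PCk_diff: "PCk k n Y T f \<Longrightarrow> PCk k n Y T g \<Longrightarrow> PCk k n Y T (\<lambda>p. f p - g p)"
  using PCk_add[of k n Y T f "\<lambda>p. - 1 * g p"] PCk_cmult[of k n Y T g "- 1"] by simp

text \<open>The derivative is written as \<open>- 1 * (inverse f * (f' * inverse f))\<close>, so
  that the induction hypothesis for \<open>inverse f\<close> and closure under products cover
  it.\<close>

lemma PCk_inverse:
  assumes "PCk k n Y T f" "\<And>p. p \<in> Y \<Longrightarrow> f p \<noteq> 0"
  shows "PCk k n Y T (\<lambda>p. inverse (f p))"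
  using assms(1)
proof (induction k)
  case 0
  then show ?case using assms(2) by (auto intro!: continuous_map_real_inverse)
next
  case (Suc k)
  then obtain f' where
    f': "pstep k n Y T f f'"
    by auto
  have I: "PCk k n Y T (\<lambda>p. inverse (f p))" using Suc PCk_SucD by blast
  have "\<forall>i<n. (\<forall>(x, t)\<in>Y. ((\<lambda>s. inverse (f (x(i := s), t))) has_real_derivative - 1 * (inverse (f (x, t)) * (f' i (x, t) * inverse (f (x, t))))) (at (x i)))
      \<and> PCk k n Y T (\<lambda>p. - 1 * (inverse (f p) * (f' i p * inverse (f p))))"
  proof (intro allI impI conjI ballI)
    fix i assume i: "i < n"
    show "PCk k n Y T (\<lambda>p. - 1 * (inverse (f p) * (f' i p * inverse (f p))))"
      using I f' i by (intro PCk_cmult PCk_mult) auto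
    fix p assume p: "p \<in> Y"
    obtain x t where xt: "p = (x, t)" by fastforce
    have "((\<lambda>s. inverse (f (x(i := s), t))) has_real_derivative - (inverse (f (x, t)) * (f' i (x, t) * inverse (f (x, t))))) (at (x i))"
      using f' i p xt assms(2)[OF p] DERIV_inverse'[of "\<lambda>s. f (x(i := s), t)" "f' i (x, t)" "x i" UNIV] by (auto simp: mult.assoc)
    then show "case p of (x, t) \<Rightarrow> ((\<lambda>s. inverse (f (x(i := s), t))) has_real_derivative - 1 * (inverse (f (x, t)) * (f' i (x, t) * inverse (f (x, t))))) (at (x i))"
      using xt by simp
  qed
  then show ?case using PCk_continuous[OF I] unfolding PCk.simps
    by (intro conjI exI[of _ "\<lambda>i p. - 1 * (inverse (f p) * (f' i p * inverse (f p)))"])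
qed

text \<open>The increment of \<open>g\<close> is telescoped along the edges of a box.\<close>

lemma box_mean_value:
  assumes "z \<in> Euclid m" "z' \<in> Euclid m"
    and box: "\<And>u. u \<in> Euclid m \<Longrightarrow> (\<And>l. l < m \<Longrightarrow> min (z l) (z' l) \<le> u l \<and> u l \<le> max (z l) (z' l)) \<Longrightarrow> (u, t) \<in> V"
    and der: "\<And>j u. j < m \<Longrightarrow> (u, t) \<in> V \<Longrightarrow> ((\<lambda>s. g (u(j := s), t)) has_real_derivative g' j (u, t)) (at (u j))"
  obtains \<xi> where "\<And>j. j < m \<Longrightarrow> \<xi> j \<in> Euclid m"
    "\<And>j l. j < m \<Longrightarrow> l < m \<Longrightarrow> min (z l) (z' l) \<le> \<xi> j l \<and> \<xi> j l \<le> max (z l) (z' l)"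
    "g (z', t) - g (z, t) = (\<Sum>j<m. g' j (\<xi> j, t) * (z' j - z j))"
proof -
  define h where "h j l = (if l < j then z' l else z l)" for j l :: nat
  have hE: "h j \<in> Euclid m" for j using assms(1,2) by (auto simp: h_def topspace_Euclidean_space)
  have h0: "h 0 = z" by (auto simp: h_def)
  have hm: "h m = z'" using assms(1,2) by (auto simp: h_def topspace_Euclidean_space fun_eq_iff)
  have "\<exists>s. min (z j) (z' j) \<le> s \<and> s \<le> max (z j) (z' j) \<and>
      g (h (Suc j), t) - g (h j, t) = g' j ((h j)(j := s), t) * (z' j - z j)" if j: "j < m" for j
  proof -
    let ?f = "\<lambda>s. g ((h j)(j := s), t)"
    have hS: "h (Suc j) = (h j)(j := z' j)" "h j = (h j)(j := z j)" by (auto simp: h_def fun_eq_iff)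
    have D: "(?f has_real_derivative g' j ((h j)(j := s), t)) (at s)"
      if "min (z j) (z' j) \<le> s" "s \<le> max (z j) (z' j)" for s
    proof -
      have "((h j)(j := s), t) \<in> V"
        by (rule box) (use that hE j in \<open>auto simp: h_def intro: Euclid_upd\<close>)
      from der[OF j this] show ?thesis by simp
    qed
    consider "z j = z' j" | "z j < z' j" | "z' j < z j" by linarith
    then show ?thesis
    proof cases
      case 1
      then show ?thesis using hS by (intro exI[of _ "z j"]) auto
    next
      case 2
      then obtain s where "z j < s" "s < z' j" "?f (z' j) - ?f (z j) = (z' j - z j) * g' j ((h j)(j := s), t)"
        using MVT2[of "z j" "z' j" ?f "\<lambda>s. g' j ((h j)(j := s), t)"] D by auto
      then show ?thesis using hS by (intro exI[of _ s]) (auto simp: mult.commute)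
    next
      case 3
      then obtain s where s: "z' j < s" "s < z j" "?f (z j) - ?f (z' j) = (z j - z' j) * g' j ((h j)(j := s), t)"
        using MVT2[of "z' j" "z j" ?f "\<lambda>s. g' j ((h j)(j := s), t)"] D by auto
      then have "?f (z' j) - ?f (z j) = g' j ((h j)(j := s), t) * (z' j - z j)" by (simp add: algebra_simps)
      then show ?thesis using hS s by (intro exI[of _ s]) auto
    qed
  qed
  then obtain s where s: "\<And>j. j < m \<Longrightarrow> min (z j) (z' j) \<le> s j \<and> s j \<le> max (z j) (z' j) \<and>
      g (h (Suc j), t) - g (h j, t) = g' j ((h j)(j := s j), t) * (z' j - z j)" by metis
  show thesis
  proof (rule that[of "\<lambda>j. (h j)(j := s j)"])
    show "(h j)(j := s j) \<in> Euclid m" if "j < m" for j using hE that by (rule Euclid_upd)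
    show "min (z l) (z' l) \<le> ((h j)(j := s j)) l \<and> ((h j)(j := s j)) l \<le> max (z l) (z' l)"
      if "j < m" "l < m" for j l using s[OF that(1)] by (auto simp: h_def)
    have "g (z', t) - g (z, t) = (\<Sum>j<m. g (h (Suc j), t) - g (h j, t))"
      using sum_lessThan_telescope[of "\<lambda>j. g (h j, t)" m] h0 hm by simp
    then show "g (z', t) - g (z, t) = (\<Sum>j<m. g' j ((h j)(j := s j), t) * (z' j - z j))"
      using s by simp
  qed
qed

text \<open>Partial derivatives that are continuous suffice for the chain rule along a curve: the
  increment of \<open>g\<close> is a sum of partial derivatives at intermediate points, and these
  are squeezed towards \<open>\<gamma> s0\<close> as \<open>s\<close> tends to
  \<open>s0\<close>.\<close>

lemma DERIV_chain_PCk: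
  assumes V: "openin (prodE m T) V" and g: "\<And>j. j < m \<Longrightarrow> contP m V T (g' j)"
    and der: "\<And>j u. j < m \<Longrightarrow> (u, t) \<in> V \<Longrightarrow> ((\<lambda>s. g (u(j := s), t)) has_real_derivative g' j (u, t)) (at (u j))"
    and \<gamma>: "\<And>s. \<gamma> s \<in> Euclid m" "(\<gamma> s0, t) \<in> V"
    and d\<gamma>: "\<And>j. j < m \<Longrightarrow> ((\<lambda>s. \<gamma> s j) has_real_derivative \<gamma>' j) (at s0)"
  shows "((\<lambda>s. g (\<gamma> s, t)) has_real_derivative (\<Sum>j<m. g' j (\<gamma> s0, t) * \<gamma>' j)) (at s0)"
proof -
  obtain d T' where d: "d > 0" "openin T T'" "t \<in> T'"
    "\<And>y s. y \<in> Euclid m \<Longrightarrow> (\<And>l. l < m \<Longrightarrow> \<bar>y l - \<gamma> s0 l\<bar> < d) \<Longrightarrow> s \<in> T' \<Longrightarrow> (y, s) \<in> V"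
    using openin_prodE_box[OF V \<gamma>(2)] by metis
  have close: "eventually (\<lambda>s. \<forall>l<m. \<bar>\<gamma> s l - \<gamma> s0 l\<bar> < e) (at s0)" if "e > 0" for e
  proof -
    have "eventually (\<lambda>s. \<bar>\<gamma> s l - \<gamma> s0 l\<bar> < e) (at s0)" if "l < m" for l
    proof -
      have "isCont (\<lambda>s. \<gamma> s l) s0" using d\<gamma>[OF that] DERIV_isCont by blast
      then have "((\<lambda>s. \<gamma> s l) \<longlongrightarrow> \<gamma> s0 l) (at s0)" by (simp add: isCont_def)
      from tendstoD[OF this \<open>e > 0\<close>] show ?thesis by (simp add: dist_real_def)
    qed
    then have "eventually (\<lambda>s. \<forall>l\<in>{..<m}. \<bar>\<gamma> s l - \<gamma> s0 l\<bar> < e) (at s0)"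
      by (intro eventually_ball_finite) auto
    then show ?thesis by (rule eventually_mono) auto
  qed
  define P where "P s \<xi> \<longleftrightarrow> (\<forall>j<m. \<xi> j \<in> Euclid m \<and> (\<forall>l<m. \<bar>\<xi> j l - \<gamma> s0 l\<bar> \<le> \<bar>\<gamma> s l - \<gamma> s0 l\<bar>)) \<and>
     g (\<gamma> s, t) - g (\<gamma> s0, t) = (\<Sum>j<m. g' j (\<xi> j, t) * (\<gamma> s j - \<gamma> s0 j))" for s \<xi>
  have "eventually (\<lambda>s. \<exists>\<xi>. P s \<xi>) (at s0)"
    using close[OF d(1)]
  proof eventually_elim
    case (elim s)
    have box: "(u, t) \<in> V" if "u \<in> Euclid m"
      "\<And>l. l < m \<Longrightarrow> min (\<gamma> s0 l) (\<gamma> s l) \<le> u l \<and> u l \<le> max (\<gamma> s0 l) (\<gamma> s l)" for u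
      by (rule d(4)[OF that(1) _ d(3)]) (use that(2) elim in fastforce)
    obtain \<xi> where \<xi>: "\<And>j. j < m \<Longrightarrow> \<xi> j \<in> Euclid m"
      "\<And>j l. j < m \<Longrightarrow> l < m \<Longrightarrow> min (\<gamma> s0 l) (\<gamma> s l) \<le> \<xi> j l \<and> \<xi> j l \<le> max (\<gamma> s0 l) (\<gamma> s l)"
      "g (\<gamma> s, t) - g (\<gamma> s0, t) = (\<Sum>j<m. g' j (\<xi> j, t) * (\<gamma> s j - \<gamma> s0 j))"
      by (rule box_mean_value[of "\<gamma> s0" m "\<gamma> s" t V g g', OF \<gamma>(1) \<gamma>(1) box der]) (assumption | rule that)+
    have "\<bar>\<xi> j l - \<gamma> s0 l\<bar> \<le> \<bar>\<gamma> s l - \<gamma> s0 l\<bar>" if "j < m" "l < m" for j l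
      using \<xi>(2)[OF that] by linarith
    then show "\<exists>\<xi>. P s \<xi>" unfolding P_def using \<xi> by blast
  qed
  \<comment> \<open>The intermediate points become functions of \<open>s\<close>; they are
    constrained only for \<open>s\<close> near \<open>s0\<close>, where the box stays inside
    \<open>V\<close>.\<close>
  then obtain \<Xi> where \<Xi>: "eventually (\<lambda>s. P s (\<Xi> s)) (at s0)"
    unfolding eventually_ex by blast
  have lim: "((\<lambda>s. g' j (\<Xi> s j, t)) \<longlongrightarrow> g' j (\<gamma> s0, t)) (at s0)" if j: "j < m" for j
  proof (rule tendstoI)
    fix e :: real assume "e > 0"
    obtain d2 T2 where d2: "d2 > 0" "openin T T2" "t \<in> T2"
      "\<And>y s. y \<in> Euclid m \<Longrightarrow> (\<And>l. l < m \<Longrightarrow> \<bar>y l - \<gamma> s0 l\<bar> < d2) \<Longrightarrow> s \<in> T2 \<Longrightarrow>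
         (y, s) \<in> V \<and> \<bar>g' j (y, s) - g' j (\<gamma> s0, t)\<bar> < e"
      using continuous_prodE_box[OF g[OF j] V \<gamma>(2) \<open>e > 0\<close>] by metis
    show "eventually (\<lambda>s. dist (g' j (\<Xi> s j, t)) (g' j (\<gamma> s0, t)) < e) (at s0)"
      using \<Xi> close[OF d2(1)]
    proof eventually_elim
      case (elim s)
      then have "(\<Xi> s j, t) \<in> V \<and> \<bar>g' j (\<Xi> s j, t) - g' j (\<gamma> s0, t)\<bar> < e"
        using j unfolding P_def by (intro d2(4) d2(3)) (auto intro: le_less_trans)
      then show ?case by (simp add: dist_real_def)
    qed
  qed
  have "((\<lambda>s. \<Sum>j<m. g' j (\<Xi> s j, t) * ((\<gamma> s j - \<gamma> s0 j) / (s - s0))) \<longlongrightarrow> (\<Sum>j<m. g' j (\<gamma> s0, t) * \<gamma>' j)) (at s0)"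
    using d\<gamma> lim by (intro tendsto_sum tendsto_mult) (auto simp: has_field_derivative_iff)
  then have "((\<lambda>s. (g (\<gamma> s, t) - g (\<gamma> s0, t)) / (s - s0)) \<longlongrightarrow> (\<Sum>j<m. g' j (\<gamma> s0, t) * \<gamma>' j)) (at s0)"
  proof (rule Lim_transform_eventually)
    show "eventually (\<lambda>s. (\<Sum>j<m. g' j (\<Xi> s j, t) * ((\<gamma> s j - \<gamma> s0 j) / (s - s0))) = (g (\<gamma> s, t) - g (\<gamma> s0, t)) / (s - s0)) (at s0)"
      using \<Xi> by eventually_elim (simp add: P_def sum_divide_distrib)
  qed
  then show ?thesis by (simp add: has_field_derivative_iff)
qed

text \<open>Points of the Euclidean space are sequences vanishing from index \<open>m\<close> on.
  Cutting off turns a family of coordinate functions indexed by all naturals into a map with values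
  in that space.\<close>

definition trunc :: "nat \<Rightarrow> (nat \<Rightarrow> real) \<Rightarrow> nat \<Rightarrow> real" where
  "trunc m z = (\<lambda>j. if j < m then z j else 0)"

lemma trunc_Euclid [simp]: "trunc m z \<in> Euclid m"
  by (auto simp: trunc_def topspace_Euclidean_space)

lemma trunc_eq: "z \<in> Euclid m \<Longrightarrow> trunc m z = z"
  by (auto simp: trunc_def topspace_Euclidean_space fun_eq_iff)

lemma trunc_nth [simp]: "j < m \<Longrightarrow> trunc m z j = z j"
  by (simp add: trunc_def)

lemma continuous_map_trunc:
  assumes "\<And>j. j < m \<Longrightarrow> creal X (\<Theta> j)"
  shows "continuous_map X (Euclidean_space m) (\<lambda>p. trunc m (\<lambda>j. \<Theta> j p))"
  unfolding continuous_map_Euclidean_space_iff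
proof (intro conjI allI)
  show "creal X (\<lambda>p. trunc m (\<lambda>j. \<Theta> j p) i)" for i
    by (cases "i < m") (auto simp: assms trunc_def)
qed auto

text \<open>Induction on \<open>k\<close> for all \<open>g\<close> at once, since the derivatives of
  the composite contain the composites of the partial derivatives of \<open>g\<close>. The map
  \<open>h\<close> changes the parameter, where nothing is differentiated; later it will be the
  inversion of the group.\<close>

lemma PCk_compose:
  assumes V: "openin (prodE m T) V" and g: "PCk k m V T g"
    and Y: "openin (prodE n T') Y" and \<Theta>: "\<And>j. j < m \<Longrightarrow> PCk k n Y T' (\<Theta> j)"
    and h: "continuous_map T' T h"
    and sub: "\<And>x t. (x, t) \<in> Y \<Longrightarrow> (trunc m (\<lambda>j. \<Theta> j (x, t)), h t) \<in> V"
  shows "PCk k n Y T' (\<lambda>p. g (trunc m (\<lambda>j. \<Theta> j p), h (snd p)))"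
  using g \<Theta>
proof (induction k arbitrary: g)
  have cont: "contP n Y T' (\<lambda>p. g (trunc m (\<lambda>j. \<Theta> j p), h (snd p)))"
    if g: "contP m V T g"
    and \<Theta>: "\<And>j. j < m \<Longrightarrow> contP n Y T' (\<Theta> j)" for g
  proof -
    have "continuous_map (subtopology (prodE n T') Y) (Euclidean_space m) (\<lambda>p. trunc m (\<lambda>j. \<Theta> j p))"
      by (rule continuous_map_trunc[OF \<Theta>])
    moreover have "continuous_map (subtopology (prodE n T') Y) T (\<lambda>p. h (snd p))"
      using continuous_map_compose[OF continuous_map_snd h, of "Euclidean_space n"]
      by (simp add: comp_def continuous_map_from_subtopology)
    ultimately have "continuous_map (subtopology (prodE n T') Y) (prodE m T) (\<lambda>p. (trunc m (\<lambda>j. \<Theta> j p), h (snd p)))"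
      by (simp add: continuous_map_paired)
    moreover have "(\<lambda>p. (trunc m (\<lambda>j. \<Theta> j p), h (snd p))) \<in> topspace (subtopology (prodE n T') Y) \<rightarrow> V"
      using sub by auto
    ultimately have "continuous_map (subtopology (prodE n T') Y) (subtopology (prodE m T) V) (\<lambda>p. (trunc m (\<lambda>j. \<Theta> j p), h (snd p)))"
      by (simp add: continuous_map_in_subtopology Pi_iff image_subset_iff)
    from continuous_map_compose[OF this g] show ?thesis by (simp add: comp_def)
  qed
  {
    case 0
    then show ?case using cont by simp
  next
    case (Suc k)
    note 2 = Suc
    let ?c = "\<lambda>p. (trunc m (\<lambda>j. \<Theta> j p), h (snd p))"
    obtain g' where g': "\<And>i x t. i < m \<Longrightarrow> (x, t) \<in> V \<Longrightarrow> ((\<lambda>s. g (x(i := s), t)) has_real_derivative g' i (x, t)) (at (x i))"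
      "\<And>i. i < m \<Longrightarrow> PCk k m V T (g' i)" using PCk_SucE[OF 2(2)] by blast
    define R where "R j f' \<longleftrightarrow> (\<forall>i x t. i < n \<longrightarrow> (x, t) \<in> Y \<longrightarrow> ((\<lambda>s. \<Theta> j (x(i := s), t)) has_real_derivative f' i (x, t)) (at (x i))) \<and> (\<forall>i<n. PCk k n Y T' (f' i))" for j f'
    have "\<exists>f'. R j f'" if "j < m" for j
      by (rule PCk_SucE[OF 2(3)[OF that]]) (auto simp: R_def)
    then obtain \<Theta>' where R: "\<And>j. j < m \<Longrightarrow> R j (\<Theta>' j)" by metis
    have \<Theta>': "((\<lambda>s. \<Theta> j (x(i := s), t)) has_real_derivative \<Theta>' j i (x, t)) (at (x i))"
      if "j < m" "i < n" "(x, t) \<in> Y" for j i x t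
      using R[OF that(1)] that(2,3) unfolding R_def by simp
    have \<Theta>'': "PCk k n Y T' (\<Theta>' j i)" if "j < m" "i < n" for j i
      using R[OF that(1)] that(2) unfolding R_def by simp
    let ?D = "\<lambda>i p. \<Sum>j<m. g' j (?c p) * \<Theta>' j i p"
    have "PCk k n Y T' (?D i)" if "i < n" for i
    proof (intro PCk_sum PCk_mult)
      show "PCk k n Y T' (\<lambda>p. g' j (?c p))" if "j \<in> {..<m}" for j
        using 2(1)[of "g' j"] g'(2) that PCk_SucD[OF 2(3)] by simp
    qed (simp_all add: \<Theta>'' that)
    moreover have "((\<lambda>s. g (?c (x(i := s), t))) has_real_derivative ?D i (x, t)) (at (x i))"
      if "i < n" "(x, t) \<in> Y" for i x t
    proof -
      have "((\<lambda>s. g (trunc m (\<lambda>j. \<Theta> j (x(i := s), t)), h t)) has_real_derivative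
         (\<Sum>j<m. g' j (trunc m (\<lambda>j. \<Theta> j (x(i := x i), t)), h t) * \<Theta>' j i (x, t))) (at (x i))"
      proof (rule DERIV_chain_PCk[OF V])
        show "contP m V T (g' j)" if "j < m" for j
          using PCk_continuous[OF g'(2)[OF that]] .
        show "((\<lambda>s. trunc m (\<lambda>j. \<Theta> j (x(i := s), t)) j) has_real_derivative \<Theta>' j i (x, t)) (at (x i))"
          if j: "j < m" for j using \<Theta>'[OF j \<open>i < n\<close> \<open>(x, t) \<in> Y\<close>] j by simp
        show "((\<lambda>s. g (u(j := s), h t)) has_real_derivative g' j (u, h t)) (at (u j))"
          if "j < m" "(u, h t) \<in> V" for j u using g'(1)[OF that] .
        show "(trunc m (\<lambda>j. \<Theta> j (x(i := x i), t)), h t) \<in> V" using sub[OF that(2)] by simp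
      qed simp
      then show ?thesis by simp
    qed
    moreover have "contP n Y T' (\<lambda>p. g (trunc m (\<lambda>j. \<Theta> j p), h (snd p)))"
      using cont[OF PCk_continuous[OF 2(2)] PCk_continuous[OF 2(3)]] .
    ultimately show ?case by (intro PCk_SucI[of _ _ _ _ ?D]) simp_all
  }
qed

lemma openin_Euclidean_space_boxD:
  assumes "openE n U" "x \<in> U"
  shows "\<exists>d>0. \<forall>y\<in>Euclid n. (\<forall>l<n. \<bar>y l - x l\<bar> < d) \<longrightarrow> y \<in> U"
  by (rule openin_Euclidean_space_box[OF assms]) auto

definition psmooth :: "nat \<Rightarrow> ((nat \<Rightarrow> real) \<times> 't) set \<Rightarrow> 't topology \<Rightarrow> ((nat \<Rightarrow> real) \<times> 't \<Rightarrow> real) \<Rightarrow> bool" where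
  "psmooth n Y T f \<longleftrightarrow> (\<forall>k. PCk k n Y T f)"

lemma psmooth_continuous: "psmooth n Y T f \<Longrightarrow> contP n Y T f"
  using PCk_continuous[of 0] unfolding psmooth_def by blast

lemma psmooth_subset: "psmooth n Y T f \<Longrightarrow> Y' \<subseteq> Y \<Longrightarrow> psmooth n Y' T f"
  unfolding psmooth_def by (rule allI, rule PCk_subset, erule spec)

lemma psmooth_cong:
  "openin (prodE n T) Y \<Longrightarrow> (\<And>p. p \<in> Y \<Longrightarrow> f p = g p) \<Longrightarrow> psmooth n Y T f \<Longrightarrow> psmooth n Y T g"
  unfolding psmooth_def using PCk_cong[of n T Y f g] by simp

lemma psmooth_local:
  assumes "openin (prodE n T) Y"
    "\<And>p. p \<in> Y \<Longrightarrow> \<exists>Y'. openin (prodE n T) Y' \<and> p \<in> Y' \<and> psmooth n (Y \<inter> Y') T f"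
  shows "psmooth n Y T f"
  unfolding psmooth_def
proof
  show "PCk k n Y T f" for k
  proof (rule PCk_local[OF assms(1)])
    fix p assume "p \<in> Y"
    from assms(2)[OF this] show "\<exists>Y'. openin (prodE n T) Y' \<and> p \<in> Y' \<and> PCk k n (Y \<inter> Y') T f"
      unfolding psmooth_def by auto
  qed
qed

lemma psmooth_param: "creal T h \<Longrightarrow> psmooth n Y T (\<lambda>p. h (snd p))"
  using PCk_param[of T h] by (simp add: psmooth_def case_prod_unfold)

lemma psmooth_const: "psmooth n Y T (\<lambda>p. a)"
  by (simp add: psmooth_def PCk_const)

lemma psmooth_coord: "psmooth n Y T (\<lambda>p. fst p j)"
  by (simp add: psmooth_def PCk_coord)

lemma psmooth_add: "psmooth n Y T f \<Longrightarrow> psmooth n Y T g \<Longrightarrow> psmooth n Y T (\<lambda>p. f p + g p)"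
  by (simp add: psmooth_def PCk_add)

lemma psmooth_diff: "psmooth n Y T f \<Longrightarrow> psmooth n Y T g \<Longrightarrow> psmooth n Y T (\<lambda>p. f p - g p)"
  by (simp add: psmooth_def PCk_diff)

lemma psmooth_mult: "psmooth n Y T f \<Longrightarrow> psmooth n Y T g \<Longrightarrow> psmooth n Y T (\<lambda>p. f p * g p)"
  by (simp add: psmooth_def PCk_mult)

lemma psmooth_sum: "finite J \<Longrightarrow> (\<And>j. j \<in> J \<Longrightarrow> psmooth n Y T (f j)) \<Longrightarrow> psmooth n Y T (\<lambda>p. \<Sum>j\<in>J. f j p)"
  by (simp add: psmooth_def PCk_sum)

lemma psmooth_prod: "finite J \<Longrightarrow> (\<And>j. j \<in> J \<Longrightarrow> psmooth n Y T (f j)) \<Longrightarrow> psmooth n Y T (\<lambda>p. \<Prod>j\<in>J. f j p)"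
  by (simp add: psmooth_def PCk_prod)

lemma psmooth_inverse: "psmooth n Y T f \<Longrightarrow> (\<And>p. p \<in> Y \<Longrightarrow> f p \<noteq> 0) \<Longrightarrow> psmooth n Y T (\<lambda>p. inverse (f p))"
  by (simp add: psmooth_def PCk_inverse)

lemma psmooth_compose:
  assumes "openin (prodE m T) V" "psmooth m V T g" "openin (prodE n T') Y"
    "\<And>j. j < m \<Longrightarrow> psmooth n Y T' (\<Theta> j)" "continuous_map T' T h"
    "\<And>x t. (x, t) \<in> Y \<Longrightarrow> (trunc m (\<lambda>j. \<Theta> j (x, t)), h t) \<in> V"
  shows "psmooth n Y T' (\<lambda>p. g (trunc m (\<lambda>j. \<Theta> j p), h (snd p)))"
  unfolding psmooth_def
proof
  show "PCk k n Y T' (\<lambda>p. g (trunc m (\<lambda>j. \<Theta> j p), h (snd p)))" for k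
    by (rule PCk_compose[OF assms(1) _ assms(3) _ assms(5,6)]) (use assms(2,4) in \<open>auto simp: psmooth_def\<close>)
qed

section \<open>Calculus without parameter as the case of a one-point parameter space\<close>

abbreviation point_topology :: "unit topology" where
  "point_topology \<equiv> discrete_topology UNIV"

lemma openin_Times_point: "openE n W \<Longrightarrow> openin (prodE n point_topology) (W \<times> UNIV)"
  by (simp add: openin_prod_Times_iff)

lemma continuous_map_point:
  "contP n (W \<times> UNIV) point_topology f \<longleftrightarrow>
   contE n W (\<lambda>x. f (x, ()))"
proof
  assume c: "contP n (W \<times> UNIV) point_topology f"
  have "continuous_map (subtopology (Euclidean_space n) W) (subtopology (prodE n point_topology) (W \<times> UNIV)) (\<lambda>x. (x, ()))"
    by (auto simp: continuous_map_in_subtopology continuous_map_paired continuous_map_from_subtopology)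
  from continuous_map_compose[OF this c]
  show "contE n W (\<lambda>x. f (x, ()))" by (simp add: comp_def)
next
  assume c: "contE n W (\<lambda>x. f (x, ()))"
  have "continuous_map (subtopology (prodE n point_topology) (W \<times> UNIV)) (subtopology (Euclidean_space n) W) fst"
    by (auto simp: continuous_map_in_subtopology continuous_map_fst continuous_map_from_subtopology)
  from continuous_map_compose[OF this c]
  show "contP n (W \<times> UNIV) point_topology f"
    by (rule continuous_map_eq) auto
qed

text \<open>Through this equivalence the rules for sums, products, inverses and composites are
  proved only once, in the version with a parameter.\<close>

lemma Ck_iff_PCk: "Ck k n W f \<longleftrightarrow> PCk k n (W \<times> UNIV) point_topology (\<lambda>p. f (fst p))"
proof (induction k arbitrary: f)
  case 0
  then show ?case by (simp add: continuous_map_point)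
next
  case (Suc k)
  show ?case
  proof
    assume "Ck (Suc k) n W f"
    then obtain f' where f': "contE n W f"
      "\<And>i. i < n \<Longrightarrow> (\<forall>x\<in>W. ((\<lambda>t. f (x(i := t))) has_real_derivative f' i x) (at (x i))) \<and> Ck k n W (f' i)" by auto
    show "PCk (Suc k) n (W \<times> UNIV) point_topology (\<lambda>p. f (fst p))"
      by (rule PCk_SucI[of _ _ _ _ "\<lambda>i p. f' i (fst p)"]) (use f' Suc in \<open>auto simp: continuous_map_point\<close>)
  next
    assume a: "PCk (Suc k) n (W \<times> UNIV) point_topology (\<lambda>p. f (fst p))"
    obtain f' where
      f'0: "\<And>i x t. i < n \<Longrightarrow> (x, t) \<in> W \<times> UNIV \<Longrightarrow> ((\<lambda>s. f (fst (x(i := s), t))) has_real_derivative f' i (x, t)) (at (x i))" and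
      f'2: "\<And>i. i < n \<Longrightarrow> PCk k n (W \<times> UNIV) point_topology (f' i)"
      by (rule PCk_SucE[OF a]) (assumption | rule that)+
    have f': "((\<lambda>s. f (x(i := s))) has_real_derivative f' i (x, ())) (at (x i))" if "i < n" "x \<in> W" for i x
      using f'0[OF that(1), of x "()"] that(2) by simp
    have "f' i = (\<lambda>p. f' i (fst p, ()))" for i by (auto simp: fun_eq_iff)
    then have "PCk k n (W \<times> UNIV) point_topology (\<lambda>p. f' i (fst p, ()))" if "i < n" for i
      using f'2[OF that] by metis
    then have "Ck k n W (\<lambda>x. f' i (x, ()))" if "i < n" for i using that Suc by blast
    then show "Ck (Suc k) n W f" using f' PCk_continuous[OF a]
      by (auto simp: continuous_map_point intro!: exI[of _ "\<lambda>i x. f' i (x, ())"])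
  qed
qed

lemma smooth_on_iff: "smooth_on n W f \<longleftrightarrow> psmooth n (W \<times> UNIV) point_topology (\<lambda>p. f (fst p))"
  by (simp add: smooth_on_def psmooth_def Ck_iff_PCk)

lemma psmooth_of_smooth_on:
  assumes "openE m V" "smooth_on m V g" "openin (prodE n T) Y"
    "\<And>j. j < m \<Longrightarrow> psmooth n Y T (\<Theta> j)"
    "\<And>x t. (x, t) \<in> Y \<Longrightarrow> trunc m (\<lambda>j. \<Theta> j (x, t)) \<in> V"
  shows "psmooth n Y T (\<lambda>p. g (trunc m (\<lambda>j. \<Theta> j p)))"
proof -
  have "psmooth n Y T (\<lambda>p. (\<lambda>q. g (fst q)) (trunc m (\<lambda>j. \<Theta> j p), (\<lambda>_. ()) (snd p)))"
    by (rule psmooth_compose[OF openin_Times_point[OF assms(1)] assms(2)[unfolded smooth_on_iff] assms(3,4)])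
      (simp_all add: assms(5))
  then show ?thesis by simp
qed

lemma smooth_on_compose:
  assumes "openE m V" "smooth_on m V g" "openE n W"
    "\<And>j. j < m \<Longrightarrow> smooth_on n W (\<Theta> j)"
    "\<And>x. x \<in> W \<Longrightarrow> trunc m (\<lambda>j. \<Theta> j x) \<in> V"
  shows "smooth_on n W (\<lambda>x. g (trunc m (\<lambda>j. \<Theta> j x)))"
  unfolding smooth_on_iff
  by (rule psmooth_of_smooth_on[OF assms(1,2) openin_Times_point[OF assms(3)] assms(4)[unfolded smooth_on_iff]])
    (simp_all add: assms(5))

lemma smooth_on_const: "smooth_on n W (\<lambda>p. a)"
  by (simp add: smooth_on_iff psmooth_const)

lemma smooth_on_coord: "smooth_on n W (\<lambda>p. p j)"
  by (simp add: smooth_on_iff psmooth_coord)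

lemma smooth_on_add: "smooth_on n W f \<Longrightarrow> smooth_on n W g \<Longrightarrow> smooth_on n W (\<lambda>p. f p + g p)"
  by (simp add: smooth_on_iff psmooth_add)

lemma smooth_on_diff: "smooth_on n W f \<Longrightarrow> smooth_on n W g \<Longrightarrow> smooth_on n W (\<lambda>p. f p - g p)"
  by (simp add: smooth_on_iff psmooth_diff)

lemma smooth_on_mult: "smooth_on n W f \<Longrightarrow> smooth_on n W g \<Longrightarrow> smooth_on n W (\<lambda>p. f p * g p)"
  by (simp add: smooth_on_iff psmooth_mult)

lemma smooth_on_sum: "finite J \<Longrightarrow> (\<And>j. j \<in> J \<Longrightarrow> smooth_on n W (f j)) \<Longrightarrow> smooth_on n W (\<lambda>p. \<Sum>j\<in>J. f j p)"
  by (simp add: smooth_on_iff psmooth_sum)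

lemma smooth_on_prod: "finite J \<Longrightarrow> (\<And>j. j \<in> J \<Longrightarrow> smooth_on n W (f j)) \<Longrightarrow> smooth_on n W (\<lambda>p. \<Prod>j\<in>J. f j p)"
  by (simp add: smooth_on_iff psmooth_prod)

lemma smooth_on_inverse: "smooth_on n W f \<Longrightarrow> (\<And>p. p \<in> W \<Longrightarrow> f p \<noteq> 0) \<Longrightarrow> smooth_on n W (\<lambda>p. inverse (f p))"
  unfolding smooth_on_iff by (rule psmooth_inverse) auto

lemma smooth_on_subset: "smooth_on n W f \<Longrightarrow> W' \<subseteq> W \<Longrightarrow> smooth_on n W' f"
  unfolding smooth_on_iff by (rule psmooth_subset) auto

lemma smooth_on_continuous: "smooth_on n W f \<Longrightarrow> contE n W f"
  unfolding smooth_on_iff by (drule psmooth_continuous) (simp add: continuous_map_point)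

lemma smooth_on_cong:
  "openE n W \<Longrightarrow> (\<And>p. p \<in> W \<Longrightarrow> f p = g p) \<Longrightarrow> smooth_on n W f \<Longrightarrow> smooth_on n W g"
  unfolding smooth_on_iff by (rule psmooth_cong[OF openin_Times_point]) auto

section \<open>Means of continuous functions on compact spaces\<close>

text \<open>A normalized positive linear functional on continuous functions, in place of a
  probability measure. Its values on discontinuous functions are left open, which is why continuity
  has to be established before each use.\<close>

definition mean_on :: "'t topology \<Rightarrow> (('t \<Rightarrow> real) \<Rightarrow> real) \<Rightarrow> bool" where
  "mean_on T I \<longleftrightarrow>
     (\<forall>f g. creal T f \<and> creal T g \<longrightarrow> I (\<lambda>t. f t + g t) = I f + I g) \<and>
     (\<forall>f a. creal T f \<longrightarrow> I (\<lambda>t. a * f t) = a * I f) \<and>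
     (\<forall>f. creal T f \<and> (\<forall>t\<in>topspace T. 0 \<le> f t) \<longrightarrow> 0 \<le> I f) \<and>
     I (\<lambda>t. 1) = 1"

context
  fixes T :: "'t topology" and I :: "('t \<Rightarrow> real) \<Rightarrow> real"
  assumes mean: "mean_on T I"
begin

lemma mean_add: "creal T f \<Longrightarrow> creal T g \<Longrightarrow> I (\<lambda>t. f t + g t) = I f + I g"
  using mean by (simp add: mean_on_def)

lemma mean_cmult: "creal T f \<Longrightarrow> I (\<lambda>t. a * f t) = a * I f"
  using mean by (simp add: mean_on_def)

lemma mean_nonneg: "creal T f \<Longrightarrow> (\<And>t. t \<in> topspace T \<Longrightarrow> 0 \<le> f t) \<Longrightarrow> 0 \<le> I f"
  using mean by (simp add: mean_on_def)

lemma mean_diff: "creal T f \<Longrightarrow> creal T g \<Longrightarrow> I (\<lambda>t. f t - g t) = I f - I g"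
  using mean_add[of f "\<lambda>t. - 1 * g t"] mean_cmult[of g "- 1"] by (simp add: continuous_map_minus)

lemma mean_const: "I (\<lambda>t. a) = a"
  using mean_cmult[of "\<lambda>_. 1" a] mean by (simp add: mean_on_def)

lemma mean_mono:
  assumes "creal T f" "creal T g" "\<And>t. t \<in> topspace T \<Longrightarrow> f t \<le> g t"
  shows "I f \<le> I g"
  using mean_nonneg[of "\<lambda>t. g t - f t"] mean_diff[OF assms(2,1)] assms by (simp add: continuous_map_diff)

text \<open>The functional takes total functions, which may differ outside the space. Monotonicity
  in both directions removes the dependence on those values.\<close>

lemma mean_cong:
  assumes "creal T f" "\<And>t. t \<in> topspace T \<Longrightarrow> f t = g t"
  shows "I f = I g"
proof -
  have "creal T g" using assms by (rule continuous_map_eq)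
  then show ?thesis using assms mean_mono[of f g] mean_mono[of g f] by simp
qed

lemma mean_sum:
  "finite J \<Longrightarrow> (\<And>j. j \<in> J \<Longrightarrow> creal T (f j)) \<Longrightarrow> I (\<lambda>t. \<Sum>j\<in>J. f j t) = (\<Sum>j\<in>J. I (f j))"
proof (induction J rule: finite_induct)
  case empty
  then show ?case using mean_const[of 0] by simp
next
  case (insert j J)
  then show ?case using mean_add[of "f j" "\<lambda>t. \<Sum>j\<in>J. f j t"] by (simp add: continuous_map_sum)
qed

lemma mean_abs_le:
  assumes "creal T f" "\<And>t. t \<in> topspace T \<Longrightarrow> \<bar>f t\<bar> \<le> e"
  shows "\<bar>I f\<bar> \<le> e"
proof -
  have "I f \<le> I (\<lambda>t. e)" "I (\<lambda>t. - e) \<le> I f" using assms by (intro mean_mono; fastforce)+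
  then show ?thesis by (simp add: mean_const abs_le_iff)
qed

end

text \<open>Finitely many parameter neighborhoods cover the compact space, and the least of their
  radii works for all parameters. Both \<open>f (y, s)\<close> and \<open>f (x, s)\<close> are
  compared with the value at the center of the neighborhood, hence the halves of
  \<open>e\<close>.\<close>

lemma compact_param_uniform:
  assumes T: "compact_space T" and W: "openE n W" "x \<in> W"
    and f: "contP n (W \<times> topspace T) T f" and e: "e > 0"
  shows "\<exists>d>0. \<forall>y\<in>Euclid n. (\<forall>l<n. \<bar>y l - x l\<bar> < d) \<longrightarrow> y \<in> W \<and> (\<forall>t\<in>topspace T. \<bar>f (y, t) - f (x, t)\<bar> < e)"
proof -
  have op: "openin (prodE n T) (W \<times> topspace T)" using W by (simp add: openin_prod_Times_iff)
  have xE: "x \<in> Euclid n" using W openin_subset by blast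
  define Q where "Q t d T' \<longleftrightarrow> d > 0 \<and> openin T T' \<and> t \<in> T' \<and> (\<forall>y\<in>Euclid n. (\<forall>l<n. \<bar>y l - x l\<bar> < d) \<longrightarrow>
     (\<forall>s\<in>T'. (y, s) \<in> W \<times> topspace T \<and> \<bar>f (y, s) - f (x, t)\<bar> < e / 2))" for t d T'
  have "\<exists>d T'. Q t d T'" if "t \<in> topspace T" for t
  proof -
    have e2: "e / 2 > 0" and xt: "(x, t) \<in> W \<times> topspace T" using e that W by auto
    show ?thesis by (rule continuous_prodE_box[OF f op xt e2]) (unfold Q_def, blast)
  qed
  then obtain D V where Q: "\<And>t. t \<in> topspace T \<Longrightarrow> Q t (D t) (V t)" by metis
  have "\<exists>F. finite F \<and> F \<subseteq> V ` topspace T \<and> topspace T \<subseteq> \<Union>F"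
    by (rule compactinD[OF T[unfolded compact_space_def]]) (use Q in \<open>auto simp: Q_def\<close>)
  then obtain F where F: "finite F" "F \<subseteq> topspace T" "topspace T \<subseteq> \<Union>(V ` F)"
    by (metis finite_subset_image)
  define d where "d = Min (insert 1 (D ` F))"
  have d: "d > 0" "\<And>t. t \<in> F \<Longrightarrow> d \<le> D t"
    unfolding d_def using F Q by (auto simp: Q_def subset_iff)
  obtain d0 where d0: "d0 > 0" "\<And>y. y \<in> Euclid n \<Longrightarrow> (\<And>l. l < n \<Longrightarrow> \<bar>y l - x l\<bar> < d0) \<Longrightarrow> y \<in> W"
    using openin_Euclidean_space_boxD[OF W] by blast
  show ?thesis
  proof (intro exI[of _ "min d d0"] conjI ballI impI)
    show "min d d0 > 0" using d d0 by simp
    fix y assume y: "y \<in> Euclid n" "\<forall>l<n. \<bar>y l - x l\<bar> < min d d0"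
    then show "y \<in> W" using d0 by simp
    fix s assume "s \<in> topspace T"
    then obtain t where t: "t \<in> F" "s \<in> V t" using F by blast
    then have Qt: "Q t (D t) (V t)" using Q F by blast
    have "\<bar>f (y, s) - f (x, t)\<bar> < e / 2" "\<bar>f (x, s) - f (x, t)\<bar> < e / 2"
      using Qt t y d(2)[OF t(1)] xE unfolding Q_def by fastforce+
    then show "\<bar>f (y, s) - f (x, s)\<bar> < e" by linarith
  qed
qed

lemma continuous_map_boxI:
  assumes "openE n W"
    "\<And>x e. x \<in> W \<Longrightarrow> e > 0 \<Longrightarrow> \<exists>d>0. \<forall>y\<in>Euclid n. (\<forall>l<n. \<bar>y l - x l\<bar> < d) \<longrightarrow> y \<in> W \<longrightarrow> \<bar>F y - F x\<bar> < e"
  shows "contE n W F"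
proof -
  have "openin (subtopology (Euclidean_space n) W) {x \<in> topspace (subtopology (Euclidean_space n) W). F x \<in> U}"
    if "open U" for U
  proof (subst openin_subopen, intro ballI)
    fix x assume x: "x \<in> {x \<in> topspace (subtopology (Euclidean_space n) W). F x \<in> U}"
    then obtain e where e: "e > 0" "\<And>y. \<bar>y - F x\<bar> < e \<Longrightarrow> y \<in> U"
      using \<open>open U\<close> unfolding open_dist by (auto simp: dist_real_def)
    from x have "x \<in> W" by simp
    from assms(2)[OF this e(1)] obtain d where d: "d > 0"
      "\<forall>y\<in>Euclid n. (\<forall>l<n. \<bar>y l - x l\<bar> < d) \<longrightarrow> y \<in> W \<longrightarrow> \<bar>F y - F x\<bar> < e" by blast
    let ?B = "{y \<in> Euclid n. \<forall>l<n. \<bar>y l - x l\<bar> < d} \<inter> W"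
    have "openin (subtopology (Euclidean_space n) W) ?B"
      using openin_box assms(1) by (simp add: openin_open_subtopology openin_Int)
    moreover have "x \<in> ?B" using x d by auto
    moreover have "?B \<subseteq> {x \<in> topspace (subtopology (Euclidean_space n) W). F x \<in> U}"
      using d e by auto
    ultimately show "\<exists>B. openin (subtopology (Euclidean_space n) W) B \<and> x \<in> B \<and>
        B \<subseteq> {x \<in> topspace (subtopology (Euclidean_space n) W). F x \<in> U}" by blast
  qed
  then show ?thesis by (simp add: continuous_map)
qed

lemma continuous_map_section:
  assumes "contP n (W \<times> topspace T) T f" "x \<in> W" "W \<subseteq> Euclid n"
  shows "creal T (\<lambda>t. f (x, t))"
proof -
  have "continuous_map T (subtopology (prodE n T) (W \<times> topspace T)) (\<lambda>t. (x, t))"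
    using assms(2,3) by (auto simp: continuous_map_in_subtopology continuous_map_paired)
  from continuous_map_compose[OF this assms(1)] show ?thesis by (simp add: comp_def)
qed

text \<open>Differentiation under the mean. By the mean value theorem the difference quotient is a
  value of the derivative at a nearby point, which by compactness is uniformly close to the
  derivative at \<open>x\<close>; positivity of the functional carries this bound over to the
  means.\<close>

lemma Ck_mean:
  assumes T: "compact_space T" and I: "mean_on T I" and W: "openE n W"
    and f: "PCk k n (W \<times> topspace T) T f"
  shows "Ck k n W (\<lambda>x. I (\<lambda>t. f (x, t)))"
  using f
proof (induction k arbitrary: f)
  have WE: "W \<subseteq> Euclid n" using W openin_subset by blast
  note sec = continuous_map_section[OF _ _ WE]
  have cont: "contE n W (\<lambda>x. I (\<lambda>t. f (x, t)))"
    if f: "contP n (W \<times> topspace T) T f" for f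
  proof (rule continuous_map_boxI[OF W])
    fix x and e :: real assume x: "x \<in> W" and "e > 0"
    then have "e / 2 > 0" by simp
    from compact_param_uniform[OF T W x f this] obtain d where d: "d > 0"
      "\<forall>y\<in>Euclid n. (\<forall>l<n. \<bar>y l - x l\<bar> < d) \<longrightarrow> y \<in> W \<and> (\<forall>t\<in>topspace T. \<bar>f (y, t) - f (x, t)\<bar> < e / 2)" by blast
    have "\<bar>I (\<lambda>t. f (y, t)) - I (\<lambda>t. f (x, t))\<bar> < e"
      if "y \<in> Euclid n" "\<forall>l<n. \<bar>y l - x l\<bar> < d" "y \<in> W" for y
    proof -
      have "\<bar>I (\<lambda>t. f (y, t) - f (x, t))\<bar> \<le> e / 2"
        using d(2) that sec[OF f] x by (intro mean_abs_le[OF I] continuous_map_diff) (auto intro: less_imp_le)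
      then show ?thesis using mean_diff[OF I sec[OF f that(3)] sec[OF f x]] \<open>e > 0\<close> by simp
    qed
    then show "\<exists>d>0. \<forall>y\<in>Euclid n. (\<forall>l<n. \<bar>y l - x l\<bar> < d) \<longrightarrow> y \<in> W \<longrightarrow> \<bar>I (\<lambda>t. f (y, t)) - I (\<lambda>t. f (x, t))\<bar> < e"
      using d(1) by blast
  qed
  {
    case 0
    then show ?case using cont by simp
  next
    case (Suc k)
    have fc: "contP n (W \<times> topspace T) T f"
      using PCk_continuous[OF Suc(2)] .
    obtain f' where f': "\<And>i x t. i < n \<Longrightarrow> (x, t) \<in> W \<times> topspace T \<Longrightarrow> ((\<lambda>s. f (x(i := s), t)) has_real_derivative f' i (x, t)) (at (x i))"
      "\<And>i. i < n \<Longrightarrow> PCk k n (W \<times> topspace T) T (f' i)"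
      by (rule PCk_SucE[OF Suc(2)]) (assumption | rule that)+
    have "((\<lambda>s. I (\<lambda>t. f (x(i := s), t))) has_real_derivative I (\<lambda>t. f' i (x, t))) (at (x i))"
      if i: "i < n" and x: "x \<in> W" for i x
      unfolding has_field_derivative_iff
    proof (rule tendstoI)
      fix e :: real assume e: "e > 0"
      then have e2: "e / 2 > 0" by simp
      note fc' = PCk_continuous[OF f'(2)[OF i]]
      from compact_param_uniform[OF T W x fc' e2] obtain d where d: "d > 0"
        "\<forall>y\<in>Euclid n. (\<forall>l<n. \<bar>y l - x l\<bar> < d) \<longrightarrow> y \<in> W \<and> (\<forall>t\<in>topspace T. \<bar>f' i (y, t) - f' i (x, t)\<bar> < e / 2)" by blast
      have near: "x(i := s) \<in> W \<and> (\<forall>t\<in>topspace T. \<bar>f' i (x(i := s), t) - f' i (x, t)\<bar> < e / 2)" if "\<bar>s - x i\<bar> < d" for s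
        using d that x WE Euclid_upd[OF _ i] by auto
      have main: "\<bar>(I (\<lambda>t. f (x(i := s), t)) - I (\<lambda>t. f (x(i := x i), t))) / (s - x i) - I (\<lambda>t. f' i (x, t))\<bar> \<le> e / 2"
        if s: "\<bar>s - x i\<bar> < d" "s \<noteq> x i" for s
      proof -
        have D: "((\<lambda>s. f (x(i := s), t)) has_real_derivative f' i (x(i := r), t)) (at r)"
          if "\<bar>r - x i\<bar> < d" "t \<in> topspace T" for r t
          using f'(1)[OF i, of "x(i := r)" t] near[OF that(1)] that(2) by simp
        have "\<bar>inverse (s - x i) * (f (x(i := s), t) - f (x, t)) - f' i (x, t)\<bar> \<le> e / 2" if t: "t \<in> topspace T" for t
        proof -
          \<comment> \<open>The intermediate point depends on \<open>t\<close> in an uncontrolled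
            way. This is harmless because the mean is taken of the difference quotient, and only the
            uniform bound is used of \<open>r\<close>.\<close>
          have "\<exists>r. \<bar>r - x i\<bar> < d \<and> f (x(i := s), t) - f (x(i := x i), t) = (s - x i) * f' i (x(i := r), t)"
          proof (cases "x i < s")
            case True
            then obtain r where "x i < r" "r < s" "f (x(i := s), t) - f (x(i := x i), t) = (s - x i) * f' i (x(i := r), t)"
              using MVT2[of "x i" s "\<lambda>s. f (x(i := s), t)" "\<lambda>r. f' i (x(i := r), t)"] D[OF _ t] s by auto
            then show ?thesis using s by (intro exI[of _ r]) auto
          next
            case False
            then have "s < x i" using s by simp
            then obtain r where r: "s < r" "r < x i" "f (x(i := x i), t) - f (x(i := s), t) = (x i - s) * f' i (x(i := r), t)"
              using MVT2[of s "x i" "\<lambda>s. f (x(i := s), t)" "\<lambda>r. f' i (x(i := r), t)"] D[OF _ t] s by auto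
            then have "f (x(i := s), t) - f (x(i := x i), t) = (s - x i) * f' i (x(i := r), t)" by (simp add: algebra_simps)
            then show ?thesis using r s by (intro exI[of _ r]) auto
          qed
          then obtain r where r: "\<bar>r - x i\<bar> < d" "f (x(i := s), t) - f (x, t) = (s - x i) * f' i (x(i := r), t)" by auto
          then have "inverse (s - x i) * (f (x(i := s), t) - f (x, t)) = f' i (x(i := r), t)" using s by simp
          then show ?thesis using near[OF r(1)] t by fastforce
        qed
        note quot = this
        have c: "creal T (\<lambda>t. f (x(i := s), t))" "creal T (\<lambda>t. f (x, t))"
          "creal T (\<lambda>t. f' i (x, t))"
          using sec[OF fc] sec[OF fc'] near[OF s(1)] x by auto
        have "\<bar>I (\<lambda>t. inverse (s - x i) * (f (x(i := s), t) - f (x, t)) - f' i (x, t))\<bar> \<le> e / 2"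
          using quot c by (intro mean_abs_le[OF I]) (auto intro!: continuous_intros)
        also have "I (\<lambda>t. inverse (s - x i) * (f (x(i := s), t) - f (x, t)) - f' i (x, t)) =
            inverse (s - x i) * (I (\<lambda>t. f (x(i := s), t)) - I (\<lambda>t. f (x, t))) - I (\<lambda>t. f' i (x, t))"
          using c mean_diff[OF I c(1,2)]
            mean_cmult[OF I, of "\<lambda>t. f (x(i := s), t) - f (x, t)" "inverse (s - x i)"]
            mean_diff[OF I, of "\<lambda>t. inverse (s - x i) * (f (x(i := s), t) - f (x, t))" "\<lambda>t. f' i (x, t)"]
          by (simp add: continuous_map_diff continuous_map_real_mult)
        finally show ?thesis by (simp add: field_simps)
      qed
      show "\<forall>\<^sub>F s in at (x i). dist ((I (\<lambda>t. f (x(i := s), t)) - I (\<lambda>t. f (x(i := x i), t))) / (s - x i)) (I (\<lambda>t. f' i (x, t))) < e"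
        unfolding eventually_at
      proof (intro exI[of _ d] conjI ballI impI)
        fix s assume "s \<noteq> x i \<and> dist s (x i) < d"
        then show "dist ((I (\<lambda>t. f (x(i := s), t)) - I (\<lambda>t. f (x(i := x i), t))) / (s - x i)) (I (\<lambda>t. f' i (x, t))) < e"
          using main[of s] e by (simp add: dist_real_def)
      qed (use d in auto)
    qed
    then show ?case using cont[OF fc] Suc(1)[OF f'(2)]
      by (auto intro!: exI[of _ "\<lambda>i x. I (\<lambda>t. f' i (x, t))"])
  }
qed

lemma smooth_on_mean:
  assumes "compact_space T" "mean_on T I" "openE n W" "psmooth n (W \<times> topspace T) T f"
  shows "smooth_on n W (\<lambda>x. I (\<lambda>t. f (x, t)))"
  using Ck_mean[OF assms(1-3)] assms(4) by (simp add: smooth_on_def psmooth_def)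

section \<open>The mean on a compact group\<close>

text \<open>The iterates of the operator \<open>Pf(x) = (\<Sum>n. 2\<^sup>-\<^sup>n\<^sup>-\<^sup>1 f (g\<^sub>n x))\<close>, with \<open>g\<close> a dense sequence, make every
  continuous function converge to a constant. As \<open>P\<close> commutes with right translations, the constant is
  right invariant.\<close>

locale compact_group =
  fixes G :: "('g, 'r) monoid_scheme" (structure) and T :: "'g topology"
  assumes group: "Group.group G" and top: "topspace T = carrier G"
    and mult: "continuous_map (prod_topology T T) T (\<lambda>(g, h). g \<otimes> h)"
    and inv: "continuous_map T T (\<lambda>g. inv g)"
    and compact: "compact_space T" and sc: "second_countable T"
begin

sublocale Group.group G by (rule group)

lemma mult_left: "a \<in> carrier G \<Longrightarrow> continuous_map T T (\<lambda>x. a \<otimes> x)"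
  using continuous_map_compose[of T "prod_topology T T" "\<lambda>x. (a, x)" T "\<lambda>(g, h). g \<otimes> h"] mult top
  by (simp add: comp_def continuous_map_paired)

lemma mult_right: "a \<in> carrier G \<Longrightarrow> continuous_map T T (\<lambda>x. x \<otimes> a)"
  using continuous_map_compose[of T "prod_topology T T" "\<lambda>x. (x, a)" T "\<lambda>(g, h). g \<otimes> h"] mult top
  by (simp add: comp_def continuous_map_paired)

abbreviation C :: "('g \<Rightarrow> real) \<Rightarrow> bool" where "C f \<equiv> creal T f"

lemma C_bounded:
  assumes "C f" obtains b where "b \<ge> 0" "\<And>x. x \<in> carrier G \<Longrightarrow> \<bar>f x\<bar> \<le> b"
proof -
  have "compactin euclideanreal (f ` topspace T)"
    using image_compactin[OF _ assms] compact by (simp add: compact_space_def)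
  then have "bounded (f ` carrier G)" using compact_imp_bounded top by simp
  then obtain b where "\<forall>x\<in>carrier G. \<bar>f x\<bar> \<le> b" unfolding bounded_iff by auto
  then show thesis by (intro that[of "max b 0"]) auto
qed

lemma dense_sequence:
  "\<exists>s. (\<forall>n::nat. s n \<in> carrier G) \<and> (\<forall>U. openin T U \<longrightarrow> U \<noteq> {} \<longrightarrow> (\<exists>n. s n \<in> U))"
proof -
  obtain D where D: "countable D" "D \<subseteq> topspace T" "T closure_of D = topspace T"
    using second_countable_imp_separable_space[OF sc] unfolding separable_space_def by auto
  have "\<one> \<in> topspace T" using top by simp
  then have ne: "D \<noteq> {}" using D(3) by auto
  show ?thesis
  \<comment> \<open>The enumeration repeats elements if the dense set is finite, as for a finite
    group; density does not suffer from this.\<close>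
  proof (intro exI[of _ "from_nat_into D"] conjI allI impI)
    show "from_nat_into D n \<in> carrier G" for n using from_nat_into[OF ne] D(2) top by auto
    fix U assume U: "openin T U" "U \<noteq> {}"
    then obtain x where "x \<in> U" by blast
    then have "x \<in> T closure_of D" using D(3) openin_subset[OF U(1)] by auto
    then obtain d where "d \<in> D" "d \<in> U" using U \<open>x \<in> U\<close> unfolding in_closure_of by blast
    then show "\<exists>n. from_nat_into D n \<in> U" using from_nat_into_surj[OF D(1)] by blast
  qed
qed

text \<open>\<open>V\<close> is a modulus of uniform continuity for \<open>f\<close>; it is inherited by \<open>Pf\<close>.\<close>

definition modulus :: "'g set \<Rightarrow> real \<Rightarrow> ('g \<Rightarrow> real) \<Rightarrow> bool" where
  "modulus V e f \<longleftrightarrow> (\<forall>x\<in>carrier G. \<forall>v\<in>V. \<bar>f (x \<otimes> v) - f x\<bar> \<le> e)"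

text \<open>The deviation \<open>\<bar>f (x \<otimes> v) - f x\<bar>\<close> is continuous and
  vanishes for \<open>v = \<one>\<close>. The tube theorem for the compact sets
  \<open>carrier G\<close> and \<open>{\<one>}\<close> yields a neighborhood of the unit that serves
  all \<open>x\<close> simultaneously.\<close>

lemma exists_modulus:
  assumes f: "C f" and e: "e > 0"
  obtains V where "openin T V" "\<one> \<in> V" "modulus V e f"
proof -
  let ?F = "\<lambda>(x, v). \<bar>f (x \<otimes> v) - f x\<bar>"
  have "creal (prod_topology T T) (\<lambda>p. f (case p of (g, h) \<Rightarrow> g \<otimes> h))"
    using continuous_map_compose[OF mult f] by (simp add: comp_def)
  moreover have "creal (prod_topology T T) (\<lambda>p. f (fst p))"
    using continuous_map_compose[OF continuous_map_fst f] by (simp add: comp_def)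
  ultimately have "creal (prod_topology T T) ?F"
    by (auto simp: case_prod_unfold intro!: continuous_intros)
  then have op: "openin (prod_topology T T) {p \<in> topspace (prod_topology T T). ?F p \<in> {..<e}}"
    by (rule openin_continuous_map_preimage) simp
  have sub: "topspace T \<times> {\<one>} \<subseteq> {p \<in> topspace (prod_topology T T). ?F p \<in> {..<e}}"
    using e top by auto
  have "compactin T (topspace T)" "compactin T {\<one>}" using compact top by (auto simp: compact_space_def)
  from Wallace_theorem_prod_topology[OF this op sub]
  obtain U V where UV: "openin T U" "openin T V" "topspace T \<subseteq> U" "{\<one>} \<subseteq> V"
    "U \<times> V \<subseteq> {p \<in> topspace (prod_topology T T). ?F p \<in> {..<e}}" by blast
  have "modulus V e f" unfolding modulus_def
  proof (intro ballI)
    fix x v assume "x \<in> carrier G" "v \<in> V"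
    then have "(x, v) \<in> U \<times> V" using UV(3) top by auto
    then have "?F (x, v) < e" using UV(5) by blast
    then show "\<bar>f (x \<otimes> v) - f x\<bar> \<le> e" by simp
  qed
  then show thesis using UV by (intro that) auto
qed

section \<open>The averaging operator and its contraction estimate\<close>

context
  fixes s :: "nat \<Rightarrow> 'g"
  assumes s: "\<And>n. s n \<in> carrier G" and dense: "\<And>U. openin T U \<Longrightarrow> U \<noteq> {} \<Longrightarrow> \<exists>n. s n \<in> U"
begin

definition P :: "('g \<Rightarrow> real) \<Rightarrow> 'g \<Rightarrow> real" where
  "P f x = (\<Sum>n. (1/2)^Suc n * f (s n \<otimes> x))"

lemma P_summable: 
  assumes "C f" "x \<in> carrier G" shows "summable (\<lambda>n. (1/2)^Suc n * f (s n \<otimes> x))"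
proof -
  obtain b where b: "b \<ge> 0" "\<And>x. x \<in> carrier G \<Longrightarrow> \<bar>f x\<bar> \<le> b" using C_bounded[OF assms(1)] by blast
  show ?thesis
  proof (rule summable_comparison_test')
    show "summable (\<lambda>n. (1/2)^Suc n * b)" by (intro summable_mult2) (simp add: summable_geometric)
    show "norm ((1/2)^Suc n * f (s n \<otimes> x)) \<le> (1/2)^Suc n * b" for n
      using b(2)[of "s n \<otimes> x"] s[of n] assms(2) by (simp add: abs_mult)
  qed
qed

lemma half_sums: "(\<lambda>n. (1/2)^Suc n * c) sums (c::real)"
  using sums_mult2[OF power_half_series, of c] by simp

lemma P_mono:
  assumes "C f" "C h" "x \<in> carrier G" "\<And>y. y \<in> carrier G \<Longrightarrow> f y \<le> h y"
  shows "P f x \<le> P h x"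
  unfolding P_def using assms s by (intro suminf_le P_summable) (auto intro!: mult_left_mono)

lemma P_const: "P (\<lambda>_. c) x = c"
  unfolding P_def by (rule sums_unique[OF half_sums, symmetric])

lemma P_add: "C f \<Longrightarrow> C h \<Longrightarrow> x \<in> carrier G \<Longrightarrow> P (\<lambda>y. f y + h y) x = P f x + P h x"
  unfolding P_def
  by (subst suminf_add[OF P_summable P_summable]) (auto simp: distrib_left)

lemma P_cmult: "C f \<Longrightarrow> x \<in> carrier G \<Longrightarrow> P (\<lambda>y. a * f y) x = a * P f x"
  unfolding P_def by (subst suminf_mult[symmetric]) (auto dest: P_summable simp: algebra_simps)

lemma P_right: "P (\<lambda>y. f (y \<otimes> a)) x = P f (x \<otimes> a)" if "x \<in> carrier G" "a \<in> carrier G"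
  using that s by (simp add: P_def m_assoc)

lemma C_right: "C f \<Longrightarrow> a \<in> carrier G \<Longrightarrow> C (\<lambda>x. f (x \<otimes> a))"
  using continuous_map_compose[OF mult_right, of a _ f] by (simp add: comp_def)

text \<open>The modulus compares right translates while \<open>P\<close> mixes left translates. The
  two commute, so the bounds \<open>f y - e \<le> f (y \<otimes> v) \<le> f y + e\<close> pass
  through \<open>P\<close> by monotonicity.\<close>

lemma P_modulus:
  assumes f: "C f" and V: "modulus V e f" "V \<subseteq> carrier G"
  shows "modulus V e (P f)"
  unfolding modulus_def
proof (intro ballI)
  fix x v assume x: "x \<in> carrier G" "v \<in> V"
  have v: "v \<in> carrier G" using x V by auto
  have b: "\<bar>f (y \<otimes> v) - f y\<bar> \<le> e" if "y \<in> carrier G" for y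
    using V(1) x(2) that by (simp add: modulus_def)
  have "P (\<lambda>y. f (y \<otimes> v)) x \<le> P (\<lambda>y. f y + e) x"
    by (rule P_mono[OF C_right[OF f v] _ x(1)]) (use b f in \<open>force intro: continuous_intros simp: abs_le_iff\<close>)+
  moreover have "P (\<lambda>y. f y) x \<le> P (\<lambda>y. f (y \<otimes> v) + e) x"
    by (rule P_mono[OF f _ x(1)]) (use b C_right[OF f v] in \<open>force intro: continuous_intros simp: abs_le_iff\<close>)+
  ultimately show "\<bar>P f (x \<otimes> v) - P f x\<bar> \<le> e"
    using P_right[OF x(1) v, of f] P_add[OF f _ x(1), of "\<lambda>_. e"] P_add[OF C_right[OF f v] _ x(1), of "\<lambda>_. e"]
    by (simp add: P_const abs_le_iff)
qed

lemma openin_translate: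
  assumes "openin T V" "x \<in> carrier G" shows "openin T ((\<lambda>v. x \<otimes> v) ` V)"
proof -
  have V: "V \<subseteq> carrier G" using openin_subset[OF assms(1)] top by simp
  have "openin T {y \<in> topspace T. inv x \<otimes> y \<in> V}"
    by (rule openin_continuous_map_preimage[OF mult_left assms(1)]) (use assms(2) in simp)
  also have "{y \<in> topspace T. inv x \<otimes> y \<in> V} = (\<lambda>v. x \<otimes> v) ` V"
  proof (intro equalityI subsetI)
    fix y assume "y \<in> {y \<in> topspace T. inv x \<otimes> y \<in> V}"
    then show "y \<in> (\<lambda>v. x \<otimes> v) ` V" using assms(2) top
      by (intro image_eqI[of _ _ "inv x \<otimes> y"]) (auto simp: m_assoc[symmetric])
  next
    fix y assume "y \<in> (\<lambda>v. x \<otimes> v) ` V"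
    then show "y \<in> {y \<in> topspace T. inv x \<otimes> y \<in> V}" using assms(2) V top
      by (auto simp: m_assoc[symmetric] subset_iff)
  qed
  finally show ?thesis .
qed

text \<open>Translates of the neighborhoods \<open>V\<close> form neighborhoods of arbitrary points.
  Continuity of \<open>P f\<close> is obtained in this way from the inherited modulus, without an
  argument about uniform convergence of the series.\<close>

lemma C_if_modulus:
  assumes "\<And>e. e > 0 \<Longrightarrow> \<exists>V. openin T V \<and> \<one> \<in> V \<and> modulus V e f"
  shows "C f"
proof -
  have "openin T {x \<in> topspace T. f x \<in> U}" if "open U" for U
  proof (subst openin_subopen, intro ballI)
    fix x assume "x \<in> {x \<in> topspace T. f x \<in> U}"
    then have x: "x \<in> carrier G" "f x \<in> U" using top by auto
    obtain e where e: "e > 0" "\<And>y. \<bar>y - f x\<bar> < e \<Longrightarrow> y \<in> U"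
      using \<open>open U\<close> x(2) unfolding open_dist by (auto simp: dist_real_def)
    from assms[of "e / 2"] e(1) obtain V where V: "openin T V" "\<one> \<in> V" "modulus V (e / 2) f" by auto
    have VG: "V \<subseteq> carrier G" using openin_subset[OF V(1)] top by simp
    have "(\<lambda>v. x \<otimes> v) ` V \<subseteq> {x \<in> topspace T. f x \<in> U}"
    proof clarify
      fix v assume v: "v \<in> V"
      have "\<bar>f (x \<otimes> v) - f x\<bar> \<le> e / 2" using V(3) v x(1) by (auto simp: modulus_def)
      then show "x \<otimes> v \<in> topspace T \<and> f (x \<otimes> v) \<in> U" using e v VG x(1) top by auto
    qed
    moreover have "x \<in> (\<lambda>v. x \<otimes> v) ` V" using V(2) x(1) by (intro image_eqI[of _ _ "\<one>"]) auto
    ultimately show "\<exists>B. openin T B \<and> x \<in> B \<and> B \<subseteq> {x \<in> topspace T. f x \<in> U}"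
      using openin_translate[OF V(1) x(1)] by blast
  qed
  then show ?thesis by (simp add: continuous_map)
qed

lemma P_C:
  assumes "C f" shows "C (P f)"
proof (rule C_if_modulus)
  fix e :: real assume "e > 0"
  then obtain V where V: "openin T V" "\<one> \<in> V" "modulus V e f" by (rule exists_modulus[OF assms])
  then have "modulus V e (P f)" using P_modulus[OF assms] openin_subset[OF V(1)] top by simp
  then show "\<exists>V. openin T V \<and> \<one> \<in> V \<and> modulus V e (P f)" using V by blast
qed

text \<open>For fixed \<open>n\<close> the pairs whose first component is moved by
  \<open>s n\<close> into the \<open>V\<close>-neighborhood of the second form an open set. By
  density these sets cover the compact square of the group, so finitely many indices suffice. The
  bound \<open>N\<close> gives a lower bound for the weights in \<open>P_contract\<close>.\<close>

lemma uniform_hit: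
  assumes "openin T V" "\<one> \<in> V"
  shows "\<exists>N. \<forall>x\<in>carrier G. \<forall>y\<in>carrier G. \<exists>n<N. inv y \<otimes> (s n \<otimes> x) \<in> V"
proof -
  define O' where "O' n = {p \<in> topspace (prod_topology T T). inv (snd p) \<otimes> (s n \<otimes> fst p) \<in> V}" for n
  have "openin (prod_topology T T) (O' n)" for n unfolding O'_def
  proof (rule openin_continuous_map_preimage[OF _ assms(1)])
    have "continuous_map (prod_topology T T) T (\<lambda>p. inv (snd p))"
      using continuous_map_compose[OF continuous_map_snd local.inv] by (simp add: comp_def)
    moreover have "continuous_map (prod_topology T T) T (\<lambda>p. s n \<otimes> fst p)"
      using continuous_map_compose[OF continuous_map_fst mult_left[OF s]] by (simp add: comp_def)
    ultimately have "continuous_map (prod_topology T T) (prod_topology T T) (\<lambda>p. (inv (snd p), s n \<otimes> fst p))"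
      by (simp add: continuous_map_paired)
    from continuous_map_compose[OF this local.mult]
    show "continuous_map (prod_topology T T) T (\<lambda>p. inv (snd p) \<otimes> (s n \<otimes> fst p))" by (simp add: comp_def)
  qed
  moreover have "topspace (prod_topology T T) \<subseteq> \<Union>(range O')"
  proof
    fix p assume p: "p \<in> topspace (prod_topology T T)"
    then have xy: "fst p \<in> carrier G" "snd p \<in> carrier G" by (simp_all add: mem_Times_iff top)
    let ?U = "{g \<in> topspace T. inv (snd p) \<otimes> g \<otimes> fst p \<in> V}"
    have "openin T ?U"
    proof (rule openin_continuous_map_preimage[OF _ assms(1)])
      show "continuous_map T T (\<lambda>g. inv (snd p) \<otimes> g \<otimes> fst p)"
        using continuous_map_compose[OF mult_left[of "inv (snd p)"] mult_right[of "fst p"]] xy by (simp add: comp_def)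
    qed
    moreover have "snd p \<otimes> inv (fst p) \<in> ?U"
      using xy assms(2) top by (simp add: m_assoc[symmetric])
    ultimately obtain n where "s n \<in> ?U" using dense by blast
    then have "p \<in> O' n" using p xy s by (simp add: O'_def m_assoc)
    then show "p \<in> \<Union>(range O')" by blast
  qed
  moreover have "compactin (prod_topology T T) (topspace (prod_topology T T))"
    using compact compact_space_prod_topology[of T T] unfolding compact_space_def by blast
  ultimately have "\<exists>F. finite F \<and> F \<subseteq> range O' \<and> topspace (prod_topology T T) \<subseteq> \<Union>F"
    by (intro compactinD) auto
  then obtain F where F: "finite F" "F \<subseteq> range O'" "topspace (prod_topology T T) \<subseteq> \<Union>F" by auto
  from finite_subset_image[OF F(1,2)] obtain J where J: "finite J" "F = O' ` J" by auto
  show ?thesis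
  proof (rule exI[of _ "Suc (Max (insert 0 J))"], intro ballI)
    fix x y assume "x \<in> carrier G" "y \<in> carrier G"
    then have "(x, y) \<in> \<Union>F" using F(3) top by auto
    then obtain n where n: "n \<in> J" "(x, y) \<in> O' n" using J by blast
    then have "n < Suc (Max (insert 0 J))" using J(1) by (simp add: less_Suc_eq_le)
    then show "\<exists>n<Suc (Max (insert 0 J)). inv y \<otimes> (s n \<otimes> x) \<in> V" using n by (auto simp: O'_def)
  qed
qed

text \<open>If \<open>y\<close> almost attains the lower bound \<open>a\<close>, some translate
  \<open>s n \<otimes> x\<close> with \<open>n < N\<close> is close to \<open>y\<close>, and
  \<open>f\<close> is at most \<open>a + 2 * e\<close> there: one \<open>e\<close> comes from the
  choice of \<open>y\<close>, the other from the modulus. This term has weight at least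
  \<open>(1/2)^N\<close> and pulls the average away from \<open>b\<close>.\<close>

lemma P_contract:
  assumes f: "C f" and V: "openin T V" "modulus V e f" and e: "e \<ge> 0"
    and N: "\<And>x y. x \<in> carrier G \<Longrightarrow> y \<in> carrier G \<Longrightarrow> \<exists>n<N. inv y \<otimes> (s n \<otimes> x) \<in> V"
    and ab: "\<And>x. x \<in> carrier G \<Longrightarrow> a \<le> f x \<and> f x \<le> b" and y: "y \<in> carrier G" "f y \<le> a + e"
    and x: "x \<in> carrier G"
  shows "a \<le> P f x" "P f x \<le> b - (1/2)^N * (b - a - 2 * e)"
proof -
  have VG: "V \<subseteq> carrier G" using openin_subset[OF V(1)] top by simp
  have Pa: "a \<le> P f x" "P f x \<le> b"
    using P_mono[of "\<lambda>_. a" f x] P_mono[of f "\<lambda>_. b" x] f x ab by (auto simp: P_const)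
  show "a \<le> P f x" by fact
  obtain n where n: "n < N" "inv y \<otimes> (s n \<otimes> x) \<in> V" using N[OF x y(1)] by blast
  have "\<bar>f (y \<otimes> (inv y \<otimes> (s n \<otimes> x))) - f y\<bar> \<le> e" using V(2) n(2) y(1) by (auto simp: modulus_def)
  then have fn: "f (s n \<otimes> x) \<le> a + 2 * e" using y x s[of n] by (simp add: m_assoc[symmetric])
  show "P f x \<le> b - (1/2)^N * (b - a - 2 * e)"
  proof (cases "b - a - 2 * e \<ge> 0")
    case False
    then have "(1/2)^N * (b - a - 2 * e) \<le> 0" by (simp add: mult_nonneg_nonpos)
    then show ?thesis using Pa by linarith
  next
    case True
    let ?t = "\<lambda>m. (1/2)^Suc m * f (s m \<otimes> x)"
    \<comment> \<open>The series is compared with one in which every value is replaced by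
      \<open>b\<close> except the \<open>n\<close>-th, which is replaced by
      \<open>a + 2 * e\<close>; its sum is explicit.\<close>
    let ?d = "\<lambda>m. if m = n then (1/2)^Suc n * (b - a - 2 * e) else 0"
    have d: "?d sums ((1/2)^Suc n * (b - a - 2 * e))" using sums_If_finite_set[of "{n}" "\<lambda>_. (1/2)^Suc n * (b - a - 2 * e)"] by simp
    have "(\<lambda>m. (1/2)^Suc m * b - ?d m) sums (b - (1/2)^Suc n * (b - a - 2 * e))"
      by (rule sums_diff[OF half_sums d])
    moreover have "?t m \<le> (1/2)^Suc m * b - ?d m" for m
    proof (cases "m = n")
      case True
      have "(1/2)^Suc n * f (s n \<otimes> x) \<le> (1/2)^Suc n * (a + 2 * e)" using fn by (intro mult_left_mono) auto
      then have "(1/2)^Suc n * f (s n \<otimes> x) \<le> (1/2)^Suc n * b - (1/2)^Suc n * (b - a - 2 * e)" by (simp only: right_diff_distrib distrib_left)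
      then show ?thesis using True by simp
    next
      case False
      have "s m \<otimes> x \<in> carrier G" using s x by simp
      then show ?thesis using ab[of "s m \<otimes> x"] False by simp
    qed
    ultimately have "P f x \<le> b - (1/2)^Suc n * (b - a - 2 * e)"
      unfolding P_def by (intro sums_le[OF _ summable_sums[OF P_summable[OF f x]]]) auto
    moreover have "(1/2)^N * (b - a - 2 * e) \<le> (1/2)^Suc n * (b - a - 2 * e)"
      using True n(1) by (intro mult_right_mono power_decreasing) auto
    ultimately show ?thesis by linarith
  qed
qed

section \<open>Convergence of the iterates\<close>

abbreviation Pn :: "nat \<Rightarrow> ('g \<Rightarrow> real) \<Rightarrow> 'g \<Rightarrow> real" where "Pn n f \<equiv> (P ^^ n) f"

lemma Pn_C: "C f \<Longrightarrow> C (Pn n f)"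
  by (induction n) (auto intro: P_C)

lemma Pn_modulus: "C f \<Longrightarrow> modulus V e f \<Longrightarrow> V \<subseteq> carrier G \<Longrightarrow> modulus V e (Pn n f)"
  by (induction n) (auto intro: P_modulus Pn_C)

definition lo where "lo f = Inf (f ` carrier G)"
definition hi where "hi f = Sup (f ` carrier G)"

lemma lo_hi:
  assumes "C f"
  shows "x \<in> carrier G \<Longrightarrow> lo f \<le> f x" "x \<in> carrier G \<Longrightarrow> f x \<le> hi f"
    "e > 0 \<Longrightarrow> \<exists>y\<in>carrier G. f y \<le> lo f + e"
    "(\<And>x. x \<in> carrier G \<Longrightarrow> f x \<le> b) \<Longrightarrow> hi f \<le> b" "(\<And>x. x \<in> carrier G \<Longrightarrow> b \<le> f x) \<Longrightarrow> b \<le> lo f"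
proof -
  obtain b where b: "\<And>x. x \<in> carrier G \<Longrightarrow> \<bar>f x\<bar> \<le> b" using C_bounded[OF assms] by blast
  have bd: "bdd_below (f ` carrier G)" "bdd_above (f ` carrier G)"
    using b by (auto simp: abs_le_iff minus_le_iff intro!: bdd_belowI2[of _ "- b"] bdd_aboveI2[of _ _ b])
  show "x \<in> carrier G \<Longrightarrow> lo f \<le> f x" "x \<in> carrier G \<Longrightarrow> f x \<le> hi f"
    unfolding lo_def hi_def using bd by (auto intro: cINF_lower cSUP_upper)
  show "(\<And>x. x \<in> carrier G \<Longrightarrow> f x \<le> b) \<Longrightarrow> hi f \<le> b" "(\<And>x. x \<in> carrier G \<Longrightarrow> b \<le> f x) \<Longrightarrow> b \<le> lo f" for b
    unfolding lo_def hi_def using one_closed by (auto intro!: cINF_greatest cSUP_least)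
  show "e > 0 \<Longrightarrow> \<exists>y\<in>carrier G. f y \<le> lo f + e"
  proof -
    assume "e > 0"
    then have "Inf (f ` carrier G) < lo f + e" by (simp add: lo_def)
    from cInf_lessD[OF _ this] one_closed obtain z where z: "z \<in> f ` carrier G" "z < lo f + e" by blast
    then show ?thesis by (auto intro: less_imp_le)
  qed
qed

text \<open>All iterates share the modulus of \<open>f\<close>, hence the same \<open>N\<close> and
  the same contraction constant \<open>q\<close>. The recursion
  \<open>w (Suc n) \<le> (1 - q) * w n + 2 * q * e\<close> forces the oscillation down to about
  \<open>2 * e\<close>.\<close>

lemma osc_tendsto: assumes f: "C f" shows "(\<lambda>n. hi (Pn n f) - lo (Pn n f)) \<longlonglongrightarrow> 0"
proof (rule LIMSEQ_I)
  fix r :: real assume r: "r > 0"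
  \<comment> \<open>The estimate ends with \<open>w n < 3 * e\<close>, so any fraction of
    \<open>r\<close> smaller than a third serves.\<close>
  define e where "e = r / 5"
  have e: "e > 0" using r by (simp add: e_def)
  obtain V where V: "openin T V" "\<one> \<in> V" "modulus V e f" by (rule exists_modulus[OF f e])
  have VG: "V \<subseteq> carrier G" using openin_subset[OF V(1)] top by simp
  obtain N where N: "\<And>x y. x \<in> carrier G \<Longrightarrow> y \<in> carrier G \<Longrightarrow> \<exists>n<N. inv y \<otimes> (s n \<otimes> x) \<in> V"
    using uniform_hit[OF V(1,2)] by blast
  define q where "q = (1/2::real)^N"
  have q: "0 < q" "q \<le> 1" by (auto simp: q_def power_le_one)
  define w where "w n = hi (Pn n f) - lo (Pn n f)" for n
  have w0: "0 \<le> w n" for n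
    using lo_hi(1,2)[OF Pn_C[OF f, of n] one_closed] by (simp add: w_def)
  have step: "w (Suc n) \<le> w n - q * (w n - 2 * e)" for n
  proof -
    note c = Pn_C[OF f, of n]
    obtain y where y: "y \<in> carrier G" "Pn n f y \<le> lo (Pn n f) + e" using lo_hi(3)[OF c e] by blast
    have *: "lo (Pn n f) \<le> P (Pn n f) x \<and> P (Pn n f) x \<le> hi (Pn n f) - q * (hi (Pn n f) - lo (Pn n f) - 2 * e)"
      if "x \<in> carrier G" for x
      using P_contract[OF c V(1) Pn_modulus[OF f V(3) VG] less_imp_le[OF e] N _ y that, of "hi (Pn n f)"] lo_hi(1,2)[OF c]
      by (simp add: q_def)
    have "lo (Pn n f) \<le> lo (Pn (Suc n) f)" using * by (intro lo_hi(5) Pn_C[OF f]) simp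
    moreover have "hi (Pn (Suc n) f) \<le> hi (Pn n f) - q * (hi (Pn n f) - lo (Pn n f) - 2 * e)"
      using * by (intro lo_hi(4) Pn_C[OF f]) simp
    ultimately show ?thesis by (simp add: w_def)
  qed
  have bd: "w n \<le> (1 - q)^n * w 0 + 2 * e" for n
  proof (induction n)
    case (Suc n)
    have "w (Suc n) \<le> (1 - q) * w n + q * (2 * e)" using step[of n] by (simp add: algebra_simps)
    also have "\<dots> \<le> (1 - q) * ((1 - q)^n * w 0 + 2 * e) + q * (2 * e)" using Suc q by (intro add_right_mono mult_left_mono) auto
    also have "\<dots> = (1 - q)^Suc n * w 0 + 2 * e" by (simp add: algebra_simps)
    finally show ?case .
  qed (use e in simp)
  have "(\<lambda>n. (1 - q)^n * w 0) \<longlonglongrightarrow> 0"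
    using q by (intro tendsto_mult_left_zero LIMSEQ_power_zero) auto
  from LIMSEQ_D[OF this e] obtain M where M: "\<And>n. n \<ge> M \<Longrightarrow> norm ((1 - q)^n * w 0 - 0) < e" by auto
  have "norm (w n - 0) < r" if "n \<ge> M" for n
  proof -
    have "(1 - q)^n * w 0 < e" using M[OF that] by simp
    with bd[of n] have "w n < 3 * e" by linarith
    also have "3 * e < r" using r by (simp add: e_def)
    finally show ?thesis using w0[of n] by simp
  qed
  then show "\<exists>M. \<forall>n\<ge>M. norm (hi (Pn n f) - lo (Pn n f) - 0) < r" unfolding w_def by blast
qed

lemma lo_mono: assumes f: "C f" shows "lo (Pn n f) \<le> lo (Pn (Suc n) f)" "hi (Pn (Suc n) f) \<le> hi (Pn n f)"
proof -
  note c = Pn_C[OF f, of n]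
  have "lo (Pn n f) \<le> P (Pn n f) x \<and> P (Pn n f) x \<le> hi (Pn n f)" if "x \<in> carrier G" for x
    using P_mono[of "\<lambda>_. lo (Pn n f)" "Pn n f" x] P_mono[of "Pn n f" "\<lambda>_. hi (Pn n f)" x] that c lo_hi(1,2)[OF c]
    by (auto simp: P_const)
  then show "lo (Pn n f) \<le> lo (Pn (Suc n) f)" "hi (Pn (Suc n) f) \<le> hi (Pn n f)"
    using lo_hi(4,5)[OF Pn_C[OF f, of "Suc n"]] by auto
qed

text \<open>The intervals between \<open>lo\<close> and \<open>hi\<close> of the iterates are nested
  and shrink to a point, which therefore is the limit at every \<open>x\<close>.\<close>

lemma Pn_convergent:
  assumes f: "C f"
  shows "\<exists>c. \<forall>x\<in>carrier G. (\<lambda>n. Pn n f x) \<longlonglongrightarrow> c"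
proof -
  have "incseq (\<lambda>n. lo (Pn n f))" "decseq (\<lambda>n. hi (Pn n f))"
    using lo_mono[OF f] by (auto intro: incseq_SucI decseq_SucI)
  moreover have "lo (Pn n f) \<le> hi (Pn n f)" for n
    using lo_hi(1,2)[OF Pn_C[OF f, of n] one_closed] by simp
  ultimately obtain c where c: "(\<lambda>n. lo (Pn n f)) \<longlonglongrightarrow> c" "(\<lambda>n. hi (Pn n f)) \<longlonglongrightarrow> c"
    using nested_sequence_unique[of "\<lambda>n. lo (Pn n f)" "\<lambda>n. hi (Pn n f)"] tendsto_minus[OF osc_tendsto[OF f]]
    by (auto simp: incseq_Suc_iff decseq_Suc_iff)
  show ?thesis
  proof (intro exI ballI)
    fix x assume x: "x \<in> carrier G"
    show "(\<lambda>n. Pn n f x) \<longlonglongrightarrow> c"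
      by (rule tendsto_sandwich[OF _ _ c]) (use lo_hi(1,2)[OF Pn_C[OF f]] x in auto)
  qed
qed

text \<open>By \<open>Pn_convergent\<close> the limit is the same at every point of the group; the
  unit is an arbitrary choice.\<close>

definition haar :: "('g \<Rightarrow> real) \<Rightarrow> real" where "haar f = lim (\<lambda>n. Pn n f \<one>)"

lemma haar_lim: assumes "C f" "x \<in> carrier G" shows "(\<lambda>n. Pn n f x) \<longlonglongrightarrow> haar f"
proof -
  obtain c where "\<And>x. x \<in> carrier G \<Longrightarrow> (\<lambda>n. Pn n f x) \<longlonglongrightarrow> c" using Pn_convergent[OF assms(1)] by blast
  then show ?thesis using limI[of "\<lambda>n. Pn n f \<one>" c] assms by (simp add: haar_def)
qed

lemma P_cong: "(\<And>y. y \<in> carrier G \<Longrightarrow> f y = h y) \<Longrightarrow> x \<in> carrier G \<Longrightarrow> P f x = P h x"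
  using s by (simp add: P_def)

lemma Pn_add: "C f \<Longrightarrow> C h \<Longrightarrow> x \<in> carrier G \<Longrightarrow> Pn n (\<lambda>y. f y + h y) x = Pn n f x + Pn n h x"
proof (induction n arbitrary: x)
  case (Suc n)
  have "P (Pn n (\<lambda>y. f y + h y)) x = P (\<lambda>y. Pn n f y + Pn n h y) x" using Suc by (intro P_cong) auto
  then show ?case using P_add[OF Pn_C Pn_C, of f h x n n] Suc.prems by simp
qed simp

lemma Pn_cmult: "C f \<Longrightarrow> x \<in> carrier G \<Longrightarrow> Pn n (\<lambda>y. a * f y) x = a * Pn n f x"
proof (induction n arbitrary: x)
  case (Suc n)
  have "P (Pn n (\<lambda>y. a * f y)) x = P (\<lambda>y. a * Pn n f y) x" using Suc by (intro P_cong) auto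
  then show ?case using P_cmult[OF Pn_C, of f x a n] Suc.prems by simp
qed simp

lemma Pn_mono: "C f \<Longrightarrow> C h \<Longrightarrow> (\<And>y. y \<in> carrier G \<Longrightarrow> f y \<le> h y) \<Longrightarrow> x \<in> carrier G \<Longrightarrow> Pn n f x \<le> Pn n h x"
proof (induction n arbitrary: x)
  case (Suc n)
  then show ?case using P_mono[OF Pn_C Pn_C, of f h x n n] by simp
qed simp

lemma Pn_const: "Pn n (\<lambda>_. c) = (\<lambda>_. c)"
  by (induction n) (auto simp: P_const)

lemma Pn_right: "x \<in> carrier G \<Longrightarrow> a \<in> carrier G \<Longrightarrow> Pn n (\<lambda>y. f (y \<otimes> a)) x = Pn n f (x \<otimes> a)"
proof (induction n arbitrary: x)
  case (Suc n)
  have "P (Pn n (\<lambda>y. f (y \<otimes> a))) x = P (\<lambda>y. Pn n f (y \<otimes> a)) x" using Suc by (intro P_cong) auto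
  then show ?case using P_right[of x a "Pn n f"] Suc.prems by simp
qed simp

lemma haar_mean: "mean_on T haar"
  unfolding mean_on_def
proof (intro conjI allI impI)
  fix f h assume "C f \<and> C h"
  then have c: "C f" "C h" "C (\<lambda>t. f t + h t)" by (auto intro: continuous_intros)
  show "haar (\<lambda>t. f t + h t) = haar f + haar h"
    using LIMSEQ_unique[OF haar_lim[OF c(3) one_closed]] tendsto_add[OF haar_lim[OF c(1) one_closed] haar_lim[OF c(2) one_closed]]
    by (simp add: Pn_add c)
next
  fix f a assume c: "C f"
  then have c': "C (\<lambda>t. a * f t)" by (auto intro: continuous_intros)
  show "haar (\<lambda>t. a * f t) = a * haar f"
    using LIMSEQ_unique[OF haar_lim[OF c' one_closed]] tendsto_mult_left[OF haar_lim[OF c one_closed], of a]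
    by (simp add: Pn_cmult c)
next
  fix f assume c: "C f \<and> (\<forall>t\<in>topspace T. 0 \<le> f t)"
  show "0 \<le> haar f"
  proof (rule LIMSEQ_le_const[OF haar_lim[OF _ one_closed]])
    show "\<exists>N. \<forall>n\<ge>N. 0 \<le> Pn n f \<one>"
      using Pn_mono[of "\<lambda>_. 0" f \<one>] c top by (auto simp: Pn_const)
  qed (use c in simp)
next
  show "haar (\<lambda>t. 1) = 1" by (simp add: haar_def Pn_const)
qed

lemma haar_right:
  assumes "C f" "a \<in> carrier G" shows "haar (\<lambda>x. f (x \<otimes> a)) = haar f"
proof -
  have c: "C (\<lambda>x. f (x \<otimes> a))" using continuous_map_compose[OF mult_right[OF assms(2)] assms(1)] by (simp add: comp_def)
  show ?thesis
    using LIMSEQ_unique[OF haar_lim[OF c one_closed]] haar_lim[OF assms]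
    by (simp add: Pn_right assms)
qed

end

theorem haar_exists:
  "\<exists>I. mean_on T I \<and> (\<forall>f a. C f \<longrightarrow> a \<in> carrier G \<longrightarrow> I (\<lambda>x. f (x \<otimes> a)) = I f) \<and>
     (\<forall>f. C f \<longrightarrow> (\<forall>x\<in>carrier G. 0 \<le> f x) \<longrightarrow> 0 < f \<one> \<longrightarrow> 0 < I f)"
proof -
  from dense_sequence obtain s
    where s': "(\<forall>n::nat. s n \<in> carrier G) \<and> (\<forall>U. openin T U \<longrightarrow> U \<noteq> {} \<longrightarrow> (\<exists>n. s n \<in> U))" ..
  then have s: "\<And>n. s n \<in> carrier G" "\<And>U. openin T U \<Longrightarrow> U \<noteq> {} \<Longrightarrow> \<exists>n. s n \<in> U" by simp_all
  have I: "mean_on T (haar s)" by (rule haar_mean) (use s in auto)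
  have R: "haar s (\<lambda>x. f (x \<otimes> a)) = haar s f" if "C f" "a \<in> carrier G" for f a
    by (rule haar_right) (use s that in auto)
  \<comment> \<open>Finitely many right translates of the open set where \<open>f\<close> exceeds
    \<open>f \<one> / 2\<close> cover the group. The sum of the corresponding translates of
    \<open>f\<close> is at least \<open>f \<one> / 2\<close> everywhere, and by invariance all of
    them have the mean of \<open>f\<close>.\<close>
  have "0 < haar s f" if f: "C f" "\<forall>x\<in>carrier G. 0 \<le> f x" "0 < f \<one>" for f
  proof -
    have tr: "C (\<lambda>x. f (x \<otimes> a))" if "a \<in> carrier G" for a
      using continuous_map_compose[OF mult_right[OF that] f(1)] by (simp add: comp_def)
    define W where "W a = {x \<in> topspace T. f (x \<otimes> a) \<in> {f \<one> / 2<..}}" for a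
    have "openin T (W a)" if "a \<in> carrier G" for a
      unfolding W_def by (rule openin_continuous_map_preimage[OF tr[OF that]]) simp
    moreover have "topspace T \<subseteq> \<Union>(W ` carrier G)"
    proof
      fix x assume "x \<in> topspace T"
      then have "x \<in> W (inv x)" "inv x \<in> carrier G" using f(3) top by (auto simp: W_def)
      then show "x \<in> \<Union>(W ` carrier G)" by blast
    qed
    ultimately have "\<exists>F. finite F \<and> F \<subseteq> W ` carrier G \<and> topspace T \<subseteq> \<Union>F"
      by (intro compactinD[OF compact[unfolded compact_space_def]]) auto
    then obtain F where F: "finite F" "F \<subseteq> W ` carrier G" "topspace T \<subseteq> \<Union>F" by auto
    from finite_subset_image[OF F(1,2)] obtain J where J: "finite J" "J \<subseteq> carrier G" "F = W ` J" by auto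
    have "f \<one> / 2 = haar s (\<lambda>_. f \<one> / 2)" using mean_const[OF I] by simp
    also have "\<dots> \<le> haar s (\<lambda>x. \<Sum>a\<in>J. f (x \<otimes> a))"
    proof (rule mean_mono[OF I])
      show "C (\<lambda>x. \<Sum>a\<in>J. f (x \<otimes> a))" using J tr by (intro continuous_map_sum) auto
      fix x assume x: "x \<in> topspace T"
      then obtain a where a: "a \<in> J" "x \<in> W a" using F(3) J(3) by blast
      then have "f \<one> / 2 \<le> f (x \<otimes> a)" by (simp add: W_def)
      also have "\<dots> \<le> (\<Sum>a\<in>J. f (x \<otimes> a))"
        using f(2) J x top a by (intro member_le_sum) auto
      finally show "f \<one> / 2 \<le> (\<Sum>a\<in>J. f (x \<otimes> a))" .
    qed simp
    also have "\<dots> = (\<Sum>a\<in>J. haar s (\<lambda>x. f (x \<otimes> a)))" 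
      by (rule mean_sum[OF I J(1), of "\<lambda>a x. f (x \<otimes> a)"]) (use tr J(2) in auto)
    also have "\<dots> = real (card J) * haar s f" using R[OF f(1)] J(2) by (simp add: subset_iff)
    finally have "0 < real (card J) * haar s f" using f(3) by linarith
    then show "0 < haar s f" by (simp add: zero_less_mult_iff)
  qed
  then have "mean_on T (haar s) \<and> (\<forall>f a. C f \<longrightarrow> a \<in> carrier G \<longrightarrow> haar s (\<lambda>x. f (x \<otimes> a)) = haar s f) \<and>
     (\<forall>f. C f \<longrightarrow> (\<forall>x\<in>carrier G. 0 \<le> f x) \<longrightarrow> 0 < f \<one> \<longrightarrow> 0 < haar s f)"
    using I R by simp
  then show ?thesis by (rule exI[of _ "haar s"])
qed

end

lemma Ck_arith:
  "Ck k n W (\<lambda>_. a)"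
  "Ck k n W f \<Longrightarrow> Ck k n W g \<Longrightarrow> Ck k n W (\<lambda>p. f p - g p)"
  "Ck k n W f \<Longrightarrow> Ck k n W g \<Longrightarrow> Ck k n W (\<lambda>p. f p * g p)"
  unfolding Ck_iff_PCk by (auto intro: PCk_const PCk_diff PCk_mult)

lemma Ck_continuous: "Ck k n W f \<Longrightarrow> contE n W f"
  by (cases k) auto

definition unit_vec :: "nat \<Rightarrow> nat \<Rightarrow> real" where "unit_vec j = (\<lambda>i. if i = j then 1 else 0)"

lemma unit_vec_Euclid: "j < n \<Longrightarrow> unit_vec j \<in> Euclid n"
  by (auto simp: unit_vec_def topspace_Euclidean_space)

lemma unit_vec_sum: "trunc m v = (\<lambda>i. \<Sum>j<m. v j * unit_vec j i)"
  by (auto simp: trunc_def unit_vec_def fun_eq_iff if_distrib[of "\<lambda>x. _ * x"] sum.delta cong: if_cong)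

section \<open>Calculus on manifolds\<close>

abbreviation (input) pts :: "'m mfd \<Rightarrow> 'm set" where "pts M \<equiv> topspace (mtop M)"

lemma chart:
  assumes M: "manifold M" and C: "(C, c) \<in> atlas M"
  shows "openin (mtop M) C" "openE (mdim M) (c ` C)" "inj_on c C"
    "continuous_map (subtopology (mtop M) C) (Euclidean_space (mdim M)) c"
    "continuous_map (subtopology (Euclidean_space (mdim M)) (c ` C)) (mtop M) (inv_into C c)"
proof -
  let ?E = "Euclidean_space (mdim M)"
  have h: "openin (mtop M) C" "openin ?E (c ` C)"
    "homeomorphic_map (subtopology (mtop M) C) (subtopology ?E (c ` C)) c"
    using M C unfolding manifold_def by auto
  then show "openin (mtop M) C" "openin ?E (c ` C)" by auto
  have tC: "topspace (subtopology (mtop M) C) = C" using openin_subset[OF h(1)] by auto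
  have tE: "topspace (subtopology ?E (c ` C)) = c ` C" using openin_subset[OF h(2)] by auto
  show inj: "inj_on c C" using homeomorphic_imp_injective_map[OF h(3)] tC by simp
  show "continuous_map (subtopology (mtop M) C) ?E c"
    using homeomorphic_imp_continuous_map[OF h(3)] continuous_map_in_subtopology by blast
  from h(3) obtain g where g: "homeomorphic_maps (subtopology (mtop M) C) (subtopology ?E (c ` C)) c g"
    unfolding homeomorphic_map_maps by blast
  have gc: "continuous_map (subtopology ?E (c ` C)) (mtop M) g" and gi: "\<And>x. x \<in> C \<Longrightarrow> g (c x) = x"
    using g tC by (auto simp: homeomorphic_maps_def continuous_map_in_subtopology)
  show "continuous_map (subtopology ?E (c ` C)) (mtop M) (inv_into C c)"
    by (rule continuous_map_eq[OF gc]) (use gi inj tE in auto)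
qed

lemma chart_Euclid: "manifold M \<Longrightarrow> (C, c) \<in> atlas M \<Longrightarrow> x \<in> C \<Longrightarrow> c x \<in> Euclid (mdim M)"
  using chart(2) openin_subset by blast

lemma chart_exists: "manifold M \<Longrightarrow> x \<in> pts M \<Longrightarrow> \<exists>C c. (C, c) \<in> atlas M \<and> x \<in> C"
proof -
  assume "manifold M" "x \<in> pts M"
  then have "x \<in> (\<Union>(C, c)\<in>atlas M. C)" by (simp add: manifold_def)
  then show ?thesis by auto
qed

lemma transition_smooth:
  "manifold M \<Longrightarrow> (C, c) \<in> atlas M \<Longrightarrow> (D, d) \<in> atlas M \<Longrightarrow> i < mdim M \<Longrightarrow>
    smooth_on (mdim M) (c ` (C \<inter> D)) (\<lambda>y. d (inv_into C c y) i)"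
proof -
  assume M: "manifold M" and C: "(C, c) \<in> atlas M" "(D, d) \<in> atlas M" "i < mdim M"
  from M have "\<forall>(C, c)\<in>atlas M. \<forall>(D, d)\<in>atlas M. \<forall>i<mdim M. smooth_on (mdim M) (c ` (C \<inter> D)) (\<lambda>y. d (inv_into C c y) i)"
    unfolding manifold_def by (elim conjE)
  from bspec[OF bspec[OF this C(1), unfolded split_conv] C(2), unfolded split_conv] C(3) show ?thesis by blast
qed

text \<open>Functions of \<open>(x, t)\<close> which are smooth in the point \<open>x\<close> of a manifold, continuous in a
  parameter \<open>t\<close>, and whose derivatives in \<open>x\<close> are jointly continuous.\<close>

abbreviation pimg :: "'m set \<Rightarrow> ('m \<Rightarrow> nat \<Rightarrow> real) \<Rightarrow> ('m \<times> 't) set \<Rightarrow> ((nat \<Rightarrow> real) \<times> 't) set" where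
  "pimg C c Y \<equiv> {p. fst p \<in> c ` C \<and> (inv_into C c (fst p), snd p) \<in> Y}"

definition psf :: "'m mfd \<Rightarrow> 't topology \<Rightarrow> ('m \<times> 't) set \<Rightarrow> ('m \<times> 't \<Rightarrow> real) \<Rightarrow> bool" where
  "psf M T Y f \<longleftrightarrow> (\<forall>(C, c)\<in>atlas M. psmooth (mdim M) (pimg C c Y) T (\<lambda>p. f (inv_into C c (fst p), snd p)))"

lemma psfD: "psf M T Y f \<Longrightarrow> (C, c) \<in> atlas M \<Longrightarrow> psmooth (mdim M) (pimg C c Y) T (\<lambda>p. f (inv_into C c (fst p), snd p))"
  unfolding psf_def by fast

lemma pimg_Times:
  assumes "inj_on c C"
  shows "pimg C c (W \<times> S) = c ` (W \<inter> C) \<times> S"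
  using assms by (auto simp: image_iff)

abbreviation sf :: "'m mfd \<Rightarrow> 'm set \<Rightarrow> ('m \<Rightarrow> real) \<Rightarrow> bool" where
  "sf M \<equiv> sfun (mfd_space M)"

lemma open_pimg:
  assumes M: "manifold M" and C: "(C, c) \<in> atlas M" and Y: "openin (prod_topology (mtop M) T) Y"
  shows "openin (prodE (mdim M) T) (pimg C c Y)"
proof -
  note ch = chart[OF M C]
  have 1: "continuous_map (subtopology (prodE (mdim M) T) (c ` C \<times> topspace T)) (prod_topology (mtop M) T)
      (\<lambda>p. (inv_into C c (fst p), snd p))"
    unfolding continuous_map_pairwise o_def fst_conv snd_conv
  proof
    show "continuous_map (subtopology (prodE (mdim M) T) (c ` C \<times> topspace T)) (mtop M) (\<lambda>p. inv_into C c (fst p))"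
    proof -
      have "continuous_map (subtopology (prodE (mdim M) T) (c ` C \<times> topspace T)) (subtopology (Euclidean_space (mdim M)) (c ` C)) fst"
        by (auto simp: continuous_map_in_subtopology intro: continuous_map_from_subtopology continuous_map_fst)
      from continuous_map_compose[OF this ch(5)] show ?thesis by (simp add: o_def)
    qed
    show "continuous_map (subtopology (prodE (mdim M) T) (c ` C \<times> topspace T)) T snd"
      by (intro continuous_map_from_subtopology continuous_map_snd)
  qed
  have o: "openin (prodE (mdim M) T) (c ` C \<times> topspace T)"
    using ch(2) by (simp add: openin_prod_Times_iff)
  have "openin (subtopology (prodE (mdim M) T) (c ` C \<times> topspace T))
     {p \<in> topspace (subtopology (prodE (mdim M) T) (c ` C \<times> topspace T)). (inv_into C c (fst p), snd p) \<in> Y}"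
    by (rule openin_continuous_map_preimage[OF 1 Y])
  then have "openin (prodE (mdim M) T)
     {p \<in> topspace (subtopology (prodE (mdim M) T) (c ` C \<times> topspace T)). (inv_into C c (fst p), snd p) \<in> Y}"
    using o openin_open_subtopology by blast
  moreover have "{p \<in> topspace (subtopology (prodE (mdim M) T) (c ` C \<times> topspace T)). (inv_into C c (fst p), snd p) \<in> Y} = pimg C c Y"
    using openin_subset[OF ch(2)] openin_subset[OF Y] by auto
  ultimately show ?thesis by simp
qed

lemma psmooth_fst:
  assumes "openE n W" "smooth_on n W f"
  shows "psmooth n (W \<times> topspace T) T (\<lambda>p. f (fst p))"
proof -
  have o: "openin (prodE n T) (W \<times> topspace T)" using assms(1) by (simp add: openin_prod_Times_iff)
  have e: "trunc n (fst p) = fst p" if "p \<in> W \<times> topspace T" for p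
    using that openin_subset[OF assms(1)] by (auto intro!: trunc_eq)
  have "psmooth n (W \<times> topspace T) T (\<lambda>p. f (trunc n (\<lambda>j. fst p j)))"
    by (rule psmooth_of_smooth_on[OF assms o psmooth_coord]) (use e in force)
  then show ?thesis by (rule psmooth_cong[OF o, rotated]) (simp add: e)
qed

text \<open>Over a single chart domain the other charts differ by a transition map, which is smooth
  and does not touch the parameter; so one chart decides.\<close>

lemma psf_chart:
  assumes M: "manifold M" and C: "(C, c) \<in> atlas M" and Y: "openin (prod_topology (mtop M) T) Y" "fst ` Y \<subseteq> C"
    and f: "psmooth (mdim M) (pimg C c Y) T (\<lambda>p. f (inv_into C c (fst p), snd p))"
  shows "psf M T Y f"
  unfolding psf_def
proof (clarify)
  fix D d assume D: "(D, d) \<in> atlas M"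
  let ?n = "mdim M"
  note cC = chart[OF M C] and cD = chart[OF M D]
  have oD: "openin (prodE ?n T) (pimg D d Y)" by (rule open_pimg[OF M D Y(1)])
  have sub: "inv_into D d (fst p) \<in> C \<inter> D" "fst p = d (inv_into D d (fst p))" "snd p \<in> topspace T" if "p \<in> pimg D d Y" for p
    using that Y(2) openin_subset[OF Y(1)] cD(3) by auto
  have od: "openE ?n (d ` (D \<inter> C))"
  proof -
    have "openin (prodE ?n point_topology) (pimg D d (C \<times> (UNIV :: unit set)))"
      by (rule open_pimg[OF M D]) (use cC(1) in \<open>simp add: openin_prod_Times_iff\<close>)
    then show ?thesis unfolding pimg_Times[OF cD(3)] by (auto simp add: openin_prod_Times_iff Int_commute)
  qed
  have \<Theta>: "psmooth ?n (pimg D d Y) T (\<lambda>p. c (inv_into D d (fst p)) j)" if "j < ?n" for j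
  proof (rule psmooth_subset)
    show "psmooth ?n (d ` (D \<inter> C) \<times> topspace T) T (\<lambda>p. c (inv_into D d (fst p)) j)"
      using psmooth_fst[OF od transition_smooth[OF M D C that]] by simp
    show "pimg D d Y \<subseteq> d ` (D \<inter> C) \<times> topspace T"
    proof
      fix p assume p: "p \<in> pimg D d Y"
      have "d (inv_into D d (fst p)) \<in> d ` (D \<inter> C)" using sub(1)[OF p] by blast
      then have "fst p \<in> d ` (D \<inter> C)" using sub(2)[OF p] by simp
      then show "p \<in> d ` (D \<inter> C) \<times> topspace T" using sub(3)[OF p] by (simp add: mem_Times_iff)
    qed
  qed
  have e: "trunc ?n (c (inv_into D d (fst p))) = c (inv_into D d (fst p))" if "p \<in> pimg D d Y" for p
    using sub[OF that] by (intro trunc_eq chart_Euclid[OF M C]) auto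
  have "psmooth ?n (pimg D d Y) T (\<lambda>p. (\<lambda>p. f (inv_into C c (fst p), snd p)) (trunc ?n (\<lambda>j. c (inv_into D d (fst p)) j), snd p))"
  proof (rule psmooth_compose[OF open_pimg[OF M C Y(1)] f oD \<Theta>])
    show "continuous_map T T (\<lambda>t. t)" by simp
    fix x t assume xt: "(x, t) \<in> pimg D d Y"
    show "(trunc ?n (\<lambda>j. c (inv_into D d (fst (x, t))) j), t) \<in> pimg C c Y"
      unfolding e[OF xt] using sub[OF xt] xt cC(3) by auto
  qed
  then show "psmooth ?n (pimg D d Y) T (\<lambda>p. f (inv_into D d (fst p), snd p))"
    by (rule psmooth_cong[OF oD, rotated]) (use e sub cC(3) in auto)
qed

lemma psf_subset: "psf M T Y f \<Longrightarrow> Y' \<subseteq> Y \<Longrightarrow> psf M T Y' f"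
  unfolding psf_def by (fast intro: psmooth_subset)

lemma psf_cong:
  assumes "manifold M" "openin (prod_topology (mtop M) T) Y" "\<And>p. p \<in> Y \<Longrightarrow> f p = g p" "psf M T Y f"
  shows "psf M T Y g"
  unfolding psf_def
proof (clarify)
  fix C c assume C: "(C, c) \<in> atlas M"
  show "psmooth (mdim M) (pimg C c Y) T (\<lambda>p. g (inv_into C c (fst p), snd p))"
    by (rule psmooth_cong[OF open_pimg[OF assms(1) C assms(2)] _ psfD[OF assms(4) C]]) (use assms(3) in simp)
qed

lemma psf_local:
  assumes M: "manifold M" and Y: "openin (prod_topology (mtop M) T) Y"
    and l: "\<And>p. p \<in> Y \<Longrightarrow> \<exists>Y'. openin (prod_topology (mtop M) T) Y' \<and> p \<in> Y' \<and> psf M T (Y \<inter> Y') f"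
  shows "psf M T Y f"
  unfolding psf_def
proof (clarify)
  fix C c assume C: "(C, c) \<in> atlas M"
  show "psmooth (mdim M) (pimg C c Y) T (\<lambda>p. f (inv_into C c (fst p), snd p))"
  proof (rule psmooth_local[OF open_pimg[OF M C Y]])
    fix p assume p: "p \<in> pimg C c Y"
    then have "(inv_into C c (fst p), snd p) \<in> Y" by simp
    from l[OF this] obtain Y' where o: "openin (prod_topology (mtop M) T) Y'" "(inv_into C c (fst p), snd p) \<in> Y'"
      "psf M T (Y \<inter> Y') f" by blast
    have "pimg C c Y \<inter> pimg C c Y' = pimg C c (Y \<inter> Y')" by auto
    then show "\<exists>Y'. openin (prodE (mdim M) T) Y' \<and> p \<in> Y' \<and>
        psmooth (mdim M) (pimg C c Y \<inter> Y') T (\<lambda>p. f (inv_into C c (fst p), snd p))"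
      using open_pimg[OF M C o(1)] o(2,3) p C by (intro exI[of _ "pimg C c Y'"]) (auto simp: psf_def)
  qed
qed

lemma psf_const: "psf M T Y (\<lambda>p. a)"
  unfolding psf_def by (auto intro: psmooth_const)

lemma psf_mult: "psf M T Y f \<Longrightarrow> psf M T Y g \<Longrightarrow> psf M T Y (\<lambda>p. f p * g p)"
  unfolding psf_def by (auto intro: psmooth_mult)

lemma psf_sum: "finite J \<Longrightarrow> (\<And>j. j \<in> J \<Longrightarrow> psf M T Y (f j)) \<Longrightarrow> psf M T Y (\<lambda>p. \<Sum>j\<in>J. f j p)"
  unfolding psf_def by (auto intro!: psmooth_sum)

section \<open>Smooth functions on a manifold\<close>

lemma open_chart_image:
  assumes "manifold M" "(C, c) \<in> atlas M" "openin (mtop M) W"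
  shows "openE (mdim M) (c ` (W \<inter> C))"
proof -
  have "openin (prodE (mdim M) point_topology) (pimg C c (W \<times> (UNIV :: unit set)))"
    using assms(3) by (intro open_pimg[OF assms(1,2)]) (simp add: openin_prod_Times_iff)
  then show ?thesis unfolding pimg_Times[OF chart(3)[OF assms(1,2)]] by (auto simp add: openin_prod_Times_iff)
qed

lemma sf_iff: "sf M W f \<longleftrightarrow> (\<forall>(C, c)\<in>atlas M. smooth_on (mdim M) (c ` (W \<inter> C)) (\<lambda>y. f (inv_into C c y)))"
  by (simp add: mfd_space_def)

lemma sf_iff_psf:
  assumes M: "manifold M" shows "sf M W f \<longleftrightarrow> psf M point_topology (W \<times> UNIV) (\<lambda>p. f (fst p))"
proof -
  have "smooth_on (mdim M) (c ` (W \<inter> C)) (\<lambda>y. f (inv_into C c y)) \<longleftrightarrow>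
     psmooth (mdim M) (pimg C c (W \<times> (UNIV :: unit set))) point_topology (\<lambda>p. f (fst (inv_into C c (fst p), snd p)))"
    if "(C, c) \<in> atlas M" for C c
    using pimg_Times[OF chart(3)[OF M that], of W "UNIV :: unit set"] by (simp add: smooth_on_iff)
  then show ?thesis unfolding sf_iff psf_def by (auto simp: Ball_def)
qed

lemma sf_const: "sf M W (\<lambda>x. a)"
  unfolding sf_iff by (auto intro: smooth_on_const)

lemma sf_add: "sf M W f \<Longrightarrow> sf M W g \<Longrightarrow> sf M W (\<lambda>x. f x + g x)"
  unfolding sf_iff by (auto intro: smooth_on_add)

lemma sf_diff: "sf M W f \<Longrightarrow> sf M W g \<Longrightarrow> sf M W (\<lambda>x. f x - g x)"
  unfolding sf_iff by (auto intro: smooth_on_diff)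

lemma sf_mult: "sf M W f \<Longrightarrow> sf M W g \<Longrightarrow> sf M W (\<lambda>x. f x * g x)"
  unfolding sf_iff by (auto intro: smooth_on_mult)

lemma sf_sum: "finite J \<Longrightarrow> (\<And>j. j \<in> J \<Longrightarrow> sf M W (f j)) \<Longrightarrow> sf M W (\<lambda>x. \<Sum>j\<in>J. f j x)"
  unfolding sf_iff by (auto intro!: smooth_on_sum)

lemma sf_inverse: "manifold M \<Longrightarrow> sf M W f \<Longrightarrow> (\<And>x. x \<in> W \<Longrightarrow> f x \<noteq> 0) \<Longrightarrow> sf M W (\<lambda>x. inverse (f x))"
  unfolding sf_iff by (fastforce intro!: smooth_on_inverse simp: chart(3))

lemma sf_subset: "sf M W f \<Longrightarrow> W' \<subseteq> W \<Longrightarrow> sf M W' f"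
  unfolding sf_iff by (fast intro: smooth_on_subset)

lemma sf_cong:
  assumes M: "manifold M" and W: "openin (mtop M) W" and "\<And>x. x \<in> W \<Longrightarrow> f x = g x" "sf M W f" shows "sf M W g"
  unfolding sf_iff_psf[OF M]
  by (rule psf_cong[OF M, of _ _ "\<lambda>p. f (fst p)"]) (use assms in \<open>auto simp: openin_prod_Times_iff sf_iff_psf\<close>)

lemma sf_local:
  assumes M: "manifold M" and W: "openin (mtop M) W"
    and l: "\<And>x. x \<in> W \<Longrightarrow> \<exists>W'. openin (mtop M) W' \<and> x \<in> W' \<and> sf M (W \<inter> W') f"
  shows "sf M W f"
  unfolding sf_iff_psf[OF M]
proof (rule psf_local[OF M])
  fix p :: "'a \<times> unit" assume "p \<in> W \<times> UNIV"
  then have "fst p \<in> W" by auto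
  from l[OF this] obtain W' where W': "openin (mtop M) W'" "fst p \<in> W'" "sf M (W \<inter> W') f" by blast
  have "(W \<times> UNIV) \<inter> (W' \<times> UNIV) = (W \<inter> W') \<times> (UNIV :: unit set)" by auto
  then show "\<exists>Y'. openin (prod_topology (mtop M) point_topology) Y' \<and> p \<in> Y' \<and> psf M point_topology (W \<times> UNIV \<inter> Y') (\<lambda>p. f (fst p))"
    using W' by (intro exI[of _ "W' \<times> UNIV"]) (auto simp: openin_prod_Times_iff sf_iff_psf[OF M] mem_Times_iff)
qed (use W in \<open>simp add: openin_prod_Times_iff\<close>)

lemma sf_Union:
  assumes "manifold M" "\<And>W. W \<in> \<W> \<Longrightarrow> openin (mtop M) W \<and> sf M W f"
  shows "sf M (\<Union>\<W>) f"
proof (rule sf_local[OF assms(1) openin_Union])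
  fix x assume "x \<in> \<Union>\<W>"
  then obtain W where W: "W \<in> \<W>" "x \<in> W" by blast
  then have "\<Union>\<W> \<inter> W = W" by blast
  then show "\<exists>W'. openin (mtop M) W' \<and> x \<in> W' \<and> sf M (\<Union>\<W> \<inter> W') f" using W assms(2)[of W] by auto
qed (use assms in auto)

lemma sf_Un: "manifold M \<Longrightarrow> openin (mtop M) V \<Longrightarrow> openin (mtop M) W \<Longrightarrow> sf M V f \<Longrightarrow> sf M W f \<Longrightarrow> sf M (V \<union> W) f"
  using sf_Union[of M "{V, W}" f] by auto

lemma sf_chart:
  assumes M: "manifold M" and C: "(C, c) \<in> atlas M" and W: "openin (mtop M) W" "W \<subseteq> C"
    and f: "smooth_on (mdim M) (c ` W) (\<lambda>y. f (inv_into C c y))"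
  shows "sf M W f"
  unfolding sf_iff_psf[OF M]
proof (rule psf_chart[OF M C])
  have "W \<inter> C = W" using W(2) by blast
  then show "psmooth (mdim M) (pimg C c (W \<times> (UNIV :: unit set))) point_topology (\<lambda>p. f (fst (inv_into C c (fst p), snd p)))"
    using f pimg_Times[OF chart(3)[OF M C], of W "UNIV :: unit set"] by (simp add: smooth_on_iff)
qed (use W in \<open>auto simp: openin_prod_Times_iff\<close>)

lemma sf_coord:
  assumes "manifold M" "(C, c) \<in> atlas M" shows "sf M C (\<lambda>x. c x j)"
proof (rule sf_chart[OF assms chart(1)[OF assms]])
  show "smooth_on (mdim M) (c ` C) (\<lambda>y. c (inv_into C c y) j)"
    by (rule smooth_on_cong[OF chart(2)[OF assms] _ smooth_on_coord[of _ _ j]]) (simp add: f_inv_into_f)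
qed simp

lemma sf_compose:
  assumes M: "manifold M" and V: "openE k V" "smooth_on k V g" and W: "openin (mtop M) W"
    and \<Theta>: "\<And>j. j < k \<Longrightarrow> sf M W (\<Theta> j)" and sub: "\<And>x. x \<in> W \<Longrightarrow> trunc k (\<lambda>j. \<Theta> j x) \<in> V"
  shows "sf M W (\<lambda>x. g (trunc k (\<lambda>j. \<Theta> j x)))"
  unfolding sf_iff
proof (clarify)
  fix C c assume C: "(C, c) \<in> atlas M"
  show "smooth_on (mdim M) (c ` (W \<inter> C)) (\<lambda>y. g (trunc k (\<lambda>j. \<Theta> j (inv_into C c y))))"
    by (rule smooth_on_compose[OF V open_chart_image[OF M C W]])
      (use \<Theta> C sub chart(3)[OF M C] in \<open>auto simp: sf_iff\<close>)
qed

lemma sf_continuous: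
  assumes M: "manifold M" and W: "openin (mtop M) W" and f: "sf M W f"
  shows "creal (subtopology (mtop M) W) f"
proof -
  have "openin (mtop M) {x \<in> W. f x \<in> U}" if U: "openin euclideanreal U" for U
  proof (subst openin_subopen, clarify)
    fix x assume x: "x \<in> W" "f x \<in> U"
    then obtain C c where C: "(C, c) \<in> atlas M" "x \<in> C" using chart_exists[OF M] W openin_subset by blast
    note ch = chart[OF M C(1)]
    have f': "contE (mdim M) (c ` (W \<inter> C)) (\<lambda>y. f (inv_into C c y))"
      using f C(1) smooth_on_continuous unfolding sf_iff by fast
    have oWC: "openin (mtop M) (W \<inter> C)" using W ch(1) by blast
    have c': "continuous_map (subtopology (mtop M) (W \<inter> C)) (subtopology (Euclidean_space (mdim M)) (c ` (W \<inter> C))) c"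
      using continuous_map_from_subtopology_mono[OF ch(4), of "W \<inter> C"] by (auto simp: continuous_map_in_subtopology)
    have "creal (subtopology (mtop M) (W \<inter> C)) f"
      by (rule continuous_map_eq[OF continuous_map_compose[OF c' f']]) (use ch(3) in auto)
    from openin_continuous_map_preimage[OF this U]
    have "openin (mtop M) {x \<in> topspace (subtopology (mtop M) (W \<inter> C)). f x \<in> U}"
      using oWC openin_open_subtopology by blast
    then show "\<exists>T. openin (mtop M) T \<and> x \<in> T \<and> T \<subseteq> {x \<in> W. f x \<in> U}"
      by (intro exI[of _ "{x \<in> topspace (subtopology (mtop M) (W \<inter> C)). f x \<in> U}"]) (use x C(2) openin_subset[OF W] in auto)
  qed
  moreover have "topspace (subtopology (mtop M) W) = W" using openin_subset[OF W] by auto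
  ultimately show ?thesis unfolding continuous_map_def using W by (auto simp: openin_open_subtopology)
qed

lemma sf_mean:
  assumes M: "manifold M" and T: "compact_space T" "mean_on T I" and W: "openin (mtop M) W"
    and f: "psf M T (W \<times> topspace T) f"
  shows "sf M W (\<lambda>x. I (\<lambda>t. f (x, t)))"
  unfolding sf_iff
proof (clarify)
  fix C c assume C: "(C, c) \<in> atlas M"
  have "psmooth (mdim M) (c ` (W \<inter> C) \<times> topspace T) T (\<lambda>p. f (inv_into C c (fst p), snd p))"
    using f C pimg_Times[OF chart(3)[OF M C], of W "topspace T"] unfolding psf_def by force
  from smooth_on_mean[OF T open_chart_image[OF M C W] this]
  show "smooth_on (mdim M) (c ` (W \<inter> C)) (\<lambda>y. I (\<lambda>t. f (inv_into C c y, t)))" by simp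
qed

lemma psf_section:
  assumes M: "manifold M" and W: "openin (mtop M) W" and f: "psf M T (W \<times> topspace T) f" and x: "x \<in> W"
  shows "creal T (\<lambda>t. f (x, t))"
proof -
  obtain C c where C: "(C, c) \<in> atlas M" "x \<in> C" using chart_exists[OF M] W x openin_subset by blast
  have "psmooth (mdim M) (c ` (W \<inter> C) \<times> topspace T) T (\<lambda>p. f (inv_into C c (fst p), snd p))"
    using f C(1) pimg_Times[OF chart(3)[OF M C(1)], of W "topspace T"] unfolding psf_def by force
  from continuous_map_section[OF psmooth_continuous[OF this], of "c x"]
  show ?thesis using x C(2) chart(3)[OF M C(1)] openin_subset[OF open_chart_image[OF M C(1) W]] by auto
qed

section \<open>From smoothness on a product to smoothness with a parameter\<close>

lemma cat_Euclid: "x \<in> Euclid m \<Longrightarrow> y \<in> Euclid n \<Longrightarrow> cat m x y \<in> Euclid (m + n)"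
  by (auto simp: cat_def topspace_Euclidean_space)

lemma cat_fst: "x \<in> Euclid m \<Longrightarrow> trunc m (cat m x y) = x"
  by (auto simp: cat_def trunc_def topspace_Euclidean_space fun_eq_iff)

lemma cat_snd: "(\<lambda>i. cat m x y (m + i)) = y"
  by (simp add: cat_def)

lemma cat_inject: "x \<in> Euclid m \<Longrightarrow> x' \<in> Euclid m \<Longrightarrow> cat m x y = cat m x' y' \<longleftrightarrow> x = x' \<and> y = y'"
  by (metis cat_fst cat_snd)

lemma trunc_cat:
  assumes "x \<in> Euclid m" "y \<in> Euclid n"
  shows "trunc (m + n) (\<lambda>j. if j < m then x j else y (j - m)) = cat m x y"
  using trunc_eq[OF cat_Euclid[OF assms]] by (simp add: cat_def)

text \<open>The chart coordinates of a parameter manifold are continuous only on the chart domain.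
  This allows shrinking the parameter space to that domain and returning afterwards.\<close>

lemma PCk_subtopology: "Y \<subseteq> UNIV \<times> D \<Longrightarrow> PCk k n Y (subtopology T D) f \<longleftrightarrow> PCk k n Y T f"
proof (induction k arbitrary: f)
  have "subtopology (prodE n (subtopology T D)) Y = subtopology (prodE n T) Y" if "Y \<subseteq> UNIV \<times> D"
  proof -
    have "prodE n (subtopology T D) = subtopology (prodE n T) (UNIV \<times> D)"
      by (simp add: subtopology_Times)
    moreover have "UNIV \<times> D \<inter> Y = Y" using that by blast
    ultimately show ?thesis by (simp add: subtopology_subtopology)
  qed
  note e = this
  {
    case 0
    then show ?case using e by simp
  next
    case (Suc k)
    then show ?case using e by simp
  }
qed

lemma psmooth_subtopology: "Y \<subseteq> UNIV \<times> D \<Longrightarrow> psmooth n Y (subtopology T D) f \<longleftrightarrow> psmooth n Y T f"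
  by (simp add: psmooth_def PCk_subtopology)

text \<open>The differentiability in \<open>N\<close> is forgotten: in a product chart the
  coordinates of \<open>N\<close> enter as continuous functions of the parameter. Smoothness of a
  Lie group action is used in this weaker form, as averaging differentiates only in the
  point.\<close>

lemma psf_of_product:
  assumes M: "manifold M" and N: "manifold N" and Y: "openin (prod_topology (mtop M) (mtop N)) Y"
    and f: "sf (mfd_prod M N) Y f"
  shows "psf M (mtop N) Y f"
  unfolding psf_def
proof (clarify)
  fix C c assume C: "(C, c) \<in> atlas M"
  let ?m = "mdim M" and ?n = "mdim N"
  note cC = chart[OF M C]
  show "psmooth ?m (pimg C c Y) (mtop N) (\<lambda>p. f (inv_into C c (fst p), snd p))"
  proof (rule psmooth_local[OF open_pimg[OF M C Y]])
    fix p assume p: "p \<in> pimg C c Y"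
    then have "snd p \<in> pts N" using openin_subset[OF Y] by auto
    then obtain D d where D: "(D, d) \<in> atlas N" "snd p \<in> D" using chart_exists[OF N] by blast
    note cD = chart[OF N D(1)]
    let ?\<kappa> = "\<lambda>(x, y). cat ?m (c x) (d y)" and ?Y = "pimg C c Y \<inter> (Euclid ?m \<times> D)"
    define V where "V = ?\<kappa> ` (Y \<inter> C \<times> D)"
    have inj: "inj_on ?\<kappa> (C \<times> D)"
      using cC(3) cD(3) chart_Euclid[OF M C] by (auto simp: inj_on_def cat_inject)
    have at: "(C \<times> D, ?\<kappa>) \<in> atlas (mfd_prod M N)" using C D(1) by (auto simp: mfd_prod_def)
    have dim: "mdim (mfd_prod M N) = ?m + ?n" by (simp add: mfd_prod_def)
    have sV: "smooth_on (?m + ?n) V (\<lambda>z. f (inv_into (C \<times> D) ?\<kappa> z))"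
      using f at unfolding sf_iff dim V_def by blast
    \<comment> \<open>\<open>V\<close> is a preimage of \<open>Y\<close> under the splitting of the
      coordinates into the blocks of \<open>M\<close> and \<open>N\<close>, followed by the inverse
      charts.\<close>
    have oV: "openE (?m + ?n) V"
    proof -
      let ?E = "Euclidean_space (?m + ?n)"
      have 1: "continuous_map ?E (prod_topology (Euclidean_space ?m) (Euclidean_space ?n)) (\<lambda>z. (trunc ?m z, \<lambda>i. z (?m + i)))"
        unfolding continuous_map_pairwise o_def fst_conv snd_conv continuous_map_Euclidean_space_iff
        by (auto simp: trunc_def topspace_Euclidean_space intro: continuous_map_Euclidean_coord)
      have oC: "openin (prod_topology (Euclidean_space ?m) (Euclidean_space ?n)) (c ` C \<times> d ` D)"
        using cC(2) cD(2) by (simp add: openin_prod_Times_iff)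
      have 2: "continuous_map (subtopology (prod_topology (Euclidean_space ?m) (Euclidean_space ?n)) (c ` C \<times> d ` D))
          (prod_topology (mtop M) (mtop N)) (\<lambda>p. (inv_into C c (fst p), inv_into D d (snd p)))"
        unfolding continuous_map_pairwise o_def fst_conv snd_conv subtopology_Times
        using continuous_map_compose[OF continuous_map_fst cC(5)] continuous_map_compose[OF continuous_map_snd cD(5)]
        by (auto simp: o_def)
      let ?Q = "{q \<in> c ` C \<times> d ` D. (inv_into C c (fst q), inv_into D d (snd q)) \<in> Y}"
      have "openin (prod_topology (Euclidean_space ?m) (Euclidean_space ?n)) ?Q"
      proof -
        have t: "topspace (subtopology (prod_topology (Euclidean_space ?m) (Euclidean_space ?n)) (c ` C \<times> d ` D)) = c ` C \<times> d ` D"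
          using openin_subset[OF oC] by auto
        show ?thesis using openin_continuous_map_preimage[OF 2 Y] oC openin_open_subtopology unfolding t by blast
      qed
      from openin_continuous_map_preimage[OF 1 this]
      have "openin ?E {z \<in> topspace ?E. (trunc ?m z, \<lambda>i. z (?m + i)) \<in> ?Q}" .
      moreover have "{z \<in> topspace ?E. (trunc ?m z, \<lambda>i. z (?m + i)) \<in> ?Q} = V"
      proof (intro equalityI subsetI)
        fix z assume z: "z \<in> {z \<in> topspace ?E. (trunc ?m z, \<lambda>i. z (?m + i)) \<in> ?Q}"
        then obtain x y where xy: "x \<in> C" "y \<in> D" "trunc ?m z = c x" "(\<lambda>i. z (?m + i)) = d y" by auto
        then have "(x, y) \<in> Y" using z cC(3) cD(3) by auto
        moreover have "z = cat ?m (c x) (d y)"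
        proof
          fix i show "z i = cat ?m (c x) (d y) i"
            using fun_cong[OF xy(3), of i] fun_cong[OF xy(4), of "i - ?m"] by (auto simp: cat_def trunc_def split: if_splits)
        qed
        ultimately show "z \<in> V" using xy unfolding V_def by (auto intro!: rev_image_eqI[of "(x, y)"])
      next
        fix z assume "z \<in> V"
        then obtain x y where xy: "x \<in> C" "y \<in> D" "(x, y) \<in> Y" "z = cat ?m (c x) (d y)" unfolding V_def by auto
        have E: "c x \<in> Euclid ?m" "d y \<in> Euclid ?n" using chart_Euclid[OF M C xy(1)] chart_Euclid[OF N D(1) xy(2)] by auto
        show "z \<in> {z \<in> topspace ?E. (trunc ?m z, \<lambda>i. z (?m + i)) \<in> ?Q}"
          using cat_Euclid[OF E] xy cC(3) cD(3) by (auto simp: cat_fst[OF E(1)] cat_snd)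
      qed
      ultimately show ?thesis by simp
    qed
    have sub: "?Y \<subseteq> UNIV \<times> D" by auto
    have o: "openin (prodE ?m (mtop N)) ?Y"
      by (intro openin_Int open_pimg[OF M C Y]) (use cD(1) in \<open>simp add: openin_prod_Times_iff\<close>)
    have eq: "trunc (?m + ?n) (\<lambda>j. if j < ?m then fst q j else d (snd q) (j - ?m)) = cat ?m (fst q) (d (snd q))"
      if "q \<in> ?Y" for q using that chart_Euclid[OF N D(1)] by (intro trunc_cat) auto
    have inV: "cat ?m (fst q) (d (snd q)) \<in> V \<and> inv_into (C \<times> D) ?\<kappa> (cat ?m (fst q) (d (snd q))) = (inv_into C c (fst q), snd q)"
      if q: "q \<in> ?Y" for q
    proof -
      obtain x where x: "x \<in> C" "fst q = c x" using q by auto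
      have xO: "(x, snd q) \<in> Y" and yD: "snd q \<in> D" using q x cC(3) by auto
      have e: "cat ?m (fst q) (d (snd q)) = ?\<kappa> (x, snd q)" by (simp add: x(2))
      have "inv_into (C \<times> D) ?\<kappa> (?\<kappa> (x, snd q)) = (x, snd q)" by (rule inv_into_f_f[OF inj]) (use x yD in auto)
      then show ?thesis unfolding e V_def using xO x yD cC(3) by auto
    qed
    have o': "openin (prodE ?m (subtopology (mtop N) D)) ?Y"
    proof -
      have "prodE ?m (subtopology (mtop N) D) = subtopology (prodE ?m (mtop N)) (UNIV \<times> D)"
        by (simp add: subtopology_Times)
      then show ?thesis using o sub by (auto simp: openin_subtopology)
    qed
    have "psmooth ?m ?Y (subtopology (mtop N) D)
       (\<lambda>q. f (inv_into (C \<times> D) ?\<kappa> (trunc (?m + ?n) (\<lambda>j. if j < ?m then fst q j else d (snd q) (j - ?m)))))"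
    proof (rule psmooth_of_smooth_on[OF oV sV o'])
      fix j assume "j < ?m + ?n"
      have "creal (subtopology (mtop N) D) (\<lambda>t. d t (j - ?m))"
        using cD(4) by (simp add: continuous_map_Euclidean_space_iff)
      from psmooth_param[OF this]
      show "psmooth ?m ?Y (subtopology (mtop N) D) (\<lambda>q. if j < ?m then fst q j else d (snd q) (j - ?m))"
        by (cases "j < ?m") (auto intro: psmooth_coord)
    next
      fix x t assume "(x, t) \<in> ?Y"
      from eq[OF this] inV[OF this]
      show "trunc (?m + ?n) (\<lambda>j. if j < ?m then fst (x, t) j else d (snd (x, t)) (j - ?m)) \<in> V" by simp
    qed
    then have "psmooth ?m ?Y (mtop N)
       (\<lambda>q. f (inv_into (C \<times> D) ?\<kappa> (trunc (?m + ?n) (\<lambda>j. if j < ?m then fst q j else d (snd q) (j - ?m)))))"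
      using psmooth_subtopology[OF sub] by blast
    then have s: "psmooth ?m ?Y (mtop N) (\<lambda>p. f (inv_into C c (fst p), snd p))"
      by (rule psmooth_cong[OF o, rotated]) (use eq inV in simp)
    have "openin (prodE ?m (mtop N)) (Euclid ?m \<times> D)" using cD(1) by (simp add: openin_prod_Times_iff)
    moreover have "p \<in> Euclid ?m \<times> D" using p D(2) openin_subset[OF cC(2)] by (auto simp: mem_Times_iff)
    ultimately show "\<exists>Y'. openin (prodE ?m (mtop N)) Y' \<and> p \<in> Y' \<and>
        psmooth ?m (pimg C c Y \<inter> Y') (mtop N) (\<lambda>p. f (inv_into C c (fst p), snd p))"
      using s by blast
  qed
qed

subsection \<open>Bump functions\<close>

text \<open>For \<open>m = 0\<close> the classical function \<open>exp (- (1 / t))\<close> extended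
  by zero. The powers are included so that derivatives are again combinations of members of the
  family.\<close>

definition flat :: "nat \<Rightarrow> real \<Rightarrow> real" where
  "flat m t = (if t > 0 then (1 / t) ^ m * exp (- (1 / t)) else 0)"

lemma flat_lim: "(flat m \<longlongrightarrow> 0) (at 0)"
proof -
  have "filterlim (\<lambda>t::real. 1 / t) at_top (at_right 0)"
    using filterlim_inverse_at_top_right by (simp add: inverse_eq_divide)
  from filterlim_compose[OF tendsto_power_div_exp_0 this, of m]
  have "((\<lambda>t. (1 / t) ^ m / exp (1 / t)) \<longlongrightarrow> (0::real)) (at_right 0)" .
  then have r: "(flat m \<longlongrightarrow> 0) (at_right 0)"
  proof (rule Lim_transform_eventually)
    show "eventually (\<lambda>t. (1 / t) ^ m / exp (1 / t) = flat m t) (at_right 0)"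
      unfolding eventually_at_right_field by (intro exI[of _ 1]) (auto simp: flat_def exp_minus divide_inverse)
  qed
  have "((\<lambda>t. 0) \<longlongrightarrow> (0::real)) (at_left 0)" by simp
  then have "(flat m \<longlongrightarrow> 0) (at_left 0)"
  proof (rule Lim_transform_eventually)
    show "eventually (\<lambda>t. 0 = flat m t) (at_left 0)"
      unfolding eventually_at_left_field by (intro exI[of _ "-1"]) (auto simp: flat_def)
  qed
  with r show ?thesis by (simp add: filterlim_split_at)
qed

lemma flat_deriv: "(flat m has_real_derivative (flat (m + 2) t - m * flat (m + 1) t)) (at t)"
proof (cases "t = 0")
  case True
  \<comment> \<open>At 0 the difference quotient is itself a member of the family, with exponent
    \<open>Suc m\<close>, so \<open>flat_lim\<close> gives the derivative.\<close>
  have "((\<lambda>s. flat m s / s) \<longlongrightarrow> 0) (at 0)"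
  proof (rule Lim_transform_eventually[OF flat_lim[of "Suc m"]])
    show "eventually (\<lambda>s. flat (Suc m) s = flat m s / s) (at 0)"
      by (auto simp: eventually_at_filter flat_def)
  qed
  then show ?thesis unfolding has_field_derivative_iff using True by (simp add: flat_def)
next
  case False
  show ?thesis
  proof (cases "t > 0")
    case True
    have "((\<lambda>t. (1 / t) ^ m * exp (- (1 / t))) has_real_derivative (flat (m + 2) t - m * flat (m + 1) t)) (at t)"
    proof -
      have d: "((\<lambda>t. 1 / t) has_real_derivative - ((1 / t) * (1 / t))) (at t)"
        using DERIV_inverse[of t] True by (simp add: inverse_eq_divide)
      have "(\<Sum>j<1::nat. (of_nat m * (- ((1 / t) * (1 / t)) * (1 / t) ^ (m - Suc 0))) * exp (- (1 / t)) +
         exp (- (1 / t)) * - (- ((1 / t) * (1 / t))) * (1 / t) ^ m) = flat (m + 2) t - m * flat (m + 1) t"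
        using True by (cases m) (simp_all add: flat_def algebra_simps)
      then show ?thesis using DERIV_mult[OF DERIV_power[OF d, of m] DERIV_fun_exp[OF DERIV_minus[OF d]]] by simp
    qed
    then show ?thesis
    proof (rule DERIV_cong_ev[THEN iffD1, rotated -1])
      show "eventually (\<lambda>t. (1 / t) ^ m * exp (- (1 / t)) = flat m t) (nhds t)"
        using eventually_nhds_in_open[of "{0<..}" t] True by (auto elim!: eventually_mono simp: flat_def)
    qed auto
  next
    case F: False
    have "((\<lambda>t. 0) has_real_derivative (flat (m + 2) t - m * flat (m + 1) t)) (at t)"
      using F by (simp add: flat_def)
    then show ?thesis
    proof (rule DERIV_cong_ev[THEN iffD1, rotated -1])
      show "eventually (\<lambda>t. 0 = flat m t) (nhds t)"
        using eventually_nhds_in_open[of "{..<0}" t] F False by (auto elim!: eventually_mono simp: flat_def)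
    qed auto
  qed
qed

text \<open>Induction on the order for all exponents \<open>m\<close> at once, because
  differentiation raises the exponent.\<close>

lemma smooth_on_flat:
  assumes q: "smooth_on n W q"
  shows "smooth_on n W (\<lambda>x. flat m (q x))"
proof -
  have "Ck k n W (\<lambda>x. flat m (q x))" for k
  proof (induction k arbitrary: m)
    case (0 m)
    have "continuous_on UNIV (flat m)" using flat_deriv DERIV_isCont by (blast intro: continuous_at_imp_continuous_on)
    then have "creal euclideanreal (flat m)" by simp
    from continuous_map_compose[OF smooth_on_continuous[OF q] this] show ?case by (simp add: o_def)
  next
    case (Suc k)
    have "Ck (Suc k) n W q" using q by (simp only: smooth_on_def)
    then obtain q' where q': "\<And>i x. i < n \<Longrightarrow> x \<in> W \<Longrightarrow> ((\<lambda>t. q (x(i := t))) has_real_derivative q' i x) (at (x i))"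
      "\<And>i. i < n \<Longrightarrow> Ck k n W (q' i)" by auto
    have "((\<lambda>t. flat m (q (x(i := t)))) has_real_derivative (flat (m + 2) (q x) - m * flat (m + 1) (q x)) * q' i x) (at (x i))"
      if "i < n" "x \<in> W" for i x
      using DERIV_chain2[OF _ q'(1)[OF that], of "flat m"] flat_deriv[of m "q x"] by simp
    moreover have "Ck k n W (\<lambda>x. (flat (m + 2) (q x) - m * flat (m + 1) (q x)) * q' i x)" if "i < n" for i
      by (intro Ck_arith Suc.IH q' that)
    moreover have "contE n W (\<lambda>x. flat m (q x))"
      using Ck_continuous[OF Suc.IH] .
    ultimately show ?case
      by (auto intro!: exI[of _ "\<lambda>i x. (flat (m + 2) (q x) - m * flat (m + 1) (q x)) * q' i x"])
  qed
  then show ?thesis by (simp add: smooth_on_def)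
qed

lemma compactin_box: 
  assumes "a \<in> Euclid n" shows "compactin (Euclidean_space n) {y \<in> Euclid n. \<forall>i<n. \<bar>y i - a i\<bar> \<le> r}"
proof -
  let ?B = "{y \<in> Euclid n. \<forall>i<n. \<bar>y i - a i\<bar> \<le> r}"
  have "?B = PiE UNIV (\<lambda>i. if i < n then {a i - r..a i + r} else {0})"
  proof (intro Set.set_eqI)
    fix y
    have "\<bar>y i - a i\<bar> \<le> r \<longleftrightarrow> y i \<in> {a i - r..a i + r}" for i by auto
    then show "y \<in> ?B \<longleftrightarrow> y \<in> PiE UNIV (\<lambda>i. if i < n then {a i - r..a i + r} else {0})"
      unfolding topspace_Euclidean_space PiE_UNIV_domain Pi_iff by (force simp: not_less)
  qed
  moreover have "compactin (product_topology (\<lambda>i. euclideanreal) UNIV) (PiE UNIV (\<lambda>i. if i < n then {a i - r..a i + r} else {0}))"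
    unfolding compactin_PiE by auto
  moreover have "?B \<subseteq> {x. \<forall>i\<ge>n. x i = 0}" by (auto simp: topspace_Euclidean_space)
  ultimately show ?thesis unfolding Euclidean_space_def compactin_subtopology by simp
qed

text \<open>A product of one-dimensional bumps is positive on an open box in a chart. A compact set
  \<open>Z\<close> outside of which the function vanishes is recorded too: being closed in a
  Hausdorff space, it permits extensions by zero, and compactness makes it closed in any larger
  manifold domain as well.\<close>

lemma bump_exists:
  assumes M: "manifold M" and A: "openin (mtop M) A" "x \<in> A"
  shows "\<exists>\<kappa> Z. sf M (pts M) \<kappa> \<and> (\<forall>y. 0 \<le> \<kappa> y) \<and> 0 < \<kappa> x \<and> compactin (mtop M) Z \<and> Z \<subseteq> A \<and>
     (\<forall>y\<in>pts M - Z. \<kappa> y = 0)"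
proof -
  let ?n = "mdim M"
  obtain C c where C: "(C, c) \<in> atlas M" "x \<in> C" using chart_exists[OF M] A openin_subset by blast
  note ch = chart[OF M C(1)]
  have "c x \<in> c ` (A \<inter> C)" using A(2) C(2) by blast
  from openin_Euclidean_space_boxD[OF open_chart_image[OF M C(1) A(1)] this] obtain d where d: "d > 0"
    "\<forall>y\<in>Euclid ?n. (\<forall>l<?n. \<bar>y l - c x l\<bar> < d) \<longrightarrow> y \<in> c ` (A \<inter> C)" by blast
  \<comment> \<open>Any radius strictly below \<open>d\<close> keeps the closed box inside the chart
    image of \<open>A\<close>.\<close>
  define r where "r = d / 2"
  have r: "0 < r" "r < d" using d(1) by (auto simp: r_def)
  define B where "B = {y \<in> Euclid ?n. \<forall>i<?n. \<bar>y i - c x i\<bar> \<le> r}"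
  have BA: "B \<subseteq> c ` (A \<inter> C)" unfolding B_def using d(2) r(2) by force
  have xE: "c x \<in> Euclid ?n" by (rule chart_Euclid[OF M C])
  define b where "b y = (\<Prod>i<?n. flat 0 (r * r - (y i - c x i) * (y i - c x i)))" for y :: "nat \<Rightarrow> real"
  have fnn: "0 \<le> flat 0 t" for t by (simp add: flat_def)
  have b0: "b y = 0" if "y \<in> Euclid ?n" "y \<notin> B" for y
  proof -
    from that obtain i where i: "i < ?n" "\<bar>y i - c x i\<bar> > r" by (auto simp: B_def not_le)
    then have "r * r < \<bar>y i - c x i\<bar> * \<bar>y i - c x i\<bar>" using r(1) by (intro mult_strict_mono) auto
    then have "flat 0 (r * r - (y i - c x i) * (y i - c x i)) = 0" by (simp add: flat_def)
    then show ?thesis unfolding b_def using i by (intro prod_zero) auto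
  qed
  define Z where "Z = inv_into C c ` B"
  define \<kappa> where "\<kappa> y = (if y \<in> C then b (c y) else 0)" for y
  have "compactin (subtopology (Euclidean_space ?n) (c ` C)) B"
    using compactin_box[OF xE] BA by (simp add: compactin_subtopology B_def) blast
  from image_compactin[OF this ch(5)] have Zc: "compactin (mtop M) Z" by (simp add: Z_def)
  have ZA: "Z \<subseteq> A \<inter> C" using BA ch(3) by (auto simp: Z_def)
  have \<kappa>0: "\<kappa> y = 0" if "y \<in> pts M" "y \<notin> Z" for y
  proof (cases "y \<in> C")
    case True
    then have "c y \<notin> B" using that(2) ch(3) by (force simp: Z_def image_iff)
    then show ?thesis using True b0 chart_Euclid[OF M C(1) True] by (simp add: \<kappa>_def)
  qed (simp add: \<kappa>_def)
  have oZ: "openin (mtop M) (pts M - Z)"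
    using M compactin_imp_closedin[OF _ Zc] by (auto simp: manifold_def)
  have sb: "smooth_on ?n (c ` C) b"
    unfolding b_def by (intro smooth_on_prod smooth_on_flat smooth_on_diff smooth_on_mult smooth_on_const smooth_on_coord) auto
  have s1: "sf M C \<kappa>"
  proof (rule sf_chart[OF M C(1) ch(1)])
    show "smooth_on ?n (c ` C) (\<lambda>y. \<kappa> (inv_into C c y))"
      by (rule smooth_on_cong[OF ch(2) _ sb]) (use ch(3) in \<open>auto simp: \<kappa>_def\<close>)
  qed simp
  have s2: "sf M (pts M - Z) \<kappa>"
    by (rule sf_cong[OF M oZ _ sf_const[of _ _ 0]]) (simp add: \<kappa>0)
  \<comment> \<open>Two open sets cover the manifold: on \<open>C\<close> the function is
    \<open>b\<close> in the chart, on the complement of \<open>Z\<close> it is zero.\<close>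
  have "C \<union> (pts M - Z) = pts M" using ZA openin_subset[OF ch(1)] by blast
  then have "sf M (pts M) \<kappa>" using sf_Un[OF M ch(1) oZ s1 s2] by simp
  moreover have "0 < \<kappa> x"
  proof -
    have "flat 0 (r * r) > 0" using r(1) by (simp add: flat_def)
    then show ?thesis using C(2) by (simp add: \<kappa>_def b_def)
  qed
  moreover have "\<forall>y. 0 \<le> \<kappa> y" by (auto simp: \<kappa>_def b_def intro!: prod_nonneg fnn)
  ultimately show ?thesis using Zc ZA \<kappa>0 by blast
qed

section \<open>Profinite dimensional vector spaces\<close>

abbreviation lim_points :: "prosys \<Rightarrow> (nat \<Rightarrow> nat \<Rightarrow> real) set" where
  "lim_points P \<equiv> topspace (prolimit P)"

lemma lim_points_iff: "v \<in> lim_points P \<longleftrightarrow> (\<forall>k. v k \<in> Euclid (fdim P k) \<and> fmap P k (v (Suc k)) = v k)"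
  by (auto simp: prolimit_def PiE_UNIV_domain)

lemma fmap_linear:
  "projective_system P \<Longrightarrow> x \<in> Euclid (fdim P (Suc k)) \<Longrightarrow> y \<in> Euclid (fdim P (Suc k)) \<Longrightarrow>
    fmap P k (\<lambda>i. a * x i + b * y i) = (\<lambda>i. a * fmap P k x i + b * fmap P k y i)"
  unfolding projective_system_def by blast

lemma Euclid_linear: "x \<in> Euclid n \<Longrightarrow> y \<in> Euclid n \<Longrightarrow> (\<lambda>i. a * x i + b * y i) \<in> Euclid n"
  by (simp add: topspace_Euclidean_space)

lemma Euclid_zero: "(\<lambda>i. 0) \<in> Euclid n"
  by (simp add: topspace_Euclidean_space)

lemma lim_points_linear:
  "projective_system P \<Longrightarrow> v \<in> lim_points P \<Longrightarrow> w \<in> lim_points P \<Longrightarrow> (\<lambda>k i. a * v k i + b * w k i) \<in> lim_points P"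
  by (simp add: lim_points_iff Euclid_linear fmap_linear)

lemma lim_points_stage:
  assumes "v \<in> lim_points P" "w \<in> lim_points P" "v L = w L" "k \<le> L"
  shows "v k = w k"
  using assms(4)
proof (induction k rule: inc_induct)
  case base
  show ?case by (rule assms(3))
next
  case (step k)
  then show ?case using assms(1,2) by (metis lim_points_iff)
qed

text \<open>Above stage \<open>k\<close> preimages are chosen one after the other along the
  surjections; below it the maps of the system are applied to \<open>q\<close>.\<close>

lemma lim_points_surj:
  assumes P: "projective_system P" and q: "q \<in> Euclid (fdim P k)"
  shows "\<exists>v\<in>lim_points P. v k = q"
proof -
  have im: "fmap P l ` Euclid (fdim P (Suc l)) = Euclid (fdim P l)" for l
    using P by (simp add: projective_system_def)
  have surj: "\<exists>y. y \<in> Euclid (fdim P (Suc l)) \<and> fmap P l y = x" if "x \<in> Euclid (fdim P l)" for x l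
  proof -
    have "x \<in> fmap P l ` Euclid (fdim P (Suc l))" using im that by simp
    then show ?thesis by auto
  qed
  have into: "fmap P l y \<in> Euclid (fdim P l)" if "y \<in> Euclid (fdim P (Suc l))" for y l
    using im[of l] that by auto
  define up where "up = rec_nat q (\<lambda>j x. SOME y. y \<in> Euclid (fdim P (Suc (k + j))) \<and> fmap P (k + j) y = x)"
  have up: "up 0 = q" "\<And>j. up (Suc j) = (SOME y. y \<in> Euclid (fdim P (Suc (k + j))) \<and> fmap P (k + j) y = up j)"
    by (simp_all add: up_def)
  have upE: "up j \<in> Euclid (fdim P (k + j))" for j
  proof (induction j)
    case (Suc j)
    show ?case using someI_ex[OF surj[OF Suc]] up(2)[of j] by simp
  qed (use q up in simp)
  have upS: "fmap P (k + j) (up (Suc j)) = up j" for j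
    using someI_ex[OF surj[OF upE[of j]]] up(2)[of j] by simp
  define down where "down = rec_nat q (\<lambda>j x. fmap P (k - Suc j) x)"
  have down: "down 0 = q" "\<And>j. down (Suc j) = fmap P (k - Suc j) (down j)" by (simp_all add: down_def)
  have downE: "j \<le> k \<Longrightarrow> down j \<in> Euclid (fdim P (k - j))" for j
  proof (induction j)
    case (Suc j)
    then have "k - j = Suc (k - Suc j)" by simp
    then show ?case using Suc into[of "down j" "k - Suc j"] down(2)[of j] by simp
  qed (use q down in simp)
  define v where "v l = (if l < k then down (k - l) else up (l - k))" for l
  have "v \<in> lim_points P"
    unfolding lim_points_iff
  proof (intro allI conjI)
    fix l
    show "v l \<in> Euclid (fdim P l)" using downE[of "k - l"] upE[of "l - k"] by (cases "l < k") (auto simp: v_def)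
    show "fmap P l (v (Suc l)) = v l"
    proof (cases "l < k")
      case True
      then have "v (Suc l) = down (k - Suc l)"
        using up(1) down(1) by (cases "Suc l < k") (auto simp: v_def)
      moreover have "v l = down (Suc (k - Suc l))" using True by (simp add: v_def Suc_diff_Suc)
      moreover have "k - Suc (k - Suc l) = l" using True by simp
      ultimately show ?thesis using down(2)[of "k - Suc l"] by simp
    next
      case False
      then show ?thesis using upS[of "l - k"] by (simp add: v_def Suc_diff_le)
    qed
  qed
  moreover have "v k = q" by (simp add: v_def up)
  ultimately show ?thesis by blast
qed

text \<open>A profinite fiber has no basis adapted to all stages. Lifts of the unit vectors of stage
  \<open>k\<close> span it modulo the vectors that vanish at stage \<open>k\<close>, which is all
  that functionals of that stage can see. The choice of lifts is arbitrary.\<close>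

definition frame :: "prosys \<Rightarrow> nat \<Rightarrow> nat \<Rightarrow> nat \<Rightarrow> nat \<Rightarrow> real" where
  "frame P k j = (SOME v. v \<in> lim_points P \<and> v k = unit_vec j)"

lemma frame:
  assumes "projective_system P" "j < fdim P k" shows "frame P k j \<in> lim_points P" "frame P k j k = unit_vec j"
proof -
  have "\<exists>v. v \<in> lim_points P \<and> v k = unit_vec j" using lim_points_surj[OF assms(1) unit_vec_Euclid[OF assms(2)]] by blast
  from someI_ex[OF this] show "frame P k j \<in> lim_points P" "frame P k j k = unit_vec j" by (auto simp: frame_def)
qed

section \<open>Vector bundles\<close>

lemma vb_manifold: "vector_bundle F \<Longrightarrow> manifold (vbase F)"
  by (simp add: vector_bundle_def)

lemma vproj_continuous: "vector_bundle F \<Longrightarrow> continuous_map (vtop F) (mtop (vbase F)) (vproj F)"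
  by (simp add: vector_bundle_def)

lemma vproj_base: "vector_bundle F \<Longrightarrow> v \<in> total F \<Longrightarrow> vproj F v \<in> pts (vbase F)"
  using vproj_continuous continuous_map_image_subset_topspace by blast

lemma triv_exists:
  assumes "vector_bundle F" "x \<in> pts (vbase F)"
  shows "\<exists>D P \<tau>. (D, P, \<tau>) \<in> vtriv F \<and> x \<in> D"
proof -
  have "x \<in> (\<Union>(D, P, \<tau>)\<in>vtriv F. D)" using assms by (simp add: vector_bundle_def)
  then show ?thesis by auto
qed

lemma stop_simps [simp]: "stop (mfd_space M) = mtop M" "stop (vb_space F) = vtop F"
  by (simp_all add: mfd_space_def vb_space_def)

lemma smooth_mapD:
  "smooth_map S T \<phi> \<Longrightarrow> openin (stop T) W \<Longrightarrow> sfun T W f \<Longrightarrow> sfun S {x \<in> points S. \<phi> x \<in> W} (f \<circ> \<phi>)"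
  by (simp add: smooth_map_def)

lemma smooth_map_continuous: "smooth_map S T \<phi> \<Longrightarrow> continuous_map (stop S) (stop T) \<phi>"
  by (simp add: smooth_map_def)

lemma continuous_map_locally:
  assumes "\<And>x. x \<in> topspace X \<Longrightarrow> \<exists>B. openin X B \<and> x \<in> B \<and> continuous_map (subtopology X B) Y f"
  shows "continuous_map X Y f"
  unfolding continuous_map_def
proof (intro conjI allI impI funcsetI)
  fix x assume x: "x \<in> topspace X"
  from assms[OF x] obtain B where B: "openin X B" "x \<in> B" "continuous_map (subtopology X B) Y f" by blast
  then show "f x \<in> topspace Y" using continuous_map_image_subset_topspace[OF B(3)] x by auto
next
  fix U assume U: "openin Y U"
  show "openin X {x \<in> topspace X. f x \<in> U}"
  proof (subst openin_subopen, clarify)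
    fix x assume x: "x \<in> topspace X" "f x \<in> U"
    from assms[OF x(1)] obtain B where B: "openin X B" "x \<in> B" "continuous_map (subtopology X B) Y f" by blast
    have "openin X {x \<in> topspace (subtopology X B). f x \<in> U}"
      using openin_continuous_map_preimage[OF B(3) U] B(1) openin_open_subtopology by blast
    then show "\<exists>V. openin X V \<and> x \<in> V \<and> V \<subseteq> {x \<in> topspace X. f x \<in> U}"
      by (intro exI[of _ "{x \<in> topspace (subtopology X B). f x \<in> U}"]) (use x B(2) in auto)
  qed
qed

lemma sfun_vb: "sfun (vb_space F) W f \<longleftrightarrow> (\<forall>(D, P, \<tau>)\<in>vtriv F. triv_smooth F (D, P, \<tau>) W f)"
  by (auto simp: vb_space_def)

lemma triv_smoothD:
  assumes "triv_smooth F (D, P, \<tau>) W f" "w \<in> W" "vproj F w \<in> D"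
  shows "\<exists>A C c k O' g. openin (mtop (vbase F)) A \<and> vproj F w \<in> A \<and> A \<subseteq> D \<and> A \<subseteq> C \<and> (C, c) \<in> atlas (vbase F) \<and>
        openE (mdim (vbase F) + fdim P k) O' \<and>
        smooth_on (mdim (vbase F) + fdim P k) O' g \<and>
        (\<forall>e \<in> W. vproj F e \<in> A \<longrightarrow>
           cat (mdim (vbase F)) (c (vproj F e)) (\<tau> e k) \<in> O' \<and>
           f e = g (cat (mdim (vbase F)) (c (vproj F e)) (\<tau> e k)))"
proof -
  have "vproj F w \<in> vproj F ` W \<inter> D" using assms by blast
  with assms(1)[unfolded triv_smooth_def split_conv] show ?thesis by (rule bspec)
qed

section \<open>Coordinates in a local trivialization\<close>

locale local_triv =
  fixes F :: "('m, 't) vbundle" and D :: "'m set" and P :: prosys and \<tau> :: "'t \<Rightarrow> nat \<Rightarrow> nat \<Rightarrow> real"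
  assumes vb: "vector_bundle F" and tr: "(D, P, \<tau>) \<in> vtriv F"
begin

abbreviation "M \<equiv> vbase F"

lemma mf: "manifold M" by (rule vb_manifold[OF vb])

lemma triv_conds: "openin (mtop M) D \<and> projective_system P \<and>
        homeomorphic_map (subtopology (vtop F) (restr F D))
          (prod_topology (subtopology (mtop M) D) (prolimit P)) (\<lambda>e. (vproj F e, \<tau> e)) \<and>
        (\<forall>x\<in>D. vzero F x \<in> total F \<and> vproj F (vzero F x) = x \<and> \<tau> (vzero F x) = (\<lambda>k i. 0)) \<and>
        (\<forall>v\<in>restr F D. \<forall>w\<in>restr F D. vproj F v = vproj F w \<longrightarrow>
           vadd F v w \<in> total F \<and> vproj F (vadd F v w) = vproj F v \<and>
           \<tau> (vadd F v w) = (\<lambda>k i. \<tau> v k i + \<tau> w k i)) \<and>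
        (\<forall>v\<in>restr F D. \<forall>t. vscale F t v \<in> total F \<and> vproj F (vscale F t v) = vproj F v \<and>
           \<tau> (vscale F t v) = (\<lambda>k i. t * \<tau> v k i))"
proof -
  from vb have "\<forall>(D, P, \<tau>)\<in>vtriv F. openin (mtop (vbase F)) D \<and> projective_system P \<and>
        homeomorphic_map (subtopology (vtop F) (restr F D))
          (prod_topology (subtopology (mtop (vbase F)) D) (prolimit P)) (\<lambda>e. (vproj F e, \<tau> e)) \<and>
        (\<forall>x\<in>D. vzero F x \<in> total F \<and> vproj F (vzero F x) = x \<and> \<tau> (vzero F x) = (\<lambda>k i. 0)) \<and>
        (\<forall>v\<in>restr F D. \<forall>w\<in>restr F D. vproj F v = vproj F w \<longrightarrow>
           vadd F v w \<in> total F \<and> vproj F (vadd F v w) = vproj F v \<and>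
           \<tau> (vadd F v w) = (\<lambda>k i. \<tau> v k i + \<tau> w k i)) \<and>
        (\<forall>v\<in>restr F D. \<forall>t. vscale F t v \<in> total F \<and> vproj F (vscale F t v) = vproj F v \<and>
           \<tau> (vscale F t v) = (\<lambda>k i. t * \<tau> v k i))"
    unfolding vector_bundle_def by (elim conjE)
  from bspec[OF this tr, unfolded split_conv] show ?thesis .
qed

lemma oD: "openin (mtop M) D" and ps: "projective_system P"
  and homeo: "homeomorphic_map (subtopology (vtop F) (restr F D))
          (prod_topology (subtopology (mtop M) D) (prolimit P)) (\<lambda>e. (vproj F e, \<tau> e))"
  using triv_conds by auto

lemma DM: "D \<subseteq> pts M" using openin_subset[OF oD] .

lemma zero: "x \<in> D \<Longrightarrow> vzero F x \<in> restr F D" "x \<in> D \<Longrightarrow> vproj F (vzero F x) = x" "x \<in> D \<Longrightarrow> \<tau> (vzero F x) = (\<lambda>k i. 0)"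
  using triv_conds by auto

lemma add:
  assumes "v \<in> restr F D" "w \<in> restr F D" "vproj F v = vproj F w"
  shows "vadd F v w \<in> restr F D" "vproj F (vadd F v w) = vproj F v" "\<tau> (vadd F v w) = (\<lambda>k i. \<tau> v k i + \<tau> w k i)"
  using triv_conds assms by auto

lemma scale:
  assumes "v \<in> restr F D"
  shows "vscale F t v \<in> restr F D" "vproj F (vscale F t v) = vproj F v" "\<tau> (vscale F t v) = (\<lambda>k i. t * \<tau> v k i)"
  using triv_conds assms by auto

lemma restr_open: "openin (vtop F) (restr F D)"
  using openin_continuous_map_preimage[OF vproj_continuous[OF vb] oD] .

lemma top1: "topspace (subtopology (vtop F) (restr F D)) = restr F D" by auto

lemma top2: "topspace (prod_topology (subtopology (mtop M) D) (prolimit P)) = D \<times> lim_points P"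
  using DM by auto

lemma bij: "bij_betw (\<lambda>e. (vproj F e, \<tau> e)) (restr F D) (D \<times> lim_points P)"
  using homeomorphic_imp_injective_map[OF homeo] homeomorphic_imp_surjective_map[OF homeo]
  unfolding bij_betw_def top1 top2 by simp

lemma tau_lim: "v \<in> restr F D \<Longrightarrow> \<tau> v \<in> lim_points P"
  using bij by (auto simp: bij_betw_def)

lemma tau_Euclid: "v \<in> restr F D \<Longrightarrow> \<tau> v k \<in> Euclid (fdim P k)"
  using tau_lim lim_points_iff by blast

lemma tau_eqI: "v \<in> restr F D \<Longrightarrow> w \<in> restr F D \<Longrightarrow> vproj F v = vproj F w \<Longrightarrow> \<tau> v = \<tau> w \<Longrightarrow> v = w"
  using bij unfolding bij_betw_def inj_on_def by blast

definition fr :: "'m \<Rightarrow> (nat \<Rightarrow> nat \<Rightarrow> real) \<Rightarrow> 't" where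
  "fr x p = inv_into (restr F D) (\<lambda>e. (vproj F e, \<tau> e)) (x, p)"

lemma fr:
  assumes "x \<in> D" "p \<in> lim_points P"
  shows "fr x p \<in> restr F D" "vproj F (fr x p) = x" "\<tau> (fr x p) = p"
proof -
  have i: "(x, p) \<in> (\<lambda>e. (vproj F e, \<tau> e)) ` restr F D" using bij assms unfolding bij_betw_def by simp
  show "fr x p \<in> restr F D" unfolding fr_def by (rule inv_into_into[OF i])
  have "(vproj F (fr x p), \<tau> (fr x p)) = (x, p)" unfolding fr_def by (rule f_inv_into_f[OF i, of])
  then show "vproj F (fr x p) = x" "\<tau> (fr x p) = p" by auto
qed

lemma fr_tau: "v \<in> restr F D \<Longrightarrow> fr (vproj F v) (\<tau> v) = v"
  using fr[of "vproj F v" "\<tau> v"] tau_lim by (intro tau_eqI) auto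

lemma fr_continuous:
  "continuous_map (prod_topology (subtopology (mtop M) D) (prolimit P)) (vtop F) (\<lambda>q. fr (fst q) (snd q))"
proof -
  from homeo obtain h where h: "homeomorphic_maps (subtopology (vtop F) (restr F D))
      (prod_topology (subtopology (mtop M) D) (prolimit P)) (\<lambda>e. (vproj F e, \<tau> e)) h"
    unfolding homeomorphic_map_maps by blast
  have c: "continuous_map (prod_topology (subtopology (mtop M) D) (prolimit P)) (vtop F) h"
    and i: "\<And>e. e \<in> restr F D \<Longrightarrow> h (vproj F e, \<tau> e) = e"
    using h unfolding homeomorphic_maps_def top1 by (auto simp: continuous_map_in_subtopology)
  have "h q = fr (fst q) (snd q)" if q: "q \<in> D \<times> lim_points P" for q
    using fr[of "fst q" "snd q"] i[of "fr (fst q) (snd q)"] q by auto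
  then show ?thesis by (intro continuous_map_eq[OF c]) (simp only: top2)
qed

lemma tau_coord_smooth: "i < fdim P k \<Longrightarrow> sfun (vb_space F) (restr F D) (\<lambda>e. \<tau> e k i)"
  unfolding sfun_vb
proof (clarify)
  fix D' P' \<tau>' assume i: "i < fdim P k" and T': "(D', P', \<tau>') \<in> vtriv F"
  from vb have "\<forall>(D, P, \<tau>)\<in>vtriv F. \<forall>(D', P', \<tau>')\<in>vtriv F. \<forall>k. \<forall>i<fdim P' k.
        triv_smooth F (D, P, \<tau>) (restr F (D \<inter> D')) (\<lambda>e. \<tau>' e k i)"
    unfolding vector_bundle_def by (elim conjE)
  from bspec[OF bspec[OF this T', unfolded split_conv] tr, unfolded split_conv] i
  have "triv_smooth F (D', P', \<tau>') (restr F (D' \<inter> D)) (\<lambda>e. \<tau> e k i)" by blast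
  then have t: "triv_smooth F (D', P', \<tau>') (restr F (D' \<inter> D)) (\<lambda>e. \<tau> e k i)" .
  show "triv_smooth F (D', P', \<tau>') (restr F D) (\<lambda>e. \<tau> e k i)"
    unfolding triv_smooth_def split_conv
  proof
    fix x assume "x \<in> vproj F ` restr F D \<inter> D'"
    then obtain w where w: "w \<in> restr F (D' \<inter> D)" "x = vproj F w" by auto
    have "vproj F w \<in> D'" using w by simp
    from triv_smoothD[OF t w(1) this] obtain A C c K O' g where
      "openin (mtop M) A" "x \<in> A" "A \<subseteq> D'" "A \<subseteq> C" "(C, c) \<in> atlas M"
        "openE (mdim M + fdim P' K) O'" "smooth_on (mdim M + fdim P' K) O' g"
        "\<forall>e \<in> restr F (D' \<inter> D). vproj F e \<in> A \<longrightarrow> cat (mdim M) (c (vproj F e)) (\<tau>' e K) \<in> O' \<and>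
           \<tau> e k i = g (cat (mdim M) (c (vproj F e)) (\<tau>' e K))"
      unfolding w(2)[symmetric] by blast
    then show "\<exists>A C c K O' g. openin (mtop M) A \<and> x \<in> A \<and> A \<subseteq> D' \<and> A \<subseteq> C \<and> (C, c) \<in> atlas M \<and>
        openE (mdim M + fdim P' K) O' \<and> smooth_on (mdim M + fdim P' K) O' g \<and>
        (\<forall>e \<in> restr F D. vproj F e \<in> A \<longrightarrow> cat (mdim M) (c (vproj F e)) (\<tau>' e K) \<in> O' \<and>
           \<tau> e k i = g (cat (mdim M) (c (vproj F e)) (\<tau>' e K)))"
      by (intro exI[of _ A] exI[of _ C] exI[of _ c] exI[of _ K] exI[of _ O'] exI[of _ g]) auto
  qed
qed

text \<open>Locally over the base \<open>f\<close> is a smooth function of the base coordinates and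
  of one finite stage \<open>K\<close>. The stage is not known in advance, so the coordinates of
  \<open>\<sigma>\<close> are required to be smooth at every stage.\<close>

lemma pullback_smooth:
  assumes f: "sfun (vb_space F) W f" and B: "openin (mtop M) B" "B \<subseteq> D"
    and \<sigma>: "\<And>x. x \<in> B \<Longrightarrow> \<sigma> x \<in> W \<and> \<sigma> x \<in> total F \<and> vproj F (\<sigma> x) = x"
    and s: "\<And>k i. i < fdim P k \<Longrightarrow> sf M B (\<lambda>x. \<tau> (\<sigma> x) k i)"
  shows "sf M B (\<lambda>x. f (\<sigma> x))"
proof (rule sf_local[OF mf B(1)])
  fix x assume x: "x \<in> B"
  have t: "triv_smooth F (D, P, \<tau>) W f" using f tr unfolding sfun_vb by blast
  have "\<sigma> x \<in> W" "vproj F (\<sigma> x) \<in> D" using \<sigma>[OF x] x B by auto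
  from triv_smoothD[OF t this] \<sigma>[OF x] obtain A C c K O' g where A: "openin (mtop M) A" "x \<in> A" "A \<subseteq> D" "A \<subseteq> C"
    and C: "(C, c) \<in> atlas M" and g: "openE (mdim M + fdim P K) O'" "smooth_on (mdim M + fdim P K) O' g"
    and e: "\<forall>e \<in> W. vproj F e \<in> A \<longrightarrow> cat (mdim M) (c (vproj F e)) (\<tau> e K) \<in> O' \<and> f e = g (cat (mdim M) (c (vproj F e)) (\<tau> e K))"
    by auto
  let ?\<Theta> = "\<lambda>j x. if j < mdim M then c x j else \<tau> (\<sigma> x) K (j - mdim M)"
  have oBA: "openin (mtop M) (B \<inter> A)" using A B by blast
  have tc: "trunc (mdim M + fdim P K) (\<lambda>j. ?\<Theta> j y) = cat (mdim M) (c y) (\<tau> (\<sigma> y) K)" if y: "y \<in> B \<inter> A" for y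
    using y A(4) \<sigma>[of y] B(2) by (intro trunc_cat chart_Euclid[OF mf C] tau_Euclid) auto
  have "sf M (B \<inter> A) (\<lambda>x. g (trunc (mdim M + fdim P K) (\<lambda>j. ?\<Theta> j x)))"
  proof (rule sf_compose[OF mf g oBA])
    fix j assume j: "j < mdim M + fdim P K"
    show "sf M (B \<inter> A) (\<lambda>x. ?\<Theta> j x)"
    proof (cases "j < mdim M")
      case True
      then show ?thesis using sf_subset[OF sf_coord[OF mf C, of j], of "B \<inter> A"] A(4) by auto
    next
      case False
      then show ?thesis using sf_subset[OF s[of "j - mdim M" K], of "B \<inter> A"] j by auto
    qed
  next
    fix y assume y: "y \<in> B \<inter> A"
    show "trunc (mdim M + fdim P K) (\<lambda>j. ?\<Theta> j y) \<in> O'"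
      unfolding tc[OF y] using e \<sigma>[of y] y by auto
  qed
  then have "sf M (B \<inter> A) (\<lambda>x. f (\<sigma> x))"
  proof (rule sf_cong[OF mf oBA, rotated])
    fix y assume y: "y \<in> B \<inter> A"
    show "g (trunc (mdim M + fdim P K) (\<lambda>j. ?\<Theta> j y)) = f (\<sigma> y)"
      unfolding tc[OF y] using e \<sigma>[of y] y by auto
  qed
  then show "\<exists>W'. openin (mtop M) W' \<and> x \<in> W' \<and> sf M (B \<inter> W') (\<lambda>x. f (\<sigma> x))" using A by blast
qed

lemma section_coord_smooth:
  assumes s: "smooth_map (mfd_space M) (vb_space F) \<sigma>" and \<sigma>: "\<And>x. x \<in> pts M \<Longrightarrow> \<sigma> x \<in> total F \<and> vproj F (\<sigma> x) = x"
    and i: "i < fdim P k"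
  shows "sf M D (\<lambda>x. \<tau> (\<sigma> x) k i)"
proof -
  have "sf M {x \<in> pts M. \<sigma> x \<in> restr F D} ((\<lambda>e. \<tau> e k i) \<circ> \<sigma>)"
    using smooth_mapD[OF s _ tau_coord_smooth[OF i]] restr_open by simp
  moreover have "{x \<in> pts M. \<sigma> x \<in> restr F D} = D" using \<sigma> DM by auto
  ultimately show ?thesis by (simp add: o_def)
qed

lemma section_continuous:
  assumes B: "openin (mtop M) B" "B \<subseteq> D"
    and \<sigma>: "\<And>x. x \<in> B \<Longrightarrow> \<sigma> x \<in> total F \<and> vproj F (\<sigma> x) = x"
    and s: "\<And>k i. i < fdim P k \<Longrightarrow> sf M B (\<lambda>x. \<tau> (\<sigma> x) k i)"
  shows "continuous_map (subtopology (mtop M) B) (vtop F) \<sigma>"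
proof -
  have tB: "topspace (subtopology (mtop M) B) = B" using openin_subset[OF B(1)] by auto
  have r: "\<sigma> x \<in> restr F D" if "x \<in> B" for x using \<sigma>[OF that] that B by auto
  have "continuous_map (subtopology (mtop M) B) (stage P k) (\<lambda>x. \<tau> (\<sigma> x) k)" for k
    unfolding continuous_map_Euclidean_space_iff tB
  proof (intro conjI allI)
    show "(\<lambda>x. \<tau> (\<sigma> x) k) \<in> B \<rightarrow> Euclid (fdim P k)" using tau_Euclid[OF r] by blast
    fix i
    show "creal (subtopology (mtop M) B) (\<lambda>x. \<tau> (\<sigma> x) k i)"
    proof (cases "i < fdim P k")
      case True
      show ?thesis by (rule sf_continuous[OF mf B(1) s[OF True]])
    next
      case False
      have "creal (subtopology (mtop M) B) (\<lambda>x. 0)" by simp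
      then show ?thesis
      proof (rule continuous_map_eq)
        fix x assume "x \<in> topspace (subtopology (mtop M) B)"
        then have "x \<in> B" using tB by simp
        from tau_Euclid[OF r[OF this], of k] show "0 = \<tau> (\<sigma> x) k i" using False by (simp add: topspace_Euclidean_space)
      qed
    qed
  qed
  then have "continuous_map (subtopology (mtop M) B) (product_topology (stage P) UNIV) (\<lambda>x. \<tau> (\<sigma> x))"
    by (simp add: continuous_map_componentwise_UNIV)
  then have 1: "continuous_map (subtopology (mtop M) B) (prolimit P) (\<lambda>x. \<tau> (\<sigma> x))"
    unfolding prolimit_def continuous_map_in_subtopology using tau_lim[OF r] unfolding tB lim_points_iff by auto
  have "continuous_map (subtopology (mtop M) B) (subtopology (mtop M) D) (\<lambda>x. x)"
    using B(2) tB by (auto simp: continuous_map_in_subtopology intro: continuous_map_from_subtopology)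
  then have "continuous_map (subtopology (mtop M) B) (prod_topology (subtopology (mtop M) D) (prolimit P)) (\<lambda>x. (x, \<tau> (\<sigma> x)))"
    using 1 by (simp add: continuous_map_pairwise o_def)
  from continuous_map_compose[OF this fr_continuous]
  show ?thesis
  proof (rule continuous_map_eq)
    fix x assume "x \<in> topspace (subtopology (mtop M) B)"
    then have "x \<in> B" using tB by simp
    then show "((\<lambda>q. fr (fst q) (snd q)) \<circ> (\<lambda>x. (x, \<tau> (\<sigma> x)))) x = \<sigma> x"
      using fr_tau[OF r, of x] \<sigma>[of x] by simp
  qed
qed

end

text \<open>Reduces smoothness of a section, which quantifies over smooth functions on the total
  space, to smoothness of its fiber coordinates in one trivialization around each point.\<close>

lemma smooth_vb_sectionI:
  assumes vb: "vector_bundle F" and \<sigma>: "\<And>x. x \<in> pts (vbase F) \<Longrightarrow> \<sigma> x \<in> total F \<and> vproj F (\<sigma> x) = x"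
    and s: "\<And>x. x \<in> pts (vbase F) \<Longrightarrow> \<exists>D P \<tau> B. (D, P, \<tau>) \<in> vtriv F \<and> openin (mtop (vbase F)) B \<and> x \<in> B \<and> B \<subseteq> D \<and>
       (\<forall>k. \<forall>i<fdim P k. sf (vbase F) B (\<lambda>x. \<tau> (\<sigma> x) k i))"
  shows "smooth_vb_section F \<sigma>"
proof -
  let ?M = "vbase F"
  note mf = vb_manifold[OF vb]
  have c: "continuous_map (mtop ?M) (vtop F) \<sigma>"
  proof (rule continuous_map_locally)
    fix x assume x: "x \<in> pts ?M"
    from s[OF x] obtain D P \<tau> B where B: "(D, P, \<tau>) \<in> vtriv F" "openin (mtop ?M) B" "x \<in> B" "B \<subseteq> D"
       "\<forall>k. \<forall>i<fdim P k. sf ?M B (\<lambda>x. \<tau> (\<sigma> x) k i)" by blast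
    interpret local_triv F D P \<tau> by (rule local_triv.intro[OF vb B(1)])
    have "continuous_map (subtopology (mtop ?M) B) (vtop F) \<sigma>"
      using B \<sigma> openin_subset[OF B(2)] by (intro section_continuous) auto
    then show "\<exists>B. openin (mtop ?M) B \<and> x \<in> B \<and> continuous_map (subtopology (mtop ?M) B) (vtop F) \<sigma>" using B by blast
  qed
  have "sf ?M {x \<in> pts ?M. \<sigma> x \<in> W} (f \<circ> \<sigma>)" if W: "openin (vtop F) W" "sfun (vb_space F) W f" for W f
  proof -
    have o: "openin (mtop ?M) {x \<in> pts ?M. \<sigma> x \<in> W}" by (rule openin_continuous_map_preimage[OF c W(1)])
    show ?thesis
    proof (rule sf_local[OF mf o])
      fix x assume "x \<in> {x \<in> pts ?M. \<sigma> x \<in> W}"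
      then have x: "x \<in> pts ?M" by simp
      from s[OF x] obtain D P \<tau> B where B: "(D, P, \<tau>) \<in> vtriv F" "openin (mtop ?M) B" "x \<in> B" "B \<subseteq> D"
         "\<forall>k. \<forall>i<fdim P k. sf ?M B (\<lambda>x. \<tau> (\<sigma> x) k i)" by blast
      interpret local_triv F D P \<tau> by (rule local_triv.intro[OF vb B(1)])
      have oB: "openin (mtop ?M) ({x \<in> pts ?M. \<sigma> x \<in> W} \<inter> B)" using o B(2) by blast
      have "sf ?M ({x \<in> pts ?M. \<sigma> x \<in> W} \<inter> B) (\<lambda>x. f (\<sigma> x))"
      proof (rule pullback_smooth[OF W(2) oB])
        show "sf ?M ({x \<in> pts ?M. \<sigma> x \<in> W} \<inter> B) (\<lambda>x. \<tau> (\<sigma> x) k i)" if "i < fdim P k" for k i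
          by (rule sf_subset[of _ B]) (use B(5) that in auto)
      qed (use B(4) \<sigma> in auto)
      then show "\<exists>W'. openin (mtop ?M) W' \<and> x \<in> W' \<and> sf ?M ({x \<in> pts ?M. \<sigma> x \<in> W} \<inter> W') (f \<circ> \<sigma>)"
        using B(2,3) unfolding o_def by blast
    qed
  qed
  then show ?thesis using c \<sigma> by (auto simp: smooth_vb_section_def smooth_map_def)
qed

lemma trunc_cat3:
  assumes "x \<in> Euclid m" "y \<in> Euclid n" "z \<in> Euclid r"
  shows "trunc (m + n + r) (\<lambda>j. if j < m then x j else if j < m + n then y (j - m) else z (j - (m + n))) = cat (m + n) (cat m x y) z"
proof -
  have "(\<lambda>j. if j < m then x j else if j < m + n then y (j - m) else z (j - (m + n))) =
      (\<lambda>j. if j < m + n then cat m x y j else z (j - (m + n)))" by (auto simp: cat_def)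
  then show ?thesis using trunc_cat[OF cat_Euclid[OF assms(1,2)] assms(3)] by simp
qed

section \<open>The product of a bundle with a manifold\<close>

lemma vb_prod_simps [simp]:
  "vbase (vb_prod F N) = mfd_prod (vbase F) N" "vtop (vb_prod F N) = prod_topology (vtop F) (mtop N)"
  "mdim (mfd_prod M N) = mdim M + mdim N" "mtop (mfd_prod M N) = prod_topology (mtop M) (mtop N)"
  "vproj (vb_prod F N) (e, y) = (vproj F e, y)"
  by (simp_all add: vb_prod_def mfd_prod_def)

lemma atlas_prod: "(CC, cc) \<in> atlas (mfd_prod M N) \<longleftrightarrow>
   (\<exists>C c C' c'. (C, c) \<in> atlas M \<and> (C', c') \<in> atlas N \<and> CC = C \<times> C' \<and> cc = (\<lambda>(x, y). cat (mdim M) (c x) (c' y)))"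
  by (auto simp: mfd_prod_def)

context local_triv
begin

lemma triv_prod: "(D \<times> pts N, P, \<lambda>(e, y). \<tau> e) \<in> vtriv (vb_prod F N)"
  using tr by (auto simp: vb_prod_def)

lemma sfun_prodD:
  assumes f: "sfun (vb_space (vb_prod F N)) W f" and e: "(e, t) \<in> W" "vproj F e \<in> D" and t: "t \<in> pts N"
  shows "\<exists>A C c C' c' k O' g. openin (prod_topology (mtop M) (mtop N)) A \<and> (vproj F e, t) \<in> A \<and>
     A \<subseteq> C \<times> C' \<and> A \<subseteq> D \<times> UNIV \<and> (C, c) \<in> atlas M \<and> (C', c') \<in> atlas N \<and>
     openE (mdim M + mdim N + fdim P k) O' \<and> smooth_on (mdim M + mdim N + fdim P k) O' g \<and>
     (\<forall>v s. (v, s) \<in> W \<longrightarrow> (vproj F v, s) \<in> A \<longrightarrow>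
        cat (mdim M + mdim N) (cat (mdim M) (c (vproj F v)) (c' s)) (\<tau> v k) \<in> O' \<and>
        f (v, s) = g (cat (mdim M + mdim N) (cat (mdim M) (c (vproj F v)) (c' s)) (\<tau> v k)))"
proof -
  have "triv_smooth (vb_prod F N) (D \<times> pts N, P, \<lambda>(e, y). \<tau> e) W f"
    using f triv_prod[of N] unfolding sfun_vb by blast
  moreover have "vproj (vb_prod F N) (e, t) \<in> D \<times> pts N" using e t by simp
  ultimately obtain A CC cc k O' g where A: "openin (prod_topology (mtop M) (mtop N)) A" "(vproj F e, t) \<in> A"
     "A \<subseteq> D \<times> pts N" "A \<subseteq> CC" and C: "(CC, cc) \<in> atlas (mfd_prod M N)" and
     g: "openE (mdim M + mdim N + fdim P k) O'" "smooth_on (mdim M + mdim N + fdim P k) O' g"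
     "\<forall>q \<in> W. vproj (vb_prod F N) q \<in> A \<longrightarrow>
           cat (mdim M + mdim N) (cc (vproj (vb_prod F N) q)) ((\<lambda>(e, y). \<tau> e) q k) \<in> O' \<and>
           f q = g (cat (mdim M + mdim N) (cc (vproj (vb_prod F N) q)) ((\<lambda>(e, y). \<tau> e) q k))"
    using triv_smoothD[of "vb_prod F N" "D \<times> pts N" P "\<lambda>(e, y). \<tau> e" W f "(e, t)"] e(1)
    unfolding vb_prod_simps by blast
  from C obtain C c C' c' where c: "(C, c) \<in> atlas M" "(C', c') \<in> atlas N" "CC = C \<times> C'"
    "cc = (\<lambda>(x, y). cat (mdim M) (c x) (c' y))" unfolding atlas_prod by blast
  have "\<forall>v s. (v, s) \<in> W \<longrightarrow> (vproj F v, s) \<in> A \<longrightarrow>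
        cat (mdim M + mdim N) (cat (mdim M) (c (vproj F v)) (c' s)) (\<tau> v k) \<in> O' \<and>
        f (v, s) = g (cat (mdim M + mdim N) (cat (mdim M) (c (vproj F v)) (c' s)) (\<tau> v k))"
    using g(3) unfolding c(4) by fastforce
  moreover have "A \<subseteq> C \<times> C'" "A \<subseteq> D \<times> UNIV" using A(3,4) c(3) by auto
  ultimately show ?thesis using A(1,2) c(1,2) g(1,2) by blast
qed

text \<open>The second variable is frozen at \<open>t\<close>, so its chart coordinates enter as
  constants. With an interval for \<open>N\<close> this evaluates the vertical extension of a
  section at a fixed time.\<close>

lemma pullback_smooth_prod:
  assumes N: "manifold N" and t: "t \<in> pts N" and f: "sfun (vb_space (vb_prod F N)) W f"
    and B: "openin (mtop M) B" "B \<subseteq> D"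
    and \<sigma>: "\<And>x. x \<in> B \<Longrightarrow> (\<sigma> x, t) \<in> W \<and> \<sigma> x \<in> total F \<and> vproj F (\<sigma> x) = x"
    and s: "\<And>k i. i < fdim P k \<Longrightarrow> sf M B (\<lambda>x. \<tau> (\<sigma> x) k i)"
  shows "sf M B (\<lambda>x. f (\<sigma> x, t))"
proof (rule sf_local[OF mf B(1)])
  fix x assume x: "x \<in> B"
  let ?m = "mdim M" and ?n = "mdim N"
  have "(\<sigma> x, t) \<in> W" "vproj F (\<sigma> x) \<in> D" using \<sigma>[OF x] x B by auto
  from sfun_prodD[OF f this t] \<sigma>[OF x] obtain A C c C' c' K O' g where
    A: "openin (prod_topology (mtop M) (mtop N)) A" "(x, t) \<in> A" "A \<subseteq> C \<times> C'" "A \<subseteq> D \<times> UNIV" and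
    C: "(C, c) \<in> atlas M" "(C', c') \<in> atlas N" and
    g: "openE (?m + ?n + fdim P K) O'" "smooth_on (?m + ?n + fdim P K) O' g"
    and e: "\<forall>v s. (v, s) \<in> W \<longrightarrow> (vproj F v, s) \<in> A \<longrightarrow>
        cat (?m + ?n) (cat ?m (c (vproj F v)) (c' s)) (\<tau> v K) \<in> O' \<and>
        f (v, s) = g (cat (?m + ?n) (cat ?m (c (vproj F v)) (c' s)) (\<tau> v K))"
    by (elim exE conjE) (auto simp only:)
  define A' where "A' = {y \<in> pts M. (y, t) \<in> A}"
  have oA: "openin (mtop M) A'"
  proof -
    have "continuous_map (mtop M) (prod_topology (mtop M) (mtop N)) (\<lambda>y. (y, t))"
      using t by (simp add: continuous_map_pairwise o_def)
    from openin_continuous_map_preimage[OF this A(1)] show ?thesis by (simp add: A'_def)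
  qed
  have xA: "x \<in> A'" using x A(2) openin_subset[OF B(1)] by (auto simp: A'_def)
  let ?\<Theta> = "\<lambda>j x. if j < ?m then c x j else if j < ?m + ?n then c' t (j - ?m) else \<tau> (\<sigma> x) K (j - (?m + ?n))"
  have oBA: "openin (mtop M) (B \<inter> A')" using oA B by blast
  have tc: "trunc (?m + ?n + fdim P K) (\<lambda>j. ?\<Theta> j y) = cat (?m + ?n) (cat ?m (c y) (c' t)) (\<tau> (\<sigma> y) K)" if y: "y \<in> B \<inter> A'" for y
    using y A(3) \<sigma>[of y] B(2)
    by (intro trunc_cat3 chart_Euclid[OF mf C(1)] chart_Euclid[OF N C(2)] tau_Euclid) (auto simp: A'_def)
  have ee: "cat (?m + ?n) (cat ?m (c y) (c' t)) (\<tau> (\<sigma> y) K) \<in> O' \<and>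
      f (\<sigma> y, t) = g (cat (?m + ?n) (cat ?m (c y) (c' t)) (\<tau> (\<sigma> y) K))" if y: "y \<in> B \<inter> A'" for y
  proof -
    have 1: "vproj F (\<sigma> y) = y" "(\<sigma> y, t) \<in> W" using \<sigma>[of y] y by auto
    have "(vproj F (\<sigma> y), t) \<in> A" using 1 y by (auto simp: A'_def)
    with e 1(2) have "cat (?m + ?n) (cat ?m (c (vproj F (\<sigma> y))) (c' t)) (\<tau> (\<sigma> y) K) \<in> O' \<and>
      f (\<sigma> y, t) = g (cat (?m + ?n) (cat ?m (c (vproj F (\<sigma> y))) (c' t)) (\<tau> (\<sigma> y) K))" by blast
    then show ?thesis unfolding 1(1) .
  qed
  have "sf M (B \<inter> A') (\<lambda>x. g (trunc (?m + ?n + fdim P K) (\<lambda>j. ?\<Theta> j x)))"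
  proof (rule sf_compose[OF mf g oBA])
    fix j assume j: "j < ?m + ?n + fdim P K"
    show "sf M (B \<inter> A') (\<lambda>x. ?\<Theta> j x)"
    proof (cases "j < ?m")
      case True
      have "B \<inter> A' \<subseteq> C" using A(3) by (auto simp: A'_def)
      from sf_subset[OF sf_coord[OF mf C(1), of j] this] show ?thesis using True by simp
    next
      case False
      then show ?thesis using sf_subset[OF s[of "j - (?m + ?n)" K], of "B \<inter> A'"] j
        by (cases "j < ?m + ?n") (auto intro: sf_const)
    qed
  next
    fix y assume y: "y \<in> B \<inter> A'"
    show "trunc (?m + ?n + fdim P K) (\<lambda>j. ?\<Theta> j y) \<in> O'"
      unfolding tc[OF y] using ee[OF y] by simp
  qed
  then have "sf M (B \<inter> A') (\<lambda>x. f (\<sigma> x, t))"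
  proof (rule sf_cong[OF mf oBA, rotated])
    fix y assume y: "y \<in> B \<inter> A'"
    show "g (trunc (?m + ?n + fdim P K) (\<lambda>j. ?\<Theta> j y)) = f (\<sigma> y, t)"
      unfolding tc[OF y] using ee[OF y] by simp
  qed
  then show "\<exists>W'. openin (mtop M) W' \<and> x \<in> W' \<and> sf M (B \<inter> W') (\<lambda>x. f (\<sigma> x, t))" using oA xA by blast
qed

end

text \<open>Smoothness on a profinite bundle asks for one finite stage locally; here that stage is
  \<open>K\<close>, and the representing function is a polynomial in the fiber coordinates with
  smooth coefficients. The averaged form will be recognized as smooth through this
  criterion.\<close>

lemma sfun_quadratic:
  assumes vb: "vector_bundle F"
    and q: "\<And>D P \<tau> x. (D, P, \<tau>) \<in> vtriv F \<Longrightarrow> x \<in> D \<Longrightarrow>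
      \<exists>A K Q. openin (mtop (vbase F)) A \<and> x \<in> A \<and> A \<subseteq> D \<and> (\<forall>i<fdim P K. \<forall>j<fdim P K. sf (vbase F) A (Q i j)) \<and>
       (\<forall>v\<in>restr F A. f v = (\<Sum>i<fdim P K. \<Sum>j<fdim P K. Q i j (vproj F v) * \<tau> v K i * \<tau> v K j))"
    and W: "W \<subseteq> total F"
  shows "sfun (vb_space F) W f"
  unfolding sfun_vb
proof (clarify)
  fix D P \<tau> assume T: "(D, P, \<tau>) \<in> vtriv F"
  interpret local_triv F D P \<tau> by (rule local_triv.intro[OF vb T])
  let ?m = "mdim (vbase F)"
  show "triv_smooth F (D, P, \<tau>) W f"
    unfolding triv_smooth_def split_conv
  proof
    fix x assume "x \<in> vproj F ` W \<inter> D"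
    then have xD: "x \<in> D" by simp
    from q[OF T this] obtain A K Q where A: "openin (mtop M) A" "x \<in> A" "A \<subseteq> D"
      and Q: "\<forall>i<fdim P K. \<forall>j<fdim P K. sf M A (Q i j)"
      and f: "\<forall>v\<in>restr F A. f v = (\<Sum>i<fdim P K. \<Sum>j<fdim P K. Q i j (vproj F v) * \<tau> v K i * \<tau> v K j)" by blast
    obtain C c where C: "(C, c) \<in> atlas M" "x \<in> C" using chart_exists[OF mf] xD DM by blast
    let ?B = "A \<inter> C" and ?d = "fdim P K"
    have oB: "openin (mtop M) ?B" using A(1) chart(1)[OF mf C(1)] by blast
    have oc: "openE ?m (c ` ?B)" using open_chart_image[OF mf C(1) A(1)] .
    define O' where "O' = {z \<in> Euclid (?m + ?d). trunc ?m z \<in> c ` ?B}"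
    define g where "g z = (\<Sum>i<?d. \<Sum>j<?d. Q i j (inv_into C c (trunc ?m z)) * z (?m + i) * z (?m + j))" for z
    have oO: "openE (?m + ?d) O'"
      unfolding O'_def by (rule openin_continuous_map_preimage[OF continuous_map_trunc oc]) (rule continuous_map_Euclidean_coord)
    have sg: "smooth_on (?m + ?d) O' g"
      unfolding g_def
    proof (intro smooth_on_sum smooth_on_mult smooth_on_coord finite_lessThan)
      fix i j assume "i \<in> {..<?d}" "j \<in> {..<?d}"
      then have "sf M A (Q i j)" using Q by simp
      then have "smooth_on ?m (c ` ?B) (\<lambda>y. Q i j (inv_into C c y))" using C(1) unfolding sf_iff by fast
      from smooth_on_compose[OF oc this oO smooth_on_coord]
      show "smooth_on (?m + ?d) O' (\<lambda>z. Q i j (inv_into C c (trunc ?m z)))" by (simp add: O'_def)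
    qed
    have "cat ?m (c (vproj F e)) (\<tau> e K) \<in> O' \<and> f e = g (cat ?m (c (vproj F e)) (\<tau> e K))" if e: "e \<in> W" "vproj F e \<in> ?B" for e
    proof
      have eE: "c (vproj F e) \<in> Euclid ?m" "\<tau> e K \<in> Euclid ?d"
        using e W A(3) by (auto intro: chart_Euclid[OF mf C(1)] tau_Euclid)
      show "cat ?m (c (vproj F e)) (\<tau> e K) \<in> O'"
        unfolding O'_def using cat_Euclid[OF eE] cat_fst[OF eE(1)] e(2) by auto
      have "e \<in> restr F A" using e W by auto
      then show "f e = g (cat ?m (c (vproj F e)) (\<tau> e K))"
        using f e(2) chart(3)[OF mf C(1)] cat_fst[OF eE(1), of "\<tau> e K"] fun_cong[OF cat_snd[of ?m "c (vproj F e)" "\<tau> e K"]]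
        by (simp add: g_def)
    qed
    then show "\<exists>A C c k O' g. openin (mtop M) A \<and> x \<in> A \<and> A \<subseteq> D \<and> A \<subseteq> C \<and> (C, c) \<in> atlas M \<and>
        openE (?m + fdim P k) O' \<and> smooth_on (?m + fdim P k) O' g \<and>
        (\<forall>e\<in>W. vproj F e \<in> A \<longrightarrow> cat ?m (c (vproj F e)) (\<tau> e k) \<in> O' \<and> f e = g (cat ?m (c (vproj F e)) (\<tau> e k)))"
      using oB A(2,3) C oO sg
      by (intro exI[of _ ?B] exI[of _ C] exI[of _ c] exI[of _ K] exI[of _ O'] exI[of _ g]) auto
  qed
qed

lemma interval_simps [simp]: "mtop (interval \<epsilon>) = top_of_set {-\<epsilon><..<\<epsilon>}" "mdim (interval \<epsilon>) = 1"
  "atlas (interval \<epsilon>) = {({-\<epsilon><..<\<epsilon>}, \<lambda>t i. if i = 0 then t else 0)}"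
  by (simp_all add: interval_def)

lemma openin_smooth_preimage:
  assumes W: "openE n W" and V: "openE m V"
    and \<Theta>: "\<And>j. j < m \<Longrightarrow> smooth_on n W (\<Theta> j)"
  shows "openE n {x \<in> W. trunc m (\<lambda>j. \<Theta> j x) \<in> V}"
proof -
  have "continuous_map (subtopology (Euclidean_space n) W) (Euclidean_space m) (\<lambda>x. trunc m (\<lambda>j. \<Theta> j x))"
    by (intro continuous_map_trunc smooth_on_continuous \<Theta>)
  from openin_continuous_map_preimage[OF this V]
  have "openE n {x \<in> topspace (subtopology (Euclidean_space n) W). trunc m (\<lambda>j. \<Theta> j x) \<in> V}"
    using W openin_open_subtopology by blast
  moreover have "topspace (subtopology (Euclidean_space n) W) = W" using openin_subset[OF W] by auto
  ultimately show ?thesis by (simp only:)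
qed

text \<open>In coordinates the map is \<open>(x, t, y) \<mapsto> (x, y + t \<sigma>(x))\<close>. It
  acts on each stage of the fiber separately, so a function that comes from stage \<open>K\<close>
  is pulled back to one that comes from stage \<open>K\<close>.\<close>

lemma vertical_smooth:
  assumes vb: "vector_bundle F" and \<sigma>: "smooth_vb_section F \<sigma>" and f: "sfun (vb_space F) W f"
    and W': "W' \<subseteq> total F \<times> {-\<epsilon><..<\<epsilon>}" "\<And>v t. (v, t) \<in> W' \<Longrightarrow> vadd F v (vscale F t (\<sigma> (vproj F v))) \<in> W"
  shows "sfun (vb_space (vb_prod F (interval \<epsilon>))) W' (\<lambda>(v, t). f (vadd F v (vscale F t (\<sigma> (vproj F v)))))"
  unfolding sfun_vb
proof (clarify)
  fix DD P \<tau>\<tau> assume "(DD, P, \<tau>\<tau>) \<in> vtriv (vb_prod F (interval \<epsilon>))"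
  then obtain D \<tau> where T: "(D, P, \<tau>) \<in> vtriv F" and DD: "DD = D \<times> {-\<epsilon><..<\<epsilon>}" "\<tau>\<tau> = (\<lambda>(e, y). \<tau> e)"
    by (auto simp: vb_prod_def)
  interpret local_triv F D P \<tau> by (rule local_triv.intro[OF vb T])
  let ?m = "mdim M" and ?I = "{-\<epsilon><..<\<epsilon>}" and ?E = "vb_prod F (interval \<epsilon>)"
  let ?h = "\<lambda>(v, t). f (vadd F v (vscale F t (\<sigma> (vproj F v))))"
  have \<sigma>M: "\<sigma> x \<in> total F \<and> vproj F (\<sigma> x) = x" if "x \<in> pts M" for x
    using \<sigma> that continuous_map_image_subset_topspace[of "mtop M" "vtop F" \<sigma>]
    by (auto simp: smooth_vb_section_def smooth_map_def)
  have s\<sigma>: "sf M D (\<lambda>x. \<tau> (\<sigma> x) k i)" if "i < fdim P k" for k i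
    using \<sigma> by (intro section_coord_smooth \<sigma>M that) (auto simp: smooth_vb_section_def)
  show "triv_smooth ?E (DD, P, \<tau>\<tau>) W' ?h"
    unfolding triv_smooth_def split_conv
  proof (rule ballI, goal_cases)
    case (1 q)
    from 1 obtain v t where vt: "(v, t) \<in> W'" "q = (vproj F v, t)" "vproj F v \<in> D" "t \<in> ?I" unfolding DD by (auto simp: vb_prod_def)
    define V where "V v t = vadd F v (vscale F t (\<sigma> (vproj F v)))" for v t
    have V: "V v t \<in> restr F D \<and> vproj F (V v t) = vproj F v \<and> \<tau> (V v t) = (\<lambda>k i. \<tau> v k i + t * \<tau> (\<sigma> (vproj F v)) k i)"
      if "v \<in> restr F D" for v t
    proof -
      have m: "vproj F v \<in> pts M" using that DM by auto
      have s: "\<sigma> (vproj F v) \<in> restr F D" "vproj F (\<sigma> (vproj F v)) = vproj F v" using \<sigma>M[OF m] that by auto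
      note sc = scale[OF s(1), of t]
      have "vproj F v = vproj F (vscale F t (\<sigma> (vproj F v)))" using sc(2) s(2) by simp
      from add[OF that sc(1) this] show ?thesis unfolding V_def sc(3) by auto
    qed
    have v: "v \<in> restr F D" using vt W'(1) by auto
    have t: "triv_smooth F (D, P, \<tau>) W f" using f tr unfolding sfun_vb by blast
    have "V v t \<in> W" "vproj F (V v t) \<in> D" using W'(2)[OF vt(1)] V[OF v, of t] by (auto simp: V_def)
    from triv_smoothD[OF t this] V[OF v, of t] obtain A C c K O' g where A: "openin (mtop M) A" "vproj F v \<in> A" "A \<subseteq> D" "A \<subseteq> C"
      and C: "(C, c) \<in> atlas M" and g: "openE (?m + fdim P K) O'" "smooth_on (?m + fdim P K) O' g"
      and e: "\<forall>e \<in> W. vproj F e \<in> A \<longrightarrow> cat ?m (c (vproj F e)) (\<tau> e K) \<in> O' \<and> f e = g (cat ?m (c (vproj F e)) (\<tau> e K))"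
      by auto
    let ?d = "fdim P K"
    have oc: "openE ?m (c ` A)" using open_chart_image[OF mf C A(1)] A(4) by (simp add: Int_absorb2)
    define U where "U = {z \<in> Euclid (?m + 1 + ?d). trunc ?m z \<in> c ` A}"
    have oU: "openE (?m + 1 + ?d) U"
      unfolding U_def by (rule openin_continuous_map_preimage[OF continuous_map_trunc oc]) (rule continuous_map_Euclidean_coord)
    \<comment> \<open>The source coordinates are ordered as base, time, fiber. The time has index
      \<open>?m\<close>, so the fiber coordinate with index \<open>j\<close> in the target stands at
      \<open>Suc j\<close> in the source.\<close>
    define \<Theta> where "\<Theta> j z = (if j < ?m then z j else z (Suc j) + z ?m * \<tau> (\<sigma> (inv_into C c (trunc ?m z))) K (j - ?m))"
      for j and z :: "nat \<Rightarrow> real"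
    have s\<Theta>: "smooth_on (?m + 1 + ?d) U (\<Theta> j)" if j: "j < ?m + ?d" for j
    proof (cases "j < ?m")
      case True
      then show ?thesis unfolding \<Theta>_def by (simp add: smooth_on_coord)
    next
      case False
      then have "sf M D (\<lambda>x. \<tau> (\<sigma> x) K (j - ?m))" using j by (intro s\<sigma>) simp
      from sf_subset[OF this A(3)] have "smooth_on ?m (c ` A) (\<lambda>y. \<tau> (\<sigma> (inv_into C c y)) K (j - ?m))"
        using C A(4) unfolding sf_iff by (auto simp: Int_absorb2)
      from smooth_on_compose[OF oc this oU smooth_on_coord]
      have "smooth_on (?m + 1 + ?d) U (\<lambda>z. \<tau> (\<sigma> (inv_into C c (trunc ?m z))) K (j - ?m))" by (simp add: U_def)
      then show ?thesis unfolding \<Theta>_def using False by (auto intro!: smooth_on_add smooth_on_mult smooth_on_coord)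
    qed
    define O2 where "O2 = {z \<in> U. trunc (?m + ?d) (\<lambda>j. \<Theta> j z) \<in> O'}"
    define g2 where "g2 z = g (trunc (?m + ?d) (\<lambda>j. \<Theta> j z))" for z
    have oO2: "openE (?m + 1 + ?d) O2"
      unfolding O2_def by (rule openin_smooth_preimage[OF oU g(1) s\<Theta>])
    have sg2: "smooth_on (?m + 1 + ?d) O2 g2"
      unfolding g2_def by (rule smooth_on_compose[OF g oO2 smooth_on_subset[OF s\<Theta>]]) (auto simp: O2_def)
    let ?cc = "\<lambda>(x, y). cat ?m (c x) (\<lambda>i. if i = 0 then y else 0)"
    have main: "cat (?m + 1) (?cc (vproj F w, s)) (\<tau> w K) \<in> O2 \<and> f (V w s) = g2 (cat (?m + 1) (?cc (vproj F w, s)) (\<tau> w K))"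
      if w: "(w, s) \<in> W'" "vproj F w \<in> A" for w s
    proof -
      have wD: "w \<in> restr F D" using w W'(1) A(3) by auto
      have wE: "c (vproj F w) \<in> Euclid ?m" "\<tau> w K \<in> Euclid ?d" "\<tau> (V w s) K \<in> Euclid ?d"
        using w A(4) V[OF wD, of s] chart_Euclid[OF mf C] tau_Euclid[OF wD] tau_Euclid[of "V w s"] by blast+
      have i1: "(\<lambda>i. if i = 0 then s else 0) \<in> Euclid 1" by (simp add: topspace_Euclidean_space)
      let ?z = "cat (?m + 1) (?cc (vproj F w, s)) (\<tau> w K)"
      have zE: "?z \<in> Euclid (?m + 1 + ?d)" using cat_Euclid[OF cat_Euclid[OF wE(1) i1] wE(2)] by simp
      have z1: "trunc ?m ?z = c (vproj F w)"
        using wE(1) by (auto simp: trunc_def cat_def topspace_Euclidean_space fun_eq_iff)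
      have z2: "?z ?m = s" "\<And>j. ?z (Suc (?m + j)) = \<tau> w K j" by (simp_all add: cat_def)
      have zU: "?z \<in> U" unfolding U_def using zE z1 w(2) by simp
      have "\<Theta> j ?z = (if j < ?m then c (vproj F w) j else \<tau> (V w s) K (j - ?m))" for j
      proof (cases "j < ?m")
        case True
        then show ?thesis using fun_cong[OF z1, of j] by (simp add: \<Theta>_def)
      next
        case False
        then obtain l where l: "j = ?m + l" using le_Suc_ex[of ?m j] by auto
        have "inv_into C c (c (vproj F w)) = vproj F w" using chart(3)[OF mf C] w(2) A(4) by auto
        then show ?thesis unfolding \<Theta>_def z1 using l V[OF wD, of s] z2 by simp
      qed
      then have th: "trunc (?m + ?d) (\<lambda>j. \<Theta> j ?z) = cat ?m (c (vproj F w)) (\<tau> (V w s) K)"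
        using trunc_cat[OF wE(1,3)] by simp
      have Vw: "V w s \<in> W" using W'(2)[OF w(1)] by (simp add: V_def)
      have "cat ?m (c (vproj F w)) (\<tau> (V w s) K) \<in> O' \<and> f (V w s) = g (cat ?m (c (vproj F w)) (\<tau> (V w s) K))"
        using bspec[OF e Vw] V[OF wD, of s] w(2) by simp
      then show ?thesis using zU th by (simp add: O2_def g2_def)
    qed
    have oAI: "openin (prod_topology (mtop M) (top_of_set ?I)) (A \<times> ?I)" using A(1) by (simp add: openin_prod_Times_iff)
    have at: "(C \<times> ?I, ?cc) \<in> atlas (mfd_prod M (interval \<epsilon>))" unfolding atlas_prod using C by (auto intro!: exI[of _ C] exI[of _ c])
    have ev: "\<forall>e\<in>W'. vproj ?E e \<in> A \<times> ?I \<longrightarrow> cat (?m + 1) (?cc (vproj ?E e)) (\<tau>\<tau> e K) \<in> O2 \<and> ?h e = g2 (cat (?m + 1) (?cc (vproj ?E e)) (\<tau>\<tau> e K))"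
    proof (intro ballI impI)
      fix e assume e: "e \<in> W'" "vproj ?E e \<in> A \<times> ?I"
      obtain w s where ws: "e = (w, s)" by (cases e)
      have "(w, s) \<in> W'" "vproj F w \<in> A" using e by (simp_all add: ws vb_prod_def)
      from main[OF this]
      show "cat (?m + 1) (?cc (vproj ?E e)) (\<tau>\<tau> e K) \<in> O2 \<and> ?h e = g2 (cat (?m + 1) (?cc (vproj ?E e)) (\<tau>\<tau> e K))"
        by (simp add: ws DD V_def)
    qed
    have q: "q \<in> A \<times> ?I" "A \<times> ?I \<subseteq> DD" "A \<times> ?I \<subseteq> C \<times> ?I" using vt(2,4) A(2,3,4) DD(1) by auto
    show ?case
      unfolding vb_prod_simps interval_simps
      by (rule exI[of _ "A \<times> ?I"], rule exI[of _ "C \<times> ?I"], rule exI[of _ ?cc], rule exI[of _ K], rule exI[of _ O2], rule exI[of _ g2])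
        (intro conjI oAI q at oO2 sg2 ev)
  qed
qed

section \<open>Bundles with symmetries\<close>

text \<open>Point and parameter are substituted at the same time: the point by a map with smooth
  coordinates, which may involve the parameter, and the parameter by a continuous map.\<close>

lemma psf_compose:
  assumes M: "manifold M" and N: "manifold N" and Y: "openin (prod_topology (mtop N) T') Y" and f: "psf N T' Y f"
    and Y': "openin (prod_topology (mtop M) T) Y'" and \<phi>: "continuous_map (subtopology (prod_topology (mtop M) T) Y') (mtop N) \<phi>"
    and s: "\<And>C c j. (C, c) \<in> atlas N \<Longrightarrow> psf M T {p \<in> Y'. \<phi> p \<in> C} (\<lambda>p. c (\<phi> p) j)"
    and h: "continuous_map T T' h" and sub: "\<And>p. p \<in> Y' \<Longrightarrow> (\<phi> p, h (snd p)) \<in> Y"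
  shows "psf M T Y' (\<lambda>p. f (\<phi> p, h (snd p)))"
proof (rule psf_local[OF M Y'])
  fix p assume p: "p \<in> Y'"
  have "\<phi> p \<in> pts N" using sub[OF p] openin_subset[OF Y] by auto
  then obtain C c where C: "(C, c) \<in> atlas N" "\<phi> p \<in> C" using chart_exists[OF N] by blast
  define Y2 where "Y2 = {q \<in> Y'. \<phi> q \<in> C}"
  have t: "topspace (subtopology (prod_topology (mtop M) T) Y') = Y'" using openin_subset[OF Y'] by (simp add: Int_absorb1)
  have o2: "openin (prod_topology (mtop M) T) Y2"
    using openin_continuous_map_preimage[OF \<phi> chart(1)[OF N C(1)]] Y' openin_open_subtopology
    unfolding t Y2_def by blast
  have "psf M T Y2 (\<lambda>p. f (\<phi> p, h (snd p)))"
    unfolding psf_def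
  proof (clarify)
    fix D d assume D: "(D, d) \<in> atlas M"
    let ?m = "mdim N" and ?Y = "pimg D d Y2"
    have o: "openin (prodE (mdim M) T) ?Y" by (rule open_pimg[OF M D o2])
    have m: "trunc ?m (c (\<phi> (inv_into D d (fst q), snd q))) = c (\<phi> (inv_into D d (fst q), snd q))" if "q \<in> ?Y" for q
      using that by (intro trunc_eq chart_Euclid[OF N C(1)]) (simp add: Y2_def)
    have "psmooth (mdim M) ?Y T (\<lambda>q. (\<lambda>p. f (inv_into C c (fst p), snd p))
       (trunc ?m (\<lambda>j. c (\<phi> (inv_into D d (fst q), snd q)) j), h (snd q)))"
    proof (rule psmooth_compose[OF open_pimg[OF N C(1) Y] psfD[OF f C(1)] o _ h])
      show "psmooth (mdim M) ?Y T (\<lambda>q. c (\<phi> (inv_into D d (fst q), snd q)) j)" for j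
        using psfD[OF s[OF C(1), of j] D] unfolding Y2_def by simp
      fix x t assume xt: "(x, t) \<in> ?Y"
      have 1: "(inv_into D d x, t) \<in> Y'" "\<phi> (inv_into D d x, t) \<in> C" using xt by (auto simp: Y2_def)
      show "(trunc ?m (\<lambda>j. c (\<phi> (inv_into D d (fst (x, t)), snd (x, t))) j), h t) \<in> pimg C c Y"
        unfolding m[OF xt] using 1 sub[OF 1(1)] chart(3)[OF N C(1)] by auto
    qed
    then show "psmooth (mdim M) ?Y T (\<lambda>q. f (\<phi> (inv_into D d (fst q), snd q), h (snd (inv_into D d (fst q), snd q))))"
    proof (rule psmooth_cong[OF o, rotated])
      fix q assume q: "q \<in> ?Y"
      have "\<phi> (inv_into D d (fst q), snd q) \<in> C" using q by (auto simp: Y2_def)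
      then show "f (inv_into C c (fst (trunc ?m (\<lambda>j. c (\<phi> (inv_into D d (fst q), snd q)) j), h (snd q))),
          snd (trunc ?m (\<lambda>j. c (\<phi> (inv_into D d (fst q), snd q)) j), h (snd q))) =
         f (\<phi> (inv_into D d (fst q), snd q), h (snd (inv_into D d (fst q), snd q)))"
        unfolding m[OF q] fst_conv snd_conv using chart(3)[OF N C(1)] by simp
    qed
  qed
  moreover have "p \<in> Y2" "Y' \<inter> Y2 = Y2" using p C(2) by (auto simp: Y2_def)
  ultimately show "\<exists>Y''. openin (prod_topology (mtop M) T) Y'' \<and> p \<in> Y'' \<and> psf M T (Y' \<inter> Y'') (\<lambda>p. f (\<phi> p, h (snd p)))"
    using o2 by auto
qed

lemma psf_Un:
  assumes "manifold M" "openin (prod_topology (mtop M) T) Y1" "openin (prod_topology (mtop M) T) Y2"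
    "psf M T Y1 f" "psf M T Y2 f"
  shows "psf M T (Y1 \<union> Y2) f"
proof (rule psf_local[OF assms(1) openin_Un[OF assms(2,3)]])
  fix p assume "p \<in> Y1 \<union> Y2"
  moreover have "(Y1 \<union> Y2) \<inter> Y1 = Y1" "(Y1 \<union> Y2) \<inter> Y2 = Y2" by auto
  ultimately show "\<exists>Y'. openin (prod_topology (mtop M) T) Y' \<and> p \<in> Y' \<and> psf M T ((Y1 \<union> Y2) \<inter> Y') f"
    using assms by (metis Un_iff)
qed

locale sym_bundle =
  fixes F :: "('m, 't) vbundle" and G :: "'g lgroup" (structure) and a :: "'g \<Rightarrow> 't \<Rightarrow> 't" and b :: "'g \<Rightarrow> 'm \<Rightarrow> 'm"
  assumes vs: "vb_sym F G a b"
begin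

abbreviation "M \<equiv> vbase F"
abbreviation "X \<equiv> pts (vbase F)"
abbreviation "T \<equiv> mtop (lmfd G)"
abbreviation "MT \<equiv> prod_topology (mtop (vbase F)) (mtop (lmfd G))"

lemma vbF: "vector_bundle F" and msym: "mfd_sym M G b" and act: "group_action G (total F) a"
  and sm_a: "smooth_map (vb_space (vb_prod F (lmfd G))) (vb_space F) (\<lambda>(v, g). a g v)"
  and vbm: "\<And>g. g \<in> carrier G \<Longrightarrow> vb_map F F (a g) (b g)"
  using vs by (auto simp: vb_sym_def)

lemma mfM: "manifold M" and lie: "compact_lie_group G" and act0: "group_action G X b"
  and sm_b: "smooth_map (mfd_space (mfd_prod M (lmfd G))) (mfd_space M) (\<lambda>(x, g). b g x)"
  using msym by (auto simp: mfd_sym_def)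

lemma grp: "Group.group G" and mfG: "manifold (lmfd G)" and topG [simp]: "topspace T = carrier G"
  and compG: "compact_space T"
  using lie by (auto simp: compact_lie_group_def)

sublocale grp: Group.group G by (rule grp)

sublocale compact_group G T
proof
  show "continuous_map (prod_topology T T) T (\<lambda>(g, h). g \<otimes> h)" "continuous_map T T (\<lambda>g. inv g)"
    using lie smooth_map_continuous unfolding compact_lie_group_def by force+
  show "second_countable T" using mfG by (simp add: manifold_def)
qed (simp_all add: grp compG)

lemma b_closed [simp]: "g \<in> carrier G \<Longrightarrow> x \<in> X \<Longrightarrow> b g x \<in> X"
  using group_action.element_image[OF act0] by blast

lemma a_closed [simp]: "g \<in> carrier G \<Longrightarrow> v \<in> total F \<Longrightarrow> a g v \<in> total F"
  using group_action.element_image[OF act] by blast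

lemma b_one [simp]: "x \<in> X \<Longrightarrow> b \<one> x = x"
  using group_action.id_eq_one[OF act0] by (metis restrict_apply')

lemma a_one [simp]: "v \<in> total F \<Longrightarrow> a \<one> v = v"
  using group_action.id_eq_one[OF act] by (metis restrict_apply')

lemma b_mult: "x \<in> X \<Longrightarrow> g \<in> carrier G \<Longrightarrow> h \<in> carrier G \<Longrightarrow> b (g \<otimes> h) x = b g (b h x)"
  using group_action.composition_rule[OF act0] by blast

lemma a_mult: "v \<in> total F \<Longrightarrow> g \<in> carrier G \<Longrightarrow> h \<in> carrier G \<Longrightarrow> a (g \<otimes> h) v = a g (a h v)"
  using group_action.composition_rule[OF act] by blast

lemma a_inv: "v \<in> total F \<Longrightarrow> g \<in> carrier G \<Longrightarrow> a (inv g) (a g v) = v"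
  using a_mult[of v "inv g" g] by simp

lemma b_inv: "x \<in> X \<Longrightarrow> g \<in> carrier G \<Longrightarrow> b (inv g) (b g x) = x"
  using b_mult[of x "inv g" g] by simp

lemma vproj_X [simp]: "v \<in> total F \<Longrightarrow> vproj F v \<in> X" by (rule vproj_base[OF vbF])

lemma vproj_a [simp]: "g \<in> carrier G \<Longrightarrow> v \<in> total F \<Longrightarrow> vproj F (a g v) = b g (vproj F v)"
  and a_add: "g \<in> carrier G \<Longrightarrow> v \<in> total F \<Longrightarrow> w \<in> total F \<Longrightarrow> vproj F v = vproj F w \<Longrightarrow> a g (vadd F v w) = vadd F (a g v) (a g w)"
  and a_scale: "g \<in> carrier G \<Longrightarrow> v \<in> total F \<Longrightarrow> a g (vscale F t v) = vscale F t (a g v)"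
  using vbm[of g] by (auto simp: vb_map_def)

lemma cont_b: "continuous_map MT (mtop M) (\<lambda>(x, g). b g x)"
  using smooth_map_continuous[OF sm_b] by simp

text \<open>The open set of point and group element on which the action goes from a trivialization
  over \<open>A\<close> to one over \<open>B\<close>.\<close>

definition moves :: "'m set \<Rightarrow> 'm set \<Rightarrow> ('m \<times> 'g) set" where
  "moves A B = {p. fst p \<in> A \<and> snd p \<in> carrier G \<and> b (snd p) (fst p) \<in> B}"

lemma moves_open:
  assumes "openin (mtop M) A" "openin (mtop M) B" shows "openin MT (moves A B)"
proof -
  have "openin MT {p \<in> topspace MT. (\<lambda>(x, g). b g x) p \<in> B}" by (rule openin_continuous_map_preimage[OF cont_b assms(2)])
  moreover have "openin MT (A \<times> carrier G)" using assms(1) openin_topspace[of T] by (simp add: openin_prod_Times_iff)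
  ultimately have "openin MT ({p \<in> topspace MT. (\<lambda>(x, g). b g x) p \<in> B} \<inter> (A \<times> carrier G))" by blast
  moreover have "{p \<in> topspace MT. (\<lambda>(x, g). b g x) p \<in> B} \<inter> (A \<times> carrier G) = moves A B"
    using openin_subset[OF assms(1)] by (auto simp: moves_def)
  ultimately show ?thesis by simp
qed

lemma psf_moved:
  assumes "openin (mtop M) B" "sf M B f"
  shows "psf M T (moves X B) (\<lambda>p. f (b (snd p) (fst p)))"
proof -
  have "sf (mfd_prod M (lmfd G)) {p \<in> points (mfd_space (mfd_prod M (lmfd G))). (\<lambda>(x, g). b g x) p \<in> B} (f \<circ> (\<lambda>(x, g). b g x))"
    by (rule smooth_mapD[OF sm_b]) (use assms in simp_all)
  moreover have "{p \<in> points (mfd_space (mfd_prod M (lmfd G))). (\<lambda>(x, g). b g x) p \<in> B} = moves X B"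
    by (auto simp: moves_def)
  ultimately have "sf (mfd_prod M (lmfd G)) (moves X B) (\<lambda>p. f (b (snd p) (fst p)))"
    by (simp add: o_def case_prod_unfold)
  then show ?thesis by (rule psf_of_product[OF mfM mfG moves_open[OF openin_topspace assms(1)]])
qed

end

section \<open>The action read in two trivializations\<close>

locale two_triv = sym_bundle F G a b + S: local_triv F D1 P1 \<tau>1 + R: local_triv F D P \<tau>
  for F :: "('m, 't) vbundle" and G :: "'g lgroup" (structure) and a b D1 P1 \<tau>1 D P \<tau>
begin

text \<open>The coordinate \<open>\<tau>\<close> over \<open>D\<close>, composed with the smooth
  action, is a smooth function on the bundle times the group. In the trivialization over
  \<open>D1\<close> it therefore depends on one stage \<open>K\<close>, locally in point and group
  element.\<close>

lemma action_local:
  assumes x: "x \<in> D1" and g: "g \<in> carrier G" and gx: "b g x \<in> D" and i: "i < fdim P k"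
  shows "\<exists>A C c C' c' K O' f. openin MT A \<and> (x, g) \<in> A \<and> A \<subseteq> C \<times> C' \<and> A \<subseteq> moves D1 D \<and>
     (C, c) \<in> atlas M \<and> (C', c') \<in> atlas (lmfd G) \<and>
     openE (mdim M + mdim (lmfd G) + fdim P1 K) O' \<and> smooth_on (mdim M + mdim (lmfd G) + fdim P1 K) O' f \<and>
     (\<forall>v s. v \<in> total F \<longrightarrow> (vproj F v, s) \<in> A \<longrightarrow>
        cat (mdim M + mdim (lmfd G)) (cat (mdim M) (c (vproj F v)) (c' s)) (\<tau>1 v K) \<in> O' \<and>
        \<tau> (a s v) k i = f (cat (mdim M + mdim (lmfd G)) (cat (mdim M) (c (vproj F v)) (c' s)) (\<tau>1 v K)))"
proof -
  define W where "W = {p \<in> points (vb_space (vb_prod F (lmfd G))). (\<lambda>(v, g). a g v) p \<in> restr F D}"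
  have f: "sfun (vb_space (vb_prod F (lmfd G))) W ((\<lambda>e. \<tau> e k i) \<circ> (\<lambda>(v, g). a g v))"
    unfolding W_def by (rule smooth_mapD[OF sm_a _ R.tau_coord_smooth[OF i]]) (simp add: R.restr_open)
  have W: "(v, s) \<in> W \<longleftrightarrow> v \<in> total F \<and> s \<in> carrier G \<and> b s (vproj F v) \<in> D" for v s
    unfolding W_def by auto
  \<comment> \<open>Smoothness is formulated around the projection of a point of the total space;
    the zero vector supplies one over \<open>x\<close>.\<close>
  have z: "vzero F x \<in> total F" "vproj F (vzero F x) = x" using S.zero[OF x] by auto
  have zW: "(vzero F x, g) \<in> W" "vproj F (vzero F x) \<in> D1" "g \<in> topspace T" using z x g gx by (auto simp: W)
  from S.sfun_prodD[OF f zW] z(2) obtain A C c C' c' K O' f0 where A: "openin MT A" "(x, g) \<in> A" "A \<subseteq> C \<times> C'" "A \<subseteq> D1 \<times> UNIV"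
    and C: "(C, c) \<in> atlas M" "(C', c') \<in> atlas (lmfd G)" and
    f0: "openE (mdim M + mdim (lmfd G) + fdim P1 K) O'" "smooth_on (mdim M + mdim (lmfd G) + fdim P1 K) O' f0"
    and e: "\<forall>v s. (v, s) \<in> W \<longrightarrow> (vproj F v, s) \<in> A \<longrightarrow>
        cat (mdim M + mdim (lmfd G)) (cat (mdim M) (c (vproj F v)) (c' s)) (\<tau>1 v K) \<in> O' \<and>
        ((\<lambda>e. \<tau> e k i) \<circ> (\<lambda>(v, g). a g v)) (v, s) = f0 (cat (mdim M + mdim (lmfd G)) (cat (mdim M) (c (vproj F v)) (c' s)) (\<tau>1 v K))"
    by (elim exE conjE) (auto simp only:)
  have o: "openin MT (A \<inter> moves D1 D)" using A(1) moves_open[OF S.oD R.oD] by blast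
  have xA: "(x, g) \<in> A \<inter> moves D1 D" using A(2) x g gx by (auto simp: moves_def)
  have "cat (mdim M + mdim (lmfd G)) (cat (mdim M) (c (vproj F v)) (c' s)) (\<tau>1 v K) \<in> O' \<and>
        \<tau> (a s v) k i = f0 (cat (mdim M + mdim (lmfd G)) (cat (mdim M) (c (vproj F v)) (c' s)) (\<tau>1 v K))"
    if "v \<in> total F" "(vproj F v, s) \<in> A \<inter> moves D1 D" for v s
  proof -
    have "(v, s) \<in> W" using that by (auto simp: W moves_def)
    with e that show ?thesis by simp
  qed
  then show ?thesis using o xA A(3) C f0
    by (intro exI[of _ "A \<inter> moves D1 D"]) blast
qed

lemma a_zero: "x \<in> D1 \<Longrightarrow> g \<in> carrier G \<Longrightarrow> b g x \<in> D \<Longrightarrow> \<tau> (a g (vzero F x)) = (\<lambda>k i. 0)"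
proof -
  assume x: "x \<in> D1" and g: "g \<in> carrier G" and gx: "b g x \<in> D"
  have z: "vzero F x \<in> restr F D1" "vproj F (vzero F x) = x" "\<tau>1 (vzero F x) = (\<lambda>k i. 0)" using S.zero[OF x] by auto
  note sc = S.scale[OF z(1), of 0]
  have "vscale F 0 (vzero F x) = vzero F x" by (rule S.tau_eqI) (use z sc in auto)
  then have "a g (vzero F x) = vscale F 0 (a g (vzero F x))" using a_scale[OF g, of "vzero F x" 0] z(1) by simp
  moreover have "a g (vzero F x) \<in> restr F D" using z g gx by auto
  from R.scale(3)[OF this, of 0] have "\<tau> (vscale F 0 (a g (vzero F x))) = (\<lambda>k i. 0)" by simp
  ultimately show ?thesis by simp
qed

text \<open>A vector that is constant in the fiber coordinates over \<open>D1\<close> is translated.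
  With \<open>p\<close> running through a frame, these are the matrix entries of the action between
  the two trivializations.\<close>

lemma action_coeff_smooth:
  assumes p: "p \<in> lim_points P1" and i: "i < fdim P k"
  shows "psf M T (moves D1 D) (\<lambda>q. \<tau> (a (snd q) (S.fr (fst q) p)) k i)"
proof (rule psf_local[OF mfM moves_open[OF S.oD R.oD]])
  fix q assume "q \<in> moves D1 D"
  then have q: "fst q \<in> D1" "snd q \<in> carrier G" "b (snd q) (fst q) \<in> D" by (auto simp: moves_def)
  from action_local[OF q i] obtain A C c C' c' K O' f where A: "openin MT A" "q \<in> A" "A \<subseteq> C \<times> C'" "A \<subseteq> moves D1 D" and
     C: "(C, c) \<in> atlas M" "(C', c') \<in> atlas (lmfd G)" and
     f: "openE (mdim M + mdim (lmfd G) + fdim P1 K) O'" "smooth_on (mdim M + mdim (lmfd G) + fdim P1 K) O' f"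
     and e: "\<forall>v s. v \<in> total F \<longrightarrow> (vproj F v, s) \<in> A \<longrightarrow>
        cat (mdim M + mdim (lmfd G)) (cat (mdim M) (c (vproj F v)) (c' s)) (\<tau>1 v K) \<in> O' \<and>
        \<tau> (a s v) k i = f (cat (mdim M + mdim (lmfd G)) (cat (mdim M) (c (vproj F v)) (c' s)) (\<tau>1 v K))"
    by (elim exE conjE) (auto simp only: prod.collapse)
  let ?m = "mdim M" and ?n = "mdim (lmfd G)" and ?d = "fdim P1 K"
  let ?Y = "pimg C c A"
  have o: "openin (prodE ?m T) ?Y" by (rule open_pimg[OF mfM C(1) A(1)])
  have sub: "?Y \<subseteq> UNIV \<times> C'" using A(3) by (auto simp: mem_Times_iff)
  have o': "openin (prodE ?m (subtopology T C')) ?Y"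
  proof -
    have "prodE ?m (subtopology T C') = subtopology (prodE ?m T) (UNIV \<times> C')" by (simp add: subtopology_Times)
    then show ?thesis using o sub by (auto simp: openin_subtopology)
  qed
  let ?\<Theta> = "\<lambda>j r. if j < ?m then fst r j else if j < ?m + ?n then c' (snd r) (j - ?m) else p K (j - (?m + ?n))"
  have pE: "p K \<in> Euclid ?d" using p lim_points_iff by blast
  have ee: "trunc (?m + ?n + ?d) (\<lambda>j. ?\<Theta> j r) = cat (?m + ?n) (cat ?m (fst r) (c' (snd r))) (p K) \<and>
      cat (?m + ?n) (cat ?m (fst r) (c' (snd r))) (p K) \<in> O' \<and>
      \<tau> (a (snd r) (S.fr (inv_into C c (fst r)) p)) k i = f (cat (?m + ?n) (cat ?m (fst r) (c' (snd r))) (p K))"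
    if r: "r \<in> ?Y" for r
  proof -
    have "(inv_into C c (fst r), snd r) \<in> A" using r by simp
    moreover from this have "inv_into C c (fst r) \<in> D1" using A(4) by (auto simp: moves_def)
    note fr = S.fr[OF this p]
    moreover have "c (inv_into C c (fst r)) = fst r" using r by (auto simp: f_inv_into_f)
    ultimately have "cat (?m + ?n) (cat ?m (fst r) (c' (snd r))) (p K) \<in> O' \<and>
      \<tau> (a (snd r) (S.fr (inv_into C c (fst r)) p)) k i = f (cat (?m + ?n) (cat ?m (fst r) (c' (snd r))) (p K))"
      using spec[OF spec[OF e, of "S.fr (inv_into C c (fst r)) p"], of "snd r"] by simp
    moreover have "trunc (?m + ?n + ?d) (\<lambda>j. ?\<Theta> j r) = cat (?m + ?n) (cat ?m (fst r) (c' (snd r))) (p K)"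
    proof (rule trunc_cat3[OF _ _ pE])
      show "fst r \<in> Euclid ?m" using r openin_subset[OF chart(2)[OF mfM C(1)]] by auto
      show "c' (snd r) \<in> Euclid ?n" using r A(3) by (intro chart_Euclid[OF mfG C(2)]) auto
    qed
    ultimately show ?thesis by simp
  qed
  have "psmooth ?m ?Y (subtopology T C') (\<lambda>r. f (trunc (?m + ?n + ?d) (\<lambda>j. ?\<Theta> j r)))"
  proof (rule psmooth_of_smooth_on[OF f o'])
    fix j
    have "creal (subtopology T C') (\<lambda>t. c' t (j - ?m))"
      using chart(4)[OF mfG C(2)] by (simp add: continuous_map_Euclidean_space_iff)
    from psmooth_param[OF this]
    show "psmooth ?m ?Y (subtopology T C') (?\<Theta> j)"
      by (cases "j < ?m"; cases "j < ?m + ?n") (auto intro: psmooth_coord psmooth_const)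
  next
    fix x t assume "(x, t) \<in> ?Y"
    from ee[OF this] show "trunc (?m + ?n + ?d) (\<lambda>j. ?\<Theta> j (x, t)) \<in> O'" by simp
  qed
  then have "psmooth ?m ?Y T (\<lambda>r. f (trunc (?m + ?n + ?d) (\<lambda>j. ?\<Theta> j r)))"
    using psmooth_subtopology[OF sub] by blast
  then have "psmooth ?m ?Y T (\<lambda>r. \<tau> (a (snd (inv_into C c (fst r), snd r)) (S.fr (fst (inv_into C c (fst r), snd r)) p)) k i)"
    by (rule psmooth_cong[OF o, rotated]) (use ee in simp)
  then have "psf M T A (\<lambda>q. \<tau> (a (snd q) (S.fr (fst q) p)) k i)"
    by (rule psf_chart[OF mfM C(1) A(1), rotated]) (use A(3) in auto)
  moreover have "moves D1 D \<inter> A = A" using A(4) by blast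
  ultimately show "\<exists>Y'. openin MT Y' \<and> q \<in> Y' \<and> psf M T (moves D1 D \<inter> Y') (\<lambda>q. \<tau> (a (snd q) (S.fr (fst q) p)) k i)"
    using A(1,2) by auto
qed

text \<open>By linearity this says that stage \<open>k\<close> of the translate is a function of
  stage \<open>K\<close> of the vector. As the action need not preserve the stages, \<open>K\<close>
  may have to be larger than \<open>k\<close>.\<close>

definition depends :: "nat \<Rightarrow> nat \<Rightarrow> 'm \<Rightarrow> 'g \<Rightarrow> bool" where
  "depends K k x g \<longleftrightarrow> (\<forall>u\<in>total F. vproj F u = x \<longrightarrow> \<tau>1 u K = (\<lambda>i. 0) \<longrightarrow> \<tau> (a g u) k = (\<lambda>i. 0))"

lemma depends_mono:
  assumes "depends K k x g" "K \<le> K'" "x \<in> D1" shows "depends K' k x g"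
  unfolding depends_def
proof (intro ballI impI)
  fix u assume u: "u \<in> total F" "vproj F u = x" "\<tau>1 u K' = (\<lambda>i. 0)"
  have "u \<in> restr F D1" "vzero F x \<in> restr F D1" using u assms(3) S.zero by auto
  from lim_points_stage[OF S.tau_lim[OF this(1)] S.tau_lim[OF this(2)] _ assms(2)]
  have "\<tau>1 u K = (\<lambda>i. 0)" using u(3) S.zero(3)[OF assms(3)] by simp
  then show "\<tau> (a g u) k = (\<lambda>i. 0)" using assms(1) u by (auto simp: depends_def)
qed

text \<open>For each of the finitely many coordinates of stage \<open>k\<close>,
  \<open>action_local\<close> provides a stage, and the largest of them is taken. A vector that
  vanishes at this stage has the same coordinate representation as the zero vector, whose translate
  is zero.\<close>

lemma depends_point:
  assumes x: "x \<in> D1" and g: "g \<in> carrier G" and gx: "b g x \<in> D"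
  shows "\<exists>A K. openin MT A \<and> (x, g) \<in> A \<and> A \<subseteq> moves D1 D \<and> (\<forall>q\<in>A. depends K k (fst q) (snd q))"
proof -
  have "\<forall>i\<in>{..<fdim P k}. \<exists>AK. openin MT (fst AK) \<and> (x, g) \<in> fst AK \<and> fst AK \<subseteq> moves D1 D \<and>
      (\<forall>v s. v \<in> total F \<longrightarrow> (vproj F v, s) \<in> fst AK \<longrightarrow> \<tau>1 v (snd AK) = (\<lambda>i. 0) \<longrightarrow> \<tau> (a s v) k i = 0)"
  proof
    fix i assume "i \<in> {..<fdim P k}"
    then have i: "i < fdim P k" by simp
    from action_local[OF x g gx i] obtain A C c C' c' K O' f where A: "openin MT A" "(x, g) \<in> A" "A \<subseteq> moves D1 D" and
     e: "\<forall>v s. v \<in> total F \<longrightarrow> (vproj F v, s) \<in> A \<longrightarrow>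
        cat (mdim M + mdim (lmfd G)) (cat (mdim M) (c (vproj F v)) (c' s)) (\<tau>1 v K) \<in> O' \<and>
        \<tau> (a s v) k i = f (cat (mdim M + mdim (lmfd G)) (cat (mdim M) (c (vproj F v)) (c' s)) (\<tau>1 v K))"
      by (elim exE conjE) (auto simp only:)
    have "\<tau> (a s v) k i = 0" if v: "v \<in> total F" "(vproj F v, s) \<in> A" "\<tau>1 v K = (\<lambda>i. 0)" for v s
    proof -
      have y: "vproj F v \<in> D1" "s \<in> carrier G" "b s (vproj F v) \<in> D" using v(2) A(3) by (auto simp: moves_def)
      have "\<tau> (a s v) k i = \<tau> (a s (vzero F (vproj F v))) k i"
        using e[THEN spec, THEN spec, of v s] e[THEN spec, THEN spec, of "vzero F (vproj F v)" s] v S.zero[OF y(1)] by simp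
      then show ?thesis using a_zero[OF y] by simp
    qed
    then show "\<exists>AK. openin MT (fst AK) \<and> (x, g) \<in> fst AK \<and> fst AK \<subseteq> moves D1 D \<and>
      (\<forall>v s. v \<in> total F \<longrightarrow> (vproj F v, s) \<in> fst AK \<longrightarrow> \<tau>1 v (snd AK) = (\<lambda>i. 0) \<longrightarrow> \<tau> (a s v) k i = 0)"
      using A by (intro exI[of _ "(A, K)"]) auto
  qed
  from bchoice[OF this] obtain AK where AK: "\<forall>i\<in>{..<fdim P k}. openin MT (fst (AK i)) \<and> (x, g) \<in> fst (AK i) \<and> fst (AK i) \<subseteq> moves D1 D \<and>
      (\<forall>v s. v \<in> total F \<longrightarrow> (vproj F v, s) \<in> fst (AK i) \<longrightarrow> \<tau>1 v (snd (AK i)) = (\<lambda>i. 0) \<longrightarrow> \<tau> (a s v) k i = 0)" ..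
  define A where "A = (\<Inter>i\<in>{..<fdim P k}. fst (AK i)) \<inter> moves D1 D"
  \<comment> \<open>The element 0 covers the case in which stage \<open>k\<close> is
    zero-dimensional.\<close>
  define K where "K = Max (insert 0 ((\<lambda>i. snd (AK i)) ` {..<fdim P k}))"
  have oA: "openin MT A"
  proof (cases "{..<fdim P k} = {}")
    case True
    then have "A = moves D1 D" unfolding A_def by simp
    then show ?thesis using moves_open[OF S.oD R.oD] by simp
  next
    case False
    then have "openin MT (\<Inter>i\<in>{..<fdim P k}. fst (AK i))" using AK by (intro openin_Inter) auto
    then show ?thesis unfolding A_def using moves_open[OF S.oD R.oD] by blast
  qed
  have "depends K k (fst q) (snd q)" if q: "q \<in> A" for q
    unfolding depends_def
  proof (intro ballI impI ext)
    fix u i assume u: "u \<in> total F" "vproj F u = fst q" "\<tau>1 u K = (\<lambda>i. 0)"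
    have m: "fst q \<in> D1" "snd q \<in> carrier G" "b (snd q) (fst q) \<in> D" using q by (auto simp: A_def moves_def)
    show "\<tau> (a (snd q) u) k i = 0"
    proof (cases "i < fdim P k")
      case True
      have "snd (AK i) \<le> K" unfolding K_def using True by (intro Max_ge) auto
      moreover have r: "u \<in> restr F D1" "vzero F (fst q) \<in> restr F D1" using u m S.zero by auto
      ultimately have "\<tau>1 u (snd (AK i)) = (\<lambda>i. 0)"
        using lim_points_stage[OF S.tau_lim[OF r(1)] S.tau_lim[OF r(2)], of K "snd (AK i)"] u(3) S.zero(3)[OF m(1)] by simp
      moreover have "(vproj F u, snd q) \<in> fst (AK i)" using q True u(2) by (auto simp: A_def)
      ultimately show ?thesis using AK True u(1) by blast
    next
      case False
      have "a (snd q) u \<in> restr F D" using m u by simp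
      from R.tau_Euclid[OF this, of k] False show ?thesis by (simp add: topspace_Euclidean_space)
    qed
  qed
  moreover have "(x, g) \<in> A" using AK x g gx by (auto simp: A_def moves_def)
  moreover have "A \<subseteq> moves D1 D" by (auto simp: A_def)
  ultimately show ?thesis using oA by blast
qed

text \<open>By compactness of the group a single stage suffices.\<close>

lemma depends_uniform:
  assumes x: "x \<in> D1" and Z: "closedin (mtop M) Z" "Z \<subseteq> D"
  shows "\<exists>A K. openin (mtop M) A \<and> x \<in> A \<and> A \<subseteq> D1 \<and>
     (\<forall>y\<in>A. \<forall>g\<in>carrier G. b g y \<in> Z \<longrightarrow> depends K k y g)"
proof -
  have xX: "x \<in> X" using x S.DM by blast
  have "\<exists>AB K. openin (mtop M) (fst AB) \<and> x \<in> fst AB \<and> fst AB \<subseteq> D1 \<and> openin T (snd AB) \<and> g \<in> snd AB \<and>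
     (\<forall>y\<in>fst AB. \<forall>h\<in>snd AB. b h y \<in> Z \<longrightarrow> depends K k y h)" if g: "g \<in> carrier G" for g
  proof (cases "b g x \<in> Z")
    case True
    then have "b g x \<in> D" using Z by blast
    from depends_point[OF x g this] obtain A K where A: "openin MT A" "(x, g) \<in> A" "A \<subseteq> moves D1 D" "\<forall>q\<in>A. depends K k (fst q) (snd q)"
      by blast
    from openin_prod_topology_alt[THEN iffD1, rule_format, OF A(1,2)]
    obtain U V where "openin (mtop M) U" "openin T V" "x \<in> U" "g \<in> V" "U \<times> V \<subseteq> A" by (elim exE conjE)
    moreover have "U \<subseteq> D1"
    proof
      fix y assume "y \<in> U"
      then have "(y, g) \<in> moves D1 D" using \<open>U \<times> V \<subseteq> A\<close> \<open>g \<in> V\<close> A(3) by blast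
      then show "y \<in> D1" by (simp add: moves_def)
    qed
    moreover have "depends K k y h" if "y \<in> U" "h \<in> V" for y h
      using bspec[OF A(4), of "(y, h)"] \<open>U \<times> V \<subseteq> A\<close> that by auto
    ultimately show ?thesis by (intro exI[of _ "(U, V)"] exI[of _ K]) auto
  next
    case False
    \<comment> \<open>Since \<open>Z\<close> is closed, \<open>b h y\<close> stays outside
      \<open>Z\<close> for all nearby pairs, and there the claim is vacuous.\<close>
    have 1: "openin MT (moves D1 (X - Z))" using Z(1) by (intro moves_open S.oD) (auto simp: openin_diff)
    have 2: "(x, g) \<in> moves D1 (X - Z)" using x g False xX by (auto simp: moves_def)
    from openin_prod_topology_alt[THEN iffD1, rule_format, OF 1 2]
    obtain U V where UV: "openin (mtop M) U" "openin T V" "x \<in> U" "g \<in> V" and sub: "U \<times> V \<subseteq> moves D1 (X - Z)"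
      by (elim exE conjE)
    have "y \<in> D1 \<and> b h y \<notin> Z" if "y \<in> U" "h \<in> V" for y h using sub that by (auto simp: moves_def)
    then show ?thesis using UV by (intro exI[of _ "(U, V)"] exI[of _ 0]) auto
  qed
  then have "\<forall>g\<in>carrier G. \<exists>ABK. openin (mtop M) (fst (fst ABK)) \<and> x \<in> fst (fst ABK) \<and> fst (fst ABK) \<subseteq> D1 \<and> openin T (snd (fst ABK)) \<and> g \<in> snd (fst ABK) \<and>
     (\<forall>y\<in>fst (fst ABK). \<forall>h\<in>snd (fst ABK). b h y \<in> Z \<longrightarrow> depends (snd ABK) k y h)" by (metis fst_conv snd_conv)
  from bchoice[OF this] obtain N where N: "\<forall>g\<in>carrier G. openin (mtop M) (fst (fst (N g))) \<and> x \<in> fst (fst (N g)) \<and> fst (fst (N g)) \<subseteq> D1 \<and>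
     openin T (snd (fst (N g))) \<and> g \<in> snd (fst (N g)) \<and>
     (\<forall>y\<in>fst (fst (N g)). \<forall>h\<in>snd (fst (N g)). b h y \<in> Z \<longrightarrow> depends (snd (N g)) k y h)" ..
  have "compactin T (carrier G)" using compG by (simp add: compact_space_def)
  from compactinD[OF this, of "(\<lambda>g. snd (fst (N g))) ` carrier G"] N
  have "\<exists>\<F>. finite \<F> \<and> \<F> \<subseteq> (\<lambda>g. snd (fst (N g))) ` carrier G \<and> carrier G \<subseteq> \<Union>\<F>" by auto
  then obtain \<F> where \<F>: "finite \<F>" "\<F> \<subseteq> (\<lambda>g. snd (fst (N g))) ` carrier G" "carrier G \<subseteq> \<Union>\<F>" by (elim exE conjE)
  from finite_subset_image[OF \<F>(1,2)] obtain J where J0: "J \<subseteq> carrier G" "finite J" "\<F> = (\<lambda>g. snd (fst (N g))) ` J" by (elim exE conjE)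
  have J: "finite J" "J \<subseteq> carrier G" "carrier G \<subseteq> (\<Union>g\<in>J. snd (fst (N g)))" using J0 \<F>(3) by simp_all
  define A where "A = (\<Inter>g\<in>J. fst (fst (N g)))"
  define K where "K = Max (insert 0 ((\<lambda>g. snd (N g)) ` J))"
  have Jne: "J \<noteq> {}" using J(3) grp.one_closed by auto
  have "openin (mtop M) A" unfolding A_def using N J Jne by (intro openin_Inter) auto
  moreover have xA: "x \<in> A" using N J(2) by (auto simp: A_def)
  moreover have AD: "A \<subseteq> D1"
  proof -
    obtain h where h: "h \<in> J" using Jne by blast
    then have "fst (fst (N h)) \<subseteq> D1" using N J(2) by blast
    then show ?thesis using h by (auto simp: A_def)
  qed
  moreover have "depends K k y g" if y: "y \<in> A" "g \<in> carrier G" "b g y \<in> Z" for y g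
  proof -
    obtain h where h: "h \<in> J" "g \<in> snd (fst (N h))" using J(3) y(2) by blast
    have "y \<in> fst (fst (N h))" using y(1) h(1) by (simp add: A_def)
    then have "depends (snd (N h)) k y g" using N h J(2) y(3) by blast
    moreover have "snd (N h) \<le> K" unfolding K_def using J(1) h(1) by (intro Max_ge) auto
    ultimately show ?thesis by (rule depends_mono) (use AD y in auto)
  qed
  ultimately show ?thesis by blast
qed

text \<open>The vector \<open>v\<close> is compared with the combination of frame vectors that has
  the same stage \<open>K\<close>. Their difference vanishes at stage \<open>K\<close>, so its
  translate vanishes at stage \<open>k\<close>, and the combination can be translated term by term.
  The combination is built by induction because addition in the fibers is binary.\<close>

lemma depends_linear:
  assumes d: "depends K k (vproj F v) g" and v: "v \<in> restr F D1" and g: "g \<in> carrier G" "b g (vproj F v) \<in> D"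
  shows "\<tau> (a g v) k i = (\<Sum>j<fdim P1 K. \<tau> (a g (S.fr (vproj F v) (frame P1 K j))) k i * \<tau>1 v K j)"
proof -
  let ?x = "vproj F v"
  have x: "?x \<in> D1" using v by simp
  have fr: "S.fr ?x p \<in> restr F D1" "vproj F (S.fr ?x p) = ?x" "\<tau>1 (S.fr ?x p) = p" if "p \<in> lim_points P1" for p
    using S.fr[OF x that] .
  have im: "w \<in> restr F D1 \<Longrightarrow> vproj F w = ?x \<Longrightarrow> a g w \<in> restr F D \<and> vproj F (a g w) = b g ?x" for w using g by simp
  define s where "s J = (\<lambda>k i. \<Sum>j\<in>J. \<tau>1 v K j * frame P1 K j k i)" for J
  have zl: "(\<lambda>k i. 0) \<in> lim_points P1" using S.tau_lim[of "vzero F ?x"] S.zero[OF x] by simp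
  have fin: "finite J \<Longrightarrow> J \<subseteq> {..<fdim P1 K} \<Longrightarrow> s J \<in> lim_points P1 \<and>
      \<tau> (a g (S.fr ?x (s J))) k i = (\<Sum>j\<in>J. \<tau> (a g (S.fr ?x (frame P1 K j))) k i * \<tau>1 v K j)" for J
  proof (induction J rule: finite_induct)
    case empty
    have "S.fr ?x (\<lambda>k i. 0) = vzero F ?x" using fr[OF zl] S.zero[OF x] by (intro S.tau_eqI) auto
    then show ?case using zl a_zero[OF x g(1,2)] by (simp add: s_def)
  next
    case (insert j J)
    then have IH: "s J \<in> lim_points P1"
      "\<tau> (a g (S.fr ?x (s J))) k i = (\<Sum>j\<in>J. \<tau> (a g (S.fr ?x (frame P1 K j))) k i * \<tau>1 v K j)" by auto
    have f: "frame P1 K j \<in> lim_points P1" using frame(1)[OF S.ps] insert by auto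
    have sl: "s (insert j J) = (\<lambda>k i. 1 * s J k i + \<tau>1 v K j * frame P1 K j k i)" using insert by (auto simp: s_def fun_eq_iff)
    have sJ: "s (insert j J) \<in> lim_points P1" unfolding sl by (rule lim_points_linear[OF S.ps IH(1) f])
    note fj = fr[OF f] and fs = fr[OF IH(1)]
    note sc = S.scale[OF fj(1), of "\<tau>1 v K j"]
    have ad: "S.fr ?x (s (insert j J)) = vadd F (S.fr ?x (s J)) (vscale F (\<tau>1 v K j) (S.fr ?x (frame P1 K j)))"
    proof (rule S.tau_eqI)
      have e: "vproj F (S.fr ?x (s J)) = vproj F (vscale F (\<tau>1 v K j) (S.fr ?x (frame P1 K j)))" using fs sc fj by simp
      note A = S.add[OF fs(1) sc(1) e]
      show "vadd F (S.fr ?x (s J)) (vscale F (\<tau>1 v K j) (S.fr ?x (frame P1 K j))) \<in> restr F D1" by (rule A(1))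
      show "vproj F (S.fr ?x (s (insert j J))) = vproj F (vadd F (S.fr ?x (s J)) (vscale F (\<tau>1 v K j) (S.fr ?x (frame P1 K j))))"
        using A(2) fs(2) fr(2)[OF sJ] by simp
      show "\<tau>1 (S.fr ?x (s (insert j J))) = \<tau>1 (vadd F (S.fr ?x (s J)) (vscale F (\<tau>1 v K j) (S.fr ?x (frame P1 K j))))"
        unfolding A(3) fr(3)[OF sJ] fs(3) sc(3) fj(3) by (simp add: sl)
    qed (rule fr(1)[OF sJ])
    have "a g (S.fr ?x (s (insert j J))) = vadd F (a g (S.fr ?x (s J))) (vscale F (\<tau>1 v K j) (a g (S.fr ?x (frame P1 K j))))"
      unfolding ad using fs fj sc by (subst a_add[OF g(1)]) (auto simp: a_scale[OF g(1)])
    moreover have "\<tau> (vadd F (a g (S.fr ?x (s J))) (vscale F (\<tau>1 v K j) (a g (S.fr ?x (frame P1 K j))))) =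
        (\<lambda>k i. \<tau> (a g (S.fr ?x (s J))) k i + \<tau>1 v K j * \<tau> (a g (S.fr ?x (frame P1 K j))) k i)"
      using im[OF fs(1,2)] im[OF fj(1,2)] R.scale[of "a g (S.fr ?x (frame P1 K j))" "\<tau>1 v K j"] by (subst R.add(3)) auto
    ultimately show ?case using sJ IH(2) insert by simp
  qed
  let ?J = "{..<fdim P1 K}"
  have sJ: "s ?J \<in> lim_points P1" "\<tau> (a g (S.fr ?x (s ?J))) k i = (\<Sum>j\<in>?J. \<tau> (a g (S.fr ?x (frame P1 K j))) k i * \<tau>1 v K j)"
    using fin[of ?J] by auto
  note w = fr[OF sJ(1)]
  have sK: "s ?J K = \<tau>1 v K"
  proof -
    have "s ?J K = (\<lambda>i. \<Sum>j<fdim P1 K. \<tau>1 v K j * unit_vec j i)"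
      unfolding s_def using frame(2)[OF S.ps] by (intro ext sum.cong) auto
    then show ?thesis using unit_vec_sum[of "fdim P1 K" "\<tau>1 v K"] trunc_eq[OF S.tau_Euclid[OF v]] by simp
  qed
  let ?u = "vadd F v (vscale F (-1) (S.fr ?x (s ?J)))"
  note sc = S.scale[OF w(1), of "-1"]
  have e: "vproj F v = vproj F (vscale F (-1) (S.fr ?x (s ?J)))" using sc w by simp
  note u = S.add[OF v sc(1) e]
  have "\<tau>1 ?u K = (\<lambda>i. 0)" unfolding u(3) sc(3) w(3) sK by simp
  then have "\<tau> (a g ?u) k = (\<lambda>i. 0)" using d u by (auto simp: depends_def)
  moreover have "a g ?u = vadd F (a g v) (vscale F (-1) (a g (S.fr ?x (s ?J))))"
    using v w sc e by (subst a_add[OF g(1)]) (auto simp: a_scale[OF g(1)])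
  moreover have "\<tau> (vadd F (a g v) (vscale F (-1) (a g (S.fr ?x (s ?J))))) = (\<lambda>k i. \<tau> (a g v) k i + (-1) * \<tau> (a g (S.fr ?x (s ?J))) k i)"
    using im[OF v refl] im[OF w(1,2)] R.scale[of "a g (S.fr ?x (s ?J))" "-1"] by (subst R.add(3)) auto
  ultimately have "\<tau> (a g v) k i + (-1) * \<tau> (a g (S.fr ?x (s ?J))) k i = 0" by (metis (no_types))
  then show ?thesis using sJ(2) by simp
qed

end

section \<open>Smooth matrices\<close>

lemma sf_prod: "finite J \<Longrightarrow> (\<And>j. j \<in> J \<Longrightarrow> sf M W (f j)) \<Longrightarrow> sf M W (\<lambda>x. \<Prod>j\<in>J. f j x)"
  by (induction J rule: finite_induct) (auto simp del: sf_iff intro: sf_const sf_mult)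

lemma sf_det:
  assumes "\<And>i j. i < n \<Longrightarrow> j < n \<Longrightarrow> sf M W (A i j)"
  shows "sf M W (\<lambda>x. Determinant.det (mat n n (\<lambda>(i, j). A i j x)))"
proof -
  have e: "Determinant.det (mat n n (\<lambda>(i, j). A i j x)) =
      (\<Sum>p | p permutes {0..<n}. signof p * (\<Prod>i\<in>{0..<n}. A i (p i) x))" for x
    by (subst det_def'[of _ n]) (auto intro!: sum.cong prod.cong)
  show ?thesis unfolding e
    by (intro sf_sum sf_mult sf_const sf_prod assms finite_permutations finite_atLeastLessThan) (auto)
qed

lemma sf_adj:
  assumes A: "\<And>i j. i < n \<Longrightarrow> j < n \<Longrightarrow> sf M W (A i j)" and ij: "i < n" "j < n"
  shows "sf M W (\<lambda>x. adj_mat (mat n n (\<lambda>(i, j). A i j x)) $$ (i, j))"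
proof -
  let ?A = "\<lambda>x. mat n n (\<lambda>(i, j). A i j x)"
  have e: "adj_mat (?A x) $$ (i, j) = (-1) ^ (j + i) *
      Determinant.det (mat (n - 1) (n - 1) (\<lambda>(k, l). A (insert_index j k) (insert_index i l) x))" for x
  proof -
    have "mat_delete (?A x) j i = mat (n - 1) (n - 1) (\<lambda>(k, l). A (insert_index j k) (insert_index i l) x)"
      using ij by (intro eq_matI) (auto simp: mat_delete_def insert_index_def)
    then show ?thesis using ij by (simp add: adj_mat_def cofactor_def)
  qed
  show ?thesis unfolding e
    by (intro sf_mult sf_const sf_det A) (use ij in \<open>auto simp: insert_index_def\<close>)
qed

text \<open>The adjugate serves as an inverse whose entries are polynomials in the entries of the matrix.\<close>

lemma adj_cancel:
  fixes A :: "nat \<Rightarrow> nat \<Rightarrow> real" and n :: nat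
  assumes sym: "\<And>i j. A i j = A j i"
  defines "m \<equiv> mat n n (\<lambda>(i, j). A i j)"
  shows "(\<Sum>i<n. \<Sum>j<n. adj_mat m $$ (i, j) * (\<Sum>k<n. a k * A k i) * t j) = Determinant.det m * (\<Sum>k<n. a k * t k)"
    and "(\<Sum>i<n. \<Sum>j<n. adj_mat m $$ (i, j) * t i * (\<Sum>k<n. a k * A k j)) = Determinant.det m * (\<Sum>k<n. a k * t k)"
proof -
  have m: "m \<in> carrier_mat n n" by (simp add: m_def)
  note ad = adj_mat[OF m]
  have 1: "(\<Sum>i<n. A k i * adj_mat m $$ (i, j)) = (if k = j then Determinant.det m else 0)" if "k < n" "j < n" for k j
    using arg_cong[OF ad(2), of "\<lambda>B. B $$ (k, j)"] that ad(1) m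
    by (simp add: scalar_prod_def m_def lessThan_atLeast0)
  have 2: "(\<Sum>j<n. adj_mat m $$ (i, j) * A k j) = (if k = i then Determinant.det m else 0)" if "k < n" "i < n" for k i
    using arg_cong[OF ad(3), of "\<lambda>B. B $$ (i, k)"] that ad(1) m
    by (simp add: scalar_prod_def m_def lessThan_atLeast0 sym[of k])
  have "(\<Sum>i<n. \<Sum>j<n. adj_mat m $$ (i, j) * (\<Sum>k<n. a k * A k i) * t j) =
      (\<Sum>i<n. \<Sum>j<n. \<Sum>k<n. a k * t j * (A k i * adj_mat m $$ (i, j)))"
    by (simp add: sum_distrib_left sum_distrib_right mult_ac)
  also have "\<dots> = (\<Sum>j<n. \<Sum>k<n. a k * t j * (\<Sum>i<n. A k i * adj_mat m $$ (i, j)))"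
    unfolding sum_distrib_left by (subst sum.swap) (intro sum.cong refl sum.swap)
  also have "\<dots> = (\<Sum>j<n. \<Sum>k<n. if k = j then Determinant.det m * (a k * t j) else 0)"
    by (intro sum.cong refl) (simp add: 1)
  finally show "(\<Sum>i<n. \<Sum>j<n. adj_mat m $$ (i, j) * (\<Sum>k<n. a k * A k i) * t j) = Determinant.det m * (\<Sum>k<n. a k * t k)"
    by (simp add: sum_distrib_left)
  have "(\<Sum>i<n. \<Sum>j<n. adj_mat m $$ (i, j) * t i * (\<Sum>k<n. a k * A k j)) =
      (\<Sum>i<n. \<Sum>j<n. \<Sum>k<n. a k * t i * (adj_mat m $$ (i, j) * A k j))"
    by (simp add: sum_distrib_left mult_ac)
  also have "\<dots> = (\<Sum>i<n. \<Sum>k<n. a k * t i * (\<Sum>j<n. adj_mat m $$ (i, j) * A k j))"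
    unfolding sum_distrib_left by (intro sum.cong refl sum.swap)
  also have "\<dots> = (\<Sum>i<n. \<Sum>k<n. if k = i then Determinant.det m * (a k * t i) else 0)"
    by (intro sum.cong refl) (simp add: 2)
  finally show "(\<Sum>i<n. \<Sum>j<n. adj_mat m $$ (i, j) * t i * (\<Sum>k<n. a k * A k j)) = Determinant.det m * (\<Sum>k<n. a k * t k)"
    by (simp add: sum_distrib_left)
qed

text \<open>A nonzero vector in the kernel of the matrix would make the quadratic form
  vanish.\<close>

lemma det_nonzero:
  fixes A :: "nat \<Rightarrow> nat \<Rightarrow> real"
  assumes "\<And>z i. i < n \<Longrightarrow> z i \<noteq> 0 \<Longrightarrow> (\<Sum>i<n. \<Sum>j<n. A i j * z i * z j) \<noteq> 0"
  shows "Determinant.det (mat n n (\<lambda>(i, j). A i j)) \<noteq> 0"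
proof
  let ?A = "mat n n (\<lambda>(i, j). A i j)"
  assume "Determinant.det ?A = 0"
  then obtain v where v: "v \<in> carrier_vec n" "v \<noteq> 0\<^sub>v n" "?A *\<^sub>v v = 0\<^sub>v n"
    using det_0_iff_vec_prod_zero[of ?A n] by auto
  then obtain i where i: "i < n" "vec_index v i \<noteq> 0" by (auto simp: vec_eq_iff)
  have "(\<Sum>j<n. A i j * vec_index v i * vec_index v j) = 0" if "i < n" for i
  proof -
    have "(\<Sum>j<n. A i j * vec_index v i * vec_index v j) = vec_index v i * (\<Sum>j<n. A i j * vec_index v j)"
      by (simp add: sum_distrib_left mult_ac)
    then show ?thesis using arg_cong[OF v(3), of "\<lambda>u. vec_index u i"] that v(1) by (simp add: scalar_prod_def lessThan_atLeast0)
  qed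
  then have "(\<Sum>i<n. \<Sum>j<n. A i j * vec_index v i * vec_index v j) = 0" by simp
  then show False using assms[OF i(1), of "\<lambda>i. vec_index v i"] i(2) by blast
qed

section \<open>Averaging over the group\<close>

context sym_bundle
begin

definition avg :: "('g \<Rightarrow> real) \<Rightarrow> real" where
  "avg = (SOME I. mean_on T I \<and> (\<forall>f x. creal T f \<longrightarrow> x \<in> carrier G \<longrightarrow> I (\<lambda>y. f (y \<otimes> x)) = I f) \<and>
     (\<forall>f. creal T f \<longrightarrow> (\<forall>x\<in>carrier G. 0 \<le> f x) \<longrightarrow> 0 < f \<one> \<longrightarrow> 0 < I f))"

lemma
  shows avg_mean: "mean_on T avg"
    and avg_right: "creal T f \<Longrightarrow> x \<in> carrier G \<Longrightarrow> avg (\<lambda>y. f (y \<otimes> x)) = avg f"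
    and avg_pos: "creal T f \<Longrightarrow> (\<And>x. x \<in> carrier G \<Longrightarrow> 0 \<le> f x) \<Longrightarrow> 0 < f \<one> \<Longrightarrow> 0 < avg f"
  using someI_ex[OF haar_exists, folded avg_def] by auto

text \<open>Carries a linear identity that holds for each group element over to the means.
  Continuity of the combined function is delivered along with it, since invariance and positivity of
  the mean are available only for continuous functions.\<close>

lemma avg_combine:
  assumes "\<And>j. j \<in> J \<Longrightarrow> creal T (f j)" "finite J"
    and "\<And>h. h \<in> carrier G \<Longrightarrow> (\<Sum>j\<in>J. c j * f j h) = \<phi> h"
  shows "(\<Sum>j\<in>J. c j * avg (f j)) = avg \<phi>" "creal T \<phi>"
proof -
  have s: "creal T (\<lambda>h. \<Sum>j\<in>J. c j * f j h)"
    using assms by (intro continuous_map_sum continuous_map_real_mult) auto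
  show "creal T \<phi>" by (rule continuous_map_eq[OF s]) (use assms in auto)
  have "(\<Sum>j\<in>J. c j * avg (f j)) = (\<Sum>j\<in>J. avg (\<lambda>h. c j * f j h))"
    by (intro sum.cong refl) (simp add: mean_cmult[OF avg_mean] assms)
  also have "\<dots> = avg (\<lambda>h. \<Sum>j\<in>J. c j * f j h)"
    by (rule mean_sum[OF avg_mean, symmetric]) (use assms in \<open>auto intro!: continuous_map_real_mult\<close>)
  also have "\<dots> = avg \<phi>" by (rule mean_cong[OF avg_mean s]) (use assms in auto)
  finally show "(\<Sum>j\<in>J. c j * avg (f j)) = avg \<phi>" .
qed

lemma moves_cover:
  assumes "A \<subseteq> X" "Z \<subseteq> B" shows "moves A B \<union> moves A (X - Z) = A \<times> carrier G"
  using assms by (auto simp: moves_def)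

text \<open>The function \<open>f\<close> is meaningful only where the translated point lies in the
  trivialization over \<open>B\<close>. The factor \<open>\<kappa>\<close> at the translated point
  vanishes off the closed set \<open>Z\<close>, so extension by zero produces a regular function on
  all of \<open>A \<times> G\<close>, ready for averaging.\<close>

lemma psf_cutoff:
  assumes A: "openin (mtop M) A" and B: "openin (mtop M) B" and Z: "closedin (mtop M) Z" "Z \<subseteq> B"
    and \<kappa>: "sf M X \<kappa>" "\<And>y. y \<in> X - Z \<Longrightarrow> \<kappa> y = 0" and f: "psf M T (moves A B) f"
  shows "psf M T (A \<times> topspace T) (\<lambda>p. \<kappa> (b (snd p) (fst p)) * f p)"
proof -
  have oZ: "openin (mtop M) (X - Z)" using Z(1) by (simp add: openin_diff)
  have AX: "A \<subseteq> X" using openin_subset[OF A] .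
  have "psf M T (moves A B) (\<lambda>p. \<kappa> (b (snd p) (fst p)) * f p)"
  proof (intro psf_mult f)
    show "psf M T (moves A B) (\<lambda>p. \<kappa> (b (snd p) (fst p)))"
      by (rule psf_subset[OF psf_moved[OF openin_topspace \<kappa>(1)]]) (use AX openin_subset[OF B] in \<open>auto simp: moves_def\<close>)
  qed
  moreover have "psf M T (moves A (X - Z)) (\<lambda>p. \<kappa> (b (snd p) (fst p)) * f p)"
    by (rule psf_cong[OF mfM moves_open[OF A oZ] _ psf_const[of _ _ _ 0]]) (auto simp: moves_def \<kappa>(2))
  ultimately have "psf M T (moves A B \<union> moves A (X - Z)) (\<lambda>p. \<kappa> (b (snd p) (fst p)) * f p)"
    by (intro psf_Un mfM moves_open A B oZ)
  then show ?thesis using moves_cover[OF AX Z(2)] by simp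
qed

lemma moved_cont:
  assumes "sf M X \<kappa>" "x \<in> X" shows "creal T (\<lambda>h. \<kappa> (b h x))"
proof -
  have "X \<times> topspace T \<subseteq> moves X X" by (auto simp: moves_def)
  from psf_subset[OF psf_moved[OF openin_topspace assms(1)] this]
  have "psf M T (X \<times> topspace T) (\<lambda>p. \<kappa> (b (snd p) (fst p)))" .
  from psf_section[OF mfM openin_topspace this assms(2)] show ?thesis by simp
qed

end

section \<open>Frames and their translates\<close>

locale self_triv = two_triv F G a b D P \<tau> D P \<tau>
  for F :: "('m, 't) vbundle" and G :: "'g lgroup" (structure) and a b D P \<tau>
begin

definition fv :: "nat \<Rightarrow> nat \<Rightarrow> 'm \<Rightarrow> 't" where "fv K j x = S.fr x (frame P K j)"

abbreviation d :: "nat \<Rightarrow> nat" where "d \<equiv> fdim P"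

lemma fv:
  assumes "x \<in> D" "j < d K"
  shows "fv K j x \<in> restr F D" "fv K j x \<in> total F" "vproj F (fv K j x) = x" "\<tau> (fv K j x) = frame P K j"
  using S.fr[OF assms(1) frame(1)[OF S.ps assms(2)]] by (auto simp: fv_def)

lemma expand:
  assumes "depends K k x g" "v \<in> total F" "vproj F v = x" "x \<in> D" "g \<in> carrier G" "b g x \<in> D"
  shows "\<tau> (a g v) k i = (\<Sum>j<d K. \<tau> (a g (fv K j x)) k i * \<tau> v K j)"
  using depends_linear[of K k v g i] assms by (simp add: fv_def)

lemma depends_one: "k \<le> K \<Longrightarrow> x \<in> D \<Longrightarrow> depends K k x \<one>"
proof -
  assume k: "k \<le> K" and x: "x \<in> D"
  have "depends k k x \<one>" by (auto simp: depends_def)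
  then show ?thesis using k x by (rule depends_mono)
qed

text \<open>The numbers \<open>frame P K j k i\<close> form the matrix of the linear surjection from
  stage \<open>K\<close> onto stage \<open>k\<close>; the formula is \<open>expand\<close> for the
  unit of the group.\<close>

lemma expand_one:
  assumes "k \<le> K" "v \<in> total F" "vproj F v = x" "x \<in> D"
  shows "\<tau> v k i = (\<Sum>j<d K. frame P K j k i * \<tau> v K j)"
proof -
  have xX: "x \<in> X" using assms(4) S.DM by blast
  have "\<tau> v k i = (\<Sum>j<d K. \<tau> (a \<one> (fv K j x)) k i * \<tau> v K j)"
    using expand[OF depends_one[OF assms(1,4)] assms(2,3,4) grp.one_closed] assms(2,4) xX by simp
  also have "\<dots> = (\<Sum>j<d K. frame P K j k i * \<tau> v K j)"
    using fv[OF assms(4)] by (intro sum.cong) auto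
  finally show ?thesis .
qed

lemma fv_smooth: "j < d K \<Longrightarrow> i < d k \<Longrightarrow> psf M T (moves D D) (\<lambda>q. \<tau> (a (snd q) (fv K j (fst q))) k i)"
  unfolding fv_def by (rule action_coeff_smooth[OF frame(1)[OF S.ps]])

text \<open>Substitution of \<open>b g x\<close> for the point and of \<open>inv g\<close> for the
  group element in \<open>fv_smooth\<close>: the frame at the translated point is moved back to the
  fiber over \<open>x\<close>.\<close>

lemma fv_smooth_inv:
  assumes "j < d K" "i < d k"
  shows "psf M T (moves D D) (\<lambda>q. \<tau> (a (inv (snd q)) (fv K j (b (snd q) (fst q)))) k i)"
proof -
  have oD: "openin MT (moves D D)" by (rule moves_open[OF S.oD S.oD])
  have "psf M T (moves D D) (\<lambda>q. (\<lambda>q. \<tau> (a (snd q) (fv K j (fst q))) k i) (b (snd q) (fst q), inv (snd q)))"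
  proof (rule psf_compose[OF mfM mfM oD fv_smooth[OF assms] oD])
    show "continuous_map (subtopology MT (moves D D)) (mtop M) (\<lambda>q. b (snd q) (fst q))"
      using continuous_map_from_subtopology[OF cont_b] by (simp add: case_prod_unfold)
    show "continuous_map T T (\<lambda>g. inv g)" by (rule inv)
    show "psf M T {p \<in> moves D D. b (snd p) (fst p) \<in> C} (\<lambda>p. c (b (snd p) (fst p)) j)" if C: "(C, c) \<in> atlas M" for C c j
      by (rule psf_subset[OF psf_moved[OF chart(1)[OF mfM C] sf_coord[OF mfM C]]]) (use S.DM in \<open>auto simp: moves_def\<close>)
    show "(b (snd p) (fst p), inv (snd p)) \<in> moves D D" if "p \<in> moves D D" for p
    proof -
      have "fst p \<in> X" using that S.DM by (auto simp: moves_def)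
      then show ?thesis using that b_inv[of "fst p" "snd p"] by (auto simp: moves_def)
    qed
  qed
  then show ?thesis by simp
qed

end

lemma sum_product_pairs:
  fixes p :: "'i \<Rightarrow> 'a :: semiring_0"
  shows "(\<Sum>i\<in>I. p i) * (\<Sum>j\<in>J. q j) = (\<Sum>ij\<in>I \<times> J. p (fst ij) * q (snd ij))"
  by (simp add: sum_product sum.cartesian_product case_prod_unfold)

text \<open>\<open>Z\<close> contains the support of the cutoff \<open>\<kappa>\<close>, and
  \<open>L\<close> is a stage that determines stage \<open>k0\<close> under every group element
  moving a point of \<open>Z\<close> into \<open>Z\<close>. Other group elements receive weight
  zero. The coordinate to be recovered is \<open>\<tau> v k0 i0\<close>; \<open>recover\<close>
  supplies the data.\<close>

locale averaging = self_triv F G a b D P \<tau>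
  for F :: "('m, 't) vbundle" and G :: "'g lgroup" (structure) and a b D P \<tau> +
  fixes Z :: "'m set" and \<kappa> :: "'m \<Rightarrow> real" and k0 i0 L :: nat
  assumes Z: "closedin (mtop (vbase F)) Z" "Z \<subseteq> D"
    and \<kappa>: "sf (vbase F) (pts (vbase F)) \<kappa>" "\<And>y. 0 \<le> \<kappa> y" "\<And>y. y \<in> pts (vbase F) - Z \<Longrightarrow> \<kappa> y = 0"
    and dep: "\<And>y g. y \<in> Z \<Longrightarrow> g \<in> carrier G \<Longrightarrow> b g y \<in> Z \<Longrightarrow> depends L k0 y g"
    and i0: "i0 < fdim P k0"
begin

lemma ZX: "y \<in> Z \<Longrightarrow> y \<in> D" "y \<in> Z \<Longrightarrow> y \<in> X" "y \<in> D \<Longrightarrow> y \<in> X"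
  using Z(2) S.DM by blast+

lemma sf_extend:
  assumes "sf M D f" shows "sf M X (\<lambda>x. \<kappa> x * f x)"
proof -
  have o: "openin (mtop M) (X - Z)" using Z(1) by (simp add: openin_diff)
  have "sf M D (\<lambda>x. \<kappa> x * f x)" using S.DM by (intro sf_mult assms sf_subset[OF \<kappa>(1)])
  moreover have "sf M (X - Z) (\<lambda>x. \<kappa> x * f x)"
    by (rule sf_cong[OF mfM o _ sf_const[of _ _ 0]]) (simp add: \<kappa>(3))
  moreover have "D \<union> (X - Z) = X" using Z(2) S.DM by blast
  ultimately show ?thesis using sf_Un[OF mfM S.oD o] by metis
qed

text \<open>The functionals \<open>\<lambda>v. \<tau> v k i\<close> on the fiber over \<open>x\<close> are translated to the fiber over \<open>b g x\<close>, where they are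
  given by their values on the frame of stage \<open>L\<close>; \<open>eta l g x\<close> are the translates of this frame. In this way \<open>gam\<close> is
  a \<open>G\<close>-invariant inner product on functionals.\<close>

definition eta :: "nat \<Rightarrow> 'g \<Rightarrow> 'm \<Rightarrow> 't" where "eta l g x = a (inv g) (fv L l (b g x))"

definition gam0 :: "nat \<Rightarrow> nat \<Rightarrow> nat \<Rightarrow> nat \<Rightarrow> 'm \<Rightarrow> 'g \<Rightarrow> real" where
  "gam0 k i k' i' x g = \<kappa> (b g x) * (\<Sum>l<d L. \<tau> (eta l g x) k i * \<tau> (eta l g x) k' i')"

definition gam :: "nat \<Rightarrow> nat \<Rightarrow> nat \<Rightarrow> nat \<Rightarrow> 'm \<Rightarrow> real" where "gam k i k' i' x = avg (gam0 k i k' i' x)"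

lemma eta:
  assumes "x \<in> X" "g \<in> carrier G" "b g x \<in> D" "l < d L"
  shows "eta l g x \<in> total F" "vproj F (eta l g x) = x"
  using fv[OF assms(3,4)] assms b_inv by (auto simp: eta_def)

lemma gam0_away: "x \<in> X \<Longrightarrow> g \<in> carrier G \<Longrightarrow> b g x \<notin> Z \<Longrightarrow> gam0 k i k' i' x g = 0"
  by (simp add: gam0_def \<kappa>(3))

lemma gam0_smooth: "i < d k \<Longrightarrow> i' < d k' \<Longrightarrow> psf M T (D \<times> topspace T) (\<lambda>p. gam0 k i k' i' (fst p) (snd p))"
  unfolding gam0_def eta_def
  by (rule psf_cutoff[OF S.oD S.oD Z \<kappa>(1,3)]) (auto intro!: psf_sum psf_mult fv_smooth_inv)

lemma gam0_cont: "i < d k \<Longrightarrow> i' < d k' \<Longrightarrow> x \<in> D \<Longrightarrow> creal T (gam0 k i k' i' x)"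
  using psf_section[OF mfM S.oD gam0_smooth] by simp

lemma gam_smooth: "i < d k \<Longrightarrow> i' < d k' \<Longrightarrow> sf M D (gam k i k' i')"
  unfolding gam_def[abs_def] using sf_mean[OF mfM compG avg_mean S.oD gam0_smooth] by simp

definition Gam :: "'m \<Rightarrow> real mat" where "Gam x = mat (d L) (d L) (\<lambda>(i, j). gam L i L j x)"

lemma gam_commute: "gam L i L j x = gam L j L i x"
  unfolding gam_def gam0_def by (simp add: mult.commute)

text \<open>The quadratic form of \<open>Gam x\<close> at \<open>z\<close> is the mean of
  \<open>\<phi>\<close>, a nonnegative weighted sum of squares. At the unit the translated frame is
  the frame itself, so \<open>\<phi>\<close> has the value \<open>\<kappa> x\<close> times the
  squared length of \<open>z\<close> there, and strict positivity of the mean applies.\<close>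

lemma Gam_det:
  assumes x: "x \<in> Z" "\<kappa> x > 0" shows "Determinant.det (Gam x) \<noteq> 0"
  unfolding Gam_def
proof (rule det_nonzero)
  fix z i assume i: "i < d L" "z i \<noteq> (0::real)"
  note x' = ZX(1,2)[OF x(1)]
  define \<phi> where "\<phi> g = \<kappa> (b g x) * (\<Sum>l<d L. (\<Sum>i<d L. z i * \<tau> (eta l g x) L i)\<^sup>2)" for g
  have e: "(\<Sum>ij\<in>{..<d L} \<times> {..<d L}. (z (fst ij) * z (snd ij)) * gam0 L (fst ij) L (snd ij) x g) = \<phi> g" for g
  proof -
    have "(\<Sum>ij\<in>{..<d L} \<times> {..<d L}. (z (fst ij) * z (snd ij)) * gam0 L (fst ij) L (snd ij) x g) =
        \<kappa> (b g x) * (\<Sum>ij\<in>{..<d L} \<times> {..<d L}. \<Sum>l<d L. (z (fst ij) * \<tau> (eta l g x) L (fst ij)) * (z (snd ij) * \<tau> (eta l g x) L (snd ij)))"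
      by (simp add: gam0_def sum_distrib_left mult_ac)
    then show ?thesis unfolding \<phi>_def power2_eq_square
      by (subst (asm) sum.swap) (simp add: sum_product sum.cartesian_product case_prod_unfold)
  qed
  note comb = avg_combine[of "{..<d L} \<times> {..<d L}" "\<lambda>ij. gam0 L (fst ij) L (snd ij) x" "\<lambda>ij. z (fst ij) * z (snd ij)" \<phi>]
  have c: "creal T \<phi>" by (rule comb(2)) (use gam0_cont x' e in auto)
  have "eta l \<one> x = fv L l x" if "l < d L" for l using x' fv[OF x'(1) that] by (simp add: eta_def)
  then have "(\<Sum>i<d L. z i * \<tau> (eta l \<one> x) L i) = z l" if "l < d L" for l
    using fv(4)[OF x'(1) that] frame(2)[OF S.ps that] that
    by (simp add: unit_vec_def if_distrib[of "\<lambda>u. _ * u"] cong: if_cong)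
  then have "\<phi> \<one> = \<kappa> x * (\<Sum>l<d L. (z l)\<^sup>2)" using x' by (simp add: \<phi>_def)
  moreover have "0 < (\<Sum>l<d L. (z l)\<^sup>2)" by (rule sum_pos2[of _ i]) (use i in auto)
  ultimately have "0 < avg \<phi>" by (intro avg_pos[OF c]) (use x \<kappa>(2) in \<open>auto simp: \<phi>_def intro!: mult_nonneg_nonneg sum_nonneg\<close>)
  moreover have "(\<Sum>ij\<in>{..<d L} \<times> {..<d L}. (z (fst ij) * z (snd ij)) * gam L (fst ij) L (snd ij) x) = avg \<phi>"
    unfolding gam_def by (rule comb(1)) (use gam0_cont x' e in auto)
  moreover have "(\<Sum>i<d L. \<Sum>j<d L. gam L i L j x * z i * z j) =
      (\<Sum>ij\<in>{..<d L} \<times> {..<d L}. (z (fst ij) * z (snd ij)) * gam L (fst ij) L (snd ij) x)"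
    by (simp add: sum.cartesian_product case_prod_unfold mult_ac)
  ultimately show "(\<Sum>i<d L. \<Sum>j<d L. gam L i L j x * z i * z j) \<noteq> 0" by simp
qed

text \<open>One determinant will come from the product of \<open>Gam\<close> with its adjugate, the
  other is put into \<open>bc\<close> to make the total weight nonnegative, whatever the sign of the
  determinant. The mean \<open>cst\<close> of the weights over an orbit is the normalizing
  factor.\<close>

definition wt :: "'m \<Rightarrow> real" where "wt x = \<kappa> x * (Determinant.det (Gam x))\<^sup>2"
definition cst :: "'m \<Rightarrow> real" where "cst x = avg (\<lambda>g. wt (b g x))"
definition B0 :: "'m set" where "B0 = {x \<in> X. \<kappa> x > 0}"

lemma det_smooth: "sf M D (\<lambda>x. Determinant.det (Gam x))"
  unfolding Gam_def by (rule sf_det[OF gam_smooth])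

lemma wt_smooth: "sf M X wt"
  unfolding wt_def[abs_def] power2_eq_square by (intro sf_extend sf_mult det_smooth)

lemma B0: "openin (mtop M) B0" "x \<in> B0 \<Longrightarrow> x \<in> Z" "x \<in> B0 \<Longrightarrow> \<kappa> x > 0"
proof -
  have "creal (mtop M) \<kappa>" using sf_continuous[OF mfM openin_topspace \<kappa>(1)] by simp
  from openin_continuous_map_preimage[OF this, of "{0<..}"] show "openin (mtop M) B0" by (simp add: B0_def)
  show "x \<in> B0 \<Longrightarrow> x \<in> Z" "x \<in> B0 \<Longrightarrow> \<kappa> x > 0" using \<kappa>(3)[of x] by (auto simp: B0_def)
qed

lemma cst_pos: "x \<in> B0 \<Longrightarrow> cst x > 0"
  unfolding cst_def
  by (rule avg_pos[OF moved_cont[OF wt_smooth]])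
    (use \<kappa>(2) Gam_det[OF B0(2,3)] B0(3) ZX(2)[OF B0(2)] in \<open>auto simp: wt_def zero_less_mult_iff\<close>)

lemma cst_smooth: "sf M B0 cst"
proof -
  have "B0 \<times> topspace T \<subseteq> moves X X" by (auto simp: moves_def B0_def)
  from psf_subset[OF psf_moved[OF openin_topspace wt_smooth] this]
  have "psf M T (B0 \<times> topspace T) (\<lambda>p. wt (b (snd p) (fst p)))" .
  from sf_mean[OF mfM compG avg_mean B0(1) this] show ?thesis by (simp add: cst_def[abs_def])
qed

text \<open>The vector representing the functional \<open>\<lambda>v. \<tau> v k0 i0\<close>, up to the factor \<open>cst\<close>.\<close>

definition wco :: "'m \<Rightarrow> nat \<Rightarrow> nat \<Rightarrow> real" where
  "wco x k i = (if i < d k then inverse (cst x) * gam k0 i0 k i x else 0)"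

definition wvec :: "'m \<Rightarrow> 't" where "wvec x = S.fr x (wco x)"

text \<open>For each group element the last two indices of \<open>gam0\<close> are coordinates of a
  vector, and \<open>expand_one\<close> computes those of stage \<open>k\<close> from those of stage
  \<open>K\<close>. The relation is linear and survives the mean, so the numbers for different
  stages fit together.\<close>

lemma wco_stage:
  assumes x: "x \<in> D" and k: "k \<le> K"
  shows "wco x k = (\<lambda>i. \<Sum>j<d K. wco x K j * frame P K j k i)"
proof
  fix i
  show "wco x k i = (\<Sum>j<d K. wco x K j * frame P K j k i)"
  proof (cases "i < d k")
    case True
    have "(\<Sum>j\<in>{..<d K}. frame P K j k i * gam k0 i0 K j x) = gam k0 i0 k i x"
      unfolding gam_def
    proof (rule avg_combine(1))
      fix g assume g: "g \<in> carrier G"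
      show "(\<Sum>j<d K. frame P K j k i * gam0 k0 i0 K j x g) = gam0 k0 i0 k i x g"
      proof (cases "b g x \<in> Z")
        case True
        have "\<tau> (eta l g x) k i = (\<Sum>j<d K. frame P K j k i * \<tau> (eta l g x) K j)" if "l < d L" for l
          by (rule expand_one[OF k eta[OF ZX(3)[OF x] g ZX(1)[OF True] that] x])
        moreover have "(\<Sum>j<d K. frame P K j k i * gam0 k0 i0 K j x g) =
            \<kappa> (b g x) * (\<Sum>l<d L. \<tau> (eta l g x) k0 i0 * (\<Sum>j<d K. frame P K j k i * \<tau> (eta l g x) K j))"
          unfolding gam0_def sum_distrib_left by (subst sum.swap) (simp add: mult_ac)
        ultimately show ?thesis by (simp add: gam0_def)
      qed (use gam0_away ZX(3)[OF x] g in simp)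
    qed (use gam0_cont i0 x in auto)
    then have "wco x k i = inverse (cst x) * (\<Sum>j\<in>{..<d K}. frame P K j k i * gam k0 i0 K j x)" using True by (simp add: wco_def)
    then show ?thesis by (simp add: wco_def sum_distrib_left mult_ac)
  next
    case False
    have "frame P K j k i = 0" if "j < d K" for j
      using S.tau_Euclid[OF fv(1)[OF x that], of k] fv(4)[OF x that] False by (simp add: topspace_Euclidean_space)
    then show ?thesis using False by (simp add: wco_def)
  qed
qed

lemma lim_points_sum: "finite J \<Longrightarrow> (\<And>j. j \<in> J \<Longrightarrow> f j \<in> lim_points P) \<Longrightarrow> (\<lambda>k i. \<Sum>j\<in>J. c j * f j k i) \<in> lim_points P"
proof (induction J rule: finite_induct)
  case empty
  have "fmap P k (\<lambda>i. 0) = (\<lambda>i. 0)" for k using fmap_linear[OF S.ps, of "\<lambda>i. 0" k "\<lambda>i. 0" 0 0] Euclid_zero by simp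
  then show ?case by (simp add: lim_points_iff Euclid_zero)
next
  case (insert j J)
  then have "(\<lambda>k i. c j * f j k i + 1 * (\<Sum>j\<in>J. c j * f j k i)) \<in> lim_points P" by (intro lim_points_linear[OF S.ps]) auto
  then show ?case using insert by simp
qed

lemma wco_lim: assumes x: "x \<in> D" shows "wco x \<in> lim_points P"
  unfolding lim_points_iff
proof (intro allI conjI)
  fix k
  \<comment> \<open>A combination of frame vectors of stage \<open>Suc k\<close> is a point of the
    limit and agrees with \<open>wco x\<close> up to stage \<open>Suc k\<close>. This gives the
    compatibility of the stages \<open>k\<close> and \<open>Suc k\<close>.\<close>
  define p where "p k' i = (\<Sum>j<d (Suc k). wco x (Suc k) j * frame P (Suc k) j k' i)" for k' i
  have "p \<in> lim_points P" unfolding p_def[abs_def] by (rule lim_points_sum) (use frame(1)[OF S.ps] in auto)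
  moreover have "p k' = wco x k'" if "k' \<le> Suc k" for k' using wco_stage[OF x that] by (simp add: p_def[abs_def])
  ultimately show "wco x k \<in> Euclid (d k)" "fmap P k (wco x (Suc k)) = wco x k"
    unfolding lim_points_iff by (metis le_SucI order_refl)+
qed

lemma wvec:
  assumes "x \<in> D" shows "wvec x \<in> restr F D" "wvec x \<in> total F" "vproj F (wvec x) = x" "\<tau> (wvec x) = wco x"
  using S.fr[OF assms wco_lim[OF assms]] by (auto simp: wvec_def)

lemma wvec_smooth: "sf M B0 (\<lambda>x. \<tau> (wvec x) k i)"
proof (cases "i < d k")
  case True
  have "sf M B0 (\<lambda>x. inverse (cst x) * gam k0 i0 k i x)"
    by (intro sf_mult sf_inverse[OF mfM] cst_smooth sf_subset[OF gam_smooth[OF i0 True]])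
      (use cst_pos B0(2) ZX(1) in force)+
  then show ?thesis by (rule sf_cong[OF mfM B0(1), rotated]) (use True wvec(4) ZX(1)[OF B0(2)] in \<open>simp add: wco_def\<close>)
next
  case False
  show ?thesis by (rule sf_cong[OF mfM B0(1) _ sf_const[of _ _ 0]]) (use False wvec(4) ZX(1)[OF B0(2)] in \<open>simp add: wco_def\<close>)
qed

text \<open>The invariance of \<open>gam\<close> in coordinates: the translate of
  \<open>wvec x\<close> by \<open>h\<close> represents, with respect to \<open>gam\<close> at
  \<open>b h x\<close>, the functional moved along \<open>h\<close>. The factors in front of
  \<open>gam L k L i\<close> are the values of this functional on the frame at \<open>b h x\<close>,
  up to normalization.\<close>

lemma wvec_moved:
  assumes x: "x \<in> Z" and h: "h \<in> carrier G" and hx: "b h x \<in> Z" and i: "i < d L"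
  shows "\<tau> (a h (wvec x)) L i =
    (\<Sum>k<d L. (inverse (cst x) * \<tau> (a (inv h) (fv L k (b h x))) k0 i0) * gam L k L i (b h x))"
proof -
  note x' = ZX(1,2)[OF x] and hx' = ZX(1,2)[OF hx] and w = wvec[OF ZX(1)[OF x]]
  \<comment> \<open>Here stage \<open>L\<close> of the translate is needed, which \<open>dep\<close>
    does not control. Point and group element are fixed, so some stage \<open>K\<close> for this
    single pair is enough.\<close>
  from depends_point[OF x'(1) h hx'(1), of L] obtain K where K: "depends K L x h" by fastforce
  define \<phi> where "\<phi> g = \<kappa> (b g x) * (\<Sum>l<d L. \<tau> (eta l g x) k0 i0 * \<tau> (a h (eta l g x)) L i)" for g
  have 1: "(\<Sum>j<d K. \<tau> (a h (fv K j x)) L i * gam0 k0 i0 K j x g) = \<phi> g" if g: "g \<in> carrier G" for g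
  proof (cases "b g x \<in> Z")
    case True
    have "\<tau> (a h (eta l g x)) L i = (\<Sum>j<d K. \<tau> (a h (fv K j x)) L i * \<tau> (eta l g x) K j)" if "l < d L" for l
      by (rule expand[OF K eta[OF x'(2) g ZX(1)[OF True] that] x'(1) h hx'(1)])
    moreover have "(\<Sum>j<d K. \<tau> (a h (fv K j x)) L i * gam0 k0 i0 K j x g) =
        \<kappa> (b g x) * (\<Sum>l<d L. \<tau> (eta l g x) k0 i0 * (\<Sum>j<d K. \<tau> (a h (fv K j x)) L i * \<tau> (eta l g x) K j))"
      unfolding gam0_def sum_distrib_left by (subst sum.swap) (simp add: mult_ac)
    ultimately show ?thesis by (simp add: \<phi>_def)
  qed (use gam0_away x' g in \<open>simp add: \<phi>_def \<kappa>(3)\<close>)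
  \<comment> \<open>The frame translate for \<open>g \<otimes> h\<close> at \<open>x\<close> is the
    one for \<open>g\<close> at \<open>b h x\<close>, moved back by \<open>h\<close>. This shift of
    the argument is absorbed by the right invariance of the mean.\<close>
  have 2: "(\<Sum>k<d L. \<tau> (a (inv h) (fv L k (b h x))) k0 i0 * gam0 L k L i (b h x) g) = \<phi> (g \<otimes> h)" if g: "g \<in> carrier G" for g
  proof (cases "b g (b h x) \<in> Z")
    case True
    note e = eta[OF hx'(2) g ZX(1)[OF True]]
    have e2: "eta l (g \<otimes> h) x = a (inv h) (eta l g (b h x))" if "l < d L" for l
      using fv[OF ZX(1)[OF True] that] g h x' a_mult[of _ "inv h" "inv g"]
      by (simp add: eta_def b_mult grp.inv_mult_group)
    have e3: "a h (eta l (g \<otimes> h) x) = eta l g (b h x)" if "l < d L" for l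
      using e2[OF that] a_mult[of "eta l g (b h x)" h "inv h"] e[OF that] h by simp
    have "b (inv h) (b h x) = x" using b_inv x' h by simp
    then have "\<tau> (a (inv h) (eta l g (b h x))) k0 i0 =
        (\<Sum>k<d L. \<tau> (a (inv h) (fv L k (b h x))) k0 i0 * \<tau> (eta l g (b h x)) L k)" if "l < d L" for l
      using dep[OF hx, of "inv h"] x x' h hx' by (intro expand e[OF that]) auto
    moreover have "(\<Sum>k<d L. \<tau> (a (inv h) (fv L k (b h x))) k0 i0 * gam0 L k L i (b h x) g) =
        \<kappa> (b g (b h x)) * (\<Sum>l<d L. (\<Sum>k<d L. \<tau> (a (inv h) (fv L k (b h x))) k0 i0 * \<tau> (eta l g (b h x)) L k) * \<tau> (eta l g (b h x)) L i)"
      unfolding gam0_def sum_distrib_left sum_distrib_right by (subst sum.swap) (simp add: mult_ac)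
    ultimately show ?thesis using g h x' by (simp add: \<phi>_def b_mult e3 flip: e2)
  qed (use gam0_away hx' x' g h in \<open>simp add: \<phi>_def b_mult \<kappa>(3)\<close>)
  have "\<tau> (a h (wvec x)) L i = inverse (cst x) * (\<Sum>j\<in>{..<d K}. \<tau> (a h (fv K j x)) L i * gam k0 i0 K j x)"
    using expand[OF K w(2,3) x'(1) h hx'(1)] w(4) by (simp add: wco_def sum_distrib_left mult_ac)
  also have "(\<Sum>j\<in>{..<d K}. \<tau> (a h (fv K j x)) L i * gam k0 i0 K j x) = avg \<phi>"
    unfolding gam_def by (rule avg_combine(1)) (use gam0_cont i0 x' 1 in auto)
  also have "avg \<phi> = avg (\<lambda>g. \<phi> (g \<otimes> h))"
  proof (rule avg_right[OF _ h, symmetric])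
    show "creal T \<phi>" by (rule avg_combine(2)[of "{..<d K}"]) (use gam0_cont i0 x' 1 in auto)
  qed
  also have "\<dots> = (\<Sum>k\<in>{..<d L}. \<tau> (a (inv h) (fv L k (b h x))) k0 i0 * gam L k L i (b h x))"
    unfolding gam_def by (rule avg_combine(1)[symmetric]) (use gam0_cont i hx' 2 in auto)
  finally show ?thesis by (simp add: sum_distrib_left mult.assoc)
qed

text \<open>Where \<open>Gam\<close> is invertible this is its inverse times the square of the
  determinant, hence up to a factor the inner product on vectors dual to \<open>gam\<close>. It
  remains smooth where the determinant vanishes.\<close>

definition bc :: "nat \<Rightarrow> nat \<Rightarrow> 'm \<Rightarrow> real" where
  "bc i j x = Determinant.det (Gam x) * adj_mat (Gam x) $$ (i, j)"

lemma bc_smooth: "i < d L \<Longrightarrow> j < d L \<Longrightarrow> sf M D (bc i j)"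
  unfolding bc_def[abs_def] Gam_def by (intro sf_mult det_smooth[unfolded Gam_def] sf_adj gam_smooth)

definition bf :: "'t \<Rightarrow> 't \<Rightarrow> 'g \<Rightarrow> real" where
  "bf u w g = \<kappa> (b g (vproj F u)) * (\<Sum>i<d L. \<Sum>j<d L. bc i j (b g (vproj F u)) * \<tau> (a g u) L i * \<tau> (a g w) L j)"

definition form :: "'t \<Rightarrow> 't \<Rightarrow> real" where "form u w = avg (bf u w)"

lemma bf_away: "g \<in> carrier G \<Longrightarrow> vproj F u \<in> X \<Longrightarrow> b g (vproj F u) \<notin> Z \<Longrightarrow> bf u w g = 0"
  by (simp add: bf_def \<kappa>(3))

text \<open>Over \<open>A\<close> a single stage \<open>K\<close> of the trivialization
  \<open>\<tau>1\<close> controls all relevant translates. The form is then determined by its values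
  on the frame of this stage, and those are means of functions that are smooth in the point because
  of the cutoff.\<close>

lemma quad:
  assumes T1: "(D1, P1, \<tau>1) \<in> vtriv F" and A: "openin (mtop M) A" "A \<subseteq> D1"
    and dp: "\<And>y g. y \<in> A \<Longrightarrow> g \<in> carrier G \<Longrightarrow> b g y \<in> Z \<Longrightarrow> two_triv.depends F a \<tau>1 \<tau> K L y g"
  defines "e \<equiv> \<lambda>j x. local_triv.fr F D1 \<tau>1 x (frame P1 K j)"
  shows "i < fdim P1 K \<Longrightarrow> j < fdim P1 K \<Longrightarrow> sf M A (\<lambda>x. form (e i x) (e j x))"
    and "u \<in> total F \<Longrightarrow> w \<in> total F \<Longrightarrow> vproj F u = x \<Longrightarrow> vproj F w = x \<Longrightarrow> x \<in> A \<Longrightarrow>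
       form u w = (\<Sum>i<fdim P1 K. \<Sum>j<fdim P1 K. form (e i x) (e j x) * \<tau>1 u K i * \<tau>1 w K j)"
    and "u \<in> total F \<Longrightarrow> w \<in> total F \<Longrightarrow> vproj F u = x \<Longrightarrow> vproj F w = x \<Longrightarrow> x \<in> A \<Longrightarrow> creal T (bf u w)"
proof -
  interpret Y: two_triv F G a b D1 P1 \<tau>1 D P \<tau>
    by (intro two_triv.intro sym_bundle.intro vs local_triv.intro vbF T1 S.tr)
  let ?d = "fdim P1 K"
  have e: "e j x \<in> restr F D1" "e j x \<in> total F" "vproj F (e j x) = x" "\<tau>1 (e j x) = frame P1 K j" if "x \<in> A" "j < ?d" for j x
    using Y.S.fr[of x "frame P1 K j"] frame(1)[OF Y.S.ps that(2)] that A by (auto simp: e_def)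
  have mv: "moves A D \<subseteq> moves D1 D" using A(2) by (auto simp: moves_def)
  have AX: "A \<subseteq> X" using openin_subset[OF A(1)] .
  have sm: "psf M T (A \<times> topspace T) (\<lambda>p. bf (e i (fst p)) (e j (fst p)) (snd p))" if ij: "i < ?d" "j < ?d" for i j
  proof -
    have r: "psf M T (moves A D) (\<lambda>p. \<tau> (a (snd p) (e i (fst p))) L l)" if "l < d L" "i < ?d" for l i
      unfolding e_def by (rule psf_subset[OF Y.action_coeff_smooth[OF frame(1)[OF Y.S.ps that(2)] that(1)] mv])
    have c: "psf M T (moves A D) (\<lambda>p. bc k l (b (snd p) (fst p)))" if "k < d L" "l < d L" for k l
      by (rule psf_subset[OF psf_moved[OF S.oD bc_smooth[OF that]]]) (use AX in \<open>auto simp: moves_def\<close>)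
    have "psf M T (moves A D) (\<lambda>p. \<Sum>k<d L. \<Sum>l<d L. bc k l (b (snd p) (fst p)) *
        \<tau> (a (snd p) (e i (fst p))) L k * \<tau> (a (snd p) (e j (fst p))) L l)"
      by (intro psf_sum psf_mult r c ij) auto
    from psf_cutoff[OF A(1) S.oD Z \<kappa>(1,3) this] show ?thesis
    proof (rule psf_cong[OF mfM, rotated 2])
      show "openin MT (A \<times> topspace T)" using A(1) openin_topspace[of T] by (simp add: openin_prod_Times_iff)
    qed (use e ij in \<open>auto simp: bf_def\<close>)
  qed
  show "sf M A (\<lambda>x. form (e i x) (e j x))" if "i < ?d" "j < ?d"
    using sf_mean[OF mfM compG avg_mean A(1) sm[OF that]] by (simp add: form_def)
  assume uw: "u \<in> total F" "w \<in> total F" "vproj F u = x" "vproj F w = x" and x: "x \<in> A"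
  have xX: "x \<in> X" using x AX by blast
  have c: "creal T (\<lambda>g. bf (e i x) (e j x) g)" if "i < ?d" "j < ?d" for i j
    using psf_section[OF mfM A(1) sm[OF that] x] by simp
  have eq: "(\<Sum>ij\<in>{..<?d} \<times> {..<?d}. (\<tau>1 u K (fst ij) * \<tau>1 w K (snd ij)) * bf (e (fst ij) x) (e (snd ij) x) g) = bf u w g"
    if g: "g \<in> carrier G" for g
  proof (cases "b g x \<in> Z")
    case False
    then have "bf u w g = 0" using bf_away[OF g, of u w] uw xX by simp
    moreover have "bf (e i x) (e j x) g = 0" if "i < ?d" "j < ?d" for i j
      using bf_away[OF g, of "e i x" "e j x"] e[OF x that(1)] xX False by simp
    ultimately show ?thesis by (auto intro!: sum.neutral)
  next
    case True
    have lin: "\<tau> (a g v) L l = (\<Sum>i<?d. \<tau>1 v K i * \<tau> (a g (e i x)) L l)" if v: "v \<in> total F" "vproj F v = x" for v l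
    proof -
      have "v \<in> restr F D1" using v x A(2) by auto
      then show ?thesis using Y.depends_linear[of K L v g l] dp[OF x g True] g ZX(1)[OF True] v(2) by (simp add: e_def mult.commute)
    qed
    let ?c = "\<lambda>i j k l. \<tau>1 u K i * \<tau>1 w K j * (\<kappa> (b g x) * (bc k l (b g x) * \<tau> (a g (e i x)) L k * \<tau> (a g (e j x)) L l))"
    have "bf u w g = \<kappa> (b g x) * (\<Sum>k<d L. \<Sum>l<d L. bc k l (b g x) * ((\<Sum>i<?d. \<tau>1 u K i * \<tau> (a g (e i x)) L k) * (\<Sum>j<?d. \<tau>1 w K j * \<tau> (a g (e j x)) L l)))"
      unfolding bf_def uw(3) lin[OF uw(1,3)] lin[OF uw(2,4)] mult.assoc ..
    also have "\<dots> = (\<Sum>k<d L. \<Sum>l<d L. \<Sum>ij\<in>{..<?d} \<times> {..<?d}. ?c (fst ij) (snd ij) k l)"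
      by (simp only: sum_product_pairs) (simp add: sum_distrib_left mult_ac)
    also have "\<dots> = (\<Sum>ij\<in>{..<?d} \<times> {..<?d}. \<Sum>k<d L. \<Sum>l<d L. ?c (fst ij) (snd ij) k l)"
      by (simp only: sum.swap[of _ "{..<?d} \<times> {..<?d}"])
    also have "\<dots> = (\<Sum>ij\<in>{..<?d} \<times> {..<?d}. (\<tau>1 u K (fst ij) * \<tau>1 w K (snd ij)) * bf (e (fst ij) x) (e (snd ij) x) g)"
      by (intro sum.cong refl) (use e[OF x] in \<open>auto simp: bf_def sum_distrib_left\<close>)
    finally show ?thesis ..
  qed
  note comb = avg_combine[of "{..<?d} \<times> {..<?d}" "\<lambda>ij. bf (e (fst ij) x) (e (snd ij) x)" "\<lambda>ij. \<tau>1 u K (fst ij) * \<tau>1 w K (snd ij)" "bf u w"]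
  show "creal T (bf u w)" by (rule comb(2)) (use c eq in auto)
  have "form u w = (\<Sum>ij\<in>{..<?d} \<times> {..<?d}. \<tau>1 u K (fst ij) * \<tau>1 w K (snd ij) * avg (bf (e (fst ij) x) (e (snd ij) x)))"
    unfolding form_def by (rule comb(1)[symmetric]) (use c eq in auto)
  then show "form u w = (\<Sum>i<?d. \<Sum>j<?d. form (e i x) (e j x) * \<tau>1 u K i * \<tau>1 w K j)"
    by (simp add: form_def sum.cartesian_product case_prod_unfold mult_ac)
qed

lemma quad_exists:
  assumes T1: "(D1, P1, \<tau>1) \<in> vtriv F" and x: "x \<in> D1"
  shows "\<exists>A K. openin (mtop M) A \<and> x \<in> A \<and> A \<subseteq> D1 \<and>
     (\<forall>y\<in>A. \<forall>g\<in>carrier G. b g y \<in> Z \<longrightarrow> two_triv.depends F a \<tau>1 \<tau> K L y g)"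
proof -
  interpret Y: two_triv F G a b D1 P1 \<tau>1 D P \<tau>
    by (intro two_triv.intro sym_bundle.intro vs local_triv.intro vbF T1 S.tr)
  from Y.depends_uniform[OF x Z] show ?thesis .
qed

lemma bf_cont:
  assumes "u \<in> total F" "w \<in> total F" "vproj F u = vproj F w"
  shows "creal T (bf u w)"
proof -
  have "vproj F u \<in> X" using assms by simp
  from triv_exists[OF vbF this] obtain D1 P1 \<tau>1 where T1: "(D1, P1, \<tau>1) \<in> vtriv F" "vproj F u \<in> D1" by blast
  from quad_exists[OF T1] obtain A K where A: "openin (mtop M) A" "vproj F u \<in> A" "A \<subseteq> D1"
     "\<forall>y\<in>A. \<forall>g\<in>carrier G. b g y \<in> Z \<longrightarrow> two_triv.depends F a \<tau>1 \<tau> K L y g" by (elim exE conjE)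
  show ?thesis
    by (rule quad(3)[OF T1(1) A(1,3) _ assms(1,2) refl assms(3)[symmetric] A(2), of K]) (use A(4) in blast)
qed

lemma form_smooth: "sfun (vb_space F) (total F) (\<lambda>v. form v v)"
proof (rule sfun_quadratic[OF vbF _ order_refl])
  fix D1 P1 \<tau>1 x assume T1: "(D1, P1, \<tau>1) \<in> vtriv F" "x \<in> D1"
  from quad_exists[OF T1] obtain A K where A: "openin (mtop M) A" "x \<in> A" "A \<subseteq> D1"
     "\<forall>y\<in>A. \<forall>g\<in>carrier G. b g y \<in> Z \<longrightarrow> two_triv.depends F a \<tau>1 \<tau> K L y g" by (elim exE conjE)
  have dp: "two_triv.depends F a \<tau>1 \<tau> K L y g" if "y \<in> A" "g \<in> carrier G" "b g y \<in> Z" for y g using A(4) that by blast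
  note Q = quad[OF T1(1) A(1,3) dp]
  let ?Q = "\<lambda>i j x. form (local_triv.fr F D1 \<tau>1 x (frame P1 K i)) (local_triv.fr F D1 \<tau>1 x (frame P1 K j))"
  have "\<forall>i<fdim P1 K. \<forall>j<fdim P1 K. sf M A (?Q i j)" using Q(1) by blast
  moreover have "\<forall>v\<in>restr F A. form v v = (\<Sum>i<fdim P1 K. \<Sum>j<fdim P1 K. ?Q i j (vproj F v) * \<tau>1 v K i * \<tau>1 v K j)"
    using Q(2) by auto
  ultimately show "\<exists>A K Q. openin (mtop M) A \<and> x \<in> A \<and> A \<subseteq> D1 \<and> (\<forall>i<fdim P1 K. \<forall>j<fdim P1 K. sf M A (Q i j)) \<and>
       (\<forall>v\<in>restr F A. form v v = (\<Sum>i<fdim P1 K. \<Sum>j<fdim P1 K. Q i j (vproj F v) * \<tau>1 v K i * \<tau>1 v K j))"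
    using A(1-3) by (intro exI[of _ A] exI[of _ K] exI[of _ ?Q]) blast
qed

text \<open>The integrand for the translate by \<open>h\<close> at \<open>g\<close> is the integrand
  for \<open>v\<close> at \<open>g \<otimes> h\<close>, so right invariance of the mean gives the
  claim.\<close>

lemma form_invariant:
  assumes v: "v \<in> total F" and h: "h \<in> carrier G" shows "form (a h v) (a h v) = form v v"
proof -
  have "form v v = avg (\<lambda>g. bf v v (g \<otimes> h))" unfolding form_def by (rule avg_right[OF bf_cont h, symmetric]) (use v in auto)
  also have "\<dots> = avg (bf (a h v) (a h v))"
  proof (rule mean_cong[OF avg_mean, symmetric])
    show "creal T (bf (a h v) (a h v))" by (rule bf_cont) (use v h in auto)
    show "bf (a h v) (a h v) g = bf v v (g \<otimes> h)" if "g \<in> topspace T" for g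
      using that v h by (simp add: bf_def a_mult b_mult)
  qed
  finally show ?thesis by (simp add: form_def)
qed

text \<open>In the difference the pure squares cancel and the two mixed terms remain. For each
  \<open>g\<close> the coordinates of the translate of \<open>wvec x\<close> are a row vector times
  \<open>Gam\<close>, which the adjugate cancels up to the determinant. What is left is the
  coordinate of \<open>v\<close>, the same for every \<open>g\<close>, times the weight
  \<open>wt\<close>; the mean of the weights cancels against \<open>cst\<close>.\<close>

lemma recover_local:
  assumes x: "x \<in> B0" and v: "v \<in> total F" "vproj F v = x"
  defines "u \<equiv> \<lambda>s. vadd F (wvec x) (vscale F s v)"
  shows "form (u t) (u t) - form (u (- t)) (u (- t)) = 4 * t * \<tau> v k0 i0"
proof -
  note xZ = B0(2)[OF x]
  note x' = ZX(1,2)[OF xZ] and w = wvec[OF ZX(1)[OF xZ]]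
  have vD: "v \<in> restr F D" using v x' by simp
  note sc = S.scale[OF vD]
  have u: "u s \<in> total F" "vproj F (u s) = x" for s
    using S.add[OF w(1) sc(1)[of s]] w sc v by (auto simp: u_def)
  have au: "\<tau> (a g (u s)) L i = \<tau> (a g (wvec x)) L i + s * \<tau> (a g v) L i" if g: "g \<in> carrier G" "b g x \<in> D" for g s i
  proof -
    have r: "a g (wvec x) \<in> restr F D" "a g v \<in> restr F D" using g w v by auto
    have "a g (u s) = vadd F (a g (wvec x)) (vscale F s (a g v))"
      unfolding u_def using g w v sc[of s] by (subst a_add) (auto simp: a_scale)
    then show ?thesis using S.add(3)[OF r(1) S.scale(1)[OF r(2)]] S.scale[OF r(2), of s] g w v by simp
  qed
  \<comment> \<open>A difference of two means, written as a signed sum over a two-element set so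
    that \<open>avg_combine\<close> applies.\<close>
  have "(\<Sum>c\<in>{True, False}. (if c then 1 else -1) * avg (if c then bf (u t) (u t) else bf (u (- t)) (u (- t)))) =
      avg (\<lambda>g. (4 * t * inverse (cst x) * \<tau> v k0 i0) * wt (b g x))"
  proof (rule avg_combine(1))
    show "creal T (if c then bf (u t) (u t) else bf (u (- t)) (u (- t)))" for c
      using bf_cont[OF u(1) u(1)] u(2) by simp
    fix g assume g: "g \<in> carrier G"
    have "bf (u t) (u t) g - bf (u (- t)) (u (- t)) g = (4 * t * inverse (cst x) * \<tau> v k0 i0) * wt (b g x)"
    proof (cases "b g x \<in> Z")
      case False
      then show ?thesis using bf_away[OF g, of "u _"] u x' g by (simp add: wt_def \<kappa>(3))
    next
      case True
      note y = ZX(1,2)[OF True]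
      define s where "s i = \<tau> (a g (wvec x)) L i" for i
      define r where "r i = \<tau> (a g v) L i" for i
      \<comment> \<open>The values on the frame at \<open>b g x\<close> of the functional to be
        recovered, moved along \<open>g\<close>, and normalized by \<open>cst\<close> at the
        original point \<open>x\<close>.\<close>
      define m where "m k = inverse (cst x) * \<tau> (a (inv g) (fv L k (b g x))) k0 i0" for k
      let ?a = "\<lambda>i j. adj_mat (Gam (b g x)) $$ (i, j)" and ?d = "Determinant.det (Gam (b g x))"
      have s: "s i = (\<Sum>k<d L. m k * gam L k L i (b g x))" if "i < d L" for i
        unfolding s_def m_def by (rule wvec_moved[OF xZ g True that])
      have bi: "b (inv g) (b g x) = x" using b_inv x' g by simp
      have "\<tau> v k0 i0 = \<tau> (a (inv g) (a g v)) k0 i0" using a_inv v(1) g by simp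
      also have "\<dots> = (\<Sum>k<d L. \<tau> (a (inv g) (fv L k (b g x))) k0 i0 * r k)"
        unfolding r_def using dep[OF True, of "inv g"] bi xZ x' y g v by (intro expand) auto
      finally have mr: "(\<Sum>k<d L. m k * r k) = inverse (cst x) * \<tau> v k0 i0"
        by (simp add: m_def sum_distrib_left mult.assoc)
      note ac = adj_cancel[where A = "\<lambda>i j. gam L i L j (b g x)" and n = "d L" and a = m and t = r, OF gam_commute, folded Gam_def]
      have 1: "(\<Sum>i<d L. \<Sum>j<d L. ?a i j * s i * r j) = ?d * (inverse (cst x) * \<tau> v k0 i0)"
        using ac(1) s unfolding mr by simp
      have 2: "(\<Sum>i<d L. \<Sum>j<d L. ?a i j * r i * s j) = ?d * (inverse (cst x) * \<tau> v k0 i0)"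
        using ac(2) s unfolding mr by simp
      define q where "q t = (\<Sum>i<d L. \<Sum>j<d L. ?a i j * (s i + t * r i) * (s j + t * r j))" for t
      have bu: "bf (u t) (u t) g = \<kappa> (b g x) * (?d * q t)" for t
        unfolding bf_def u(2) au[OF g y(1)] s_def r_def bc_def q_def by (simp add: sum_distrib_left mult.assoc)
      have "q t = q (- t) + 2 * t * ((\<Sum>i<d L. \<Sum>j<d L. ?a i j * s i * r j) + (\<Sum>i<d L. \<Sum>j<d L. ?a i j * r i * s j))"
        unfolding q_def sum_distrib_left sum.distrib[symmetric] by (intro sum.cong refl) (simp add: algebra_simps)
      then have "q t = q (- t) + 4 * t * (?d * (inverse (cst x) * \<tau> v k0 i0))" unfolding 1 2 by simp
      then show ?thesis unfolding bu wt_def power2_eq_square by (simp only:) (simp add: algebra_simps)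
    qed
    then show "(\<Sum>c\<in>{True, False}. (if c then 1 else -1) * (if c then bf (u t) (u t) else bf (u (- t)) (u (- t))) g) =
        (4 * t * inverse (cst x) * \<tau> v k0 i0) * wt (b g x)" by simp
  qed simp
  also have "\<dots> = (4 * t * inverse (cst x) * \<tau> v k0 i0) * cst x"
    unfolding cst_def by (rule mean_cmult[OF avg_mean moved_cont[OF wt_smooth x'(2)]])
  finally show ?thesis using cst_pos[OF x] by (simp add: form_def)
qed

end

section \<open>The invariant form near a given point\<close>

context self_triv
begin

text \<open>Two cutoffs are needed. The first one yields a compact target \<open>Z1\<close> for the
  translates, and compactness of the group then gives a stage \<open>L\<close> for all points of a
  neighborhood \<open>A\<close>. The second one has its support in \<open>A\<close> and inside
  \<open>Z1\<close>, so that both a point and its relevant translates are under control.\<close>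

theorem recover:
  assumes x0: "x0 \<in> D" and i0: "i0 < d k0"
  shows "\<exists>f w A. openin (mtop M) A \<and> x0 \<in> A \<and> A \<subseteq> D \<and> sfun (vb_space F) (total F) f \<and>
     (\<forall>g\<in>carrier G. \<forall>v\<in>total F. f (a g v) = f v) \<and> (\<forall>x\<in>A. w x \<in> total F \<and> vproj F (w x) = x) \<and>
     (\<forall>k i. sf M A (\<lambda>x. \<tau> (w x) k i)) \<and>
     (\<forall>v\<in>total F. vproj F v \<in> A \<longrightarrow> (\<forall>t. f (vadd F (w (vproj F v)) (vscale F t v)) -
        f (vadd F (w (vproj F v)) (vscale F (- t) v)) = 4 * t * \<tau> v k0 i0))"
proof -
  have haus: "Hausdorff_space (mtop M)" using mfM by (simp add: manifold_def)
  from bump_exists[OF mfM S.oD x0] obtain \<kappa>1 Z1 where \<kappa>1: "sf M X \<kappa>1" "0 < \<kappa>1 x0"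
    and Z1: "compactin (mtop M) Z1" "Z1 \<subseteq> D" "\<forall>y\<in>X - Z1. \<kappa>1 y = 0" by (elim exE conjE)
  from depends_uniform[OF x0 compactin_imp_closedin[OF haus Z1(1)] Z1(2), of k0] obtain A L where
    A: "openin (mtop M) A" "x0 \<in> A" "\<forall>y\<in>A. \<forall>g\<in>carrier G. b g y \<in> Z1 \<longrightarrow> depends L k0 y g" by (elim exE conjE)
  have "creal (mtop M) \<kappa>1" using sf_continuous[OF mfM openin_topspace \<kappa>1(1)] by simp
  from openin_continuous_map_preimage[OF this, of "{0<..}"] have "openin (mtop M) {x \<in> X. \<kappa>1 x > 0}" by simp
  from bump_exists[OF mfM openin_Int[OF A(1) this]] A(2) \<kappa>1(2) x0 S.DM
  obtain \<kappa> Z where \<kappa>: "sf M X \<kappa>" "\<forall>y. 0 \<le> \<kappa> y" "0 < \<kappa> x0"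
    and Z: "compactin (mtop M) Z" "Z \<subseteq> A \<inter> {x \<in> X. \<kappa>1 x > 0}" "\<forall>y\<in>X - Z. \<kappa> y = 0" by blast
  \<comment> \<open>\<open>\<kappa>1\<close> is positive on \<open>Z\<close> and vanishes outside
    \<open>Z1\<close>.\<close>
  have ZZ: "Z \<subseteq> Z1" using Z(2) Z1(3) by force
  interpret V: averaging F G a b D P \<tau> Z \<kappa> k0 i0 L
    by unfold_locales (use compactin_imp_closedin[OF haus Z(1)] Z(2,3) \<kappa> i0 A(3) ZZ Z1(2) in \<open>auto simp: subset_iff\<close>)
  have B: "V.B0 \<subseteq> D" "x0 \<in> V.B0" using V.B0(2) V.ZX \<kappa>(3) x0 by (auto simp: V.B0_def)
  have "\<forall>g\<in>carrier G. \<forall>v\<in>total F. V.form (a g v) (a g v) = V.form v v" using V.form_invariant by blast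
  moreover have "\<forall>x\<in>V.B0. V.wvec x \<in> total F \<and> vproj F (V.wvec x) = x" using V.wvec B(1) by blast
  moreover have "\<forall>v\<in>total F. vproj F v \<in> V.B0 \<longrightarrow> (\<forall>t. V.form (vadd F (V.wvec (vproj F v)) (vscale F t v)) (vadd F (V.wvec (vproj F v)) (vscale F t v)) -
        V.form (vadd F (V.wvec (vproj F v)) (vscale F (- t) v)) (vadd F (V.wvec (vproj F v)) (vscale F (- t) v)) = 4 * t * \<tau> v k0 i0)"
    using V.recover_local by blast
  ultimately show ?thesis using V.B0(1) B V.form_smooth V.wvec_smooth
    by (intro exI[of _ "\<lambda>v. V.form v v"] exI[of _ V.wvec] exI[of _ V.B0]) blast
qed

end

context local_triv
begin

lemma tau_continuous: "continuous_map (subtopology (vtop F) (restr F D)) (stage P k) (\<lambda>e. \<tau> e k)"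
proof -
  have "continuous_map (subtopology (vtop F) (restr F D)) (prolimit P) \<tau>"
    using homeomorphic_imp_continuous_map[OF homeo] by (simp add: continuous_map_pairwise o_def)
  then have "continuous_map (subtopology (vtop F) (restr F D)) (product_topology (stage P) UNIV) \<tau>"
    unfolding prolimit_def continuous_map_in_subtopology by blast
  then show ?thesis by (simp add: continuous_map_componentwise_UNIV)
qed

end

text \<open>Smoothness on a bundle is given by local representations through finite stages, from
  which continuity has to be derived. On the orbibundle continuity is demanded explicitly, so it is
  needed when an invariant function descends.\<close>

lemma sfun_continuous:
  assumes vb: "vector_bundle F" and W: "openin (vtop F) W" and f: "sfun (vb_space F) W f"
  shows "creal (subtopology (vtop F) W) f"
proof (rule continuous_map_locally)
  fix e assume "e \<in> topspace (subtopology (vtop F) W)"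
  then have e: "e \<in> W" "e \<in> total F" by auto
  from triv_exists[OF vb vproj_base[OF vb e(2)]] obtain D P \<tau> where T: "(D, P, \<tau>) \<in> vtriv F" "vproj F e \<in> D" by blast
  interpret local_triv F D P \<tau> by (rule local_triv.intro[OF vb T(1)])
  have t: "triv_smooth F (D, P, \<tau>) W f" using f tr unfolding sfun_vb by blast
  from triv_smoothD[OF t e(1) T(2)] obtain A C c K O' g where A: "openin (mtop M) A" "vproj F e \<in> A" "A \<subseteq> D" "A \<subseteq> C"
    and C: "(C, c) \<in> atlas M" and g: "openE (mdim M + fdim P K) O'" "smooth_on (mdim M + fdim P K) O' g"
    and h: "\<forall>e \<in> W. vproj F e \<in> A \<longrightarrow> cat (mdim M) (c (vproj F e)) (\<tau> e K) \<in> O' \<and> f e = g (cat (mdim M) (c (vproj F e)) (\<tau> e K))"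
    by (elim exE conjE)
  let ?B = "W \<inter> restr F A"
  have rA: "openin (vtop F) (restr F A)" using openin_continuous_map_preimage[OF vproj_continuous[OF vb] A(1)] .
  have oB: "openin (subtopology (vtop F) W) ?B" using rA W by (simp add: openin_open_subtopology openin_Int)
  have ss: "subtopology (subtopology (vtop F) W) ?B = subtopology (vtop F) ?B" by (simp add: subtopology_subtopology)
  have tB: "topspace (subtopology (vtop F) ?B) = ?B" by auto
  have c1: "continuous_map (subtopology (vtop F) ?B) (Euclidean_space (mdim M)) (\<lambda>e. c (vproj F e))"
  proof -
    have "continuous_map (subtopology (vtop F) ?B) (subtopology (mtop M) C) (vproj F)"
      using A(4) by (auto simp: continuous_map_in_subtopology tB intro: continuous_map_from_subtopology vproj_continuous[OF vb])
    from continuous_map_compose[OF this chart(4)[OF mf C]] show ?thesis by (simp add: o_def)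
  qed
  have c2: "continuous_map (subtopology (vtop F) ?B) (stage P K) (\<lambda>e. \<tau> e K)"
    by (rule continuous_map_from_subtopology_mono[OF tau_continuous]) (use A(3) in auto)
  have r: "trunc (mdim M + fdim P K) (\<lambda>j. if j < mdim M then c (vproj F e) j else \<tau> e K (j - mdim M)) = cat (mdim M) (c (vproj F e)) (\<tau> e K)"
    if "e \<in> ?B" for e using that A by (intro trunc_cat chart_Euclid[OF mf C] tau_Euclid) auto
  have "continuous_map (subtopology (vtop F) ?B) (Euclidean_space (mdim M + fdim P K))
     (\<lambda>e. trunc (mdim M + fdim P K) (\<lambda>j. if j < mdim M then c (vproj F e) j else \<tau> e K (j - mdim M)))"
  proof (rule continuous_map_trunc)
    fix j show "creal (subtopology (vtop F) ?B) (\<lambda>e. if j < mdim M then c (vproj F e) j else \<tau> e K (j - mdim M))"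
      using c1 c2 by (cases "j < mdim M") (auto simp: continuous_map_Euclidean_space_iff)
  qed
  then have "continuous_map (subtopology (vtop F) ?B) (subtopology (Euclidean_space (mdim M + fdim P K)) O')
     (\<lambda>e. trunc (mdim M + fdim P K) (\<lambda>j. if j < mdim M then c (vproj F e) j else \<tau> e K (j - mdim M)))"
    unfolding continuous_map_in_subtopology tB using h r by auto
  from continuous_map_compose[OF this smooth_on_continuous[OF g(2)]]
  have "creal (subtopology (vtop F) ?B) f"
    by (rule continuous_map_eq) (use h r in auto)
  then show "\<exists>B. openin (subtopology (vtop F) W) B \<and> e \<in> B \<and> creal (subtopology (subtopology (vtop F) W) B) f"
    using oB e A(2) ss by (intro exI[of _ ?B]) auto
qed

section \<open>Orbispace charts\<close>

text \<open>Extracts from the homeomorphism with the orbit space the facts by which charts are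
  handled below: the fibers of the chart map are the orbits, and the chart map is open.\<close>

lemma orbichart_facts:
  fixes S :: "('a, 'g) sym_space" and \<rho> :: "'a \<Rightarrow> 'y"
  assumes ch: "orbichart Y S \<rho> U" and act: "group_action (sgrp S) (points (ssp S)) (sact S)"
    and cont: "\<And>g. g \<in> carrier (sgrp S) \<Longrightarrow> continuous_map (stop (ssp S)) (stop (ssp S)) (sact S g)"
  shows "openin Y U" "continuous_map (stop (ssp S)) Y \<rho>" "\<rho> ` points (ssp S) = U"
    "\<And>x y. x \<in> points (ssp S) \<Longrightarrow> y \<in> points (ssp S) \<Longrightarrow> \<rho> x = \<rho> y \<Longrightarrow> \<exists>g\<in>carrier (sgrp S). y = sact S g x"
    "\<And>W. openin (stop (ssp S)) W \<Longrightarrow> openin Y (\<rho> ` W)"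
proof -
  let ?P = "points (ssp S)" and ?orb = "orbit (sgrp S) (sact S)" and ?h = "\<lambda>Q. the_elem (\<rho> ` Q)"
  show oU: "openin Y U" and "continuous_map (stop (ssp S)) Y \<rho>" using ch by (auto simp: orbichart_def)
  have inv: "\<rho> (sact S g x) = \<rho> x" if "g \<in> carrier (sgrp S)" "x \<in> ?P" for g x using ch that by (auto simp: orbichart_def)
  have hom: "homeomorphic_map (orbit_space S) (subtopology Y U) ?h" using ch by (simp add: orbichart_def)
  interpret group_action "sgrp S" ?P "sact S" by (rule act)
  have grp: "Group.group (sgrp S)" using group_hom by (simp add: group_hom_def)
  have "openin (orbit_space S) (orbits (sgrp S) ?P (sact S))"
  proof -
    have "{x \<in> ?P. ?orb x \<in> orbits (sgrp S) ?P (sact S)} = ?P" by (auto simp: orbits_def)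
    then show ?thesis by (simp add: openin_orbit_space)
  qed
  then have top: "topspace (orbit_space S) = orbits (sgrp S) ?P (sact S)"
    using openin_subset[OF openin_topspace[of "orbit_space S"], of] openin_orbit_space[of S "topspace (orbit_space S)"]
    by (auto dest: openin_subset)
  have orb: "\<rho> ` ?orb x = {\<rho> x}" if "x \<in> ?P" for x
    using that inv orbit_refl by (force simp: orbit_def image_iff)
  then have h: "?h (?orb x) = \<rho> x" if "x \<in> ?P" for x using that by simp
  have "?h ` orbits (sgrp S) ?P (sact S) = \<rho> ` ?P"
    unfolding orbits_def using h by (force simp: image_iff)
  moreover have "topspace (subtopology Y U) = U" using openin_subset[OF oU] by auto
  ultimately show "\<rho> ` ?P = U" using homeomorphic_imp_surjective_map[OF hom] top by simp
  show "\<exists>g\<in>carrier (sgrp S). y = sact S g x" if xy: "x \<in> ?P" "y \<in> ?P" "\<rho> x = \<rho> y" for x y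
  proof -
    have "?orb x = ?orb y"
    proof (rule inj_onD[OF homeomorphic_imp_injective_map[OF hom], unfolded top])
      show "?h (?orb x) = ?h (?orb y)" unfolding h[OF xy(1)] h[OF xy(2)] by (rule xy(3))
    qed (use xy in \<open>auto simp: orbits_def\<close>)
    then have "y \<in> ?orb x" using orbit_refl[OF xy(2)] by simp
    then show ?thesis by (auto simp: orbit_def)
  qed
  show "openin Y (\<rho> ` W)" if W: "openin (stop (ssp S)) W" for W
  proof -
    have WP: "W \<subseteq> ?P" using openin_subset[OF W] .
    \<comment> \<open>The saturation of \<open>W\<close> is the union of its preimages under all
      group elements, hence open; this makes the projection to the orbit space an open map.\<close>
    have "{x \<in> ?P. ?orb x \<in> ?orb ` W} = (\<Union>g\<in>carrier (sgrp S). {x \<in> ?P. sact S g x \<in> W})"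
    proof (intro equalityI subsetI)
      fix x assume "x \<in> {x \<in> ?P. ?orb x \<in> ?orb ` W}"
      then obtain w where w: "x \<in> ?P" "w \<in> W" "?orb x = ?orb w" by auto
      then have "w \<in> ?orb x" using orbit_refl WP by auto
      then show "x \<in> (\<Union>g\<in>carrier (sgrp S). {x \<in> ?P. sact S g x \<in> W})" using w by (auto simp: orbit_def)
    next
      fix x assume "x \<in> (\<Union>g\<in>carrier (sgrp S). {x \<in> ?P. sact S g x \<in> W})"
      then obtain g where g: "g \<in> carrier (sgrp S)" "x \<in> ?P" "sact S g x \<in> W" by auto
      have "?orb x = ?orb (sact S g x)"
      proof -
        have "sact S g x \<in> ?orb x \<inter> ?orb (sact S g x)" using g WP orbit_refl by (auto simp: orbit_def)
        then show ?thesis using disjoint_union[of "?orb x" "?orb (sact S g x)"] g WP by (auto simp: orbits_def)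
      qed
      then show "x \<in> {x \<in> ?P. ?orb x \<in> ?orb ` W}" using g by auto
    qed
    moreover have "openin (stop (ssp S)) (\<Union>g\<in>carrier (sgrp S). {x \<in> ?P. sact S g x \<in> W})"
      using openin_continuous_map_preimage[OF cont W] by blast
    moreover have "?orb ` W \<subseteq> orbits (sgrp S) ?P (sact S)" using WP by (auto simp: orbits_def)
    ultimately have "openin (orbit_space S) (?orb ` W)" by (simp add: openin_orbit_space)
    then have "openin (subtopology Y U) (?h ` ?orb ` W)"
      using homeomorphic_imp_open_map[OF hom] by (simp add: open_map_def)
    moreover have "?h ` ?orb ` W = \<rho> ` W" using h WP by (force simp: image_iff)
    ultimately show ?thesis using oU openin_open_subtopology by force
  qed
qed

text \<open>The component of \<open>x\<close> in the intersection of all members of both finite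
  families is again an object. It is connected and lies in both intersections, hence in both given
  components. Two charts are always compared through such a smaller one.\<close>

lemma cover_objects_refine:
  assumes "U \<in> cover_objects X \<U>" "V \<in> cover_objects X \<U>" "x \<in> U" "x \<in> V"
  shows "\<exists>W\<in>cover_objects X \<U>. x \<in> W \<and> W \<subseteq> U \<and> W \<subseteq> V"
proof -
  from assms(1) obtain F1 where F1: "F1 \<subseteq> \<U>" "finite F1" "F1 \<noteq> {}" "U \<in> connected_components_of (subtopology X (\<Inter>F1))"
    by (auto simp: cover_objects_def)
  from assms(2) obtain F2 where F2: "F2 \<subseteq> \<U>" "finite F2" "F2 \<noteq> {}" "V \<in> connected_components_of (subtopology X (\<Inter>F2))"
    by (auto simp: cover_objects_def)
  define Y where "Y = subtopology X (\<Inter>(F1 \<union> F2))"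
  define W where "W = connected_component_of_set Y x"
  have sub: "W \<subseteq> U'" if "U' \<in> connected_components_of (subtopology X (\<Inter>F'))" "x \<in> U'" "F' \<subseteq> F1 \<union> F2" for U' F'
  proof -
    have "connectedin Y W" unfolding W_def by (rule connectedin_connected_component_of)
    then have c: "connectedin X W" "W \<subseteq> \<Inter>(F1 \<union> F2)" unfolding Y_def connectedin_subtopology by auto
    then have c': "connectedin (subtopology X (\<Inter>F')) W" using that(3) by (auto simp: connectedin_subtopology)
    have e: "U' = connected_component_of_set (subtopology X (\<Inter>F')) x"
    proof -
      from that(1) obtain y where y: "U' = connected_component_of_set (subtopology X (\<Inter>F')) y"
        by (auto simp: connected_components_of_def)
      with that(2) have "connected_component_of (subtopology X (\<Inter>F')) y x" by simp
      then show ?thesis unfolding y using connected_component_of_equiv[of "subtopology X (\<Inter>F')" y x] by auto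
    qed
    show ?thesis
    proof (cases "x \<in> W")
      case True
      show ?thesis unfolding e by (rule connected_component_of_maximal[OF c' True])
    next
      case False
      then have "x \<notin> topspace Y" unfolding W_def using connected_component_of_refl[of Y x] by simp
      then have "W = {}" unfolding W_def by (rule connected_component_of_eq_empty[THEN iffD2])
      then show ?thesis by simp
    qed
  qed
  have WU: "W \<subseteq> U" by (rule sub[OF F1(4) assms(3)]) auto
  have WV: "W \<subseteq> V" by (rule sub[OF F2(4) assms(4)]) auto
  have "x \<in> topspace (subtopology X (\<Inter>F1))" "x \<in> topspace (subtopology X (\<Inter>F2))"
    using connected_components_of_subset F1(4) F2(4) assms(3,4) by blast+
  then have xY: "x \<in> topspace Y" by (auto simp: Y_def)
  then have xW: "x \<in> W" unfolding W_def using connected_component_of_refl[of Y x] by simp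
  have "W \<in> connected_components_of (subtopology X (\<Inter>(F1 \<union> F2)))"
    unfolding W_def Y_def[symmetric] using xY by (simp add: connected_component_in_connected_components_of)
  moreover have "F1 \<union> F2 \<in> {F. F \<subseteq> \<U> \<and> finite F \<and> F \<noteq> {}}" using F1 F2 by auto
  ultimately have "W \<in> cover_objects X \<U>" unfolding cover_objects_def by blast
  then show ?thesis using xW WU WV by blast
qed

lemma cover_objects_exist:
  assumes "open_covering X \<U>" "x \<in> topspace X" shows "\<exists>U\<in>cover_objects X \<U>. x \<in> U"
proof -
  from assms obtain U where U: "U \<in> \<U>" "x \<in> U" by (auto simp: open_covering_def)
  let ?Y = "subtopology X (\<Inter>{U})"
  have x: "x \<in> topspace ?Y" using U assms(2) by simp
  have "connected_component_of_set ?Y x \<in> connected_components_of ?Y"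
    using x connected_component_in_connected_components_of by metis
  then have "connected_component_of_set ?Y x \<in> cover_objects X \<U>" unfolding cover_objects_def using U by blast
  moreover have "x \<in> connected_component_of_set ?Y x" using x connected_component_of_refl[of ?Y x] by simp
  ultimately show ?thesis by blast
qed

section \<open>Fibers of vector bundles\<close>

lemma vb_scale:
  assumes "vector_bundle F" "v \<in> total F"
  shows "vscale F t v \<in> total F" "vproj F (vscale F t v) = vproj F v"
proof -
  from triv_exists[OF assms(1) vproj_base[OF assms]] obtain D P \<tau> where T: "(D, P, \<tau>) \<in> vtriv F" "vproj F v \<in> D" by blast
  interpret local_triv F D P \<tau> by (rule local_triv.intro[OF assms(1) T(1)])
  have "v \<in> restr F D" using assms T by simp
  from scale[OF this, of t] show "vscale F t v \<in> total F" "vproj F (vscale F t v) = vproj F v" by auto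
qed

lemma vb_add:
  assumes "vector_bundle F" "v \<in> total F" "w \<in> total F" "vproj F v = vproj F w"
  shows "vadd F v w \<in> total F" "vproj F (vadd F v w) = vproj F w"
proof -
  from triv_exists[OF assms(1) vproj_base[OF assms(1,2)]] obtain D P \<tau> where T: "(D, P, \<tau>) \<in> vtriv F" "vproj F v \<in> D" by blast
  interpret local_triv F D P \<tau> by (rule local_triv.intro[OF assms(1) T(1)])
  have "v \<in> restr F D" "w \<in> restr F D" using assms T by auto
  from add[OF this assms(4)] assms(4) show "vadd F v w \<in> total F" "vproj F (vadd F v w) = vproj F w" by auto
qed

lemma vb_zero:
  assumes "vector_bundle F" "x \<in> pts (vbase F)"
  shows "vzero F x \<in> total F" "vproj F (vzero F x) = x" 
proof -
  from triv_exists[OF assms] obtain D P \<tau> where T: "(D, P, \<tau>) \<in> vtriv F" "x \<in> D" by blast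
  interpret local_triv F D P \<tau> by (rule local_triv.intro[OF assms(1) T(1)])
  from zero[OF T(2)] show "vzero F x \<in> total F" "vproj F (vzero F x) = x" by auto
qed

text \<open>Turns identities between vectors of a fiber into identities between real coordinates;
  the vector space laws in \<open>fiber_algebra\<close> are obtained in this way.\<close>

lemma vb_eq:
  assumes F: "vector_bundle F" and "v \<in> total F" "w \<in> total F" "vproj F v = vproj F w"
    and e: "\<And>D P \<tau>. (D, P, \<tau>) \<in> vtriv F \<Longrightarrow> vproj F v \<in> D \<Longrightarrow> \<tau> v = \<tau> w"
  shows "v = w"
proof -
  from triv_exists[OF F vproj_base[OF F assms(2)]] obtain D P \<tau> where T: "(D, P, \<tau>) \<in> vtriv F" "vproj F v \<in> D" by blast
  interpret local_triv F D P \<tau> by (rule local_triv.intro[OF F T(1)])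
  show ?thesis by (rule tau_eqI) (use assms T e[OF T] in auto)
qed

lemma tau_ops:
  assumes F: "vector_bundle F" and T: "(D, P, \<tau>) \<in> vtriv F" 
  shows "v \<in> total F \<Longrightarrow> w \<in> total F \<Longrightarrow> vproj F v \<in> D \<Longrightarrow> vproj F v = vproj F w \<Longrightarrow> \<tau> (vadd F v w) = (\<lambda>k i. \<tau> v k i + \<tau> w k i)"
    "v \<in> total F \<Longrightarrow> vproj F v \<in> D \<Longrightarrow> \<tau> (vscale F t v) = (\<lambda>k i. t * \<tau> v k i)"
    "x \<in> D \<Longrightarrow> \<tau> (vzero F x) = (\<lambda>k i. 0)"
proof -
  interpret local_triv F D P \<tau> by (rule local_triv.intro[OF F T])
  show "v \<in> total F \<Longrightarrow> w \<in> total F \<Longrightarrow> vproj F v \<in> D \<Longrightarrow> vproj F v = vproj F w \<Longrightarrow> \<tau> (vadd F v w) = (\<lambda>k i. \<tau> v k i + \<tau> w k i)"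
    by (rule add(3)) auto
  show "v \<in> total F \<Longrightarrow> vproj F v \<in> D \<Longrightarrow> \<tau> (vscale F t v) = (\<lambda>k i. t * \<tau> v k i)" by (rule scale(3)) auto
  show "x \<in> D \<Longrightarrow> \<tau> (vzero F x) = (\<lambda>k i. 0)" by (rule zero(3))
qed

lemma fiber_algebra:
  assumes F: "vector_bundle F" and u: "u \<in> total F" "vproj F u = x" and v: "v \<in> total F" "vproj F v = x"
    and w: "w \<in> total F" "vproj F w = x"
  shows "vadd F (vadd F u v) w = vadd F u (vadd F v w)" "vadd F u v = vadd F v u" "vadd F (vzero F x) u = u"
    "vadd F (vscale F (-1) u) u = vzero F x" "vscale F 1 u = u" "vscale F s (vscale F t u) = vscale F (s * t) u"
    "vscale F (s + t) u = vadd F (vscale F s u) (vscale F t u)" "vscale F t (vadd F u v) = vadd F (vscale F t u) (vscale F t v)"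
    "vscale F 0 u = vzero F x"
proof -
  have x: "x \<in> pts (vbase F)" using vproj_base[OF F u(1)] u(2) by simp
  note c = vb_scale[OF F] vb_add[OF F] vb_zero[OF F x] u v w tau_ops[OF F]
  show "vadd F (vadd F u v) w = vadd F u (vadd F v w)" by (rule vb_eq[OF F]) (simp_all add: c add.assoc)
  show "vadd F u v = vadd F v u" by (rule vb_eq[OF F]) (simp_all add: c add.commute)
  show "vadd F (vzero F x) u = u" by (rule vb_eq[OF F]) (simp_all add: c)
  show "vadd F (vscale F (-1) u) u = vzero F x" by (rule vb_eq[OF F]) (simp_all add: c)
  show "vscale F 1 u = u" by (rule vb_eq[OF F]) (simp_all add: c)
  show "vscale F s (vscale F t u) = vscale F (s * t) u" by (rule vb_eq[OF F]) (simp_all add: c mult.assoc)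
  show "vscale F (s + t) u = vadd F (vscale F s u) (vscale F t u)" by (rule vb_eq[OF F]) (simp_all add: c distrib_right)
  show "vscale F t (vadd F u v) = vadd F (vscale F t u) (vscale F t v)" by (rule vb_eq[OF F]) (simp_all add: c distrib_left)
  show "vscale F 0 u = vzero F x" by (rule vb_eq[OF F]) (simp_all add: c)
qed

context local_triv
begin

lemma scale_continuous:
  assumes u: "u \<in> restr F D" shows "continuous_map euclideanreal (vtop F) (\<lambda>t. vscale F t u)"
proof -
  have "continuous_map euclideanreal (stage P k) (\<lambda>t i. t * \<tau> u k i)" for k
    unfolding continuous_map_Euclidean_space_iff
    using Euclid_linear[OF tau_Euclid[OF u, of k] tau_Euclid[OF u, of k], of _ 0] by (auto intro!: continuous_intros)
  then have "continuous_map euclideanreal (product_topology (stage P) UNIV) (\<lambda>t k i. t * \<tau> u k i)"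
    by (simp add: continuous_map_componentwise_UNIV)
  then have "continuous_map euclideanreal (prolimit P) (\<lambda>t k i. t * \<tau> u k i)"
    unfolding prolimit_def continuous_map_in_subtopology
    using tau_lim[OF scale(1)[OF u]] unfolding scale(3)[OF u] lim_points_iff by auto
  then have "continuous_map euclideanreal (prod_topology (subtopology (mtop M) D) (prolimit P)) (\<lambda>t. (vproj F u, \<lambda>k i. t * \<tau> u k i))"
    using u DM by (auto simp: continuous_map_pairwise o_def)
  from continuous_map_compose[OF this fr_continuous] show ?thesis
  proof (rule continuous_map_eq)
    fix t
    show "((\<lambda>q. fr (fst q) (snd q)) \<circ> (\<lambda>t. (vproj F u, \<lambda>k i. t * \<tau> u k i))) t = vscale F t u"
      using fr_tau[OF scale(1)[OF u, of t]] scale[OF u, of t] by simp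
  qed
qed

end

text \<open>The image of \<open>\<psi>\<close> is only known to be open, but it contains the zero
  vector of the fiber and hence a small positive multiple of \<open>u\<close>. By linearity the
  preimage of this multiple can be rescaled. Injectivity of \<open>\<phi>\<close> identifies its
  base point.\<close>

lemma open_linear_image:
  assumes F: "vector_bundle F" and F': "vector_bundle F'" and m: "vb_map F' F \<psi> \<phi>" and o: "openin (vtop F) (\<psi> ` total F')"
    and inj: "inj_on \<phi> (pts (vbase F'))" and y: "y \<in> pts (vbase F')" and u: "u \<in> total F" "vproj F u = \<phi> y"
  shows "\<exists>v\<in>total F'. vproj F' v = y \<and> \<psi> v = u"
proof -
  have lin: "\<And>v t. v \<in> total F' \<Longrightarrow> \<psi> (vscale F' t v) = vscale F t (\<psi> v)" "\<And>v. v \<in> total F' \<Longrightarrow> vproj F (\<psi> v) = \<phi> (vproj F' v)"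
    and im: "\<And>v. v \<in> total F' \<Longrightarrow> \<psi> v \<in> total F"
    using m smooth_map_continuous[of "vb_space F'" "vb_space F" \<psi>] continuous_map_image_subset_topspace[of "vtop F'" "vtop F" \<psi>]
    unfolding vb_map_def by auto
  note z = vb_zero[OF F' y]
  have z0: "\<psi> (vzero F' y) = vscale F 0 u"
  proof -
    have "\<psi> (vzero F' y) = \<psi> (vscale F' 0 (vzero F' y))" using fiber_algebra(9)[OF F' z z z] by simp
    also have "\<dots> = vscale F 0 (\<psi> (vzero F' y))" using lin(1)[OF z(1)] by simp
    also have "\<dots> = vzero F (\<phi> y)" using fiber_algebra(9)[OF F im[OF z(1)] _ im[OF z(1)] _ im[OF z(1)]] lin(2)[OF z(1)] z(2) by simp
    also have "\<dots> = vscale F 0 u" using fiber_algebra(9)[OF F u u u] by simp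
    finally show ?thesis .
  qed
  from triv_exists[OF F vproj_base[OF F u(1)]] obtain D P \<tau> where T: "(D, P, \<tau>) \<in> vtriv F" "vproj F u \<in> D" by blast
  interpret local_triv F D P \<tau> by (rule local_triv.intro[OF F T(1)])
  have "continuous_map euclideanreal (vtop F) (\<lambda>t. vscale F t u)" by (rule scale_continuous) (use u T in simp)
  from openin_continuous_map_preimage[OF this o] have "openin euclideanreal {t. vscale F t u \<in> \<psi> ` total F'}" by simp
  then have op: "open {t. vscale F t u \<in> \<psi> ` total F'}" by (rule open_openin[THEN iffD2])
  have z1: "0 \<in> {t. vscale F t u \<in> \<psi> ` total F'}" unfolding mem_Collect_eq z0[symmetric] using z(1) by (rule imageI)
  obtain e where e: "e > 0" "ball 0 e \<subseteq> {t. vscale F t u \<in> \<psi> ` total F'}" by (rule openE[OF op z1])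
  \<comment> \<open>Any nonzero number in the ball would do, as the scaling is undone by its
    reciprocal.\<close>
  have "e / 2 \<in> ball 0 e" using e(1) by (simp add: dist_real_def)
  then have "vscale F (e / 2) u \<in> \<psi> ` total F'" using e(2) by blast
  then obtain v where v: "v \<in> total F'" "vscale F (e / 2) u = \<psi> v" by (rule imageE) simp
  let ?v = "vscale F' (2 / e) v"
  have v': "?v \<in> total F'" "vproj F' ?v = vproj F' v" using vb_scale[OF F' v(1)] by auto
  have "\<psi> ?v = vscale F (2 / e) (vscale F (e / 2) u)" using lin(1)[OF v(1)] v(2) by simp
  also have "\<dots> = u" using fiber_algebra(5,6)[OF F u u u] e(1) by simp
  finally have pu: "\<psi> ?v = u" .
  have "\<phi> (vproj F' v) = \<phi> y" using lin(2)[OF v'(1)] pu v'(2) u(2) by simp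
  then have "vproj F' v = y" using inj y vproj_base[OF F' v(1)] by (simp add: inj_on_def)
  then show ?thesis using v' pu by auto
qed

section \<open>Vector orbibundles\<close>

locale orbib =
  fixes E :: "('x, 'e, 'm, 't, 'g) orbibundle"
  assumes vo: "vector_orbibundle E"
begin

abbreviation "I \<equiv> bobjects E"
abbreviation "over U \<equiv> {e \<in> topspace (btop E). bproj E e \<in> U}"
abbreviation "SE U \<equiv> \<lparr>ssp = vb_space (bdom E U), sgrp = bgrp E U, sact = bact E U\<rparr>"
abbreviation "SX U \<equiv> \<lparr>ssp = mfd_space (vbase (bdom E U)), sgrp = bgrp E U, sact = bact0 E U\<rparr>"

lemma orbE: "orbi_functor (btop E) I over SE (bchart E) (bmap E) (bhom E)"
  and vsym: "U \<in> I \<Longrightarrow> vb_sym (bdom E U) (bgrp E U) (bact E U) (bact0 E U)"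
  and bproj_cont: "continuous_map (btop E) (btop0 E) (bproj E)"
  and bproj_chart: "U \<in> I \<Longrightarrow> v \<in> total (bdom E U) \<Longrightarrow> bproj E (bchart E U v) = bchart0 E U (vproj (bdom E U) v)"
  and bmap_vb: "U \<in> I \<Longrightarrow> V \<in> I \<Longrightarrow> V \<subseteq> U \<Longrightarrow> vb_map (bdom E V) (bdom E U) (bmap E V U) (bmap0 E V U)"
  and orbX: "orbispace (base_orbispace E)"
proof -
  note d = vo[unfolded vector_orbibundle_def]
  show "orbi_functor (btop E) I over SE (bchart E) (bmap E) (bhom E)" "continuous_map (btop E) (btop0 E) (bproj E)"
    "orbispace (base_orbispace E)" using d by - (elim conjE, assumption)+
  show "U \<in> I \<Longrightarrow> vb_sym (bdom E U) (bgrp E U) (bact E U) (bact0 E U)" using d by (elim conjE) (rule bspec)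
  show "U \<in> I \<Longrightarrow> v \<in> total (bdom E U) \<Longrightarrow> bproj E (bchart E U v) = bchart0 E U (vproj (bdom E U) v)"
    using d by (elim conjE) (drule (1) bspec, drule (1) bspec, assumption)
  show "U \<in> I \<Longrightarrow> V \<in> I \<Longrightarrow> V \<subseteq> U \<Longrightarrow> vb_map (bdom E V) (bdom E U) (bmap E V U) (bmap0 E V U)"
    using d by (elim conjE) (drule (1) bspec, drule (1) bspec, erule (1) mp)
qed

lemma orbX': "orbi_functor (btop0 E) I (\<lambda>U. U) SX (bchart0 E) (bmap0 E) (bhom E)"
  and cov: "open_covering (btop0 E) (bcover E)"
  using orbX by (auto simp: orbispace_def base_orbispace_def)

lemma orb_parts:
  assumes U: "U \<in> I"
  shows "orbichart (btop E) (SE U) (bchart E U) (over U)" "orbichart (btop0 E) (SX U) (bchart0 E U) U"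
    "V \<in> I \<Longrightarrow> V \<subseteq> U \<Longrightarrow> sym_open_embedding (SE V) (SE U) (bmap E V U) (bhom E V U) \<and>
        (\<forall>y\<in>points (ssp (SE V)). bchart E U (bmap E V U y) = bchart E V y)"
    "V \<in> I \<Longrightarrow> V \<subseteq> U \<Longrightarrow> sym_open_embedding (SX V) (SX U) (bmap0 E V U) (bhom E V U) \<and>
        (\<forall>y\<in>points (ssp (SX V)). bchart0 E U (bmap0 E V U y) = bchart0 E V y)"
proof -
  have 1: "\<forall>U\<in>I. orbichart (btop E) (SE U) (bchart E U) (over U) \<and> connected_space (stop (ssp (SE U)))"
    and 3: "\<forall>U\<in>I. \<forall>V\<in>I. V \<subseteq> U \<longrightarrow> sym_open_embedding (SE V) (SE U) (bmap E V U) (bhom E V U) \<and>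
        (\<forall>y\<in>points (ssp (SE V)). bchart E U (bmap E V U y) = bchart E V y)"
    using orbE unfolding orbi_functor_def by - (elim conjE, assumption)+
  have 2: "\<forall>U\<in>I. orbichart (btop0 E) (SX U) (bchart0 E U) U \<and> connected_space (stop (ssp (SX U)))"
    and 4: "\<forall>U\<in>I. \<forall>V\<in>I. V \<subseteq> U \<longrightarrow> sym_open_embedding (SX V) (SX U) (bmap0 E V U) (bhom E V U) \<and>
        (\<forall>y\<in>points (ssp (SX V)). bchart0 E U (bmap0 E V U y) = bchart0 E V y)"
    using orbX' unfolding orbi_functor_def by - (elim conjE, assumption)+
  show "orbichart (btop E) (SE U) (bchart E U) (over U)" by (rule bspec[OF 1 U, THEN conjunct1])
  show "orbichart (btop0 E) (SX U) (bchart0 E U) U" by (rule bspec[OF 2 U, THEN conjunct1])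
  show "V \<in> I \<Longrightarrow> V \<subseteq> U \<Longrightarrow> sym_open_embedding (SE V) (SE U) (bmap E V U) (bhom E V U) \<and>
        (\<forall>y\<in>points (ssp (SE V)). bchart E U (bmap E V U y) = bchart E V y)"
    by (rule bspec[OF bspec[OF 3 U], THEN mp])
  show "V \<in> I \<Longrightarrow> V \<subseteq> U \<Longrightarrow> sym_open_embedding (SX V) (SX U) (bmap0 E V U) (bhom E V U) \<and>
        (\<forall>y\<in>points (ssp (SX V)). bchart0 E U (bmap0 E V U y) = bchart0 E V y)"
    by (rule bspec[OF bspec[OF 4 U], THEN mp])
qed

lemma sym: "U \<in> I \<Longrightarrow> sym_bundle (bdom E U) (bgrp E U) (bact E U) (bact0 E U)"
  by (rule sym_bundle.intro[OF vsym])

lemma vbun: "U \<in> I \<Longrightarrow> vector_bundle (bdom E U)"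
  using sym_bundle.vbF[OF sym] .

lemma chartE:
  assumes U: "U \<in> I"
  shows "openin (btop E) (over U)" "continuous_map (vtop (bdom E U)) (btop E) (bchart E U)"
    "bchart E U ` total (bdom E U) = over U"
    "\<And>v w. v \<in> total (bdom E U) \<Longrightarrow> w \<in> total (bdom E U) \<Longrightarrow> bchart E U v = bchart E U w \<Longrightarrow> \<exists>g\<in>carrier (bgrp E U). w = bact E U g v"
    "\<And>W. openin (vtop (bdom E U)) W \<Longrightarrow> openin (btop E) (bchart E U ` W)"
    "\<And>g v. g \<in> carrier (bgrp E U) \<Longrightarrow> v \<in> total (bdom E U) \<Longrightarrow> bchart E U (bact E U g v) = bchart E U v"
proof -
  interpret S: sym_bundle "bdom E U" "bgrp E U" "bact E U" "bact0 E U" by (rule sym[OF U])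
  have ch: "orbichart (btop E) (SE U) (bchart E U) (over U)" by (rule orb_parts(1)[OF U])
  have act: "group_action (sgrp (SE U)) (points (ssp (SE U))) (sact (SE U))" using S.act by simp
  have cont: "continuous_map (stop (ssp (SE U))) (stop (ssp (SE U))) (sact (SE U) g)" if "g \<in> carrier (sgrp (SE U))" for g
  proof -
    have "smooth_map (vb_space (bdom E U)) (vb_space (bdom E U)) (bact E U g)"
      using S.vbm[of g] that by (simp add: vb_map_def)
    from smooth_map_continuous[OF this] show ?thesis by simp
  qed
  note f = orbichart_facts[OF ch act cont, simplified]
  show "openin (btop E) (over U)" "continuous_map (vtop (bdom E U)) (btop E) (bchart E U)"
    "bchart E U ` total (bdom E U) = over U"
    "\<And>v w. v \<in> total (bdom E U) \<Longrightarrow> w \<in> total (bdom E U) \<Longrightarrow> bchart E U v = bchart E U w \<Longrightarrow> \<exists>g\<in>carrier (bgrp E U). w = bact E U g v"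
    "\<And>W. openin (vtop (bdom E U)) W \<Longrightarrow> openin (btop E) (bchart E U ` W)" by (rule f; assumption)+
  show "\<And>g v. g \<in> carrier (bgrp E U) \<Longrightarrow> v \<in> total (bdom E U) \<Longrightarrow> bchart E U (bact E U g v) = bchart E U v"
    using ch by (simp add: orbichart_def)
qed

lemma chartX:
  assumes U: "U \<in> I"
  shows "openin (btop0 E) U" "continuous_map (mtop (vbase (bdom E U))) (btop0 E) (bchart0 E U)"
    "bchart0 E U ` bdom0 E U = U"
    "\<And>x y. x \<in> bdom0 E U \<Longrightarrow> y \<in> bdom0 E U \<Longrightarrow> bchart0 E U x = bchart0 E U y \<Longrightarrow> \<exists>g\<in>carrier (bgrp E U). y = bact0 E U g x"
    "\<And>W. openin (mtop (vbase (bdom E U))) W \<Longrightarrow> openin (btop0 E) (bchart0 E U ` W)"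
    "\<And>g x. g \<in> carrier (bgrp E U) \<Longrightarrow> x \<in> bdom0 E U \<Longrightarrow> bchart0 E U (bact0 E U g x) = bchart0 E U x"
proof -
  interpret S: sym_bundle "bdom E U" "bgrp E U" "bact E U" "bact0 E U" by (rule sym[OF U])
  have ch: "orbichart (btop0 E) (SX U) (bchart0 E U) U" by (rule orb_parts(2)[OF U])
  have act: "group_action (sgrp (SX U)) (points (ssp (SX U))) (sact (SX U))" using S.act0 by simp
  have cont: "continuous_map (stop (ssp (SX U))) (stop (ssp (SX U))) (sact (SX U) g)" if "g \<in> carrier (sgrp (SX U))" for g
  proof -
    have "smooth_map (mfd_space (vbase (bdom E U))) (mfd_space (vbase (bdom E U))) (bact0 E U g)"
      using S.vbm[of g] that by (simp add: vb_map_def)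
    from smooth_map_continuous[OF this] show ?thesis by simp
  qed
  note f = orbichart_facts[OF ch act cont, simplified]
  show "openin (btop0 E) U" "continuous_map (mtop (vbase (bdom E U))) (btop0 E) (bchart0 E U)"
    "bchart0 E U ` bdom0 E U = U"
    "\<And>x y. x \<in> bdom0 E U \<Longrightarrow> y \<in> bdom0 E U \<Longrightarrow> bchart0 E U x = bchart0 E U y \<Longrightarrow> \<exists>g\<in>carrier (bgrp E U). y = bact0 E U g x"
    "\<And>W. openin (mtop (vbase (bdom E U))) W \<Longrightarrow> openin (btop0 E) (bchart0 E U ` W)" by (rule f; assumption)+
  show "\<And>g x. g \<in> carrier (bgrp E U) \<Longrightarrow> x \<in> bdom0 E U \<Longrightarrow> bchart0 E U (bact0 E U g x) = bchart0 E U x"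
    using ch by (simp add: orbichart_def)
qed

lemma chartE_in: "U \<in> I \<Longrightarrow> v \<in> total (bdom E U) \<Longrightarrow> bchart E U v \<in> topspace (btop E) \<and> bproj E (bchart E U v) \<in> U"
  using chartE(3) by blast

lemma chartX_in: "U \<in> I \<Longrightarrow> x \<in> bdom0 E U \<Longrightarrow> bchart0 E U x \<in> U \<and> bchart0 E U x \<in> topspace (btop0 E)"
  using chartX(1,3) openin_subset by blast

lemma point_lift: "U \<in> I \<Longrightarrow> x \<in> U \<Longrightarrow> \<exists>y\<in>bdom0 E U. bchart0 E U y = x"
proof -
  assume U: "U \<in> I" and x: "x \<in> U"
  from x have "x \<in> bchart0 E U ` bdom0 E U" by (simp only: chartX(3)[OF U])
  then show ?thesis by auto
qed

lemma point_exists: "x \<in> topspace (btop0 E) \<Longrightarrow> \<exists>U\<in>I. \<exists>y\<in>bdom0 E U. bchart0 E U y = x"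
  using cover_objects_exist[OF cov] point_lift by blast

lemma
  assumes V: "V \<in> I" and U: "U \<in> I" and VU: "V \<subseteq> U"
  shows psi_act: "\<And>h v. h \<in> carrier (bgrp E V) \<Longrightarrow> v \<in> total (bdom E V) \<Longrightarrow> bmap E V U (bact E V h v) = bact E U (bhom E V U h) (bmap E V U v)"
    and phi_act: "\<And>h x. h \<in> carrier (bgrp E V) \<Longrightarrow> x \<in> bdom0 E V \<Longrightarrow> bmap0 E V U (bact0 E V h x) = bact0 E U (bhom E V U h) (bmap0 E V U x)"
    and iota: "\<And>h. h \<in> carrier (bgrp E V) \<Longrightarrow> bhom E V U h \<in> carrier (bgrp E U)"
    and psi_emb: "open_smooth_embedding (vb_space (bdom E V)) (vb_space (bdom E U)) (bmap E V U)"
    and phi_emb: "open_smooth_embedding (mfd_space (vbase (bdom E V))) (mfd_space (vbase (bdom E U))) (bmap0 E V U)"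
    and eta_psi: "\<And>v. v \<in> total (bdom E V) \<Longrightarrow> bchart E U (bmap E V U v) = bchart E V v"
    and rho_phi: "\<And>x. x \<in> bdom0 E V \<Longrightarrow> bchart0 E U (bmap0 E V U x) = bchart0 E V x"
proof -
  have 1: "sym_open_embedding (SE V) (SE U) (bmap E V U) (bhom E V U) \<and> (\<forall>y\<in>points (ssp (SE V)). bchart E U (bmap E V U y) = bchart E V y)"
    by (rule orb_parts(3)[OF U V VU])
  have 2: "sym_open_embedding (SX V) (SX U) (bmap0 E V U) (bhom E V U) \<and> (\<forall>y\<in>points (ssp (SX V)). bchart0 E U (bmap0 E V U y) = bchart0 E V y)"
    by (rule orb_parts(4)[OF U V VU])
  show "\<And>h v. h \<in> carrier (bgrp E V) \<Longrightarrow> v \<in> total (bdom E V) \<Longrightarrow> bmap E V U (bact E V h v) = bact E U (bhom E V U h) (bmap E V U v)"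
    "\<And>h. h \<in> carrier (bgrp E V) \<Longrightarrow> bhom E V U h \<in> carrier (bgrp E U)"
    "open_smooth_embedding (vb_space (bdom E V)) (vb_space (bdom E U)) (bmap E V U)"
    "\<And>v. v \<in> total (bdom E V) \<Longrightarrow> bchart E U (bmap E V U v) = bchart E V v"
    using 1 by (auto simp: sym_open_embedding_def equivariant_def hom_def)
  show "\<And>h x. h \<in> carrier (bgrp E V) \<Longrightarrow> x \<in> bdom0 E V \<Longrightarrow> bmap0 E V U (bact0 E V h x) = bact0 E U (bhom E V U h) (bmap0 E V U x)"
    "open_smooth_embedding (mfd_space (vbase (bdom E V))) (mfd_space (vbase (bdom E U))) (bmap0 E V U)"
    "\<And>x. x \<in> bdom0 E V \<Longrightarrow> bchart0 E U (bmap0 E V U x) = bchart0 E V x"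
    using 2 by (auto simp: sym_open_embedding_def equivariant_def)
qed

lemma emb_maps:
  assumes "V \<in> I" "U \<in> I" "V \<subseteq> U"
  shows "inj_on (bmap E V U) (total (bdom E V))" "inj_on (bmap0 E V U) (bdom0 E V)"
    "openin (vtop (bdom E U)) (bmap E V U ` total (bdom E V))" "openin (mtop (vbase (bdom E U))) (bmap0 E V U ` bdom0 E V)"
    "\<And>v. v \<in> total (bdom E V) \<Longrightarrow> bmap E V U v \<in> total (bdom E U)" "\<And>x. x \<in> bdom0 E V \<Longrightarrow> bmap0 E V U x \<in> bdom0 E U"
    "\<And>v. v \<in> total (bdom E V) \<Longrightarrow> vproj (bdom E U) (bmap E V U v) = bmap0 E V U (vproj (bdom E V) v)"
    "\<And>v w. v \<in> total (bdom E V) \<Longrightarrow> w \<in> total (bdom E V) \<Longrightarrow> vproj (bdom E V) v = vproj (bdom E V) w \<Longrightarrow>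
       bmap E V U (vadd (bdom E V) v w) = vadd (bdom E U) (bmap E V U v) (bmap E V U w)"
    "\<And>v t. v \<in> total (bdom E V) \<Longrightarrow> bmap E V U (vscale (bdom E V) t v) = vscale (bdom E U) t (bmap E V U v)"
  using psi_emb[OF assms] phi_emb[OF assms] bmap_vb[OF assms(2,1,3)] openin_subset
  unfolding open_smooth_embedding_def vb_map_def stop_simps by (blast | fastforce dest: openin_subset)+

lemma refine: "U \<in> I \<Longrightarrow> V \<in> I \<Longrightarrow> x \<in> U \<Longrightarrow> x \<in> V \<Longrightarrow> \<exists>W\<in>I. x \<in> W \<and> W \<subseteq> U \<and> W \<subseteq> V"
  by (rule cover_objects_refine)

text \<open>The chart at \<open>U\<close> identifies \<open>x\<close> with the image of
  \<open>y\<close>, so some \<open>g\<close> moves \<open>x\<close> into the image of the smaller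
  chart. By \<open>open_linear_image\<close> the whole fiber over \<open>x\<close> is then carried
  into the image of the embedding of bundles.\<close>

lemma pull:
  assumes W: "W \<in> I" and U: "U \<in> I" and WU: "W \<subseteq> U" and x: "x \<in> bdom0 E U" and y: "y \<in> bdom0 E W"
    and xy: "bchart0 E W y = bchart0 E U x"
  shows "\<exists>g\<in>carrier (bgrp E U). bact0 E U g x = bmap0 E W U y \<and>
     (\<forall>v\<in>total (bdom E U). vproj (bdom E U) v = x \<longrightarrow>
        (\<exists>u\<in>total (bdom E W). vproj (bdom E W) u = y \<and> bmap E W U u = bact E U g v))"
proof -
  interpret S: sym_bundle "bdom E U" "bgrp E U" "bact E U" "bact0 E U" by (rule sym[OF U])
  note em = emb_maps[OF W U WU]
  have "bchart0 E U x = bchart0 E U (bmap0 E W U y)" using rho_phi[OF W U WU y] xy by simp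
  from chartX(4)[OF U x em(6)[OF y] this] obtain g where g: "g \<in> carrier (bgrp E U)" "bmap0 E W U y = bact0 E U g x" by blast
  have "\<exists>u\<in>total (bdom E W). vproj (bdom E W) u = y \<and> bmap E W U u = bact E U g v"
    if v: "v \<in> total (bdom E U)" "vproj (bdom E U) v = x" for v
  proof (rule open_linear_image[OF vbun[OF U] vbun[OF W] bmap_vb[OF U W WU] em(3,2) y])
    show "bact E U g v \<in> total (bdom E U)" "vproj (bdom E U) (bact E U g v) = bmap0 E W U y" using v g by auto
  qed
  then show ?thesis using g by auto
qed

section \<open>Vectors fixed by isotropy groups\<close>

lemma fixed_iff:
  "v \<in> fixed_vectors E U \<longleftrightarrow> v \<in> total (bdom E U) \<and>
     (\<forall>g\<in>carrier (bgrp E U). bact0 E U g (vproj (bdom E U) v) = vproj (bdom E U) v \<longrightarrow> bact E U g v = v)"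
  by (auto simp: fixed_vectors_def stabilizer_def)

lemma fixed_total: "v \<in> fixed_vectors E U \<Longrightarrow> v \<in> total (bdom E U)"
  by (simp add: fixed_iff)

lemma fixed_act:
  assumes U: "U \<in> I" and v: "v \<in> fixed_vectors E U" and g: "g \<in> carrier (bgrp E U)"
  shows "bact E U g v \<in> fixed_vectors E U"
  unfolding fixed_iff
proof (intro conjI ballI impI)
  interpret S: sym_bundle "bdom E U" "bgrp E U" "bact E U" "bact0 E U" by (rule sym[OF U])
  let ?F = "bdom E U" and ?G = "bgrp E U"
  note vt = fixed_total[OF v]
  show "bact E U g v \<in> total ?F" using vt g by simp
  fix h assume h: "h \<in> carrier ?G" "bact0 E U h (vproj ?F (bact E U g v)) = vproj ?F (bact E U g v)"
  \<comment> \<open>The isotropy group of the translated point is a conjugate of that of the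
    original point; \<open>?k\<close> is \<open>h\<close> conjugated back.\<close>
  let ?k = "inv\<^bsub>?G\<^esub> g \<otimes>\<^bsub>?G\<^esub> (h \<otimes>\<^bsub>?G\<^esub> g)"
  have "bact0 E U ?k (vproj ?F v) = bact0 E U (inv\<^bsub>?G\<^esub> g) (bact0 E U h (bact0 E U g (vproj ?F v)))"
    using vt g h by (simp add: S.b_mult)
  also have "\<dots> = bact0 E U (inv\<^bsub>?G\<^esub> g) (bact0 E U g (vproj ?F v))" using h(2) vt g by simp
  also have "\<dots> = vproj ?F v" using vt g by (simp add: S.b_inv)
  finally have "bact E U ?k v = v" using v g h(1) by (simp add: fixed_iff)
  moreover have "g \<otimes>\<^bsub>?G\<^esub> ?k = h \<otimes>\<^bsub>?G\<^esub> g" using g h(1) by (simp add: S.grp.m_assoc[symmetric])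
  ultimately have "bact E U g v = bact E U (h \<otimes>\<^bsub>?G\<^esub> g) v" using S.a_mult[of v g ?k] vt g h(1) by simp
  then show "bact E U h (bact E U g v) = bact E U g v" using S.a_mult[of v h g] vt g h(1) by simp
qed

lemma fixed_zero:
  assumes U: "U \<in> I" and x: "x \<in> bdom0 E U"
  shows "vzero (bdom E U) x \<in> fixed_vectors E U"
proof -
  interpret S: sym_bundle "bdom E U" "bgrp E U" "bact E U" "bact0 E U" by (rule sym[OF U])
  note F = vbun[OF U]
  show ?thesis
    unfolding fixed_iff
  proof (intro conjI ballI impI)
    note z = vb_zero[OF F x]
    show "vzero (bdom E U) x \<in> total (bdom E U)" by (rule z(1))
    fix g assume g: "g \<in> carrier (bgrp E U)" "bact0 E U g (vproj (bdom E U) (vzero (bdom E U) x)) = vproj (bdom E U) (vzero (bdom E U) x)"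
    have e: "vscale (bdom E U) 0 u = vzero (bdom E U) x" if "u \<in> total (bdom E U)" "vproj (bdom E U) u = x" for u
      by (rule fiber_algebra(9)[OF F that that that])
    have gz: "bact E U g (vzero (bdom E U) x) \<in> total (bdom E U)" "vproj (bdom E U) (bact E U g (vzero (bdom E U) x)) = x"
      using g z by auto
    have "bact E U g (vzero (bdom E U) x) = bact E U g (vscale (bdom E U) 0 (vzero (bdom E U) x))" using e[OF z] by simp
    also have "\<dots> = vscale (bdom E U) 0 (bact E U g (vzero (bdom E U) x))" by (rule S.a_scale[OF g(1) z(1)])
    also have "\<dots> = vzero (bdom E U) x" by (rule e[OF gz])
    finally show "bact E U g (vzero (bdom E U) x) = vzero (bdom E U) x" .
  qed
qed

text \<open>Two vectors with the same image in \<open>E\<close> differ by a group element. If they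
  have the same base point, this element belongs to its isotropy group and therefore fixes
  \<open>v\<close>. Uniqueness and compatibility of lifts rest on this.\<close>

lemma fixed_unique:
  assumes U: "U \<in> I" and v: "v \<in> fixed_vectors E U" and w: "w \<in> total (bdom E U)"
    and "vproj (bdom E U) v = vproj (bdom E U) w" "bchart E U v = bchart E U w"
  shows "v = w"
proof -
  interpret S: sym_bundle "bdom E U" "bgrp E U" "bact E U" "bact0 E U" by (rule sym[OF U])
  from chartE(4)[OF U fixed_total[OF v] w assms(5)] obtain g where g: "g \<in> carrier (bgrp E U)" "w = bact E U g v" by blast
  then have "bact0 E U g (vproj (bdom E U) v) = vproj (bdom E U) v" using assms(4) fixed_total[OF v] by simp
  then show ?thesis using v g by (simp add: fixed_iff)
qed

text \<open>From left to right, isotropy elements of the smaller chart are sent to isotropy elements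
  of the larger one, and the embedding is injective. Conversely, an isotropy element of the larger
  chart is not known to come from the smaller one; but it sends the image of \<open>u\<close> to a
  vector that comes from the smaller chart, over the same point and with the same image in
  \<open>E\<close>, and \<open>fixed_unique\<close> identifies that vector with
  \<open>u\<close>.\<close>

lemma fixed_psi:
  assumes W: "W \<in> I" and U: "U \<in> I" and WU: "W \<subseteq> U" and u: "u \<in> total (bdom E W)"
  shows "bmap E W U u \<in> fixed_vectors E U \<longleftrightarrow> u \<in> fixed_vectors E W"
proof
  interpret S: sym_bundle "bdom E U" "bgrp E U" "bact E U" "bact0 E U" by (rule sym[OF U])
  interpret R: sym_bundle "bdom E W" "bgrp E W" "bact E W" "bact0 E W" by (rule sym[OF W])
  note em = emb_maps[OF W U WU] and ac = psi_act[OF W U WU] phi_act[OF W U WU] iota[OF W U WU]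
  let ?y = "vproj (bdom E W) u"
  have y: "?y \<in> bdom0 E W" using u by simp
  {
    assume f: "bmap E W U u \<in> fixed_vectors E U"
    show "u \<in> fixed_vectors E W"
      unfolding fixed_iff
    proof (intro conjI u ballI impI)
      fix h assume h: "h \<in> carrier (bgrp E W)" "bact0 E W h ?y = ?y"
      have "bact0 E U (bhom E W U h) (bmap0 E W U ?y) = bmap0 E W U ?y" using ac(2)[OF h(1) y] h(2) by simp
      then have "bact E U (bhom E W U h) (bmap E W U u) = bmap E W U u" using f ac(3)[OF h(1)] em(7)[OF u] by (simp add: fixed_iff)
      then have "bmap E W U (bact E W h u) = bmap E W U u" using ac(1)[OF h(1) u] by simp
      then show "bact E W h u = u" using em(1) u h(1) by (simp add: inj_on_def)
    qed
  }
  assume f: "u \<in> fixed_vectors E W"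
  show "bmap E W U u \<in> fixed_vectors E U"
    unfolding fixed_iff
  proof (intro conjI em(5)[OF u] ballI impI)
    fix g assume g: "g \<in> carrier (bgrp E U)" "bact0 E U g (vproj (bdom E U) (bmap E W U u)) = vproj (bdom E U) (bmap E W U u)"
    have "\<exists>v\<in>total (bdom E W). vproj (bdom E W) v = ?y \<and> bmap E W U v = bact E U g (bmap E W U u)"
    proof (rule open_linear_image[OF vbun[OF U] vbun[OF W] bmap_vb[OF U W WU] em(3,2) y])
      show "bact E U g (bmap E W U u) \<in> total (bdom E U)" using g em(5)[OF u] by simp
      show "vproj (bdom E U) (bact E U g (bmap E W U u)) = bmap0 E W U ?y" using g em(5)[OF u] em(7)[OF u] by simp
    qed
    then obtain v where v: "v \<in> total (bdom E W)" "vproj (bdom E W) v = ?y" "bmap E W U v = bact E U g (bmap E W U u)" by blast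
    have "bchart E W v = bchart E U (bact E U g (bmap E W U u))" using eta_psi[OF W U WU v(1)] v(3) by simp
    also have "\<dots> = bchart E W u" using chartE(6)[OF U g(1) em(5)[OF u]] eta_psi[OF W U WU u] by simp
    finally have "u = v" using fixed_unique[OF W f v(1)] v(2) by simp
    then show "bact E U g (bmap E W U u) = bmap E W U u" using v(3) by simp
  qed
qed

text \<open>By definition \<open>e\<close> has a fixed representative in some chart
  \<open>V\<close>. It is transported to the chart \<open>U\<close> through a smaller chart
  \<open>W\<close> contained in both, and a final translation puts it over the prescribed point
  \<open>x\<close>.\<close>

lemma fixed_lift:
  assumes e: "e \<in> Estr E" and U: "U \<in> I" and x: "x \<in> bdom0 E U" "bchart0 E U x = bproj E e"
  shows "\<exists>v\<in>fixed_vectors E U. vproj (bdom E U) v = x \<and> bchart E U v = e"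
proof -
  from e obtain V v where V: "V \<in> I" and v: "v \<in> fixed_vectors E V" "bchart E V v = e" by (auto simp: Estr_def)
  note vt = fixed_total[OF v(1)]
  interpret S: sym_bundle "bdom E U" "bgrp E U" "bact E U" "bact0 E U" by (rule sym[OF U])
  interpret R: sym_bundle "bdom E V" "bgrp E V" "bact E V" "bact0 E V" by (rule sym[OF V])
  have pv: "bchart0 E V (vproj (bdom E V) v) = bproj E e" using bproj_chart[OF V vt] v(2) by simp
  have "bproj E e \<in> U" "bproj E e \<in> V" using chartX_in[OF U x(1)] x(2) chartX_in[OF V, of "vproj (bdom E V) v"] pv vt by auto
  from refine[OF U V this] obtain W where W: "W \<in> I" "bproj E e \<in> W" "W \<subseteq> U" "W \<subseteq> V" by blast
  from point_lift[OF W(1,2)] obtain y where y: "y \<in> bdom0 E W" "bchart0 E W y = bproj E e" by blast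
  note eV = emb_maps[OF W(1) V W(4)] and eU = emb_maps[OF W(1) U W(3)]
  have "bchart0 E W y = bchart0 E V (vproj (bdom E V) v)" using y pv by simp
  from pull[OF W(1) V W(4) _ y(1) this] vt obtain h u where h: "h \<in> carrier (bgrp E V)" and
    u: "u \<in> total (bdom E W)" "vproj (bdom E W) u = y" "bmap E W V u = bact E V h v" by auto
  have uf: "u \<in> fixed_vectors E W" using fixed_act[OF V v(1) h] u(3) fixed_psi[OF W(1) V W(4) u(1)] by simp
  have ue: "bchart E W u = e" using eta_psi[OF W(1) V W(4) u(1)] u(3) chartE(6)[OF V h vt] v(2) by simp
  have z: "bmap E W U u \<in> fixed_vectors E U" using fixed_psi[OF W(1) U W(3) u(1)] uf by simp
  have "bchart0 E U (bmap0 E W U y) = bchart0 E U x" using rho_phi[OF W(1) U W(3) y(1)] y(2) x(2) by simp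
  from chartX(4)[OF U eU(6)[OF y(1)] x(1) this] obtain g where g: "g \<in> carrier (bgrp E U)" "x = bact0 E U g (bmap0 E W U y)" by blast
  show ?thesis
  proof (intro bexI conjI)
    show "bact E U g (bmap E W U u) \<in> fixed_vectors E U" by (rule fixed_act[OF U z g(1)])
    show "vproj (bdom E U) (bact E U g (bmap E W U u)) = x" using g eU(5,7)[OF u(1)] u(2) by simp
    show "bchart E U (bact E U g (bmap E W U u)) = e"
      using chartE(6)[OF U g(1) eU(5)[OF u(1)]] eta_psi[OF W(1) U W(3) u(1)] ue by simp
  qed
qed

text \<open>Both pairs are transported to a common smaller chart, over one point \<open>y\<close>.
  There the fixed vectors \<open>b2\<close> and \<open>b3\<close> coincide by uniqueness, whereas
  \<open>a2\<close> and \<open>a3\<close> may differ by an element \<open>h\<close> of the isotropy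
  group. As \<open>h\<close> fixes \<open>b2\<close>, the two sums lie in one orbit. This is why one
  summand has to be in \<open>Estr E\<close>.\<close>

lemma sum_well_defined:
  assumes U: "U \<in> I" and a: "a \<in> total (bdom E U)" and b: "b \<in> fixed_vectors E U" and ab: "vproj (bdom E U) a = vproj (bdom E U) b"
    and U': "U' \<in> I" and a': "a' \<in> total (bdom E U')" and b': "b' \<in> fixed_vectors E U'" and ab': "vproj (bdom E U') a' = vproj (bdom E U') b'"
    and e: "bchart E U a = bchart E U' a'" "bchart E U b = bchart E U' b'"
  shows "bchart E U (vadd (bdom E U) a (vscale (bdom E U) t b)) = bchart E U' (vadd (bdom E U') a' (vscale (bdom E U') t b'))"
proof -
  have down: "\<exists>a2\<in>total (bdom E W). \<exists>b2\<in>fixed_vectors E W. vproj (bdom E W) a2 = y \<and> vproj (bdom E W) b2 = y \<and>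
      bchart E W a2 = bchart E U a \<and> bchart E W b2 = bchart E U b \<and>
      bchart E W (vadd (bdom E W) a2 (vscale (bdom E W) t b2)) = bchart E U (vadd (bdom E U) a (vscale (bdom E U) t b))"
    if U: "U \<in> I" and a: "a \<in> total (bdom E U)" and b: "b \<in> fixed_vectors E U" and ab: "vproj (bdom E U) a = vproj (bdom E U) b"
     and W: "W \<in> I" "W \<subseteq> U" and y: "y \<in> bdom0 E W" "bchart0 E W y = bchart0 E U (vproj (bdom E U) a)" for U a b W y
  proof -
    interpret S: sym_bundle "bdom E U" "bgrp E U" "bact E U" "bact0 E U" by (rule sym[OF U])
    note bt = fixed_total[OF b] and em = emb_maps[OF W(1) U W(2)]
    from pull[OF W(1) U W(2) _ y] a obtain g where g: "g \<in> carrier (bgrp E U)" and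
      gl: "\<forall>v\<in>total (bdom E U). vproj (bdom E U) v = vproj (bdom E U) a \<longrightarrow>
        (\<exists>u\<in>total (bdom E W). vproj (bdom E W) u = y \<and> bmap E W U u = bact E U g v)" by auto
    from gl a obtain a2 where a2: "a2 \<in> total (bdom E W)" "vproj (bdom E W) a2 = y" "bmap E W U a2 = bact E U g a" by blast
    from gl bt ab obtain b2 where b2: "b2 \<in> total (bdom E W)" "vproj (bdom E W) b2 = y" "bmap E W U b2 = bact E U g b" by metis
    have bf: "b2 \<in> fixed_vectors E W" using fixed_act[OF U b g] b2(3) fixed_psi[OF W(1) U W(2) b2(1)] by simp
    note sc = vb_scale[OF vbun[OF W(1)] b2(1), of t] and sc' = vb_scale[OF vbun[OF U] bt, of t]
    have pe: "vproj (bdom E W) a2 = vproj (bdom E W) (vscale (bdom E W) t b2)" using sc a2 b2 by simp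
    have pe': "vproj (bdom E U) a = vproj (bdom E U) (vscale (bdom E U) t b)" using sc' ab by simp
    note ad = vb_add[OF vbun[OF W(1)] a2(1) sc(1) pe] and ad' = vb_add[OF vbun[OF U] a sc'(1) pe']
    have "bmap E W U (vadd (bdom E W) a2 (vscale (bdom E W) t b2)) = vadd (bdom E U) (bact E U g a) (vscale (bdom E U) t (bact E U g b))"
      using em(8)[OF a2(1) sc(1) pe] em(9)[OF b2(1)] a2(3) b2(3) by simp
    also have "\<dots> = bact E U g (vadd (bdom E U) a (vscale (bdom E U) t b))"
      using S.a_add[OF g a sc'(1) pe'] S.a_scale[OF g bt] by simp
    finally have "bchart E W (vadd (bdom E W) a2 (vscale (bdom E W) t b2)) = bchart E U (vadd (bdom E U) a (vscale (bdom E U) t b))"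
      using eta_psi[OF W(1) U W(2) ad(1)] chartE(6)[OF U g ad'(1)] by simp
    moreover have "bchart E W a2 = bchart E U a" "bchart E W b2 = bchart E U b"
      using eta_psi[OF W(1) U W(2)] a2 b2 chartE(6)[OF U g] a bt by metis+
    ultimately show ?thesis using a2 b2 bf by blast
  qed
  have pa: "bchart0 E U (vproj (bdom E U) a) = bproj E (bchart E U a)" "bchart0 E U' (vproj (bdom E U') a') = bproj E (bchart E U a)"
    using bproj_chart[OF U a] bproj_chart[OF U' a'] e by auto
  have "bproj E (bchart E U a) \<in> U" "bproj E (bchart E U a) \<in> U'" using chartE_in[OF U a] chartE_in[OF U' a'] e by auto
  from refine[OF U U' this] obtain W where W: "W \<in> I" "bproj E (bchart E U a) \<in> W" "W \<subseteq> U" "W \<subseteq> U'" by blast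
  from point_lift[OF W(1,2)] obtain y where y: "y \<in> bdom0 E W" "bchart0 E W y = bproj E (bchart E U a)" by blast
  from down[OF U a b ab W(1,3) y(1)] y(2) pa obtain a2 b2 where 2: "a2 \<in> total (bdom E W)" "b2 \<in> fixed_vectors E W"
     "vproj (bdom E W) a2 = y" "vproj (bdom E W) b2 = y" "bchart E W a2 = bchart E U a" "bchart E W b2 = bchart E U b"
     "bchart E W (vadd (bdom E W) a2 (vscale (bdom E W) t b2)) = bchart E U (vadd (bdom E U) a (vscale (bdom E U) t b))" by auto
  from down[OF U' a' b' ab' W(1,4) y(1)] y(2) pa obtain a3 b3 where 3: "a3 \<in> total (bdom E W)" "b3 \<in> fixed_vectors E W"
     "vproj (bdom E W) a3 = y" "vproj (bdom E W) b3 = y" "bchart E W a3 = bchart E U' a'" "bchart E W b3 = bchart E U' b'"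
     "bchart E W (vadd (bdom E W) a3 (vscale (bdom E W) t b3)) = bchart E U' (vadd (bdom E U') a' (vscale (bdom E U') t b'))" by auto
  interpret R: sym_bundle "bdom E W" "bgrp E W" "bact E W" "bact0 E W" by (rule sym[OF W(1)])
  have b: "b3 = b2" by (rule fixed_unique[OF W(1) 3(2) fixed_total[OF 2(2)]]) (use 2 3 e in auto)
  have "bchart E W a2 = bchart E W a3" using 2 3 e by simp
  from chartE(4)[OF W(1) 2(1) 3(1) this] obtain h where h: "h \<in> carrier (bgrp E W)" "a3 = bact E W h a2" by blast
  have "bact0 E W h y = y" using h 2(1,3) 3(3) by simp
  then have hb: "bact E W h b2 = b2" using 2(2,4) h(1) by (simp add: fixed_iff)
  note bt = fixed_total[OF 2(2)]
  note sc = vb_scale[OF vbun[OF W(1)] bt, of t]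
  have pe: "vproj (bdom E W) a2 = vproj (bdom E W) (vscale (bdom E W) t b2)" using sc 2 by simp
  have "vadd (bdom E W) a3 (vscale (bdom E W) t b3) = bact E W h (vadd (bdom E W) a2 (vscale (bdom E W) t b2))"
    using R.a_add[OF h(1) 2(1) sc(1) pe] R.a_scale[OF h(1) bt] hb h(2) b by simp
  then show ?thesis using 2(7) 3(7) chartE(6)[OF W(1) h(1) vb_add(1)[OF vbun[OF W(1)] 2(1) sc(1) pe]] by simp
qed

lemma str_plus_eq:
  assumes "U \<in> I" "a \<in> total (bdom E U)" "b \<in> fixed_vectors E U" "vproj (bdom E U) a = vproj (bdom E U) b"
  shows "str_plus E (bchart E U a) t (bchart E U b) = bchart E U (vadd (bdom E U) a (vscale (bdom E U) t b))"
  unfolding str_plus_def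
proof (rule the_equality)
  show "\<exists>U'\<in>I. \<exists>a'\<in>total (bdom E U'). \<exists>b'\<in>fixed_vectors E U'. vproj (bdom E U') a' = vproj (bdom E U') b' \<and>
      bchart E U' a' = bchart E U a \<and> bchart E U' b' = bchart E U b \<and>
      bchart E U (vadd (bdom E U) a (vscale (bdom E U) t b)) = bchart E U' (vadd (bdom E U') a' (vscale (bdom E U') t b'))"
    using assms by blast
  fix z assume "\<exists>U'\<in>I. \<exists>a'\<in>total (bdom E U'). \<exists>b'\<in>fixed_vectors E U'. vproj (bdom E U') a' = vproj (bdom E U') b' \<and>
      bchart E U' a' = bchart E U a \<and> bchart E U' b' = bchart E U b \<and> z = bchart E U' (vadd (bdom E U') a' (vscale (bdom E U') t b'))"
  then obtain U' a' b' where *: "U' \<in> I" "a' \<in> total (bdom E U')" "b' \<in> fixed_vectors E U'" "vproj (bdom E U') a' = vproj (bdom E U') b'"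
      "bchart E U' a' = bchart E U a" "bchart E U' b' = bchart E U b" "z = bchart E U' (vadd (bdom E U') a' (vscale (bdom E U') t b'))" by blast
  show "z = bchart E U (vadd (bdom E U) a (vscale (bdom E U) t b))"
    unfolding *(7) by (rule sum_well_defined[OF *(1-4) assms *(5,6)])
qed

text \<open>The zero vector is \<open>v + (-1) v\<close> for a fixed vector \<open>v\<close>, so
  this becomes an instance of the well-defined sum, with \<open>v\<close> a lift of the first zero
  vector to the second chart.\<close>

lemma zero_well_defined:
  assumes U: "U \<in> I" "x \<in> bdom0 E U" and U': "U' \<in> I" "x' \<in> bdom0 E U'" and e: "bchart0 E U x = bchart0 E U' x'"
  shows "bchart E U (vzero (bdom E U) x) = bchart E U' (vzero (bdom E U') x')"
proof -
  note z = vb_zero[OF vbun[OF U(1)] U(2)] and z' = vb_zero[OF vbun[OF U'(1)] U'(2)]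
  have "bchart E U (vzero (bdom E U) x) \<in> Estr E" using fixed_zero[OF U] U by (auto simp: Estr_def)
  moreover have "bchart0 E U' x' = bproj E (bchart E U (vzero (bdom E U) x))" using bproj_chart[OF U(1) z(1)] z(2) e by simp
  ultimately obtain v where v: "v \<in> fixed_vectors E U'" "vproj (bdom E U') v = x'" "bchart E U' v = bchart E U (vzero (bdom E U) x)"
    using fixed_lift[OF _ U'] by blast
  note vt = fixed_total[OF v(1)]
  have f: "vzero (bdom E U) x \<in> fixed_vectors E U" by (rule fixed_zero[OF U])
  have "bchart E U (vadd (bdom E U) (vzero (bdom E U) x) (vscale (bdom E U) (-1) (vzero (bdom E U) x))) =
     bchart E U' (vadd (bdom E U') v (vscale (bdom E U') (-1) v))"
    by (rule sum_well_defined[OF U(1) z(1) f refl U'(1) vt v(1) refl]) (use v in auto)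
  moreover have n: "vadd (bdom E V) u (vscale (bdom E V) (-1) u) = vzero (bdom E V) (vproj (bdom E V) u)"
    if "V \<in> I" "u \<in> total (bdom E V)" for V u
  proof -
    note sc = vb_scale[OF vbun[OF that(1)] that(2), of "-1"]
    have "vadd (bdom E V) u (vscale (bdom E V) (-1) u) = vadd (bdom E V) (vscale (bdom E V) (-1) u) u"
      by (rule fiber_algebra(2)[OF vbun[OF that(1)] that(2) refl sc that(2) refl])
    also have "\<dots> = vzero (bdom E V) (vproj (bdom E V) u)" by (rule fiber_algebra(4)[OF vbun[OF that(1)] that(2) refl that(2) refl that(2) refl])
    finally show ?thesis .
  qed
  ultimately show ?thesis using n[OF U(1) z(1)] n[OF U'(1) vt] z(2) v(2) by simp
qed

lemma str_zero_eq:
  assumes "U \<in> I" "x \<in> bdom0 E U"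
  shows "str_zero E (bchart0 E U x) = bchart E U (vzero (bdom E U) x)"
  unfolding str_zero_def
proof (rule the_equality)
  show "\<exists>U'\<in>I. \<exists>y\<in>bdom0 E U'. bchart0 E U' y = bchart0 E U x \<and> bchart E U (vzero (bdom E U) x) = bchart E U' (vzero (bdom E U') y)"
    using assms by blast
  fix z assume "\<exists>U'\<in>I. \<exists>y\<in>bdom0 E U'. bchart0 E U' y = bchart0 E U x \<and> z = bchart E U' (vzero (bdom E U') y)"
  then show "z = bchart E U (vzero (bdom E U) x)" using zero_well_defined[OF _ _ assms] by blast
qed

text \<open>A scalar multiple is written as the zero vector plus \<open>t\<close> times
  \<open>b\<close>, which reduces independence of the chart to that of the sum.\<close>

lemma str_scale_eq:
  assumes U: "U \<in> I" and b: "b \<in> fixed_vectors E U"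
  shows "str_scale E t (bchart E U b) = bchart E U (vscale (bdom E U) t b)"
  unfolding str_scale_def
proof (rule the_equality)
  show "\<exists>U'\<in>I. \<exists>b'\<in>fixed_vectors E U'. bchart E U' b' = bchart E U b \<and> bchart E U (vscale (bdom E U) t b) = bchart E U' (vscale (bdom E U') t b')"
    using assms by blast
  fix z assume "\<exists>U'\<in>I. \<exists>b'\<in>fixed_vectors E U'. bchart E U' b' = bchart E U b \<and> z = bchart E U' (vscale (bdom E U') t b')"
  then obtain U' b' where *: "U' \<in> I" "b' \<in> fixed_vectors E U'" "bchart E U' b' = bchart E U b" "z = bchart E U' (vscale (bdom E U') t b')" by blast
  note bt = fixed_total[OF b] and bt' = fixed_total[OF *(2)]
  have x: "vproj (bdom E V) u \<in> bdom0 E V" if "V \<in> I" "u \<in> total (bdom E V)" for V u by (rule vproj_base[OF vbun[OF that(1)] that(2)])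
  have n: "vadd (bdom E V) (vzero (bdom E V) (vproj (bdom E V) u)) (vscale (bdom E V) t u) = vscale (bdom E V) t u"
    if "V \<in> I" "u \<in> total (bdom E V)" for V u
  proof -
    note sc = vb_scale[OF vbun[OF that(1)] that(2), of t]
    show ?thesis by (rule fiber_algebra(3)[OF vbun[OF that(1)] sc sc sc])
  qed
  have pe: "bchart0 E U' (vproj (bdom E U') b') = bchart0 E U (vproj (bdom E U) b)"
    using bproj_chart[OF *(1) bt'] bproj_chart[OF U bt] *(3) by simp
  note z = vb_zero[OF vbun[OF U] x[OF U bt]] and z' = vb_zero[OF vbun[OF *(1)] x[OF *(1) bt']]
  have "bchart E U' (vadd (bdom E U') (vzero (bdom E U') (vproj (bdom E U') b')) (vscale (bdom E U') t b')) =
     bchart E U (vadd (bdom E U) (vzero (bdom E U) (vproj (bdom E U) b)) (vscale (bdom E U) t b))"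
    by (rule sum_well_defined[OF *(1) z'(1) *(2) z'(2) U z(1) b z(2) zero_well_defined[OF *(1) x[OF *(1) bt'] U x[OF U bt] pe] *(3)])
  then show "z = bchart E U (vscale (bdom E U) t b)" using n[OF U bt] n[OF *(1) bt'] *(4) by simp
qed

end

section \<open>Testing continuity and smoothness in charts\<close>

lemma open_quotient_continuous:
  assumes op: "\<And>W. openin A W \<Longrightarrow> openin X (\<rho> ` W)" and im: "\<rho> ` topspace A = U"
    and c: "continuous_map A Y (\<lambda>y. s (\<rho> y))"
  shows "continuous_map (subtopology X U) Y s"
proof -
  have oU: "openin X U" using op[OF openin_topspace] im by simp
  have t: "topspace (subtopology X U) = U" using openin_subset[OF oU] by auto
  show ?thesis
    unfolding continuous_map_def t
  proof (intro conjI allI impI)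
    show "s \<in> U \<rightarrow> topspace Y" using continuous_map_image_subset_topspace[OF c] im by auto
    fix O' assume "openin Y O'"
    from op[OF openin_continuous_map_preimage[OF c this]]
    have o: "openin X (\<rho> ` {y \<in> topspace A. s (\<rho> y) \<in> O'})" .
    have "\<rho> ` {y \<in> topspace A. s (\<rho> y) \<in> O'} = {x \<in> U. s x \<in> O'}" using im by auto
    with o have "openin X {x \<in> U. s x \<in> O'}" by simp
    then show "openin (subtopology X U) {x \<in> U. s x \<in> O'}" using oU by (auto simp: openin_open_subtopology)
  qed
qed

lemma triv_smooth_mono:
  assumes "triv_smooth F (D, P, \<tau>) W f" "W' \<subseteq> W" "\<And>e. e \<in> W' \<Longrightarrow> f e = g e"
  shows "triv_smooth F (D, P, \<tau>) W' g"
  unfolding triv_smooth_def split_conv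
proof
  fix x assume "x \<in> vproj F ` W' \<inter> D"
  then obtain w where w: "w \<in> W'" "x = vproj F w" "vproj F w \<in> D" by auto
  then have "w \<in> W" using assms(2) by blast
  from triv_smoothD[OF assms(1) this w(3)] obtain A C c k O' h where
    1: "openin (mtop (vbase F)) A" "x \<in> A" "A \<subseteq> D" "A \<subseteq> C" "(C, c) \<in> atlas (vbase F)"
        "openE (mdim (vbase F) + fdim P k) O'" "smooth_on (mdim (vbase F) + fdim P k) O' h"
    and 2: "\<forall>e \<in> W. vproj F e \<in> A \<longrightarrow> cat (mdim (vbase F)) (c (vproj F e)) (\<tau> e k) \<in> O' \<and>
           f e = h (cat (mdim (vbase F)) (c (vproj F e)) (\<tau> e k))"
    unfolding w(2) by (elim exE conjE)
  have 3: "\<forall>e \<in> W'. vproj F e \<in> A \<longrightarrow> cat (mdim (vbase F)) (c (vproj F e)) (\<tau> e k) \<in> O' \<and>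
           g e = h (cat (mdim (vbase F)) (c (vproj F e)) (\<tau> e k))"
    using 2 assms(2,3) by (metis subsetD)
  show "\<exists>A C c k O' h. openin (mtop (vbase F)) A \<and> x \<in> A \<and> A \<subseteq> D \<and> A \<subseteq> C \<and> (C, c) \<in> atlas (vbase F) \<and>
        openE (mdim (vbase F) + fdim P k) O' \<and> smooth_on (mdim (vbase F) + fdim P k) O' h \<and>
        (\<forall>e \<in> W'. vproj F e \<in> A \<longrightarrow> cat (mdim (vbase F)) (c (vproj F e)) (\<tau> e k) \<in> O' \<and>
           g e = h (cat (mdim (vbase F)) (c (vproj F e)) (\<tau> e k)))"
    by (rule exI[of _ A], rule exI[of _ C], rule exI[of _ c], rule exI[of _ k], rule exI[of _ O'], rule exI[of _ h])
      (intro conjI 1 3)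
qed

lemma sfun_vb_mono:
  assumes "sfun (vb_space F) W f" "W' \<subseteq> W" "\<And>e. e \<in> W' \<Longrightarrow> f e = g e"
  shows "sfun (vb_space F) W' g"
  unfolding sfun_vb
proof (clarify)
  fix D P \<tau> assume T: "(D, P, \<tau>) \<in> vtriv F"
  have "triv_smooth F (D, P, \<tau>) W f" using assms(1) T unfolding sfun_vb by blast
  then show "triv_smooth F (D, P, \<tau>) W' g" by (rule triv_smooth_mono[OF _ assms(2,3)])
qed

lemma sfun_vb_local:
  assumes "\<And>w. w \<in> W \<Longrightarrow> \<exists>B. openin (mtop (vbase F)) B \<and> vproj F w \<in> B \<and> sfun (vb_space F) {v \<in> W. vproj F v \<in> B} f"
  shows "sfun (vb_space F) W f"
  unfolding sfun_vb
proof (clarify)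
  fix D P \<tau> assume T: "(D, P, \<tau>) \<in> vtriv F"
  show "triv_smooth F (D, P, \<tau>) W f"
    unfolding triv_smooth_def split_conv
  proof
    fix x assume "x \<in> vproj F ` W \<inter> D"
    then obtain w where w: "w \<in> W" "x = vproj F w" "vproj F w \<in> D" by auto
    from assms[OF w(1)] obtain B where B: "openin (mtop (vbase F)) B" "vproj F w \<in> B" "sfun (vb_space F) {v \<in> W. vproj F v \<in> B} f" by blast
    have t: "triv_smooth F (D, P, \<tau>) {v \<in> W. vproj F v \<in> B} f" using B(3) T unfolding sfun_vb by blast
    have wB: "w \<in> {v \<in> W. vproj F v \<in> B}" using w B by simp
    from triv_smoothD[OF t wB w(3)] obtain A C c k O' h where
      1: "openin (mtop (vbase F)) A" "x \<in> A" "A \<subseteq> D" "A \<subseteq> C" "(C, c) \<in> atlas (vbase F)"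
        "openE (mdim (vbase F) + fdim P k) O'" "smooth_on (mdim (vbase F) + fdim P k) O' h"
      and 2: "\<forall>e \<in> {v \<in> W. vproj F v \<in> B}. vproj F e \<in> A \<longrightarrow> cat (mdim (vbase F)) (c (vproj F e)) (\<tau> e k) \<in> O' \<and>
           f e = h (cat (mdim (vbase F)) (c (vproj F e)) (\<tau> e k))"
      unfolding w(2) by (elim exE conjE)
    have 3: "\<forall>e \<in> W. vproj F e \<in> A \<inter> B \<longrightarrow> cat (mdim (vbase F)) (c (vproj F e)) (\<tau> e k) \<in> O' \<and>
           f e = h (cat (mdim (vbase F)) (c (vproj F e)) (\<tau> e k))" using 2 by simp
    have 4: "openin (mtop (vbase F)) (A \<inter> B)" "x \<in> A \<inter> B" "A \<inter> B \<subseteq> D" "A \<inter> B \<subseteq> C" using 1 B w(2) by auto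
    show "\<exists>A C c k O' h. openin (mtop (vbase F)) A \<and> x \<in> A \<and> A \<subseteq> D \<and> A \<subseteq> C \<and> (C, c) \<in> atlas (vbase F) \<and>
        openE (mdim (vbase F) + fdim P k) O' \<and> smooth_on (mdim (vbase F) + fdim P k) O' h \<and>
        (\<forall>e \<in> W. vproj F e \<in> A \<longrightarrow> cat (mdim (vbase F)) (c (vproj F e)) (\<tau> e k) \<in> O' \<and>
           f e = h (cat (mdim (vbase F)) (c (vproj F e)) (\<tau> e k)))"
      by (rule exI[of _ "A \<inter> B"], rule exI[of _ C], rule exI[of _ c], rule exI[of _ k], rule exI[of _ O'], rule exI[of _ h])
        (intro conjI 1 3 4)
  qed
qed

lemma vb_sectionD:
  assumes "smooth_vb_section F \<sigma>" "x \<in> pts (vbase F)" shows "\<sigma> x \<in> total F" "vproj F (\<sigma> x) = x"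
proof -
  have "continuous_map (mtop (vbase F)) (vtop F) \<sigma>"
    using assms(1) smooth_map_continuous[of "mfd_space (vbase F)" "vb_space F" \<sigma>] by (simp add: smooth_vb_section_def)
  then show "\<sigma> x \<in> total F" using continuous_map_image_subset_topspace assms(2) by blast
  show "vproj F (\<sigma> x) = x" using assms by (simp add: smooth_vb_section_def)
qed

lemma vertical_continuous:
  assumes F: "vector_bundle F" and \<sigma>: "smooth_vb_section F \<sigma>"
  shows "continuous_map (prod_topology (vtop F) (top_of_set J)) (vtop F) (\<lambda>p. vadd F (fst p) (vscale F (snd p) (\<sigma> (vproj F (fst p)))))"
proof (rule continuous_map_locally)
  let ?V = "\<lambda>p. vadd F (fst p) (vscale F (snd p) (\<sigma> (vproj F (fst p))))"
  fix p assume p: "p \<in> topspace (prod_topology (vtop F) (top_of_set J))"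
  then have p': "fst p \<in> total F" "snd p \<in> J" by auto
  from triv_exists[OF F vproj_base[OF F p'(1)]] obtain D P \<tau> where T: "(D, P, \<tau>) \<in> vtriv F" "vproj F (fst p) \<in> D" by blast
  interpret local_triv F D P \<tau> by (rule local_triv.intro[OF F T(1)])
  let ?Q = "prod_topology (subtopology (vtop F) (restr F D)) (top_of_set J)"
  have tQ: "q \<in> topspace ?Q \<longleftrightarrow> fst q \<in> restr F D \<and> snd q \<in> J" for q by (auto simp: mem_Times_iff)
  have sub: "subtopology (prod_topology (vtop F) (top_of_set J)) (restr F D \<times> J) = ?Q"
    unfolding subtopology_Times by (simp add: subtopology_subtopology)
  have \<sigma>D: "\<sigma> x \<in> restr F D" "vproj F (\<sigma> x) = x" if "x \<in> D" for x using vb_sectionD[OF \<sigma>, of x] that DM by auto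
  have V: "?V q \<in> restr F D \<and> vproj F (?V q) = vproj F (fst q) \<and> \<tau> (?V q) = (\<lambda>k i. \<tau> (fst q) k i + snd q * \<tau> (\<sigma> (vproj F (fst q))) k i)"
    if q: "fst q \<in> restr F D" for q
  proof -
    have s: "\<sigma> (vproj F (fst q)) \<in> restr F D" "vproj F (\<sigma> (vproj F (fst q))) = vproj F (fst q)" using \<sigma>D q by auto
    note sc = scale[OF s(1), of "snd q"]
    have "vproj F (fst q) = vproj F (vscale F (snd q) (\<sigma> (vproj F (fst q))))" using sc(2) s(2) by simp
    from add[OF q sc(1) this] show ?thesis unfolding sc(3) by auto
  qed
  have c1: "continuous_map ?Q (subtopology (vtop F) (restr F D)) fst" by (rule continuous_map_fst)
  have c2: "creal ?Q snd"
    using continuous_map_into_fulltopology[OF continuous_map_snd] by blast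
  have ct: "creal (subtopology (vtop F) (restr F D)) (\<lambda>e. \<tau> e k i)" for k i
    using tau_continuous[of k] by (simp add: continuous_map_Euclidean_space_iff)
  have cp: "continuous_map (subtopology (vtop F) (restr F D)) (subtopology (mtop M) D) (vproj F)"
    by (auto simp: continuous_map_in_subtopology intro: continuous_map_from_subtopology vproj_continuous[OF F])
  have cs: "creal (subtopology (mtop M) D) (\<lambda>x. \<tau> (\<sigma> x) k i)" for k i
  proof (cases "i < fdim P k")
    case True
    have "sf M D (\<lambda>x. \<tau> (\<sigma> x) k i)"
      by (rule section_coord_smooth[OF _ _ True]) (use \<sigma> vb_sectionD[OF \<sigma>] in \<open>auto simp: smooth_vb_section_def\<close>)
    then show ?thesis by (rule sf_continuous[OF mf oD])
  next
    case False
    have "creal (subtopology (mtop M) D) (\<lambda>x. 0)" by simp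
    then show ?thesis
    proof (rule continuous_map_eq)
      fix x assume "x \<in> topspace (subtopology (mtop M) D)"
      then have "x \<in> D" by simp
      from tau_Euclid[OF \<sigma>D(1)[OF this], of k] False show "0 = \<tau> (\<sigma> x) k i" by (simp add: topspace_Euclidean_space)
    qed
  qed
  have co: "creal ?Q (\<lambda>q. \<tau> (fst q) k i + snd q * \<tau> (\<sigma> (vproj F (fst q))) k i)" for k i
    using continuous_map_compose[OF c1 ct[of k i]] continuous_map_compose[OF c1 continuous_map_compose[OF cp cs[of k i]]] c2
    by (intro continuous_map_add continuous_map_real_mult) (simp_all add: o_def)
  have "continuous_map ?Q (stage P k) (\<lambda>q i. \<tau> (fst q) k i + snd q * \<tau> (\<sigma> (vproj F (fst q))) k i)" for k
    unfolding continuous_map_Euclidean_space_iff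
  proof (intro conjI allI co)
    show "(\<lambda>q i. \<tau> (fst q) k i + snd q * \<tau> (\<sigma> (vproj F (fst q))) k i) \<in> topspace ?Q \<rightarrow> Euclid (fdim P k)"
    proof
      fix q assume "q \<in> topspace ?Q"
      then have "fst q \<in> restr F D" using tQ by blast
      from V[OF this] tau_Euclid[of "?V q" k] show "(\<lambda>i. \<tau> (fst q) k i + snd q * \<tau> (\<sigma> (vproj F (fst q))) k i) \<in> Euclid (fdim P k)" by auto
    qed
  qed
  then have "continuous_map ?Q (product_topology (stage P) UNIV) (\<lambda>q k i. \<tau> (fst q) k i + snd q * \<tau> (\<sigma> (vproj F (fst q))) k i)"
    by (simp add: continuous_map_componentwise_UNIV)
  moreover have "(\<lambda>k i. \<tau> (fst q) k i + snd q * \<tau> (\<sigma> (vproj F (fst q))) k i) \<in> lim_points P" if "q \<in> topspace ?Q" for q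
  proof -
    have "fst q \<in> restr F D" using that tQ by blast
    from V[OF this] tau_lim[of "?V q"] show ?thesis by auto
  qed
  ultimately have cl: "continuous_map ?Q (prolimit P) (\<lambda>q k i. \<tau> (fst q) k i + snd q * \<tau> (\<sigma> (vproj F (fst q))) k i)"
    unfolding prolimit_def continuous_map_in_subtopology lim_points_iff by auto
  have "continuous_map ?Q (prod_topology (subtopology (mtop M) D) (prolimit P))
     (\<lambda>q. (vproj F (fst q), \<lambda>k i. \<tau> (fst q) k i + snd q * \<tau> (\<sigma> (vproj F (fst q))) k i))"
    using cl continuous_map_compose[OF c1 cp] by (simp add: continuous_map_pairwise o_def)
  from continuous_map_compose[OF this fr_continuous] have "continuous_map ?Q (vtop F) ?V"
  proof (rule continuous_map_eq)
    fix q assume "q \<in> topspace ?Q"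
    then have "fst q \<in> restr F D" using tQ by blast
    from V[OF this] fr_tau[OF conjunct1[OF V[OF this]]]
    show "((\<lambda>q. fr (fst q) (snd q)) \<circ> (\<lambda>q. (vproj F (fst q), \<lambda>k i. \<tau> (fst q) k i + snd q * \<tau> (\<sigma> (vproj F (fst q))) k i))) q = ?V q"
      by simp
  qed
  moreover have "openin (prod_topology (vtop F) (top_of_set J)) (restr F D \<times> J)"
    using restr_open openin_topspace[of "top_of_set J"] by (simp add: openin_prod_Times_iff)
  moreover have "p \<in> restr F D \<times> J" using p' T(2) by (auto simp: mem_Times_iff)
  ultimately show "\<exists>B. openin (prod_topology (vtop F) (top_of_set J)) B \<and> p \<in> B \<and>
      continuous_map (subtopology (prod_topology (vtop F) (top_of_set J)) B) (vtop F) ?V"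
    using sub by (intro exI[of _ "restr F D \<times> J"]) simp
qed

lemma second_countable_euclidean: "second_countable (euclidean :: 'a :: second_countable_topology topology)"
proof -
  obtain B :: "'a set set" where B: "countable B" "topological_basis B" using ex_countable_basis by blast
  have "\<exists>V\<in>B. x \<in> V \<and> V \<subseteq> U" if "open U" "x \<in> U" for U x
    using topological_basisE[OF B(2) that] by metis
  then show ?thesis
    unfolding second_countable_def using B topological_basis_open[OF B(2)] by (intro exI[of _ B]) auto
qed

lemma manifold_interval: "manifold (interval \<epsilon>)"
proof -
  let ?I = "{-\<epsilon><..<\<epsilon>}" and ?c = "\<lambda>t (i::nat). if i = 0 then t else (0::real)"
  have im: "?c ` ?I = {x \<in> Euclid 1. x 0 \<in> ?I}"
  proof (intro equalityI subsetI)
    fix x assume x: "x \<in> {x \<in> Euclid 1. x 0 \<in> ?I}"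
    then have "x = ?c (x 0)" by (auto simp: topspace_Euclidean_space fun_eq_iff)
    then show "x \<in> ?c ` ?I" using x by blast
  qed (auto simp: topspace_Euclidean_space)
  have o: "openE 1 (?c ` ?I)"
    unfolding im by (rule openin_continuous_map_preimage[OF continuous_map_Euclidean_coord]) simp
  have "homeomorphic_maps (subtopology (top_of_set ?I) ?I) (subtopology (Euclidean_space 1) (?c ` ?I)) ?c (\<lambda>x. x 0)"
    unfolding homeomorphic_maps_def
  proof (intro conjI)
    have "creal (subtopology (top_of_set ?I) ?I) (\<lambda>x. x)" by (simp add: subtopology_subtopology)
    then show "continuous_map (subtopology (top_of_set ?I) ?I) (subtopology (Euclidean_space 1) (?c ` ?I)) ?c"
      unfolding continuous_map_in_subtopology continuous_map_Euclidean_space_iff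
      by (auto simp: topspace_Euclidean_space)
    show "continuous_map (subtopology (Euclidean_space 1) (?c ` ?I)) (subtopology (top_of_set ?I) ?I) (\<lambda>x. x 0)"
      unfolding continuous_map_in_subtopology
      by (auto intro: continuous_map_from_subtopology continuous_map_Euclidean_coord)
  qed auto
  then have h: "homeomorphic_map (subtopology (top_of_set ?I) ?I) (subtopology (Euclidean_space 1) (?c ` ?I)) ?c"
    by (rule homeomorphic_maps_imp_map)
  have s: "smooth_on 1 (?c ` (?I \<inter> ?I)) (\<lambda>y. ?c (inv_into ?I ?c y) i)" if "i < 1" for i
  proof -
    have inj: "inj_on ?c ?I" by (auto simp: inj_on_def fun_eq_iff)
    have "smooth_on 1 (?c ` ?I) (\<lambda>y. ?c (inv_into ?I ?c y) i)"
    proof (rule smooth_on_cong[OF o _ smooth_on_coord[of _ _ i]])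
      fix p assume "p \<in> ?c ` ?I"
      then have "?c (inv_into ?I ?c p) = p" by (rule f_inv_into_f)
      from fun_cong[OF this, of i] show "p i = ?c (inv_into ?I ?c p) i" by (rule sym)
    qed
    then show ?thesis by simp
  qed
  have 1: "Hausdorff_space (top_of_set ?I)" "second_countable (top_of_set ?I)"
    by (auto intro: Hausdorff_space_subtopology second_countable_subtopology second_countable_euclidean)
  show ?thesis unfolding manifold_def interval_simps using 1 o h s by auto
qed

text \<open>The product of a quotient map with an identity map need not be a quotient map, but
  openness does pass to the product. Continuity on \<open>E\<close> times an interval can therefore
  be tested in a chart of \<open>E\<close>.\<close>

lemma open_map_times:
  assumes op: "\<And>W. openin A W \<Longrightarrow> openin X (\<rho> ` W)" and W: "openin (prod_topology A C) W"
  shows "openin (prod_topology X C) ((\<lambda>p. (\<rho> (fst p), snd p)) ` W)"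
  unfolding openin_prod_topology_alt
proof (intro allI impI)
  fix x t assume "(x, t) \<in> (\<lambda>p. (\<rho> (fst p), snd p)) ` W"
  then obtain v where v: "(v, t) \<in> W" "x = \<rho> v" by auto
  from openin_prod_topology_alt[THEN iffD1, rule_format, OF W v(1)]
  obtain V J where VJ: "openin A V" "openin C J" "v \<in> V" "t \<in> J" "V \<times> J \<subseteq> W" by (elim exE conjE)
  have "\<rho> ` V \<times> J \<subseteq> (\<lambda>p. (\<rho> (fst p), snd p)) ` W" using VJ(5) by force
  then show "\<exists>U V. openin X U \<and> openin C V \<and> x \<in> U \<and> t \<in> V \<and> U \<times> V \<subseteq> (\<lambda>p. (\<rho> (fst p), snd p)) ` W"
    using op[OF VJ(1)] VJ v(2) by blast
qed

context orbib
begin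

section \<open>Good sections are smooth stratified sections\<close>

lemma space_simps [simp]: "stop (orbispace_space (base_orbispace E)) = btop0 E" "stop (orbibundle_space E) = btop E"
    "stop (orbibundle_times_interval E \<epsilon>) = prod_topology (btop E) (top_of_set {-\<epsilon><..<\<epsilon>})"
  by (simp_all add: orbispace_space_def orbibundle_space_def orbibundle_times_interval_def base_orbispace_def)

lemma sfun_X: "sfun (orbispace_space (base_orbispace E)) W f \<longleftrightarrow>
    creal (subtopology (btop0 E) W) f \<and>
    (\<forall>U\<in>I. sf (vbase (bdom E U)) {x \<in> bdom0 E U. bchart0 E U x \<in> W} (f \<circ> bchart0 E U))"
  by (simp add: orbispace_space_def base_orbispace_def)

lemma sfun_E: "sfun (orbibundle_space E) W f \<longleftrightarrow>
    creal (subtopology (btop E) W) f \<and>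
    (\<forall>U\<in>I. sfun (vb_space (bdom E U)) {v \<in> total (bdom E U). bchart E U v \<in> W} (f \<circ> bchart E U))"
  by (simp add: orbibundle_space_def)

lemma sfun_EI: "sfun (orbibundle_times_interval E \<epsilon>) W f \<longleftrightarrow>
    creal (subtopology (prod_topology (btop E) (top_of_set {-\<epsilon><..<\<epsilon>})) W) f \<and>
    (\<forall>U\<in>I. sfun (vb_space (vb_prod (bdom E U) (interval \<epsilon>)))
          {(v, t) \<in> total (bdom E U) \<times> {-\<epsilon><..<\<epsilon>}. (bchart E U v, t) \<in> W} (\<lambda>(v, t). f (bchart E U v, t)))"
  by (simp add: orbibundle_times_interval_def)

text \<open>Equivariance at an element of the isotropy group of \<open>x\<close> says that the value
  at \<open>x\<close> is fixed by it. Hence values of a good family represent points of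
  \<open>Estr E\<close>.\<close>

lemma goodD:
  assumes "good_family E s \<sigma>" "U \<in> I"
  shows "smooth_vb_section (bdom E U) (\<sigma> U)"
    "\<And>g x. g \<in> carrier (bgrp E U) \<Longrightarrow> x \<in> bdom0 E U \<Longrightarrow> \<sigma> U (bact0 E U g x) = bact E U g (\<sigma> U x)"
    "\<And>x. x \<in> bdom0 E U \<Longrightarrow> bchart E U (\<sigma> U x) = s (bchart0 E U x)"
    "\<And>x. x \<in> bdom0 E U \<Longrightarrow> \<sigma> U x \<in> total (bdom E U) \<and> vproj (bdom E U) (\<sigma> U x) = x \<and> \<sigma> U x \<in> fixed_vectors E U"
proof -
  show s: "smooth_vb_section (bdom E U) (\<sigma> U)"
    and e: "\<And>g x. g \<in> carrier (bgrp E U) \<Longrightarrow> x \<in> bdom0 E U \<Longrightarrow> \<sigma> U (bact0 E U g x) = bact E U g (\<sigma> U x)"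
    and "\<And>x. x \<in> bdom0 E U \<Longrightarrow> bchart E U (\<sigma> U x) = s (bchart0 E U x)"
    using assms by (simp_all add: good_family_def)
  fix x assume x: "x \<in> bdom0 E U"
  note t = vb_sectionD[OF s x]
  have "bact E U g (\<sigma> U x) = \<sigma> U x" if "g \<in> carrier (bgrp E U)" "bact0 E U g x = x" for g
    using e[OF that(1) x] that(2) by simp
  then show "\<sigma> U x \<in> total (bdom E U) \<and> vproj (bdom E U) (\<sigma> U x) = x \<and> \<sigma> U x \<in> fixed_vectors E U"
    using t by (auto simp: fixed_iff)
qed

lemma good_orbisection:
  assumes g: "good_family E s \<sigma>" shows "orbisection E s"
  unfolding orbisection_def
proof
  show "continuous_map (btop0 E) (btop E) s"
  proof (rule continuous_map_locally)
    fix x assume "x \<in> topspace (btop0 E)"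
    from point_exists[OF this] obtain U y where U: "U \<in> I" "y \<in> bdom0 E U" "bchart0 E U y = x" by blast
    note gd = goodD[OF g U(1)]
    have "continuous_map (mtop (vbase (bdom E U))) (vtop (bdom E U)) (\<sigma> U)"
      using gd(1) smooth_map_continuous[of "mfd_space (vbase (bdom E U))" "vb_space (bdom E U)"] by (simp add: smooth_vb_section_def)
    from continuous_map_compose[OF this chartE(2)[OF U(1)]]
    have "continuous_map (mtop (vbase (bdom E U))) (btop E) (\<lambda>y. s (bchart0 E U y))"
      by (rule continuous_map_eq) (simp add: gd(3))
    from open_quotient_continuous[OF chartX(5)[OF U(1)] chartX(3)[OF U(1)] this]
    have "continuous_map (subtopology (btop0 E) U) (btop E) s" .
    then show "\<exists>B. openin (btop0 E) B \<and> x \<in> B \<and> continuous_map (subtopology (btop0 E) B) (btop E) s"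
      using chartX(1)[OF U(1)] chartX_in[OF U(1,2)] U(3) by blast
  qed
  show "\<forall>x\<in>topspace (btop0 E). bproj E (s x) = x"
  proof
    fix x assume "x \<in> topspace (btop0 E)"
    from point_exists[OF this] obtain U y where U: "U \<in> I" "y \<in> bdom0 E U" "bchart0 E U y = x" by blast
    note gd = goodD[OF g U(1)]
    show "bproj E (s x) = x" using gd(3,4)[OF U(2)] bproj_chart[OF U(1), of "\<sigma> U y"] U(3) by simp
  qed
qed

lemma good_Estr: "good_family E s \<sigma> \<Longrightarrow> s ` topspace (btop0 E) \<subseteq> Estr E"
proof
  assume g: "good_family E s \<sigma>"
  fix e assume "e \<in> s ` topspace (btop0 E)"
  then obtain x where x: "x \<in> topspace (btop0 E)" "e = s x" by blast
  from point_exists[OF x(1)] obtain U y where U: "U \<in> I" "y \<in> bdom0 E U" "bchart0 E U y = x" by blast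
  note gd = goodD[OF g U(1)]
  have "e = bchart E U (\<sigma> U y)" "\<sigma> U y \<in> fixed_vectors E U" using gd(3,4)[OF U(2)] U(3) x(2) by auto
  then show "e \<in> Estr E" using U(1) by (auto simp: Estr_def)
qed

lemma good_smooth:
  assumes g: "good_family E s \<sigma>"
  shows "smooth_map (orbispace_space (base_orbispace E)) (orbibundle_space E) s"
  unfolding smooth_map_def space_simps
proof (intro conjI allI impI)
  show cs: "continuous_map (btop0 E) (btop E) s" using good_orbisection[OF g] by (simp add: orbisection_def)
  fix W f assume "openin (btop E) W \<and> sfun (orbibundle_space E) W f"
  then have W: "openin (btop E) W" and f: "sfun (orbibundle_space E) W f" by auto
  let ?V = "{x \<in> topspace (btop0 E). s x \<in> W}"
  show "sfun (orbispace_space (base_orbispace E)) ?V (f \<circ> s)"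
    unfolding sfun_X
  proof (intro conjI ballI)
    have "continuous_map (subtopology (btop0 E) ?V) (subtopology (btop E) W) s"
      unfolding continuous_map_in_subtopology using continuous_map_from_subtopology[OF cs] by auto
    then show "creal (subtopology (btop0 E) ?V) (f \<circ> s)"
      using f continuous_map_compose unfolding sfun_E by blast
    fix U assume U: "U \<in> I"
    let ?F = "bdom E U"
    note gd = goodD[OF g U]
    have oW: "openin (vtop ?F) {v \<in> total ?F. bchart E U v \<in> W}" by (rule openin_continuous_map_preimage[OF chartE(2)[OF U] W])
    have sm: "smooth_map (mfd_space (vbase ?F)) (vb_space ?F) (\<sigma> U)" using gd(1) by (simp add: smooth_vb_section_def)
    have "sfun (vb_space ?F) {v \<in> total ?F. bchart E U v \<in> W} (f \<circ> bchart E U)" using f U by (simp add: sfun_E)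
    from smooth_mapD[OF sm _ this] oW
    have 1: "sf (vbase ?F) {x \<in> bdom0 E U. \<sigma> U x \<in> {v \<in> total ?F. bchart E U v \<in> W}} (f \<circ> bchart E U \<circ> \<sigma> U)" by simp
    have eq: "{x \<in> bdom0 E U. \<sigma> U x \<in> {v \<in> total ?F. bchart E U v \<in> W}} = {x \<in> bdom0 E U. bchart0 E U x \<in> ?V}"
      using gd(3,4) chartX_in[OF U] by auto
    have o: "openin (mtop (vbase ?F)) {x \<in> bdom0 E U. bchart0 E U x \<in> ?V}"
      by (rule openin_continuous_map_preimage[OF chartX(2)[OF U] openin_continuous_map_preimage[OF cs W]])
    show "sf (vbase ?F) {x \<in> bdom0 E U. bchart0 E U x \<in> ?V} (f \<circ> s \<circ> bchart0 E U)"
      by (rule sf_cong[OF vb_manifold[OF vbun[OF U]] o _ 1[unfolded eq]]) (use gd(3) in auto)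
  qed
qed

lemma good_vertical_formula:
  assumes g: "good_family E s \<sigma>" and U: "U \<in> I" and v: "v \<in> total (bdom E U)"
  shows "vertical_extension E s (bchart E U v, t) =
     bchart E U (vadd (bdom E U) v (vscale (bdom E U) t (\<sigma> U (vproj (bdom E U) v))))"
proof -
  note gd = goodD[OF g U]
  have x: "vproj (bdom E U) v \<in> bdom0 E U" by (rule vproj_base[OF vbun[OF U] v])
  have "s (bproj E (bchart E U v)) = bchart E U (\<sigma> U (vproj (bdom E U) v))"
    using gd(3)[OF x] bproj_chart[OF U v] by simp
  then show ?thesis unfolding vertical_extension_def using str_plus_eq[OF U v, of "\<sigma> U (vproj (bdom E U) v)"] gd(4)[OF x] by simp
qed

text \<open>In a chart the vertical extension lifts to \<open>v + t \<sigma>(\<pi>(v))\<close>,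
  where \<open>\<sigma>\<close> is the member of the family for that chart. Continuity descends
  along the open chart map, and smoothness is \<open>vertical_smooth\<close>.\<close>

lemma good_vertical:
  assumes g: "good_family E s \<sigma>"
  shows "smooth_map (orbibundle_times_interval E \<epsilon>) (orbibundle_space E) (vertical_extension E s)"
  unfolding smooth_map_def space_simps
proof (intro conjI allI impI)
  let ?J = "{-\<epsilon><..<\<epsilon>}"
  let ?Y = "prod_topology (btop E) (top_of_set ?J)" and ?s = "vertical_extension E s"
  show cs: "continuous_map ?Y (btop E) ?s"
  proof (rule continuous_map_locally)
    fix p assume "p \<in> topspace ?Y"
    then have p: "fst p \<in> topspace (btop E)" "snd p \<in> ?J" by auto
    have "bproj E (fst p) \<in> topspace (btop0 E)" using continuous_map_image_subset_topspace[OF bproj_cont] p(1) by blast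
    from point_exists[OF this] obtain U y where U: "U \<in> I" "y \<in> bdom0 E U" "bchart0 E U y = bproj E (fst p)" by blast
    let ?F = "bdom E U" and ?r = "\<lambda>p. (bchart E U (fst p), snd p)"
    note gd = goodD[OF g U(1)]
    have "continuous_map (prod_topology (vtop ?F) (top_of_set ?J)) (btop E) (\<lambda>q. ?s (?r q))"
    proof (rule continuous_map_eq[OF continuous_map_compose[OF vertical_continuous[OF vbun[OF U(1)] gd(1)] chartE(2)[OF U(1)]]])
      fix q assume "q \<in> topspace (prod_topology (vtop ?F) (top_of_set ?J))"
      then have "fst q \<in> total ?F" by auto
      from good_vertical_formula[OF g U(1) this, of "snd q"]
      show "(bchart E U \<circ> (\<lambda>p. vadd ?F (fst p) (vscale ?F (snd p) (\<sigma> U (vproj ?F (fst p)))))) q = ?s (?r q)" by simp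
    qed
    moreover have "?r ` topspace (prod_topology (vtop ?F) (top_of_set ?J)) = over U \<times> ?J"
    proof -
      have "?r ` (total ?F \<times> ?J) = bchart E U ` total ?F \<times> ?J" by force
      then show ?thesis unfolding chartE(3)[OF U(1)] by simp
    qed
    ultimately have "continuous_map (subtopology ?Y (over U \<times> ?J)) (btop E) ?s"
      by (intro open_quotient_continuous[where \<rho> = ?r, OF open_map_times[OF chartE(5)[OF U(1)]]])
    moreover have "openin ?Y (over U \<times> ?J)"
      using chartE(1)[OF U(1)] openin_topspace[of "top_of_set ?J"] by (simp add: openin_prod_Times_iff)
    moreover have "p \<in> over U \<times> ?J" using p U(3) chartX_in[OF U(1,2)] by (auto simp: mem_Times_iff)
    ultimately show "\<exists>B. openin ?Y B \<and> p \<in> B \<and> continuous_map (subtopology ?Y B) (btop E) ?s" by blast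
  qed
  fix W f assume "openin (btop E) W \<and> sfun (orbibundle_space E) W f"
  then have W: "openin (btop E) W" and f: "sfun (orbibundle_space E) W f" by auto
  let ?V = "{x \<in> topspace ?Y. ?s x \<in> W}"
  show "sfun (orbibundle_times_interval E \<epsilon>) ?V (f \<circ> ?s)"
    unfolding sfun_EI
  proof (intro conjI ballI)
    have "continuous_map (subtopology ?Y ?V) (subtopology (btop E) W) ?s"
      unfolding continuous_map_in_subtopology using continuous_map_from_subtopology[OF cs] by auto
    then show "creal (subtopology ?Y ?V) (f \<circ> ?s)"
      using f continuous_map_compose unfolding sfun_E by blast
    fix U assume U: "U \<in> I"
    let ?F = "bdom E U" and ?W = "{v \<in> total (bdom E U). bchart E U v \<in> W}"
    note gd = goodD[OF g U]
    have fW: "sfun (vb_space ?F) ?W (f \<circ> bchart E U)" using f U by (simp add: sfun_E)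
    let ?W' = "{(v, t) \<in> total ?F \<times> ?J. (bchart E U v, t) \<in> ?V}"
    have in_W: "vadd ?F v (vscale ?F t (\<sigma> U (vproj ?F v))) \<in> ?W" if "(v, t) \<in> ?W'" for v t
    proof -
      have v: "v \<in> total ?F" using that by simp
      have x: "vproj ?F v \<in> bdom0 E U" by (rule vproj_base[OF vbun[OF U] v])
      note sx = gd(4)[OF x] and sc = vb_scale[OF vbun[OF U], of "\<sigma> U (vproj ?F v)" t]
      have "vadd ?F v (vscale ?F t (\<sigma> U (vproj ?F v))) \<in> total ?F"
        by (rule vb_add(1)[OF vbun[OF U] v]) (use sx sc in auto)
      then show ?thesis using that good_vertical_formula[OF g U v, of t] by simp
    qed
    have "sfun (vb_space (vb_prod ?F (interval \<epsilon>))) ?W' (\<lambda>(v, t). (f \<circ> bchart E U) (vadd ?F v (vscale ?F t (\<sigma> U (vproj ?F v)))))"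
      by (rule vertical_smooth[OF vbun[OF U] gd(1) fW _ in_W]) auto
    then show "sfun (vb_space (vb_prod ?F (interval \<epsilon>))) ?W' (\<lambda>(v, t). (f \<circ> ?s) (bchart E U v, t))"
      by (rule sfun_vb_mono) (auto simp: good_vertical_formula[OF g U])
  qed
qed

lemma good_imp_stratified: "good_family E s \<sigma> \<Longrightarrow> smooth_stratified_section E s"
  unfolding smooth_stratified_section_def using good_orbisection good_smooth good_Estr good_vertical
  \<comment> \<open>The vertical extension of a good section is smooth for every
    \<open>\<epsilon>\<close>, so the bound 1 is arbitrary.\<close>
  by (auto intro!: exI[of _ 1])

text \<open>Invariance makes \<open>h\<close> independent of the chosen representative. Smoothness
  must be tested in every chart \<open>V\<close>: near a given base point, a group element moves the
  bundle into the image of a smaller chart \<open>W\<close>, from which one passes to the chart at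
  \<open>U\<close>. There \<open>h\<close> becomes the given function \<open>f\<close>, and all
  three maps used are smooth.\<close>

lemma descend:
  assumes U: "U \<in> I" and f: "sfun (vb_space (bdom E U)) (total (bdom E U)) f"
    and inv: "\<And>g v. g \<in> carrier (bgrp E U) \<Longrightarrow> v \<in> total (bdom E U) \<Longrightarrow> f (bact E U g v) = f v"
  shows "\<exists>h. sfun (orbibundle_space E) (over U) h \<and> (\<forall>v\<in>total (bdom E U). h (bchart E U v) = f v)"
proof -
  define h where "h e = f (SOME v. v \<in> total (bdom E U) \<and> bchart E U v = e)" for e
  have h: "h (bchart E U v) = f v" if v: "v \<in> total (bdom E U)" for v
  proof -
    have "\<exists>w. w \<in> total (bdom E U) \<and> bchart E U w = bchart E U v" using v by blast
    from someI_ex[OF this] obtain w where w: "w \<in> total (bdom E U)" "bchart E U v = bchart E U w"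
      and hw: "h (bchart E U v) = f w" unfolding h_def by auto
    from chartE(4)[OF U v w] obtain g where "g \<in> carrier (bgrp E U)" "w = bact E U g v" by blast
    then show ?thesis using inv v hw by simp
  qed
  have "sfun (orbibundle_space E) (over U) h"
    unfolding sfun_E
  proof (intro conjI ballI)
    have "creal (vtop (bdom E U)) f"
      using sfun_continuous[OF vbun[OF U] openin_topspace f] by simp
    then have "creal (vtop (bdom E U)) (\<lambda>v. h (bchart E U v))"
      by (rule continuous_map_eq) (simp add: h)
    from open_quotient_continuous[OF chartE(5)[OF U] chartE(3)[OF U] this]
    show "creal (subtopology (btop E) (over U)) h" .
    fix V assume V: "V \<in> I"
    let ?F = "bdom E V" and ?W = "{v \<in> total (bdom E V). bchart E V v \<in> over U}"
    interpret S: sym_bundle "bdom E V" "bgrp E V" "bact E V" "bact0 E V" by (rule sym[OF V])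
    show "sfun (vb_space ?F) ?W (h \<circ> bchart E V)"
    proof (rule sfun_vb_local)
      fix v0 assume v0: "v0 \<in> ?W"
      then have vt: "v0 \<in> total ?F" and vU: "bproj E (bchart E V v0) \<in> U" by auto
      have vV: "bproj E (bchart E V v0) \<in> V" using chartE_in[OF V vt] by simp
      from refine[OF U V vU vV] obtain W where W: "W \<in> I" "bproj E (bchart E V v0) \<in> W" "W \<subseteq> U" "W \<subseteq> V" by blast
      from point_lift[OF W(1,2)] obtain y where y: "y \<in> bdom0 E W" "bchart0 E W y = bproj E (bchart E V v0)" by blast
      note eV = emb_maps[OF W(1) V W(4)] and eU = emb_maps[OF W(1) U W(3)]
      let ?H = "bdom E W" and ?\<psi> = "bmap E W V"
      have xb: "vproj ?F v0 \<in> bdom0 E V" using vt by simp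
      have "bchart0 E W y = bchart0 E V (vproj ?F v0)" using y(2) bproj_chart[OF V vt] by simp
      from pull[OF W(1) V W(4) xb y(1) this] obtain g where g: "g \<in> carrier (bgrp E V)" "bact0 E V g (vproj ?F v0) = bmap0 E W V y" by blast
      have smU: "smooth_map (vb_space ?H) (vb_space (bdom E U)) (bmap E W U)" using psi_emb[OF W(1) U W(3)] by (simp add: open_smooth_embedding_def)
      have smI: "smooth_map (open_subspace (vb_space ?F) (?\<psi> ` total ?H)) (vb_space ?H) (inv_into (total ?H) ?\<psi>)"
        using psi_emb[OF W(1) V W(4)] by (simp add: open_smooth_embedding_def)
      have smg: "smooth_map (vb_space ?F) (vb_space ?F) (bact E V g)" using S.vbm[OF g(1)] by (simp add: vb_map_def)
      have smg0: "continuous_map (mtop (vbase ?F)) (mtop (vbase ?F)) (bact0 E V g)"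
        using S.vbm[OF g(1)] smooth_map_continuous[of "mfd_space (vbase ?F)" "mfd_space (vbase ?F)"] by (simp add: vb_map_def)
      have 1: "sfun (vb_space ?H) (total ?H) (f \<circ> bmap E W U)"
      proof -
        have "sfun (vb_space ?H) {x \<in> points (vb_space ?H). bmap E W U x \<in> total (bdom E U)} (f \<circ> bmap E W U)"
          by (rule smooth_mapD[OF smU _ f]) simp
        then show ?thesis by (rule sfun_vb_mono) (use eU(5) in auto)
      qed
      have im: "?\<psi> ` total ?H \<subseteq> total ?F" using eV(5) by auto
      have 2: "sfun (vb_space ?F) (?\<psi> ` total ?H) (f \<circ> bmap E W U \<circ> inv_into (total ?H) ?\<psi>)"
      proof -
        have "sfun (open_subspace (vb_space ?F) (?\<psi> ` total ?H))
          {x \<in> points (open_subspace (vb_space ?F) (?\<psi> ` total ?H)). inv_into (total ?H) ?\<psi> x \<in> total ?H} (f \<circ> bmap E W U \<circ> inv_into (total ?H) ?\<psi>)"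
          by (rule smooth_mapD[OF smI _ 1]) simp
        then show ?thesis
          unfolding open_subspace_def by simp (rule sfun_vb_mono, assumption, use im in \<open>auto intro: inv_into_into\<close>)
      qed
      have 3: "sfun (vb_space ?F) {v \<in> total ?F. bact E V g v \<in> ?\<psi> ` total ?H} (f \<circ> bmap E W U \<circ> inv_into (total ?H) ?\<psi> \<circ> bact E V g)"
        using smooth_mapD[OF smg _ 2] eV(3) by simp
      define B where "B = {x \<in> bdom0 E V. bact0 E V g x \<in> bmap0 E W V ` bdom0 E W}"
      have oB: "openin (mtop (vbase ?F)) B" unfolding B_def by (rule openin_continuous_map_preimage[OF smg0 eV(4)])
      have vB: "vproj ?F v0 \<in> B" using g(2) y(1) xb by (auto simp: B_def)
      \<comment> \<open>Over \<open>B\<close> the translate by \<open>g\<close> has its base points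
        in the image of \<open>W\<close>; by \<open>open_linear_image\<close> the entire fibers then
        lie in the image of the bundle embedding.\<close>
      have full: "\<exists>u\<in>total ?H. bact E V g v = ?\<psi> u" if v: "v \<in> total ?F" "vproj ?F v \<in> B" for v
      proof -
        from v(2) obtain z where z: "z \<in> bdom0 E W" "bact0 E V g (vproj ?F v) = bmap0 E W V z" by (auto simp: B_def)
        have "\<exists>u\<in>total ?H. vproj ?H u = z \<and> ?\<psi> u = bact E V g v"
        proof (rule open_linear_image[OF vbun[OF V] vbun[OF W(1)] bmap_vb[OF V W(1) W(4)] eV(3,2) z(1)])
          show "bact E V g v \<in> total ?F" "vproj ?F (bact E V g v) = bmap0 E W V z" using v(1) g(1) z(2) by auto
        qed
        then show ?thesis by metis
      qed
      have "sfun (vb_space ?F) {v \<in> ?W. vproj ?F v \<in> B} (h \<circ> bchart E V)"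
      proof (rule sfun_vb_mono[OF 3])
        show "{v \<in> ?W. vproj ?F v \<in> B} \<subseteq> {v \<in> total ?F. bact E V g v \<in> ?\<psi> ` total ?H}"
        proof
          fix v assume "v \<in> {v \<in> ?W. vproj ?F v \<in> B}"
          then have v: "v \<in> total ?F" "vproj ?F v \<in> B" by auto
          from full[OF v] show "v \<in> {v \<in> total ?F. bact E V g v \<in> ?\<psi> ` total ?H}" using v(1) by auto
        qed
        fix v assume "v \<in> {v \<in> ?W. vproj ?F v \<in> B}"
        then have v: "v \<in> total ?F" "vproj ?F v \<in> B" by auto
        from full[OF v] obtain u where u: "u \<in> total ?H" "bact E V g v = ?\<psi> u" by blast
        have "bchart E V v = bchart E V (?\<psi> u)" using chartE(6)[OF V g(1) v(1)] u(2) by simp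
        also have "\<dots> = bchart E U (bmap E W U u)" using eta_psi[OF W(1) V W(4) u(1)] eta_psi[OF W(1) U W(3) u(1)] by simp
        finally have "h (bchart E V v) = f (bmap E W U u)" using h[OF eU(5)[OF u(1)]] by simp
        then show "(f \<circ> bmap E W U \<circ> inv_into (total ?H) ?\<psi> \<circ> bact E V g) v = (h \<circ> bchart E V) v"
          using u eV(1) by simp
      qed
      then show "\<exists>B. openin (mtop (vbase ?F)) B \<and> vproj ?F v0 \<in> B \<and> sfun (vb_space ?F) {v \<in> ?W. vproj ?F v \<in> B} (h \<circ> bchart E V)"
        using oB vB by blast
    qed
  qed
  then show ?thesis using h by blast
qed

section \<open>Smooth stratified sections are good\<close>

definition lift :: "('x \<Rightarrow> 'e) \<Rightarrow> 'x set \<Rightarrow> 'm \<Rightarrow> 't" where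
  "lift s U x = (SOME v. v \<in> fixed_vectors E U \<and> vproj (bdom E U) v = x \<and> bchart E U v = s (bchart0 E U x))"

lemma lift:
  assumes s: "orbisection E s" "s ` topspace (btop0 E) \<subseteq> Estr E" and U: "U \<in> I" and x: "x \<in> bdom0 E U"
  shows "lift s U x \<in> fixed_vectors E U" "vproj (bdom E U) (lift s U x) = x" "bchart E U (lift s U x) = s (bchart0 E U x)"
    "lift s U x \<in> total (bdom E U)"
proof -
  note r = chartX_in[OF U x]
  have "\<exists>v. v \<in> fixed_vectors E U \<and> vproj (bdom E U) v = x \<and> bchart E U v = s (bchart0 E U x)"
    using fixed_lift[of "s (bchart0 E U x)", OF _ U x] r s by (auto simp: orbisection_def)
  from someI_ex[OF this] show "lift s U x \<in> fixed_vectors E U" "vproj (bdom E U) (lift s U x) = x"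
    "bchart E U (lift s U x) = s (bchart0 E U x)" by (auto simp: lift_def)
  then show "lift s U x \<in> total (bdom E U)" using fixed_total by blast
qed

text \<open>The invariant function \<open>f\<close> supplied by \<open>recover\<close> descends to a
  smooth function \<open>h\<close> over \<open>U\<close>, and the hypothesis makes its composite
  with the vertical extension smooth. Pulled back along \<open>x \<mapsto> (w x, r)\<close>, this
  composite is \<open>f\<close> at \<open>w x\<close> plus \<open>r\<close> times the lift. A linear
  coordinate of the lift is then read off from \<open>r = t\<close> and
  \<open>r = - t\<close>.\<close>

lemma lift_smooth:
  assumes ss: "smooth_stratified_section E s" and U: "U \<in> I"
  shows "smooth_vb_section (bdom E U) (lift s U)"
proof -
  have s: "orbisection E s" "s ` topspace (btop0 E) \<subseteq> Estr E" using ss by (auto simp: smooth_stratified_section_def)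
  let ?F = "bdom E U"
  let ?M = "vbase (bdom E U)"
  note lf = lift[OF s U] and F = vbun[OF U]
  interpret Y: sym_bundle ?F "bgrp E U" "bact E U" "bact0 E U" by (rule sym[OF U])
  from ss obtain \<epsilon>0 where e0: "\<epsilon>0 > 0" "\<forall>\<epsilon>. 0 < \<epsilon> \<and> \<epsilon> < \<epsilon>0 \<longrightarrow>
        smooth_map (orbibundle_times_interval E \<epsilon>) (orbibundle_space E) (vertical_extension E s)"
    unfolding smooth_stratified_section_def by blast
  \<comment> \<open>One admissible \<open>\<epsilon>\<close> and one nonzero time \<open>t\<close>
    in its interval are fixed. Only division by \<open>4 * t\<close> occurs later, so no limit in
    \<open>t\<close> has to be taken.\<close>
  define \<epsilon> where "\<epsilon> = \<epsilon>0 / 2"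
  have \<epsilon>: "0 < \<epsilon>" "\<epsilon> < \<epsilon>0" using e0(1) by (auto simp: \<epsilon>_def)
  have sV: "smooth_map (orbibundle_times_interval E \<epsilon>) (orbibundle_space E) (vertical_extension E s)" using e0(2) \<epsilon> by blast
  define t where "t = \<epsilon> / 2"
  have t: "0 < t" "t \<in> {-\<epsilon><..<\<epsilon>}" "-t \<in> {-\<epsilon><..<\<epsilon>}" using \<epsilon> by (auto simp: t_def)
  have VE: "vertical_extension E s (bchart E U v, r) = bchart E U (vadd ?F v (vscale ?F r (lift s U (vproj ?F v))))"
    if v: "v \<in> total ?F" for v r
  proof -
    note lx = lf[OF Y.vproj_X[OF v]]
    have "s (bproj E (bchart E U v)) = bchart E U (lift s U (vproj ?F v))" using lx(3) bproj_chart[OF U v] by simp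
    then show ?thesis unfolding vertical_extension_def using str_plus_eq[OF U v lx(1)] lx(2) by simp
  qed
  have coord: "sf ?M D (\<lambda>x. \<tau> (lift s U x) k0 i0)" if T: "(D, P, \<tau>) \<in> vtriv ?F" and i0: "i0 < fdim P k0" for D P \<tau> k0 i0
  proof -
    interpret Z: self_triv ?F "bgrp E U" "bact E U" "bact0 E U" D P \<tau>
      by (intro self_triv.intro two_triv.intro sym[OF U] local_triv.intro F T)
    show ?thesis
    proof (rule sf_local[OF Y.mfM Z.S.oD])
      fix x0 assume x0: "x0 \<in> D"
      from Z.recover[OF x0 i0] obtain f w A where A: "openin (mtop ?M) A" "x0 \<in> A" "A \<subseteq> D" and f: "sfun (vb_space ?F) (total ?F) f"
        "\<forall>g\<in>carrier (bgrp E U). \<forall>v\<in>total ?F. f (bact E U g v) = f v" and w: "\<forall>x\<in>A. w x \<in> total ?F \<and> vproj ?F (w x) = x"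
        "\<forall>k i. sf ?M A (\<lambda>x. \<tau> (w x) k i)" and rec: "\<forall>v\<in>total ?F. vproj ?F v \<in> A \<longrightarrow> (\<forall>t. f (vadd ?F (w (vproj ?F v)) (vscale ?F t v)) -
        f (vadd ?F (w (vproj ?F v)) (vscale ?F (- t) v)) = 4 * t * \<tau> v k0 i0)" by (elim exE conjE)
      have "f (bact E U g v) = f v" if "g \<in> carrier (bgrp E U)" "v \<in> total ?F" for g v using f(2) that by blast
      then have "\<exists>h. sfun (orbibundle_space E) (over U) h \<and> (\<forall>v\<in>total ?F. h (bchart E U v) = f v)"
        by (rule descend[OF U f(1)])
      then obtain h where h: "sfun (orbibundle_space E) (over U) h" "\<forall>v\<in>total ?F. h (bchart E U v) = f v"
        by (elim exE conjE)
      have AX: "A \<subseteq> bdom0 E U" using openin_subset[OF A(1)] .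
      have V: "vadd ?F (w x) (vscale ?F r (lift s U x)) \<in> total ?F" if "x \<in> A" for x r
      proof -
        have "x \<in> bdom0 E U" using that AX by blast
        note lx = lf[OF this]
        note sc = vb_scale[OF F lx(4), of r]
        show ?thesis by (rule vb_add(1)[OF F]) (use w(1) that sc lx in auto)
      qed
      have sr: "sf ?M A (\<lambda>x. f (vadd ?F (w x) (vscale ?F r (lift s U x))))" if r: "r \<in> {-\<epsilon><..<\<epsilon>}" for r
      proof -
        \<comment> \<open>The part of the product on which \<open>h\<close> can be composed with the
          vertical extension. It contains the image points of \<open>(w x, r)\<close>, because
          adding a multiple of the section does not change the base point.\<close>
        let ?O = "{p \<in> points (orbibundle_times_interval E \<epsilon>). vertical_extension E s p \<in> over U}"
        have "sfun (orbibundle_times_interval E \<epsilon>) ?O (h \<circ> vertical_extension E s)"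
          by (rule smooth_mapD[OF sV _ h(1)]) (use chartE(1)[OF U] in simp)
        then have sp: "sfun (vb_space (vb_prod ?F (interval \<epsilon>)))
          {(v, t) \<in> total ?F \<times> {-\<epsilon><..<\<epsilon>}. (bchart E U v, t) \<in> ?O} (\<lambda>(v, t). (h \<circ> vertical_extension E s) (bchart E U v, t))"
          using U by (simp add: sfun_EI)
        have in_O: "(w x, r) \<in> {(v, t) \<in> total ?F \<times> {-\<epsilon><..<\<epsilon>}. (bchart E U v, t) \<in> ?O} \<and> w x \<in> total ?F \<and> vproj ?F (w x) = x"
          if x: "x \<in> A" for x
        proof -
          have wx: "w x \<in> total ?F" "vproj ?F (w x) = x" using w(1) x by auto
          have "vertical_extension E s (bchart E U (w x), r) \<in> over U"
            using VE[OF wx(1), of r] wx(2) chartE_in[OF U V[OF x, of r]] by simp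
          then show ?thesis using wx r chartE_in[OF U wx(1)] by simp
        qed
        have rT: "r \<in> pts (interval \<epsilon>)" using r by simp
        have "sf ?M A (\<lambda>x. (\<lambda>(v, t). (h \<circ> vertical_extension E s) (bchart E U v, t)) (w x, r))"
          by (rule Z.S.pullback_smooth_prod[OF manifold_interval rT sp A(1,3) in_O]) (use w(2) in auto)
        then show ?thesis
        proof (rule sf_cong[OF Y.mfM A(1), rotated])
          fix x assume x: "x \<in> A"
          then have wx: "w x \<in> total ?F" "vproj ?F (w x) = x" using w(1) by auto
          show "(\<lambda>(v, t). (h \<circ> vertical_extension E s) (bchart E U v, t)) (w x, r) = f (vadd ?F (w x) (vscale ?F r (lift s U x)))"
            using VE[OF wx(1), of r] wx(2) h(2) V[OF x, of r] by simp
        qed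
      qed
      have "sf ?M A (\<lambda>x. (f (vadd ?F (w x) (vscale ?F t (lift s U x))) - f (vadd ?F (w x) (vscale ?F (- t) (lift s U x)))) * inverse (4 * t))"
        by (intro sf_mult sf_diff sr t sf_const)
      then have "sf ?M A (\<lambda>x. \<tau> (lift s U x) k0 i0)"
      proof (rule sf_cong[OF Y.mfM A(1), rotated])
        fix x assume x: "x \<in> A"
        then have "x \<in> bdom0 E U" using AX by blast
        note lx = lf[OF this]
        have "f (vadd ?F (w x) (vscale ?F t (lift s U x))) - f (vadd ?F (w x) (vscale ?F (- t) (lift s U x))) = 4 * t * \<tau> (lift s U x) k0 i0"
          using rec lx x by metis
        then show "(f (vadd ?F (w x) (vscale ?F t (lift s U x))) - f (vadd ?F (w x) (vscale ?F (- t) (lift s U x)))) * inverse (4 * t) = \<tau> (lift s U x) k0 i0"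
          using t(1) by simp
      qed
      moreover have "D \<inter> A = A" using A(3) by blast
      ultimately show "\<exists>W'. openin (mtop ?M) W' \<and> x0 \<in> W' \<and> sf ?M (D \<inter> W') (\<lambda>x. \<tau> (lift s U x) k0 i0)" using A(1,2) by auto
    qed
  qed
  show ?thesis
  proof (rule smooth_vb_sectionI[OF F])
    show "lift s U x \<in> total ?F \<and> vproj ?F (lift s U x) = x" if "x \<in> bdom0 E U" for x using lf[OF that] by blast
    fix x assume x: "x \<in> bdom0 E U"
    from triv_exists[OF F x] obtain D P \<tau> where T: "(D, P, \<tau>) \<in> vtriv ?F" "x \<in> D" by blast
    interpret Z: local_triv ?F D P \<tau> by (rule local_triv.intro[OF F T(1)])
    have "\<forall>k. \<forall>i<fdim P k. sf ?M D (\<lambda>x. \<tau> (lift s U x) k i)" using coord[OF T(1)] by blast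
    then show "\<exists>D P \<tau> B. (D, P, \<tau>) \<in> vtriv ?F \<and> openin (mtop ?M) B \<and> x \<in> B \<and> B \<subseteq> D \<and>
       (\<forall>k. \<forall>i<fdim P k. sf ?M B (\<lambda>x. \<tau> (lift s U x) k i))"
      using T Z.oD by blast
  qed
qed

text \<open>Equivariance and compatibility with the embeddings both follow from
  \<open>fixed_unique\<close>: the two sides are fixed vectors over the same point with the same
  image in \<open>E\<close>.\<close>

lemma lift_good:
  assumes ss: "smooth_stratified_section E s" shows "good_family E s (lift s)"
  unfolding good_family_def
proof (intro conjI ballI impI)
  have s: "orbisection E s" "s ` topspace (btop0 E) \<subseteq> Estr E" using ss by (auto simp: smooth_stratified_section_def)
  note lf = lift[OF s]
  show "smooth_vb_section (bdom E U) (lift s U)" if "U \<in> I" for U by (rule lift_smooth[OF ss that])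
  show "bchart E U (lift s U x) = s (bchart0 E U x)" if "U \<in> I" "x \<in> bdom0 E U" for U x by (rule lf(3)[OF that])
  show "lift s U (bact0 E U g x) = bact E U g (lift s U x)" if U: "U \<in> I" and g: "g \<in> carrier (bgrp E U)" and x: "x \<in> bdom0 E U" for U g x
  proof -
    interpret Y: sym_bundle "bdom E U" "bgrp E U" "bact E U" "bact0 E U" by (rule sym[OF U])
    note lx = lf[OF U x] and lgx = lf[OF U Y.b_closed[OF g x]]
    have "bact E U g (lift s U x) = lift s U (bact0 E U g x)"
      by (rule fixed_unique[OF U fixed_act[OF U lx(1) g] lgx(4)])
        (use lx lgx g chartE(6)[OF U g lx(4)] chartX(6)[OF U g x] in auto)
    then show ?thesis by simp
  qed
  show "lift s U (bmap0 E V U y) = bmap E V U (lift s V y)" if U: "U \<in> I" and V: "V \<in> I" and VU: "V \<subseteq> U" and y: "y \<in> bdom0 E V" for U V y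
  proof -
    note em = emb_maps[OF V U VU] and ly = lf[OF V y]
    note lp = lf[OF U em(6)[OF y]]
    have "bmap E V U (lift s V y) = lift s U (bmap0 E V U y)"
    proof (rule fixed_unique[OF U _ lp(4)])
      show "bmap E V U (lift s V y) \<in> fixed_vectors E U" using fixed_psi[OF V U VU ly(4)] ly(1) by simp
    qed (use em(7)[OF ly(4)] ly lp eta_psi[OF V U VU ly(4)] rho_phi[OF V U VU y] in auto)
    then show ?thesis by simp
  qed
qed

theorem stratified_iff_good: "smooth_stratified_section E s \<longleftrightarrow> good_section E s"
  unfolding good_section_def using lift_good good_imp_stratified by blast

theorem good_family_unique:
  assumes "good_family E s \<sigma>" "good_family E s \<sigma>'" "U \<in> I" "x \<in> bdom0 E U"
  shows "\<sigma> U x = \<sigma>' U x"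
  by (rule fixed_unique[OF assms(3)])
    (use goodD(3,4)[OF assms(1,3,4)] goodD(3,4)[OF assms(2,3,4)] in auto)

end

section \<open>The module of stratified sections\<close>

text \<open>A bundle map is required to respect sums and multiples; the zero vector is reached as
  its own multiple by 0.\<close>

lemma vb_map_zero:
  assumes F: "vector_bundle F" and F': "vector_bundle F'" and m: "vb_map F F' \<psi> \<phi>" and x: "x \<in> pts (vbase F)"
  shows "\<psi> (vzero F x) = vzero F' (\<phi> x)"
proof -
  note z = vb_zero[OF F x]
  have im: "\<psi> (vzero F x) \<in> total F'"
  proof -
    have "smooth_map (vb_space F) (vb_space F') \<psi>" using m by (simp add: vb_map_def)
    then have "continuous_map (vtop F) (vtop F') \<psi>" using smooth_map_continuous by fastforce
    from continuous_map_image_subset_topspace[OF this] z(1) show ?thesis by blast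
  qed
  have p: "vproj F' (\<psi> (vzero F x)) = \<phi> x" using m z by (simp add: vb_map_def)
  have "\<psi> (vzero F x) = \<psi> (vscale F 0 (vzero F x))" using fiber_algebra(9)[OF F z z z] by simp
  also have "\<dots> = vscale F' 0 (\<psi> (vzero F x))" using m z(1) by (simp add: vb_map_def)
  also have "\<dots> = vzero F' (\<phi> x)" by (rule fiber_algebra(9)[OF F' im p im p im p])
  finally show ?thesis .
qed

lemma smooth_vb_section_ops:
  assumes F: "vector_bundle F"
  shows "smooth_vb_section F \<sigma> \<Longrightarrow> smooth_vb_section F \<sigma>' \<Longrightarrow> smooth_vb_section F (\<lambda>x. vadd F (\<sigma> x) (\<sigma>' x))"
    "smooth_vb_section F \<sigma> \<Longrightarrow> sf (vbase F) (pts (vbase F)) f \<Longrightarrow> smooth_vb_section F (\<lambda>x. vscale F (f x) (\<sigma> x))"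
    "smooth_vb_section F (vzero F)"
proof -
  let ?M = "vbase F"
  have main: "smooth_vb_section F \<sigma>" if \<sigma>: "\<And>x. x \<in> pts ?M \<Longrightarrow> \<sigma> x \<in> total F \<and> vproj F (\<sigma> x) = x"
    and c: "\<And>D P \<tau> k i. (D, P, \<tau>) \<in> vtriv F \<Longrightarrow> i < fdim P k \<Longrightarrow> sf ?M D (\<lambda>x. \<tau> (\<sigma> x) k i)" for \<sigma>
  proof (rule smooth_vb_sectionI[OF F \<sigma>])
    fix x assume x: "x \<in> pts ?M"
    from triv_exists[OF F x] obtain D P \<tau> where T: "(D, P, \<tau>) \<in> vtriv F" "x \<in> D" by blast
    interpret Z: local_triv F D P \<tau> by (rule local_triv.intro[OF F T(1)])
    have "\<forall>k. \<forall>i<fdim P k. sf ?M D (\<lambda>x. \<tau> (\<sigma> x) k i)" using c[OF T(1)] by blast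
    then show "\<exists>D P \<tau> B. (D, P, \<tau>) \<in> vtriv F \<and> openin (mtop ?M) B \<and> x \<in> B \<and> B \<subseteq> D \<and>
       (\<forall>k. \<forall>i<fdim P k. sf ?M B (\<lambda>x. \<tau> (\<sigma> x) k i))" using T Z.oD by blast
  qed
  have cs: "sf ?M D (\<lambda>x. \<tau> (\<sigma> x) k i)" if s: "smooth_vb_section F \<sigma>" and T: "(D, P, \<tau>) \<in> vtriv F" and i: "i < fdim P k" for \<sigma> D P \<tau> k i
  proof -
    interpret Z: local_triv F D P \<tau> by (rule local_triv.intro[OF F T])
    show ?thesis by (rule Z.section_coord_smooth[OF _ _ i]) (use s vb_sectionD[OF s] in \<open>auto simp: smooth_vb_section_def\<close>)
  qed
  have base: "openin (mtop ?M) D" "D \<subseteq> pts ?M" if T: "(D, P, \<tau>) \<in> vtriv F" for D P \<tau>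
    using local_triv.oD[OF local_triv.intro[OF F T]] openin_subset by blast+
  note M = vb_manifold[OF F]
  show "smooth_vb_section F (\<lambda>x. vadd F (\<sigma> x) (\<sigma>' x))" if s: "smooth_vb_section F \<sigma>" "smooth_vb_section F \<sigma>'"
  proof (rule main)
    note d = vb_sectionD[OF s(1)] vb_sectionD[OF s(2)]
    show "vadd F (\<sigma> x) (\<sigma>' x) \<in> total F \<and> vproj F (vadd F (\<sigma> x) (\<sigma>' x)) = x" if "x \<in> pts ?M" for x
      using vb_add[OF F, of "\<sigma> x" "\<sigma>' x"] d that by simp
    fix D P \<tau> k i assume T: "(D, P, \<tau>) \<in> vtriv F" and i: "i < fdim P k"
    show "sf ?M D (\<lambda>x. \<tau> (vadd F (\<sigma> x) (\<sigma>' x)) k i)"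
    proof (rule sf_cong[OF M base(1)[OF T] _ sf_add[OF cs[OF s(1) T i] cs[OF s(2) T i]]])
      fix x assume x: "x \<in> D"
      then have "x \<in> pts ?M" using base(2)[OF T] by blast
      then show "\<tau> (\<sigma> x) k i + \<tau> (\<sigma>' x) k i = \<tau> (vadd F (\<sigma> x) (\<sigma>' x)) k i" using tau_ops(1)[OF F T] d x by simp
    qed
  qed
  show "smooth_vb_section F (\<lambda>x. vscale F (f x) (\<sigma> x))" if s: "smooth_vb_section F \<sigma>" and f: "sf ?M (pts ?M) f"
  proof (rule main)
    note d = vb_sectionD[OF s]
    show "vscale F (f x) (\<sigma> x) \<in> total F \<and> vproj F (vscale F (f x) (\<sigma> x)) = x" if "x \<in> pts ?M" for x
      using vb_scale[OF F, of "\<sigma> x"] d that by simp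
    fix D P \<tau> k i assume T: "(D, P, \<tau>) \<in> vtriv F" and i: "i < fdim P k"
    show "sf ?M D (\<lambda>x. \<tau> (vscale F (f x) (\<sigma> x)) k i)"
    proof (rule sf_cong[OF M base(1)[OF T] _ sf_mult[OF sf_subset[OF f base(2)[OF T]] cs[OF s T i]]])
      fix x assume x: "x \<in> D"
      then have "x \<in> pts ?M" using base(2)[OF T] by blast
      then show "f x * \<tau> (\<sigma> x) k i = \<tau> (vscale F (f x) (\<sigma> x)) k i" using tau_ops(2)[OF F T] d x by simp
    qed
  qed
  show "smooth_vb_section F (vzero F)"
  proof (rule main)
    show "vzero F x \<in> total F \<and> vproj F (vzero F x) = x" if "x \<in> pts ?M" for x using vb_zero[OF F that] by blast
    fix D P \<tau> k i assume T: "(D, P, \<tau>) \<in> vtriv F" and i: "i < fdim P k"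
    show "sf ?M D (\<lambda>x. \<tau> (vzero F x) k i)"
      by (rule sf_cong[OF M base(1)[OF T] _ sf_const[of _ _ 0]]) (simp add: tau_ops(3)[OF F T])
  qed
qed

context orbib
begin

abbreviation "X0 \<equiv> topspace (btop0 E)"
abbreviation "CX \<equiv> smooth_functions (base_orbispace E)"
abbreviation "\<Gamma> \<equiv> stratified_sections E"

lemma good_plus:
  assumes g: "good_family E s \<sigma>" and g': "good_family E s' \<sigma>'"
  shows "good_family E (\<lambda>x\<in>X0. str_plus E (s x) 1 (s' x)) (\<lambda>U x. vadd (bdom E U) (\<sigma> U x) (\<sigma>' U x))"
  unfolding good_family_def
proof (intro conjI ballI impI)
  show "smooth_vb_section (bdom E U) (\<lambda>x. vadd (bdom E U) (\<sigma> U x) (\<sigma>' U x))" if U: "U \<in> I" for U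
    by (rule smooth_vb_section_ops(1)[OF vbun[OF U] goodD(1)[OF g U] goodD(1)[OF g' U]])
  show "vadd (bdom E U) (\<sigma> U (bact0 E U h x)) (\<sigma>' U (bact0 E U h x)) = bact E U h (vadd (bdom E U) (\<sigma> U x) (\<sigma>' U x))"
    if U: "U \<in> I" and h: "h \<in> carrier (bgrp E U)" and x: "x \<in> bdom0 E U" for U h x
  proof -
    interpret Y: sym_bundle "bdom E U" "bgrp E U" "bact E U" "bact0 E U" by (rule sym[OF U])
    note d = goodD[OF g U] and d' = goodD[OF g' U]
    show ?thesis using d(2)[OF h x] d'(2)[OF h x] d(4)[OF x] d'(4)[OF x] Y.a_add[OF h] by simp
  qed
  show "vadd (bdom E U) (\<sigma> U (bmap0 E V U y)) (\<sigma>' U (bmap0 E V U y)) = bmap E V U (vadd (bdom E V) (\<sigma> V y) (\<sigma>' V y))"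
    if U: "U \<in> I" and V: "V \<in> I" and VU: "V \<subseteq> U" and y: "y \<in> bdom0 E V" for U V y
  proof -
    have "\<sigma> U (bmap0 E V U y) = bmap E V U (\<sigma> V y)" "\<sigma>' U (bmap0 E V U y) = bmap E V U (\<sigma>' V y)"
      using g g' U V VU y by (auto simp: good_family_def)
    then show ?thesis using emb_maps(8)[OF V U VU] goodD(4)[OF g V y] goodD(4)[OF g' V y] by simp
  qed
  show "bchart E U (vadd (bdom E U) (\<sigma> U x) (\<sigma>' U x)) = (\<lambda>x\<in>X0. str_plus E (s x) 1 (s' x)) (bchart0 E U x)"
    if U: "U \<in> I" and x: "x \<in> bdom0 E U" for U x
  proof -
    note d = goodD[OF g U] and d' = goodD[OF g' U]
    have "str_plus E (s (bchart0 E U x)) 1 (s' (bchart0 E U x)) = bchart E U (vadd (bdom E U) (\<sigma> U x) (vscale (bdom E U) 1 (\<sigma>' U x)))"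
      using str_plus_eq[OF U, of "\<sigma> U x" "\<sigma>' U x" 1] d(3,4)[OF x] d'(3,4)[OF x] by simp
    also have "vscale (bdom E U) 1 (\<sigma>' U x) = \<sigma>' U x" using fiber_algebra(5)[OF vbun[OF U]] d'(4)[OF x] by blast
    finally show ?thesis using chartX_in[OF U x] by simp
  qed
qed

lemma good_scale:
  assumes g: "good_family E s \<sigma>" and f: "sfun (orbispace_space (base_orbispace E)) X0 f"
  shows "good_family E (\<lambda>x\<in>X0. str_scale E (f x) (s x)) (\<lambda>U x. vscale (bdom E U) (f (bchart0 E U x)) (\<sigma> U x))"
  unfolding good_family_def
proof (intro conjI ballI impI)
  show "smooth_vb_section (bdom E U) (\<lambda>x. vscale (bdom E U) (f (bchart0 E U x)) (\<sigma> U x))" if U: "U \<in> I" for U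
  proof (rule smooth_vb_section_ops(2)[OF vbun[OF U] goodD(1)[OF g U]])
    have "sf (vbase (bdom E U)) {x \<in> bdom0 E U. bchart0 E U x \<in> X0} (f \<circ> bchart0 E U)" using f U by (simp add: sfun_X)
    moreover have "{x \<in> bdom0 E U. bchart0 E U x \<in> X0} = bdom0 E U" using chartX_in[OF U] by blast
    ultimately show "sf (vbase (bdom E U)) (bdom0 E U) (\<lambda>x. f (bchart0 E U x))" by (simp add: o_def)
  qed
  show "vscale (bdom E U) (f (bchart0 E U (bact0 E U h x))) (\<sigma> U (bact0 E U h x)) = bact E U h (vscale (bdom E U) (f (bchart0 E U x)) (\<sigma> U x))"
    if U: "U \<in> I" and h: "h \<in> carrier (bgrp E U)" and x: "x \<in> bdom0 E U" for U h x
  proof -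
    interpret Y: sym_bundle "bdom E U" "bgrp E U" "bact E U" "bact0 E U" by (rule sym[OF U])
    note d = goodD[OF g U]
    show ?thesis using d(2)[OF h x] d(4)[OF x] Y.a_scale[OF h] chartX(6)[OF U h x] by simp
  qed
  show "vscale (bdom E U) (f (bchart0 E U (bmap0 E V U y))) (\<sigma> U (bmap0 E V U y)) = bmap E V U (vscale (bdom E V) (f (bchart0 E V y)) (\<sigma> V y))"
    if U: "U \<in> I" and V: "V \<in> I" and VU: "V \<subseteq> U" and y: "y \<in> bdom0 E V" for U V y
  proof -
    have "\<sigma> U (bmap0 E V U y) = bmap E V U (\<sigma> V y)" using g U V VU y by (auto simp: good_family_def)
    then show ?thesis using emb_maps(9)[OF V U VU] goodD(4)[OF g V y] rho_phi[OF V U VU y] by simp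
  qed
  show "bchart E U (vscale (bdom E U) (f (bchart0 E U x)) (\<sigma> U x)) = (\<lambda>x\<in>X0. str_scale E (f x) (s x)) (bchart0 E U x)"
    if U: "U \<in> I" and x: "x \<in> bdom0 E U" for U x
    using str_scale_eq[OF U, of "\<sigma> U x"] goodD(3,4)[OF g U x] chartX_in[OF U x] by simp
qed

lemma good_zero: "good_family E (\<lambda>x\<in>X0. str_zero E x) (\<lambda>U. vzero (bdom E U))"
  unfolding good_family_def
proof (intro conjI ballI impI)
  show "smooth_vb_section (bdom E U) (vzero (bdom E U))" if U: "U \<in> I" for U
    by (rule smooth_vb_section_ops(3)[OF vbun[OF U]])
  show "vzero (bdom E U) (bact0 E U h x) = bact E U h (vzero (bdom E U) x)"
    if U: "U \<in> I" and h: "h \<in> carrier (bgrp E U)" and x: "x \<in> bdom0 E U" for U h x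
    using vb_map_zero[OF vbun[OF U] vbun[OF U] sym_bundle.vbm[OF sym[OF U] h] x] by simp
  show "vzero (bdom E U) (bmap0 E V U y) = bmap E V U (vzero (bdom E V) y)"
    if U: "U \<in> I" and V: "V \<in> I" and VU: "V \<subseteq> U" and y: "y \<in> bdom0 E V" for U V y
    using vb_map_zero[OF vbun[OF V] vbun[OF U] bmap_vb[OF U V VU] y] by simp
  show "bchart E U (vzero (bdom E U) x) = (\<lambda>x\<in>X0. str_zero E x) (bchart0 E U x)" if U: "U \<in> I" and x: "x \<in> bdom0 E U" for U x
    using str_zero_eq[OF U x] chartX_in[OF U x] by simp
qed

section \<open>The ring of smooth functions and the module axioms\<close>

lemma CX_simps: "carrier CX = {f \<in> extensional X0. sfun (orbispace_space (base_orbispace E)) X0 f}"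
  "f \<otimes>\<^bsub>CX\<^esub> g = (\<lambda>x\<in>X0. f x * g x)" "\<one>\<^bsub>CX\<^esub> = (\<lambda>x\<in>X0. 1)" "\<zero>\<^bsub>CX\<^esub> = (\<lambda>x\<in>X0. 0)" "f \<oplus>\<^bsub>CX\<^esub> g = (\<lambda>x\<in>X0. f x + g x)"
  by (simp_all add: smooth_functions_def base_orbispace_def)

lemma \<Gamma>_simps: "carrier \<Gamma> = {s \<in> extensional X0. smooth_stratified_section E s}"
  "\<zero>\<^bsub>\<Gamma>\<^esub> = (\<lambda>x\<in>X0. str_zero E x)" "s \<oplus>\<^bsub>\<Gamma>\<^esub> s' = (\<lambda>x\<in>X0. str_plus E (s x) 1 (s' x))"
  "f \<odot>\<^bsub>\<Gamma>\<^esub> s = (\<lambda>x\<in>X0. str_scale E (f x) (s x))"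
  by (simp_all add: stratified_sections_def)

lemma sfun_X_cong:
  assumes "sfun (orbispace_space (base_orbispace E)) X0 f" "\<And>x. x \<in> X0 \<Longrightarrow> f x = g x"
  shows "sfun (orbispace_space (base_orbispace E)) X0 g"
  unfolding sfun_X
proof (intro conjI ballI)
  show "creal (subtopology (btop0 E) X0) g"
    by (rule continuous_map_eq[of _ _ f]) (use assms in \<open>auto simp: sfun_X\<close>)
  fix U assume U: "U \<in> I"
  have e: "{x \<in> bdom0 E U. bchart0 E U x \<in> X0} = bdom0 E U" using chartX_in[OF U] by blast
  have "sf (vbase (bdom E U)) {x \<in> bdom0 E U. bchart0 E U x \<in> X0} (f \<circ> bchart0 E U)"
    using assms(1) U unfolding sfun_X by blast
  then show "sf (vbase (bdom E U)) {x \<in> bdom0 E U. bchart0 E U x \<in> X0} (g \<circ> bchart0 E U)"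
    unfolding e by (rule sf_cong[OF vb_manifold[OF vbun[OF U]] openin_topspace, rotated]) (use assms(2) chartX_in[OF U] in auto)
qed

lemma sfun_X_ops:
  shows "sfun (orbispace_space (base_orbispace E)) X0 (\<lambda>x. c)"
    "sfun (orbispace_space (base_orbispace E)) X0 f \<Longrightarrow> sfun (orbispace_space (base_orbispace E)) X0 g \<Longrightarrow>
      sfun (orbispace_space (base_orbispace E)) X0 (\<lambda>x. f x + g x)"
    "sfun (orbispace_space (base_orbispace E)) X0 f \<Longrightarrow> sfun (orbispace_space (base_orbispace E)) X0 g \<Longrightarrow>
      sfun (orbispace_space (base_orbispace E)) X0 (\<lambda>x. f x * g x)"
  unfolding sfun_X o_def by (auto simp del: sf_iff intro!: sf_const sf_add sf_mult continuous_map_add continuous_map_real_mult)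

lemma CX_ext: "f \<in> carrier CX \<Longrightarrow> g \<in> carrier CX \<Longrightarrow> (\<And>x. x \<in> X0 \<Longrightarrow> f x = g x) \<Longrightarrow> f = g"
  unfolding CX_simps by (auto intro: extensionalityI)

lemma CX_closed:
  "(\<lambda>x\<in>X0. c) \<in> carrier CX"
  "f \<in> carrier CX \<Longrightarrow> g \<in> carrier CX \<Longrightarrow> f \<oplus>\<^bsub>CX\<^esub> g \<in> carrier CX"
  "f \<in> carrier CX \<Longrightarrow> g \<in> carrier CX \<Longrightarrow> f \<otimes>\<^bsub>CX\<^esub> g \<in> carrier CX"
proof -
  have r: "restrict h X0 \<in> carrier CX" if "sfun (orbispace_space (base_orbispace E)) X0 h" for h
    unfolding CX_simps using sfun_X_cong[OF that, of "restrict h X0"] by simp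
  show "(\<lambda>x\<in>X0. c) \<in> carrier CX" by (rule r[OF sfun_X_ops(1)])
  show "f \<in> carrier CX \<Longrightarrow> g \<in> carrier CX \<Longrightarrow> f \<oplus>\<^bsub>CX\<^esub> g \<in> carrier CX"
    unfolding CX_simps(5) by (rule r[OF sfun_X_ops(2)]) (simp_all add: CX_simps(1))
  show "f \<in> carrier CX \<Longrightarrow> g \<in> carrier CX \<Longrightarrow> f \<otimes>\<^bsub>CX\<^esub> g \<in> carrier CX"
    unfolding CX_simps(2) by (rule r[OF sfun_X_ops(3)]) (simp_all add: CX_simps(1))
qed

lemma CX_cring: "cring CX"
proof (rule cringI)
  have z: "\<zero>\<^bsub>CX\<^esub> \<in> carrier CX" "\<one>\<^bsub>CX\<^esub> \<in> carrier CX" unfolding CX_simps(3,4) by (rule CX_closed(1))+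
  note cl = CX_closed z
  have ev: "(f \<oplus>\<^bsub>CX\<^esub> g) x = f x + g x" "(f \<otimes>\<^bsub>CX\<^esub> g) x = f x * g x" "\<zero>\<^bsub>CX\<^esub> x = 0" "\<one>\<^bsub>CX\<^esub> x = 1" if "x \<in> X0" for f g x
    using that by (simp_all add: CX_simps)
  show "abelian_group CX"
  proof (rule abelian_groupI)
    fix f assume f: "f \<in> carrier CX"
    show "\<exists>g\<in>carrier CX. g \<oplus>\<^bsub>CX\<^esub> f = \<zero>\<^bsub>CX\<^esub>"
    proof (rule bexI)
      show c: "(\<lambda>x\<in>X0. -1) \<otimes>\<^bsub>CX\<^esub> f \<in> carrier CX" by (rule CX_closed(3)[OF CX_closed(1) f])
      show "(\<lambda>x\<in>X0. -1) \<otimes>\<^bsub>CX\<^esub> f \<oplus>\<^bsub>CX\<^esub> f = \<zero>\<^bsub>CX\<^esub>"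
        by (rule CX_ext[OF CX_closed(2)[OF c f] z(1)]) (simp add: ev)
    qed
  qed (auto intro!: CX_ext cl simp: ev)
  show "Group.comm_monoid CX" by (rule comm_monoidI) (auto intro!: CX_ext cl simp: ev)
  show "(f \<oplus>\<^bsub>CX\<^esub> g) \<otimes>\<^bsub>CX\<^esub> h = f \<otimes>\<^bsub>CX\<^esub> h \<oplus>\<^bsub>CX\<^esub> g \<otimes>\<^bsub>CX\<^esub> h"
    if "f \<in> carrier CX" "g \<in> carrier CX" "h \<in> carrier CX" for f g h
    by (rule CX_ext) (use that in \<open>auto intro!: cl simp: ev distrib_right\<close>)
qed

lemma \<Gamma>_good: "s \<in> carrier \<Gamma> \<Longrightarrow> good_family E s (lift s)"
  using lift_good by (simp add: \<Gamma>_simps)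

lemma \<Gamma>_closed:
  "\<zero>\<^bsub>\<Gamma>\<^esub> \<in> carrier \<Gamma>" "s \<in> carrier \<Gamma> \<Longrightarrow> s' \<in> carrier \<Gamma> \<Longrightarrow> s \<oplus>\<^bsub>\<Gamma>\<^esub> s' \<in> carrier \<Gamma>"
  "f \<in> carrier CX \<Longrightarrow> s \<in> carrier \<Gamma> \<Longrightarrow> f \<odot>\<^bsub>\<Gamma>\<^esub> s \<in> carrier \<Gamma>"
proof -
  show "\<zero>\<^bsub>\<Gamma>\<^esub> \<in> carrier \<Gamma>" using good_imp_stratified[OF good_zero] by (simp add: \<Gamma>_simps)
  show "s \<in> carrier \<Gamma> \<Longrightarrow> s' \<in> carrier \<Gamma> \<Longrightarrow> s \<oplus>\<^bsub>\<Gamma>\<^esub> s' \<in> carrier \<Gamma>"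
    using good_imp_stratified[OF good_plus[OF \<Gamma>_good \<Gamma>_good]] by (simp add: \<Gamma>_simps)
  show "f \<in> carrier CX \<Longrightarrow> s \<in> carrier \<Gamma> \<Longrightarrow> f \<odot>\<^bsub>\<Gamma>\<^esub> s \<in> carrier \<Gamma>"
    using good_imp_stratified[OF good_scale[OF \<Gamma>_good]] by (simp add: \<Gamma>_simps CX_simps)
qed

text \<open>Fiberwise operations applied to the lifts give good families for the resulting sections,
  and a good family is unique. Thus lifting turns the operations on stratified sections into vector
  operations in the fibers of the charts.\<close>

lemma \<Gamma>_lift:
  assumes U: "U \<in> I" and x: "x \<in> bdom0 E U"
  shows "lift \<zero>\<^bsub>\<Gamma>\<^esub> U x = vzero (bdom E U) x"
    "s \<in> carrier \<Gamma> \<Longrightarrow> s' \<in> carrier \<Gamma> \<Longrightarrow> lift (s \<oplus>\<^bsub>\<Gamma>\<^esub> s') U x = vadd (bdom E U) (lift s U x) (lift s' U x)"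
    "f \<in> carrier CX \<Longrightarrow> s \<in> carrier \<Gamma> \<Longrightarrow> lift (f \<odot>\<^bsub>\<Gamma>\<^esub> s) U x = vscale (bdom E U) (f (bchart0 E U x)) (lift s U x)"
    "s \<in> carrier \<Gamma> \<Longrightarrow> lift s U x \<in> total (bdom E U)" "s \<in> carrier \<Gamma> \<Longrightarrow> vproj (bdom E U) (lift s U x) = x"
proof -
  show "lift \<zero>\<^bsub>\<Gamma>\<^esub> U x = vzero (bdom E U) x"
    by (rule good_family_unique[OF \<Gamma>_good[OF \<Gamma>_closed(1)] _ U x]) (use good_zero in \<open>simp add: \<Gamma>_simps\<close>)
  show "lift (s \<oplus>\<^bsub>\<Gamma>\<^esub> s') U x = vadd (bdom E U) (lift s U x) (lift s' U x)" if s: "s \<in> carrier \<Gamma>" "s' \<in> carrier \<Gamma>"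
    by (rule good_family_unique[OF \<Gamma>_good[OF \<Gamma>_closed(2)[OF s]] _ U x]) (use good_plus[OF \<Gamma>_good[OF s(1)] \<Gamma>_good[OF s(2)]] in \<open>simp add: \<Gamma>_simps\<close>)
  show "lift (f \<odot>\<^bsub>\<Gamma>\<^esub> s) U x = vscale (bdom E U) (f (bchart0 E U x)) (lift s U x)" if s: "f \<in> carrier CX" "s \<in> carrier \<Gamma>"
    by (rule good_family_unique[OF \<Gamma>_good[OF \<Gamma>_closed(3)[OF s]] _ U x])
      (use good_scale[OF \<Gamma>_good[OF s(2)], of f] s(1) in \<open>simp add: \<Gamma>_simps CX_simps\<close>)
  show "s \<in> carrier \<Gamma> \<Longrightarrow> lift s U x \<in> total (bdom E U)" "s \<in> carrier \<Gamma> \<Longrightarrow> vproj (bdom E U) (lift s U x) = x"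
    using goodD(4)[OF \<Gamma>_good U x] by blast+
qed

text \<open>A section is recovered from its lifts through the chart maps. Together with
  \<open>\<Gamma>_lift\<close> this reduces each module axiom to a vector space law in the
  fibers.\<close>

lemma \<Gamma>_ext:
  assumes s: "s \<in> carrier \<Gamma>" and s': "s' \<in> carrier \<Gamma>" and e: "\<And>U x. U \<in> I \<Longrightarrow> x \<in> bdom0 E U \<Longrightarrow> lift s U x = lift s' U x"
  shows "s = s'"
proof (rule extensionalityI[of _ X0])
  show "s \<in> extensional X0" "s' \<in> extensional X0" using s s' by (simp_all add: \<Gamma>_simps)
  fix x assume "x \<in> X0"
  from point_exists[OF this] obtain U y where U: "U \<in> I" "y \<in> bdom0 E U" "bchart0 E U y = x" by blast
  show "s x = s' x" using goodD(3)[OF \<Gamma>_good[OF s] U(1,2)] goodD(3)[OF \<Gamma>_good[OF s'] U(1,2)] e[OF U(1,2)] U(3) by simp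
qed

lemma \<Gamma>_module: "Module.module CX \<Gamma>"
proof (rule moduleI[OF CX_cring])
  note cl = \<Gamma>_closed CX_closed and li = \<Gamma>_lift and fa = fiber_algebra[OF vbun]
  have ev: "(f \<oplus>\<^bsub>CX\<^esub> g) x = f x + g x" "(f \<otimes>\<^bsub>CX\<^esub> g) x = f x * g x" "\<one>\<^bsub>CX\<^esub> x = 1" if "x \<in> X0" for f g x
    using that by (simp_all add: CX_simps)
  show "abelian_group \<Gamma>"
  proof (rule abelian_groupI)
    show "s \<oplus>\<^bsub>\<Gamma>\<^esub> t \<in> carrier \<Gamma>" if "s \<in> carrier \<Gamma>" "t \<in> carrier \<Gamma>" for s t by (rule cl(2)[OF that])
    show "\<zero>\<^bsub>\<Gamma>\<^esub> \<in> carrier \<Gamma>" by (rule cl(1))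
    show "s \<oplus>\<^bsub>\<Gamma>\<^esub> t \<oplus>\<^bsub>\<Gamma>\<^esub> u = s \<oplus>\<^bsub>\<Gamma>\<^esub> (t \<oplus>\<^bsub>\<Gamma>\<^esub> u)" if s: "s \<in> carrier \<Gamma>" "t \<in> carrier \<Gamma>" "u \<in> carrier \<Gamma>" for s t u
    proof (rule \<Gamma>_ext)
      fix U x assume U: "U \<in> I" "x \<in> bdom0 E U"
      show "lift (s \<oplus>\<^bsub>\<Gamma>\<^esub> t \<oplus>\<^bsub>\<Gamma>\<^esub> u) U x = lift (s \<oplus>\<^bsub>\<Gamma>\<^esub> (t \<oplus>\<^bsub>\<Gamma>\<^esub> u)) U x"
        using s cl(2) by (simp add: li(2)[OF U] fa(1)[OF U(1) li(4,5)[OF U] li(4,5)[OF U] li(4,5)[OF U]])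
    qed (use s cl in auto)
    show "s \<oplus>\<^bsub>\<Gamma>\<^esub> t = t \<oplus>\<^bsub>\<Gamma>\<^esub> s" if s: "s \<in> carrier \<Gamma>" "t \<in> carrier \<Gamma>" for s t
    proof (rule \<Gamma>_ext)
      fix U x assume U: "U \<in> I" "x \<in> bdom0 E U"
      note l = li(4,5)[OF U s(1)] and l' = li(4,5)[OF U s(2)]
      show "lift (s \<oplus>\<^bsub>\<Gamma>\<^esub> t) U x = lift (t \<oplus>\<^bsub>\<Gamma>\<^esub> s) U x" using s fa(2)[OF U(1) l l' l] by (simp add: li(2)[OF U])
    qed (use s cl in auto)
    show "\<zero>\<^bsub>\<Gamma>\<^esub> \<oplus>\<^bsub>\<Gamma>\<^esub> s = s" if s: "s \<in> carrier \<Gamma>" for s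
    proof (rule \<Gamma>_ext)
      fix U x assume U: "U \<in> I" "x \<in> bdom0 E U"
      note l = li(4,5)[OF U s]
      show "lift (\<zero>\<^bsub>\<Gamma>\<^esub> \<oplus>\<^bsub>\<Gamma>\<^esub> s) U x = lift s U x" using s cl(1) fa(3)[OF U(1) l l l] by (simp add: li(1,2)[OF U])
    qed (use s cl in auto)
    show "\<exists>t\<in>carrier \<Gamma>. t \<oplus>\<^bsub>\<Gamma>\<^esub> s = \<zero>\<^bsub>\<Gamma>\<^esub>" if s: "s \<in> carrier \<Gamma>" for s
    proof (rule bexI)
      let ?m = "\<lambda>x\<in>X0. -1 :: real"
      show c: "?m \<odot>\<^bsub>\<Gamma>\<^esub> s \<in> carrier \<Gamma>" by (rule cl(3)[OF CX_closed(1) s])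
      show "?m \<odot>\<^bsub>\<Gamma>\<^esub> s \<oplus>\<^bsub>\<Gamma>\<^esub> s = \<zero>\<^bsub>\<Gamma>\<^esub>"
      proof (rule \<Gamma>_ext[OF cl(2)[OF c s] cl(1)])
        fix U x assume U: "U \<in> I" "x \<in> bdom0 E U"
        note l = li(4,5)[OF U s]
        have "?m (bchart0 E U x) = -1" using chartX_in[OF U] by simp
        then show "lift (?m \<odot>\<^bsub>\<Gamma>\<^esub> s \<oplus>\<^bsub>\<Gamma>\<^esub> s) U x = lift \<zero>\<^bsub>\<Gamma>\<^esub> U x"
          using s c fa(4)[OF U(1) l l l] li(3)[OF U CX_closed(1) s, of "-1"] by (simp add: li(1,2)[OF U])
      qed
    qed
  qed
  show "f \<odot>\<^bsub>\<Gamma>\<^esub> s \<in> carrier \<Gamma>" if "f \<in> carrier CX" "s \<in> carrier \<Gamma>" for f s by (rule cl(3)[OF that])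
  show "(f \<oplus>\<^bsub>CX\<^esub> g) \<odot>\<^bsub>\<Gamma>\<^esub> s = f \<odot>\<^bsub>\<Gamma>\<^esub> s \<oplus>\<^bsub>\<Gamma>\<^esub> g \<odot>\<^bsub>\<Gamma>\<^esub> s" if f: "f \<in> carrier CX" "g \<in> carrier CX" and s: "s \<in> carrier \<Gamma>" for f g s
  proof (rule \<Gamma>_ext)
    fix U x assume U: "U \<in> I" "x \<in> bdom0 E U"
    note l = li(4,5)[OF U s]
    show "lift ((f \<oplus>\<^bsub>CX\<^esub> g) \<odot>\<^bsub>\<Gamma>\<^esub> s) U x = lift (f \<odot>\<^bsub>\<Gamma>\<^esub> s \<oplus>\<^bsub>\<Gamma>\<^esub> g \<odot>\<^bsub>\<Gamma>\<^esub> s) U x"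
      using f s cl(3) CX_closed(2)[OF f] fa(7)[OF U(1) l l l] chartX_in[OF U] by (simp add: li(2,3)[OF U] ev)
  qed (use f s cl CX_closed in auto)
  show "f \<odot>\<^bsub>\<Gamma>\<^esub> (s \<oplus>\<^bsub>\<Gamma>\<^esub> t) = f \<odot>\<^bsub>\<Gamma>\<^esub> s \<oplus>\<^bsub>\<Gamma>\<^esub> f \<odot>\<^bsub>\<Gamma>\<^esub> t" if f: "f \<in> carrier CX" and s: "s \<in> carrier \<Gamma>" "t \<in> carrier \<Gamma>" for f s t
  proof (rule \<Gamma>_ext)
    fix U x assume U: "U \<in> I" "x \<in> bdom0 E U"
    note l = li(4,5)[OF U s(1)] and l' = li(4,5)[OF U s(2)]
    show "lift (f \<odot>\<^bsub>\<Gamma>\<^esub> (s \<oplus>\<^bsub>\<Gamma>\<^esub> t)) U x = lift (f \<odot>\<^bsub>\<Gamma>\<^esub> s \<oplus>\<^bsub>\<Gamma>\<^esub> f \<odot>\<^bsub>\<Gamma>\<^esub> t) U x"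
      using f s cl(2,3) fa(8)[OF U(1) l l' l] by (simp add: li(2,3)[OF U])
  qed (use f s cl in auto)
  show "(f \<otimes>\<^bsub>CX\<^esub> g) \<odot>\<^bsub>\<Gamma>\<^esub> s = f \<odot>\<^bsub>\<Gamma>\<^esub> (g \<odot>\<^bsub>\<Gamma>\<^esub> s)" if f: "f \<in> carrier CX" "g \<in> carrier CX" and s: "s \<in> carrier \<Gamma>" for f g s
  proof (rule \<Gamma>_ext)
    fix U x assume U: "U \<in> I" "x \<in> bdom0 E U"
    note l = li(4,5)[OF U s]
    show "lift ((f \<otimes>\<^bsub>CX\<^esub> g) \<odot>\<^bsub>\<Gamma>\<^esub> s) U x = lift (f \<odot>\<^bsub>\<Gamma>\<^esub> (g \<odot>\<^bsub>\<Gamma>\<^esub> s)) U x"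
      using f s cl(3) CX_closed(3)[OF f] fa(6)[OF U(1) l l l] chartX_in[OF U] by (simp add: li(3)[OF U] ev)
  qed (use f s cl CX_closed in auto)
  show "\<one>\<^bsub>CX\<^esub> \<odot>\<^bsub>\<Gamma>\<^esub> s = s" if s: "s \<in> carrier \<Gamma>" for s
  proof -
    have o: "\<one>\<^bsub>CX\<^esub> \<in> carrier CX" unfolding CX_simps(3) by (rule CX_closed(1))
    show ?thesis
    proof (rule \<Gamma>_ext[OF cl(3)[OF o s] s])
      fix U x assume U: "U \<in> I" "x \<in> bdom0 E U"
      note l = li(4,5)[OF U s]
      show "lift (\<one>\<^bsub>CX\<^esub> \<odot>\<^bsub>\<Gamma>\<^esub> s) U x = lift s U x"
        using o s fa(5)[OF U(1) l l l] chartX_in[OF U] by (simp add: li(3)[OF U] ev)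
    qed
  qed
qed

end

theorem theorem2p13:
  fixes E :: "('x, 'e, 'm, 't, 'g) orbibundle"
  assumes "vector_orbibundle E"
  shows "Module.module (smooth_functions (base_orbispace E)) (stratified_sections E) \<and>
    (\<forall>s. orbisection E s \<longrightarrow> (smooth_stratified_section E s \<longleftrightarrow> good_section E s)) \<and>
    (\<forall>s \<sigma> \<sigma>'. smooth_stratified_section E s \<and> good_family E s \<sigma> \<and> good_family E s \<sigma>' \<longrightarrow>
       (\<forall>U\<in>bobjects E. \<forall>x\<in>bdom0 E U. \<sigma> U x = \<sigma>' U x))"
proof -
  interpret orbib E by (rule orbib.intro[OF assms])
  show ?thesis
  proof (intro conjI allI impI ballI)
    show "Module.module (smooth_functions (base_orbispace E)) (stratified_sections E)" by (rule \<Gamma>_module)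
    show "smooth_stratified_section E s \<longleftrightarrow> good_section E s" if "orbisection E s" for s
      by (rule stratified_iff_good)
    show "\<sigma> U x = \<sigma>' U x" if "smooth_stratified_section E s \<and> good_family E s \<sigma> \<and> good_family E s \<sigma>'"
      "U \<in> bobjects E" "x \<in> bdom0 E U" for s \<sigma> \<sigma>' U x
      using that by (elim conjE) (rule good_family_unique)
  qed
qed

end
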